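(* Let $D$ be a uniformly discrete metric space of bounded geometry. (a) If there exists $\alpha>0$ such that the graph $D(\alpha)$ has no finite connected components, then for any $D_0\subset D$ we have $(i_D)_*([1_{D_0}])=0$ in $K_0(C^*_H(D))$. Hence, if moreover $D$ is a subspace of a proper metric measure space $X$ with non-atomic measure and $D$ is coarsely equivalent to $X$, then $[p_\phi]=0$ in $K_0(C^*_{\mathbb C}(X))$ for any Wannier basis $\{\phi_x\}_{x\in D_0}$ on $X$ with localization centers in $D_0$. (b) Conversely, if $(i_D)_*([1_D])=0$ in $K_0(C^*_H(D))$, then there exists $\alpha>0$ such that the graph $D(\alpha)$ has no finite connected components.
   Context: A metric space $D$ is uniformly discrete if $\inf_{g,h\in D,\,g\neq h}d(g,h)>0$, and a discrete $D$ has bounded geometry if for any $R>0$ the number of points of $D$ in each ball of radius $R$ is uniformly bounded. $D$ carries counting measure. For $\alpha>0$, $D(\alpha)$ is the graph with vertex set $D$ in which two (distinct) vertices $x,y$ are joined by an edge whenever $d(x,y)\le\alpha$. A proper metric measure space $X$ is a set with a metric $d$ and a measure $m$ on the Borel $\sigma$-algebra of the metric topology, such that all balls are compact. Standing assumption on the $C_0(X)$-module $L^2(X)$ (with $C_0(X)$ acting by multiplication): $C_0(X)L^2(X)$ is dense in $L^2(X)$, and multiplication by any non-zero $f\in C_0(X)$ is not compact (in particular $m$ is non-zero on non-empty open sets). $D\subset X$ is coarsely equivalent to $X$ if there is $C>0$ such that for every $x\in X$ there is $y\in D$ with $d(x,y)<C$. Roe algebras: for $Y=X$ or $Y=D$ and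 a Hilbert space $K$, $C^*_K(Y)$ is the norm closure in $\mathbb B(L^2(Y)\otimes K)$ of the $*$-algebra of locally compact, finite propagation operators, where $C_0(Y)$ acts by multiplication on $L^2(Y)$; $T$ is locally compact if $Tf,fT$ are compact for all $f\in C_0(Y)$, and has finite propagation if there is $R>0$ with $fTg=0$ whenever $f,g\in C_0(Y)$ have supports at distance greater than $R$. $H$ is a fixed infinite-dimensional Hilbert space. The map $i_D:C^*_{\mathbb C}(D)\to C^*_H(D)$ is $i_D(T)=T\otimes e$ with $e\in\mathbb K(H)$ a rank one projection, and $(i_D)_*:K_0(C^*_{\mathbb C}(D))\to K_0(C^*_H(D))$ is the induced map (independent of $e$). For $D_0\subset D$, $1_{D_0}\in C^*_{\mathbb C}(D)$ denotes the projection of $l^2(D)$ onto $l^2(D_0)$; $1_D$ is the unit of $C^*_{\mathbb C}(D)$. Wannier basis with localization centers in $D_0$: an orthonormal set $\{\phi_x:x\in D_0\}\subset L^2(X)$ for which there is $R>0$ with $\operatorname{supp}\phi_x\subset B_R(x)$ for all $x\in D_0$, where $B_R(x)$ is the ball of radius $R$ centered at $x$. $p_\phi\in C^*_{\mathbb C}(X)$ is the orthogonal projection onto the closed linear span of $\{\phi_x\}$. *)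

theory Defs
  imports "HOL-Analysis.Analysis" "HOL-Algebra.Module" "HOL-Algebra.Coset"
begin

section \<open>Complex Hilbert spaces as a type class\<close>

text \<open>The inner product is antilinear in the first and linear in the second argument.\<close>

class complex_hilbert_space = banach +
  fixes scaleC :: "complex \<Rightarrow> 'a \<Rightarrow> 'a"
    and cinner :: "'a \<Rightarrow> 'a \<Rightarrow> complex"
  assumes scaleC_add_right: "scaleC a (x + y) = scaleC a x + scaleC a y"
    and scaleC_add_left: "scaleC (a + b) x = scaleC a x + scaleC b x"
    and scaleC_scaleC: "scaleC a (scaleC b x) = scaleC (a * b) x"
    and scaleR_scaleC: "scaleR r x = scaleC (complex_of_real r) x"
    and cinner_commute: "cinner x y = cnj (cinner y x)"
    and cinner_add_right: "cinner x (y + z) = cinner x y + cinner x z"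
    and cinner_scaleC_right: "cinner x (scaleC a y) = a * cinner x y"
    and norm_eq_sqrt_cinner: "norm x = sqrt (Re (cinner x x))"

instantiation complex :: complex_hilbert_space
begin
definition "scaleC_complex (a :: complex) (x :: complex) = a * x"
definition "cinner_complex (x :: complex) (y :: complex) = cnj x * y"
instance
  by standard (auto simp: scaleC_complex_def cinner_complex_def algebra_simps
      scaleR_conv_of_real cmod_def power2_eq_square)
end

lemma scaleC_one: "scaleC 1 (x :: 'a :: complex_hilbert_space) = x"
  using scaleR_scaleC[of 1 x] by simp

global_interpretation complex_vs: vector_space
  "scaleC :: complex \<Rightarrow> 'a \<Rightarrow> 'a :: complex_hilbert_space"
  by standard (simp_all add: scaleC_add_right scaleC_add_left scaleC_scaleC scaleC_one)

definition infinite_dimensional :: "'h :: complex_hilbert_space itself \<Rightarrow> bool" where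
  "infinite_dimensional _ \<longleftrightarrow> \<not> (\<exists>B :: 'h set. finite B \<and> complex_vs.span B = UNIV)"

definition rank_one_projection :: "('h :: complex_hilbert_space \<Rightarrow> 'h) \<Rightarrow> bool" where
  "rank_one_projection e \<longleftrightarrow>
     Vector_Spaces.linear scaleC scaleC e \<and>
     e \<circ> e = e \<and>
     (\<forall>x y. cinner (e x) y = cinner x (e y)) \<and>
     (\<exists>v. v \<noteq> 0 \<and> range e = complex_vs.span {v})"


section \<open>Hilbert spaces with explicit carriers and their operators\<close>

text \<open>
  The space of square integrable functions depends on a measure, which is a term; it is therefore
  not a type, and carriers are used.
\<close>

record 'v hspace =
  hcarrier :: "'v set"
  hzero :: 'v
  hadd :: "'v \<Rightarrow> 'v \<Rightarrow> 'v"
  hscale :: "complex \<Rightarrow> 'v \<Rightarrow> 'v"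
  hinner :: "'v \<Rightarrow> 'v \<Rightarrow> complex"

definition hnorm :: "'v hspace \<Rightarrow> 'v \<Rightarrow> real" where
  "hnorm E x = sqrt (Re (hinner E x x))"

definition hdiff :: "'v hspace \<Rightarrow> 'v \<Rightarrow> 'v \<Rightarrow> 'v" where
  "hdiff E x y = hadd E x (hscale E (-1) y)"

text \<open>
  *-algebras over the complex numbers. The field \<open>one\<close> inherited from rings is meaningful
  for unital algebras only; in subalgebras of the algebra of all bounded operators it denotes the
  identity operator, whether or not the latter belongs to the carrier.
\<close>

record 'b star_algebra = "(complex, 'b) module" +
  star :: "'b \<Rightarrow> 'b"

definition hadjoint :: "'v hspace \<Rightarrow> ('v \<Rightarrow> 'v) \<Rightarrow> 'v \<Rightarrow> 'v" where
  "hadjoint E T = (\<lambda>y\<in>hcarrier E. THE z. z \<in> hcarrier E \<and>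
     (\<forall>x\<in>hcarrier E. hinner E x z = hinner E (T x) y))"

definition bounded_operators :: "'v hspace \<Rightarrow> ('v \<Rightarrow> 'v) set" where
  "bounded_operators E = {T \<in> hcarrier E \<rightarrow>\<^sub>E hcarrier E.
     (\<forall>x\<in>hcarrier E. \<forall>y\<in>hcarrier E. T (hadd E x y) = hadd E (T x) (T y)) \<and>
     (\<forall>c. \<forall>x\<in>hcarrier E. T (hscale E c x) = hscale E c (T x)) \<and>
     (\<exists>C. \<forall>x\<in>hcarrier E. hnorm E (T x) \<le> C * hnorm E x)}"

definition operator_algebra :: "'v hspace \<Rightarrow> ('v \<Rightarrow> 'v) star_algebra" where
  "operator_algebra E = \<lparr>
     carrier = bounded_operators E,
     mult = (\<lambda>S T. compose (hcarrier E) S T),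
     one = (\<lambda>x\<in>hcarrier E. x),
     zero = (\<lambda>x\<in>hcarrier E. hzero E),
     add = (\<lambda>S T. \<lambda>x\<in>hcarrier E. hadd E (S x) (T x)),
     smult = (\<lambda>c T. \<lambda>x\<in>hcarrier E. hscale E c (T x)),
     star = hadjoint E\<rparr>"

definition compact_operator :: "'v hspace \<Rightarrow> ('v \<Rightarrow> 'v) \<Rightarrow> bool" where
  "compact_operator E T \<longleftrightarrow> T \<in> bounded_operators E \<and>
     (\<forall>X :: nat \<Rightarrow> 'v. (\<forall>n. X n \<in> hcarrier E) \<and> (\<exists>C. \<forall>n. hnorm E (X n) \<le> C) \<longrightarrow>
        (\<exists>r y. strict_mono r \<and> y \<in> hcarrier E \<and>
           (\<lambda>n. hnorm E (hdiff E (T (X (r n))) y)) \<longlonglongrightarrow> 0))"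

definition norm_closure :: "'v hspace \<Rightarrow> ('v \<Rightarrow> 'v) set \<Rightarrow> ('v \<Rightarrow> 'v) set" where
  "norm_closure E A = {T \<in> bounded_operators E. \<forall>\<epsilon>>0. \<exists>S\<in>A.
     \<forall>x\<in>hcarrier E. hnorm E (hdiff E (T x) (S x)) \<le> \<epsilon> * hnorm E x}"

inductive_set hspan :: "'v hspace \<Rightarrow> 'v set \<Rightarrow> 'v set" for E :: "'v hspace" and S :: "'v set" where
  zero: "hzero E \<in> hspan E S"
| base: "x \<in> S \<Longrightarrow> x \<in> hspan E S"
| add: "x \<in> hspan E S \<Longrightarrow> y \<in> hspan E S \<Longrightarrow> hadd E x y \<in> hspan E S"
| scale: "x \<in> hspan E S \<Longrightarrow> hscale E c x \<in> hspan E S"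

definition closed_hspan :: "'v hspace \<Rightarrow> 'v set \<Rightarrow> 'v set" where
  "closed_hspan E S =
     {x \<in> hcarrier E. \<forall>\<epsilon>>0. \<exists>y\<in>hspan E S. hnorm E (hdiff E x y) < \<epsilon>}"

definition orthogonal_projection :: "'v hspace \<Rightarrow> 'v set \<Rightarrow> 'v \<Rightarrow> 'v" where
  "orthogonal_projection E V = (\<lambda>x\<in>hcarrier E. THE y. y \<in> V \<and>
     (\<forall>z\<in>V. hinner E z (hdiff E x y) = 0))"


section \<open>The Hilbert space of square integrable functions with values in a Hilbert space\<close>

text \<open>
  Borel functions with separable range, so that this is the Hilbert tensor product of the scalar
  space and \<open>'k\<close> also when \<open>'k\<close> is not separable. Values outside
  \<open>space M\<close> are irrelevant, since functions are identified almost everywhere.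
\<close>

definition l2_functions :: "'a measure \<Rightarrow> ('a \<Rightarrow> 'k :: complex_hilbert_space) set" where
  "l2_functions M = {f \<in> borel_measurable M.
     (\<exists>S. countable S \<and> f ` space M \<subseteq> closure S) \<and>
     (\<integral>\<^sup>+x. ennreal ((norm (f x))\<^sup>2) \<partial>M) < \<infinity>}"

definition l2_class ::
  "'a measure \<Rightarrow> ('a \<Rightarrow> 'k :: complex_hilbert_space) \<Rightarrow> ('a \<Rightarrow> 'k) set" where
  "l2_class M f = {g \<in> l2_functions M. AE x in M. g x = f x}"

definition rep :: "('a \<Rightarrow> 'k) set \<Rightarrow> 'a \<Rightarrow> 'k" where
  "rep F = (SOME f. f \<in> F)"

definition L2 :: "'a measure \<Rightarrow> ('a \<Rightarrow> 'k :: complex_hilbert_space) set hspace" where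
  "L2 M = \<lparr>
     hcarrier = l2_class M ` l2_functions M,
     hzero = l2_class M (\<lambda>x. 0),
     hadd = (\<lambda>F G. l2_class M (\<lambda>x. rep F x + rep G x)),
     hscale = (\<lambda>c F. l2_class M (\<lambda>x. scaleC c (rep F x))),
     hinner = (\<lambda>F G. LINT x|M. cinner (rep F x) (rep G x))\<rparr>"

definition mult_operator ::
  "'a measure \<Rightarrow> ('a \<Rightarrow> complex) \<Rightarrow>
   ('a \<Rightarrow> 'k :: complex_hilbert_space) set \<Rightarrow> ('a \<Rightarrow> 'k) set" where
  "mult_operator M f = (\<lambda>F\<in>hcarrier (L2 M). l2_class M (\<lambda>x. scaleC (f x) (rep F x)))"

definition elementary_tensor ::
  "'a measure \<Rightarrow> ('a \<Rightarrow> complex) set \<Rightarrow> 'k \<Rightarrow> ('a \<Rightarrow> 'k :: complex_hilbert_space) set" where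
  "elementary_tensor M F v = l2_class M (\<lambda>x. scaleC (rep F x) v)"

definition tensor_operator ::
  "'a measure \<Rightarrow> (('a \<Rightarrow> complex) set \<Rightarrow> ('a \<Rightarrow> complex) set) \<Rightarrow> ('k \<Rightarrow> 'k) \<Rightarrow>
   ('a \<Rightarrow> 'k :: complex_hilbert_space) set \<Rightarrow> ('a \<Rightarrow> 'k) set" where
  "tensor_operator M T e = (THE S. S \<in> bounded_operators (L2 M) \<and>
     (\<forall>F\<in>hcarrier (L2 M). \<forall>v. S (elementary_tensor M F v) = elementary_tensor M (T F) (e v)))"


section \<open>Roe algebras\<close>

definition C0 :: "'a :: metric_space set \<Rightarrow> ('a \<Rightarrow> complex) set" where
  "C0 Y = {f. continuous_on Y f \<and>
     (\<forall>\<epsilon>>0. \<exists>C\<subseteq>Y. compact C \<and> (\<forall>y\<in>Y - C. norm (f y) < \<epsilon>))}"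

definition supp_in :: "'a :: metric_space set \<Rightarrow> ('a \<Rightarrow> complex) \<Rightarrow> 'a set" where
  "supp_in Y f = Y \<inter> closure {y \<in> Y. f y \<noteq> 0}"

definition locally_compact_operator ::
  "'a :: metric_space measure \<Rightarrow>
   (('a \<Rightarrow> 'k :: complex_hilbert_space) set \<Rightarrow> ('a \<Rightarrow> 'k) set) \<Rightarrow> bool" where
  "locally_compact_operator M T \<longleftrightarrow> (\<forall>f\<in>C0 (space M).
     compact_operator (L2 M) (T \<otimes>\<^bsub>operator_algebra (L2 M)\<^esub> mult_operator M f) \<and>
     compact_operator (L2 M) (mult_operator M f \<otimes>\<^bsub>operator_algebra (L2 M)\<^esub> T))"

text \<open>
  The library distance to an empty set is 0; this is harmless, as a function with empty
  support acts as 0.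
\<close>

definition finite_propagation ::
  "'a :: metric_space measure \<Rightarrow>
   (('a \<Rightarrow> 'k :: complex_hilbert_space) set \<Rightarrow> ('a \<Rightarrow> 'k) set) \<Rightarrow> bool" where
  "finite_propagation M T \<longleftrightarrow> (\<exists>R>0. \<forall>f\<in>C0 (space M). \<forall>g\<in>C0 (space M).
     setdist (supp_in (space M) f) (supp_in (space M) g) > R \<longrightarrow>
     mult_operator M f \<otimes>\<^bsub>operator_algebra (L2 M)\<^esub> T
       \<otimes>\<^bsub>operator_algebra (L2 M)\<^esub> mult_operator M g
     = \<zero>\<^bsub>operator_algebra (L2 M)\<^esub>)"

text \<open>
  The metric space is \<open>space M\<close>, with the metric of the type \<open>'a\<close>. A discrete
  space \<open>D\<close> with counting measure is \<open>count_space D\<close>.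
\<close>

definition roe_algebra ::
  "'k :: complex_hilbert_space itself \<Rightarrow> 'a :: metric_space measure \<Rightarrow>
   (('a \<Rightarrow> 'k) set \<Rightarrow> ('a \<Rightarrow> 'k) set) star_algebra" where
  "roe_algebra _ M = (operator_algebra (L2 M))\<lparr>carrier := norm_closure (L2 M)
     {T \<in> bounded_operators (L2 M). locally_compact_operator M T \<and> finite_propagation M T}\<rparr>"


section \<open>K-theory in degree zero\<close>

definition complex_algebra :: "complex star_algebra" where
  "complex_algebra = \<lparr>carrier = UNIV, mult = (*), one = 1, zero = 0, add = (+),
     smult = (*), star = cnj\<rparr>"

text \<open>A unit is always adjoined, also to an algebra that already has one.\<close>

definition unitization :: "'b star_algebra \<Rightarrow> ('b \<times> complex) star_algebra" where
  "unitization A = \<lparr>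
     carrier = carrier A \<times> UNIV,
     mult = (\<lambda>(a, s) (b, t). (a \<otimes>\<^bsub>A\<^esub> b \<oplus>\<^bsub>A\<^esub> (s \<odot>\<^bsub>A\<^esub> b \<oplus>\<^bsub>A\<^esub> t \<odot>\<^bsub>A\<^esub> a), s * t)),
     one = (\<zero>\<^bsub>A\<^esub>, 1),
     zero = (\<zero>\<^bsub>A\<^esub>, 0),
     add = (\<lambda>(a, s) (b, t). (a \<oplus>\<^bsub>A\<^esub> b, s + t)),
     smult = (\<lambda>c (a, s). (c \<odot>\<^bsub>A\<^esub> a, c * s)),
     star = (\<lambda>(a, s). (star A a, cnj s))\<rparr>"

text \<open>Matrices are functions of two indices which vanish outside the index range.\<close>

type_synonym 'b mtx = "nat \<Rightarrow> nat \<Rightarrow> 'b"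

definition mtx_carrier :: "'b star_algebra \<Rightarrow> nat \<Rightarrow> nat \<Rightarrow> 'b mtx set" where
  "mtx_carrier B m n = {a. \<forall>i j. (i < m \<and> j < n \<longrightarrow> a i j \<in> carrier B) \<and>
     (\<not> (i < m \<and> j < n) \<longrightarrow> a i j = \<zero>\<^bsub>B\<^esub>)}"

text \<open>The parameter \<open>k\<close> is the common inner dimension.\<close>

definition mtx_mult :: "'b star_algebra \<Rightarrow> nat \<Rightarrow> 'b mtx \<Rightarrow> 'b mtx \<Rightarrow> 'b mtx" where
  "mtx_mult B k a b = (\<lambda>i j. finsum B (\<lambda>l. a i l \<otimes>\<^bsub>B\<^esub> b l j) {..<k})"

definition mtx_star :: "'b star_algebra \<Rightarrow> 'b mtx \<Rightarrow> 'b mtx" where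
  "mtx_star B a = (\<lambda>i j. star B (a j i))"

definition mtx_projections :: "'b star_algebra \<Rightarrow> (nat \<times> 'b mtx) set" where
  "mtx_projections B = {(n, p). p \<in> mtx_carrier B n n \<and> mtx_star B p = p \<and> mtx_mult B n p p = p}"

definition murray_von_neumann ::
  "'b star_algebra \<Rightarrow> ((nat \<times> 'b mtx) \<times> (nat \<times> 'b mtx)) set" where
  "murray_von_neumann B = {((n, p), (m, q)).
     (n, p) \<in> mtx_projections B \<and> (m, q) \<in> mtx_projections B \<and>
     (\<exists>v\<in>mtx_carrier B m n. p = mtx_mult B m (mtx_star B v) v \<and> q = mtx_mult B n v (mtx_star B v))}"

definition direct_sum ::
  "'b star_algebra \<Rightarrow> nat \<times> 'b mtx \<Rightarrow> nat \<times> 'b mtx \<Rightarrow> nat \<times> 'b mtx" where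
  "direct_sum B = (\<lambda>(n, p) (m, q). (n + m, \<lambda>i j.
     if i < n \<and> j < n then p i j
     else if n \<le> i \<and> n \<le> j then q (i - n) (j - n)
     else \<zero>\<^bsub>B\<^esub>))"

definition projection_monoid :: "'b star_algebra \<Rightarrow> (nat \<times> 'b mtx) set monoid" where
  "projection_monoid B = \<lparr>
     carrier = mtx_projections B // murray_von_neumann B,
     mult = (\<lambda>X Y. \<Union>p\<in>X. \<Union>q\<in>Y. murray_von_neumann B `` {direct_sum B p q}),
     one = murray_von_neumann B `` {(0, \<lambda>i j. \<zero>\<^bsub>B\<^esub>)}\<rparr>"

definition projection_monoid_map ::
  "'c star_algebra \<Rightarrow> ('b \<Rightarrow> 'c) \<Rightarrow> (nat \<times> 'b mtx) set \<Rightarrow> (nat \<times> 'c mtx) set" where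
  "projection_monoid_map C h X =
     (\<Union>(n, p)\<in>X. murray_von_neumann C `` {(n, \<lambda>i j. h (p i j))})"

definition grothendieck_rel :: "('m, 'z) monoid_scheme \<Rightarrow> (('m \<times> 'm) \<times> ('m \<times> 'm)) set" where
  "grothendieck_rel M = {((a, b), (c, d)).
     a \<in> carrier M \<and> b \<in> carrier M \<and> c \<in> carrier M \<and> d \<in> carrier M \<and>
     (\<exists>x\<in>carrier M. a \<otimes>\<^bsub>M\<^esub> d \<otimes>\<^bsub>M\<^esub> x = c \<otimes>\<^bsub>M\<^esub> b \<otimes>\<^bsub>M\<^esub> x)}"

definition grothendieck_group :: "('m, 'z) monoid_scheme \<Rightarrow> ('m \<times> 'm) set monoid" where
  "grothendieck_group M = \<lparr>
     carrier = (carrier M \<times> carrier M) // grothendieck_rel M,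
     mult = (\<lambda>X Y. \<Union>(a, b)\<in>X. \<Union>(c, d)\<in>Y.
               grothendieck_rel M `` {(a \<otimes>\<^bsub>M\<^esub> c, b \<otimes>\<^bsub>M\<^esub> d)}),
     one = grothendieck_rel M `` {(\<one>\<^bsub>M\<^esub>, \<one>\<^bsub>M\<^esub>)}\<rparr>"

type_synonym 'b k0_elem = "((nat \<times> 'b mtx) set \<times> (nat \<times> 'b mtx) set) set"

text \<open>The group \<open>K00 B\<close> is the usual one for unital \<open>B\<close>; in general
  \<open>K0 A\<close> is the kernel of the map induced by the augmentation of the unitization.
  These groups are written multiplicatively.\<close>

definition K00 :: "'b star_algebra \<Rightarrow> 'b k0_elem monoid" where
  "K00 B = grothendieck_group (projection_monoid B)"

definition K00_map :: "'c star_algebra \<Rightarrow> ('b \<Rightarrow> 'c) \<Rightarrow> 'b k0_elem \<Rightarrow> 'c k0_elem" where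
  "K00_map C h X = (\<Union>(a, b)\<in>X. grothendieck_rel (projection_monoid C) ``
     {(projection_monoid_map C h a, projection_monoid_map C h b)})"

definition K0 :: "'b star_algebra \<Rightarrow> ('b \<times> complex) k0_elem monoid" where
  "K0 A = (K00 (unitization A))\<lparr>carrier :=
     kernel (K00 (unitization A)) (K00 complex_algebra) (K00_map complex_algebra snd)\<rparr>"

definition K0_map ::
  "'c star_algebra \<Rightarrow> ('b \<Rightarrow> 'c) \<Rightarrow> ('b \<times> complex) k0_elem \<Rightarrow> ('c \<times> complex) k0_elem" where
  "K0_map C h = K00_map (unitization C) (\<lambda>(a, s). (h a, s))"

text \<open>The class of a projection in the algebra itself, i.e. of a matrix of size 1.\<close>

definition K0_class :: "'b star_algebra \<Rightarrow> 'b \<Rightarrow> ('b \<times> complex) k0_elem" where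
  "K0_class A p = grothendieck_rel (projection_monoid (unitization A)) ``
     {(murray_von_neumann (unitization A) ``
         {(1, \<lambda>i j. if i = 0 \<and> j = 0 then (p, 0) else \<zero>\<^bsub>unitization A\<^esub>)},
       \<one>\<^bsub>projection_monoid (unitization A)\<^esub>)}"


section \<open>Coarse geometry and Wannier bases\<close>

definition bounded_geometry :: "'a :: metric_space set \<Rightarrow> bool" where
  "bounded_geometry D \<longleftrightarrow>
     (\<forall>R>0. \<exists>N. \<forall>x\<in>D. finite (D \<inter> cball x R) \<and> card (D \<inter> cball x R) \<le> N)"

definition graph_edges :: "'a :: metric_space set \<Rightarrow> real \<Rightarrow> ('a \<times> 'a) set" where
  "graph_edges D \<alpha> = {(x, y). x \<in> D \<and> y \<in> D \<and> x \<noteq> y \<and> dist x y \<le> \<alpha>}"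

definition connected_components :: "'a :: metric_space set \<Rightarrow> real \<Rightarrow> 'a set set" where
  "connected_components D \<alpha> = (\<lambda>x. (graph_edges D \<alpha>)\<^sup>* `` {x}) ` D"

definition no_finite_components :: "'a :: metric_space set \<Rightarrow> real \<Rightarrow> bool" where
  "no_finite_components D \<alpha> \<longleftrightarrow> (\<forall>C\<in>connected_components D \<alpha>. infinite C)"

text \<open>
  Here the whole type \<open>'a\<close> is the metric measure space. The measure is not required to be
  locally finite.
\<close>

definition proper_metric_measure_space :: "'a :: metric_space measure \<Rightarrow> bool" where
  "proper_metric_measure_space M \<longleftrightarrow> sets M = sets borel \<and> (\<forall>(x :: 'a) r. compact (cball x r))"

text \<open>
  The next two definitions are the standing assumptions on the module of square integrable
  functions: the products of continuous functions vanishing at infinity with square integrable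
  functions are dense, and no non-zero continuous function vanishing at infinity acts as a compact
  operator.
\<close>

definition nondegenerate_module :: "'a :: metric_space measure \<Rightarrow> bool" where
  "nondegenerate_module M \<longleftrightarrow>
     (\<forall>F\<in>hcarrier (L2 M :: ('a \<Rightarrow> complex) set hspace). \<forall>\<epsilon>>0.
        \<exists>f\<in>C0 (space M). \<exists>G\<in>hcarrier (L2 M). hnorm (L2 M) (hdiff (L2 M) F (mult_operator M f G)) < \<epsilon>)"

definition ample_module :: "'a :: metric_space measure \<Rightarrow> bool" where
  "ample_module M \<longleftrightarrow>
     (\<forall>f\<in>C0 (space M). (\<exists>x\<in>space M. f x \<noteq> 0) \<longrightarrow>
        \<not> compact_operator (L2 M :: ('a \<Rightarrow> complex) set hspace) (mult_operator M f))"

definition non_atomic :: "'a measure \<Rightarrow> bool" where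
  "non_atomic M \<longleftrightarrow> \<not> (\<exists>A\<in>sets M. emeasure M A > 0 \<and>
     (\<forall>B\<in>sets M. B \<subseteq> A \<longrightarrow> emeasure M B = 0 \<or> emeasure M (A - B) = 0))"

definition coarsely_equivalent_subspace :: "'a :: metric_space set \<Rightarrow> bool" where
  "coarsely_equivalent_subspace D \<longleftrightarrow> (\<exists>C>0. \<forall>x. \<exists>y\<in>D. dist x y < C)"

definition essential_support ::
  "'a :: metric_space measure \<Rightarrow> ('a \<Rightarrow> complex) set \<Rightarrow> 'a set" where
  "essential_support M F =
     {x. \<forall>U. open U \<and> x \<in> U \<longrightarrow> \<not> (AE y in M. y \<in> U \<longrightarrow> rep F y = 0)}"

definition wannier_basis ::
  "'a :: metric_space measure \<Rightarrow> 'a set \<Rightarrow> ('a \<Rightarrow> ('a \<Rightarrow> complex) set) \<Rightarrow> bool" where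
  "wannier_basis M D0 \<phi> \<longleftrightarrow>
     (\<forall>x\<in>D0. \<phi> x \<in> hcarrier (L2 M)) \<and>
     (\<forall>x\<in>D0. \<forall>y\<in>D0. hinner (L2 M) (\<phi> x) (\<phi> y) = (if x = y then 1 else 0)) \<and>
     (\<exists>R>0. \<forall>x\<in>D0. essential_support M (\<phi> x) \<subseteq> cball x R)"

definition wannier_projection ::
  "'a :: metric_space measure \<Rightarrow> 'a set \<Rightarrow> ('a \<Rightarrow> ('a \<Rightarrow> complex) set) \<Rightarrow>
   ('a \<Rightarrow> complex) set \<Rightarrow> ('a \<Rightarrow> complex) set" where
  "wannier_projection M D0 \<phi> = orthogonal_projection (L2 M) (closed_hspan (L2 M) (\<phi> ` D0))"


section \<open>The map induced by a rank one projection\<close>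

definition subset_projection ::
  "'a set \<Rightarrow> 'a set \<Rightarrow> ('a \<Rightarrow> complex) set \<Rightarrow> ('a \<Rightarrow> complex) set" where
  "subset_projection D D0 = mult_operator (count_space D) (indicator D0)"

definition stabilization_map ::
  "'a :: metric_space set \<Rightarrow> ('h :: complex_hilbert_space \<Rightarrow> 'h) \<Rightarrow>
   (('a \<Rightarrow> complex) set \<Rightarrow> ('a \<Rightarrow> complex) set) \<Rightarrow> ('a \<Rightarrow> 'h) set \<Rightarrow> ('a \<Rightarrow> 'h) set" where
  "stabilization_map D e T = tensor_operator (count_space D) T e"

definition stabilization_K0 ::
  "'a :: metric_space set \<Rightarrow> ('h :: complex_hilbert_space \<Rightarrow> 'h) \<Rightarrow>
   ((('a \<Rightarrow> complex) set \<Rightarrow> ('a \<Rightarrow> complex) set) \<times> complex) k0_elem \<Rightarrow>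
   ((('a \<Rightarrow> 'h) set \<Rightarrow> ('a \<Rightarrow> 'h) set) \<times> complex) k0_elem" where
  "stabilization_K0 D e = K0_map (roe_algebra TYPE('h) (count_space D)) (stabilization_map D e)"

end

theory Submission
  imports Defs "HOL-Library.Diagonal_Subsequence"
begin

text \<open>
  Equivalence of projections is implemented by partial isometries between orthonormal families: if
  \<open>b\<close> and \<open>c\<close> are orthonormal families whose members are localised near points \<open>q i\<close> and \<open>p i\<close>
  at bounded distance, then the operator taking \<open>b i\<close> to \<open>c i\<close> lies in the Roe algebra as soon as
  only finitely many centres lie in each ball.

  (a) Without finite components every point \<open>x\<close> starts a ray \<open>\<gamma> x\<close> to infinity such that each point
  is met by only finitely many rays. Choosing orthonormal vectors \<open>\<psi> (x, n)\<close> near \<open>\<gamma> x (n + 1)\<close>, the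
  operators \<open>\<phi> x \<mapsto> \<psi> (x, 0)\<close> and \<open>\<psi> (x, n) \<mapsto> \<psi> (x, n + 1)\<close> show that the projection onto the span
  of \<open>\<phi>\<close> plus the one onto the span of \<open>\<psi>\<close> is equivalent to the latter (an Eilenberg swindle).

  (b) If the class of \<open>1 \<otimes> e\<close> vanishes, there are an isometry \<open>u = 1 + a\<close> and a partial isometry \<open>y\<close>
  over the unitization with \<open>y\<^sup>*y = 1 \<otimes> e\<close> and \<open>u\<^sup>*y = 0\<close>. Replace both by operators of finite
  propagation up to a small error. If there were finite components \<open>C\<close> for arbitrarily large
  \<open>\<alpha>\<close>, both would preserve the functions supported on \<open>C\<close>, where \<open>a\<close> is compact; there \<open>u\<close> is
  bounded below, hence surjective, contradicting \<open>u\<^sup>*y = 0\<close>.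
\<close>

section \<open>Matrices over *-rings\<close>

text \<open>For a finite non-empty set \<open>C\<close> the Roe algebra consists of compact
  operators, whose \<open>K0\<close> group records the rank, and the rank of
  \<open>1 \<otimes> e\<close> over \<open>C\<close> is not zero. In (b) this cannot be used
  directly: compression to \<open>C\<close> is multiplicative in general only for operators whose
  propagation is below the distance from \<open>C\<close> to its complement, and elements of the
  norm closure may have unbounded propagation. Approximation destroys the algebraic relations, so
  these are first put into a form that survives a perturbation: an isometry is bounded below, and a
  unit vector orthogonal to its range keeps a positive distance from it. The scalar part of the
  isometry is normalised to 1 so that \<open>u - 1\<close> is compact over \<open>C\<close>.

  In (a) the obstacle is local compactness: the span of the vectors along all rays yields an element
  of the Roe algebra only if each ball meets finitely many pairs of a ray and a time. The number of
  rays through a vertex is finite but not bounded in advance, so infinitely many orthonormal vectors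
  are kept available near every vertex. They come from \<open>H\<close> on \<open>D\<close> and from
  ampleness on \<open>X\<close>.\<close>

locale star_ring = ring B for B :: "'b star_algebra" (structure) +
  assumes star_closed [simp, intro]: "a \<in> carrier B \<Longrightarrow> star B a \<in> carrier B"
    and star_star [simp]: "a \<in> carrier B \<Longrightarrow> star B (star B a) = a"
    and star_add: "\<lbrakk>a \<in> carrier B; b \<in> carrier B\<rbrakk> \<Longrightarrow> star B (a \<oplus> b) = star B a \<oplus> star B b"
    and star_mult: "\<lbrakk>a \<in> carrier B; b \<in> carrier B\<rbrakk> \<Longrightarrow> star B (a \<otimes> b) = star B b \<otimes> star B a"
begin

lemma star_zero [simp]: "star B \<zero> = \<zero>"
proof -
  have "star B \<zero> \<oplus> star B \<zero> = star B \<zero>"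
    using star_add[of \<zero> \<zero>] by simp
  then show ?thesis
    by (metis star_closed zero_closed add.r_cancel_one)
qed

lemma star_one [simp]: "star B \<one> = \<one>"
  by (metis one_closed r_one l_one star_closed star_mult star_star)

lemma finsum_swap:
  assumes "finite I" "finite J" "\<And>i j. i \<in> I \<Longrightarrow> j \<in> J \<Longrightarrow> f i j \<in> carrier B"
  shows "finsum B (\<lambda>i. finsum B (f i) J) I = finsum B (\<lambda>j. finsum B (\<lambda>i. f i j) I) J"
  using assms(1,3)
proof (induction I)
  case empty
  show ?case by (simp add: finsum_zero)
next
  case (insert x I)
  have "finsum B (\<lambda>i. finsum B (f i) J) (insert x I)
      = finsum B (f x) J \<oplus> finsum B (\<lambda>i. finsum B (f i) J) I"
    using insert by (subst finsum_insert) (auto intro!: finsum_closed)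
  also have "\<dots> = finsum B (f x) J \<oplus> finsum B (\<lambda>j. finsum B (\<lambda>i. f i j) I) J"
    using insert by simp
  also have "\<dots> = finsum B (\<lambda>j. f x j \<oplus> finsum B (\<lambda>i. f i j) I) J"
    using insert by (subst finsum_addf) (auto intro!: finsum_closed)
  also have "\<dots> = finsum B (\<lambda>j. finsum B (\<lambda>i. f i j) (insert x I)) J"
    using insert by (intro finsum_cong') (auto intro!: finsum_closed)
  finally show ?case .
qed

lemma finsum_star:
  assumes "finite I" "\<And>i. i \<in> I \<Longrightarrow> f i \<in> carrier B"
  shows "star B (finsum B f I) = finsum B (\<lambda>i. star B (f i)) I"
  using assms
proof (induction I)
  case (insert x I)
  then show ?case
    by (simp add: finsum_insert Pi_I star_add finsum_closed)
qed simp

lemma finsum_add_index: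
  assumes "\<And>l. f l \<in> carrier B"
  shows "finsum B f {..<m + n} = finsum B f {..<m} \<oplus> finsum B (\<lambda>l. f (m + l)) {..<(n::nat)}"
proof (induction n)
  case 0
  show ?case using assms by (simp add: finsum_closed)
next
  case (Suc n)
  have "finsum B f {..<m + Suc n} = f (m + n) \<oplus> finsum B f {..<m + n}"
    using assms by (simp add: lessThan_Suc)
  also have "\<dots> = finsum B f {..<m} \<oplus> (f (m + n) \<oplus> finsum B (\<lambda>l. f (m + l)) {..<n})"
    using assms Suc by (simp add: a_ac finsum_closed)
  also have "f (m + n) \<oplus> finsum B (\<lambda>l. f (m + l)) {..<n} = finsum B (\<lambda>l. f (m + l)) {..<Suc n}"
    using assms by (simp add: lessThan_Suc)
  finally show ?case .
qed

lemma finsum_neutral: "(\<And>i. i \<in> I \<Longrightarrow> f i = \<zero>) \<Longrightarrow> finsum B f I = \<zero>"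
  by (metis (mono_tags, lifting) add.finprod_one_eqI)

lemma finsum_delta:
  assumes "finite I" "k \<in> I" "f k \<in> carrier B" "\<And>i. i \<in> I \<Longrightarrow> i \<noteq> k \<Longrightarrow> f i = \<zero>"
  shows "finsum B f I = f k"
proof -
  have "finsum B f I = finsum B f (insert k (I - {k}))"
    using assms by (simp add: insert_absorb)
  also have "\<dots> = f k \<oplus> finsum B f (I - {k})"
    using assms by (subst finsum_insert) auto
  also have "finsum B f (I - {k}) = \<zero>"
    by (rule finsum_neutral) (use assms in auto)
  finally show ?thesis using assms by simp
qed

text \<open>Index bounds do not occur, since the entries outside the range are zero and so lie in
  the carrier as well.\<close>

lemma mtx_entry [simp]: "a \<in> mtx_carrier B m n \<Longrightarrow> a i j \<in> carrier B"
  unfolding mtx_carrier_def by (cases "i < m \<and> j < n") auto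

lemma mtx_carrierI:
  "\<lbrakk>\<And>i j. i < m \<Longrightarrow> j < n \<Longrightarrow> a i j \<in> carrier B; \<And>i j. \<not> (i < m \<and> j < n) \<Longrightarrow> a i j = \<zero>\<rbrakk>
    \<Longrightarrow> a \<in> mtx_carrier B m n"
  unfolding mtx_carrier_def by blast

lemma mtx_outside: "a \<in> mtx_carrier B m n \<Longrightarrow> \<not> (i < m \<and> j < n) \<Longrightarrow> a i j = \<zero>"
  unfolding mtx_carrier_def by auto

lemma mtx_mult_closed [intro]:
  assumes "a \<in> mtx_carrier B m k" "b \<in> mtx_carrier B k n"
  shows "mtx_mult B k a b \<in> mtx_carrier B m n"
proof (rule mtx_carrierI)
  show "mtx_mult B k a b i j \<in> carrier B" for i j
    using assms unfolding mtx_mult_def by (intro finsum_closed) simp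
  show "mtx_mult B k a b i j = \<zero>" if "\<not> (i < m \<and> j < n)" for i j
  proof -
    have "a i l = \<zero> \<or> b l j = \<zero>" for l
      using that mtx_outside[OF assms(1), of i l] mtx_outside[OF assms(2), of l j] by auto
    then have "a i l \<otimes> b l j = \<zero>" for l
      using mtx_entry[OF assms(1), of i l] mtx_entry[OF assms(2), of l j] by (metis l_null r_null)
    then show ?thesis unfolding mtx_mult_def by (intro finsum_neutral) simp
  qed
qed

lemma mtx_mult_assoc:
  assumes a: "a \<in> mtx_carrier B m k" and b: "b \<in> mtx_carrier B k l" and c: "c \<in> mtx_carrier B l n"
  shows "mtx_mult B l (mtx_mult B k a b) c = mtx_mult B k a (mtx_mult B l b c)"
proof (intro ext)
  fix i j
  have "mtx_mult B l (mtx_mult B k a b) c i j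
      = finsum B (\<lambda>r. finsum B (\<lambda>s. a i s \<otimes> b s r) {..<k} \<otimes> c r j) {..<l}"
    by (simp add: mtx_mult_def)
  also have "\<dots> = finsum B (\<lambda>r. finsum B (\<lambda>s. a i s \<otimes> b s r \<otimes> c r j) {..<k}) {..<l}"
    using a b c by (intro finsum_cong') (auto intro!: finsum_closed finsum_ldistr)
  also have "\<dots> = finsum B (\<lambda>s. finsum B (\<lambda>r. a i s \<otimes> b s r \<otimes> c r j) {..<l}) {..<k}"
    using a b c by (intro finsum_swap) auto
  also have "\<dots> = finsum B (\<lambda>s. finsum B (\<lambda>r. a i s \<otimes> (b s r \<otimes> c r j)) {..<l}) {..<k}"
    using a b c by (intro finsum_cong') (auto intro!: finsum_closed finsum_cong' simp: m_assoc)
  also have "\<dots> = finsum B (\<lambda>s. a i s \<otimes> finsum B (\<lambda>r. b s r \<otimes> c r j) {..<l}) {..<k}"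
    using a b c by (intro finsum_cong') (auto intro!: finsum_closed finsum_rdistr[symmetric])
  finally show "mtx_mult B l (mtx_mult B k a b) c i j = mtx_mult B k a (mtx_mult B l b c) i j"
    by (simp add: mtx_mult_def)
qed

lemma mtx_star_closed [intro]: "a \<in> mtx_carrier B m n \<Longrightarrow> mtx_star B a \<in> mtx_carrier B n m"
  unfolding mtx_star_def by (rule mtx_carrierI) (auto, (metis mtx_outside star_zero)+)

lemma mtx_star_star [simp]: "a \<in> mtx_carrier B m n \<Longrightarrow> mtx_star B (mtx_star B a) = a"
  by (auto simp: mtx_star_def)

lemma mtx_star_mult:
  assumes "a \<in> mtx_carrier B m k" "b \<in> mtx_carrier B k n"
  shows "mtx_star B (mtx_mult B k a b) = mtx_mult B k (mtx_star B b) (mtx_star B a)"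
  using assms by (intro ext) (simp add: mtx_star_def mtx_mult_def finsum_star star_mult)

text \<open>Unlike in \<open>direct_sum\<close> the blocks may be rectangular, so that matrices
  intertwining projections of different sizes can be added too.\<close>

definition dsum :: "nat \<Rightarrow> nat \<Rightarrow> 'b mtx \<Rightarrow> 'b mtx \<Rightarrow> 'b mtx" where
  "dsum r c a b = (\<lambda>i j. if i < r \<and> j < c then a i j
     else if r \<le> i \<and> c \<le> j then b (i - r) (j - c) else \<zero>)"

lemma direct_sum_dsum: "direct_sum B (n, p) (m, q) = (n + m, dsum n n p q)"
  by (simp add: direct_sum_def dsum_def)

lemma dsum_closed [intro]:
  "a \<in> mtx_carrier B r c \<Longrightarrow> b \<in> mtx_carrier B r' c' \<Longrightarrow> dsum r c a b \<in> mtx_carrier B (r + r') (c + c')"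
  unfolding dsum_def by (rule mtx_carrierI) (auto simp: mtx_outside intro!: mtx_outside[of b r' c'])

lemma dsum_star: "mtx_star B (dsum r c a b) = dsum c r (mtx_star B a) (mtx_star B b)"
  by (auto simp: mtx_star_def dsum_def intro!: ext)

lemma dsum_mult:
  assumes a: "a \<in> mtx_carrier B r k" and b: "b \<in> mtx_carrier B r' k'"
    and a': "a' \<in> mtx_carrier B k c" and b': "b' \<in> mtx_carrier B k' c'"
  shows "mtx_mult B (k + k') (dsum r k a b) (dsum k c a' b')
    = dsum r c (mtx_mult B k a a') (mtx_mult B k' b b')"
proof (intro ext)
  fix i j
  have cl: "dsum r k a b i l \<in> carrier B" "dsum k c a' b' l j \<in> carrier B" for l
    using assms by (auto simp: dsum_def)
  have "mtx_mult B (k + k') (dsum r k a b) (dsum k c a' b') i j =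
     finsum B (\<lambda>l. dsum r k a b i l \<otimes> dsum k c a' b' l j) {..<k}
     \<oplus> finsum B (\<lambda>l. dsum r k a b i (k + l) \<otimes> dsum k c a' b' (k + l) j) {..<k'}"
    unfolding mtx_mult_def by (rule finsum_add_index) (use cl in auto)
  also have "finsum B (\<lambda>l. dsum r k a b i l \<otimes> dsum k c a' b' l j) {..<k}
      = (if i < r \<and> j < c then mtx_mult B k a a' i j else \<zero>)"
    using a a' b b'
    by (auto simp: mtx_mult_def dsum_def intro!: finsum_cong' finsum_neutral)
  also have "finsum B (\<lambda>l. dsum r k a b i (k + l) \<otimes> dsum k c a' b' (k + l) j) {..<k'}
      = (if r \<le> i \<and> c \<le> j then mtx_mult B k' b b' (i - r) (j - c) else \<zero>)"
    using a a' b b'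
    by (auto simp: mtx_mult_def dsum_def intro!: finsum_cong' finsum_neutral)
  also have "(if i < r \<and> j < c then mtx_mult B k a a' i j else \<zero>) \<oplus>
      (if r \<le> i \<and> c \<le> j then mtx_mult B k' b b' (i - r) (j - c) else \<zero>)
      = dsum r c (mtx_mult B k a a') (mtx_mult B k' b b') i j"
    using mtx_entry[OF mtx_mult_closed[OF a a'], of i j]
      mtx_entry[OF mtx_mult_closed[OF b b'], of "i - r" "j - c"]
    by (auto simp: dsum_def)
  finally show "mtx_mult B (k + k') (dsum r k a b) (dsum k c a' b') i j
    = dsum r c (mtx_mult B k a a') (mtx_mult B k' b b') i j" .
qed

text \<open>An anti-diagonal block matrix. The product of two of them is block diagonal, which
  provides the intertwiner that swaps two summands.\<close>

definition odsum :: "nat \<Rightarrow> nat \<Rightarrow> 'b mtx \<Rightarrow> 'b mtx \<Rightarrow> 'b mtx" where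
  "odsum r c a b = (\<lambda>i j. if i < r \<and> c \<le> j then a i (j - c)
     else if r \<le> i \<and> j < c then b (i - r) j else \<zero>)"

lemma odsum_closed [intro]:
  "a \<in> mtx_carrier B r c' \<Longrightarrow> b \<in> mtx_carrier B r' c \<Longrightarrow> odsum r c a b \<in> mtx_carrier B (r + r') (c + c')"
  unfolding odsum_def by (rule mtx_carrierI) (auto simp: mtx_outside)

lemma odsum_star: "mtx_star B (odsum r c a b) = odsum c r (mtx_star B b) (mtx_star B a)"
  by (auto simp: mtx_star_def odsum_def intro!: ext)

lemma odsum_mult:
  assumes a: "a \<in> mtx_carrier B r k'" and b: "b \<in> mtx_carrier B r' k"
    and a': "a' \<in> mtx_carrier B k c'" and b': "b' \<in> mtx_carrier B k' c"
  shows "mtx_mult B (k + k') (odsum r k a b) (odsum k c a' b')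
    = dsum r c (mtx_mult B k' a b') (mtx_mult B k b a')"
proof (intro ext)
  fix i j
  have cl: "odsum r k a b i l \<in> carrier B" "odsum k c a' b' l j \<in> carrier B" for l
    using assms by (auto simp: odsum_def)
  have "mtx_mult B (k + k') (odsum r k a b) (odsum k c a' b') i j =
     finsum B (\<lambda>l. odsum r k a b i l \<otimes> odsum k c a' b' l j) {..<k}
     \<oplus> finsum B (\<lambda>l. odsum r k a b i (k + l) \<otimes> odsum k c a' b' (k + l) j) {..<k'}"
    unfolding mtx_mult_def by (rule finsum_add_index) (use cl in auto)
  also have "finsum B (\<lambda>l. odsum r k a b i l \<otimes> odsum k c a' b' l j) {..<k}
      = (if r \<le> i \<and> c \<le> j then mtx_mult B k b a' (i - r) (j - c) else \<zero>)"
    using a a' b b'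
    by (auto simp: mtx_mult_def odsum_def intro!: finsum_cong' finsum_neutral)
  also have "finsum B (\<lambda>l. odsum r k a b i (k + l) \<otimes> odsum k c a' b' (k + l) j) {..<k'}
      = (if i < r \<and> j < c then mtx_mult B k' a b' i j else \<zero>)"
    using a a' b b'
    by (auto simp: mtx_mult_def odsum_def intro!: finsum_cong' finsum_neutral)
  also have "(if r \<le> i \<and> c \<le> j then mtx_mult B k b a' (i - r) (j - c) else \<zero>) \<oplus>
      (if i < r \<and> j < c then mtx_mult B k' a b' i j else \<zero>)
      = dsum r c (mtx_mult B k' a b') (mtx_mult B k b a') i j"
    using mtx_entry[OF mtx_mult_closed[OF a b'], of i j]
      mtx_entry[OF mtx_mult_closed[OF b a'], of "i - r" "j - c"]
    by (auto simp: dsum_def)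
  finally show "mtx_mult B (k + k') (odsum r k a b) (odsum k c a' b') i j
    = dsum r c (mtx_mult B k' a b') (mtx_mult B k b a') i j" .
qed


section \<open>Murray-von Neumann equivalence and the Grothendieck group\<close>

lemma equiv_murray_von_neumann: "equiv (mtx_projections B) (murray_von_neumann B)"
proof (rule equivI)
  show "murray_von_neumann B \<subseteq> mtx_projections B \<times> mtx_projections B"
    by (auto simp: murray_von_neumann_def)
  show "refl_on (mtx_projections B) (murray_von_neumann B)"
    by (auto simp: refl_on_def murray_von_neumann_def mtx_projections_def)
       (metis)
  show "sym (murray_von_neumann B)"
  proof (rule symI)
    fix x y assume "(x, y) \<in> murray_von_neumann B"
    then obtain n p m q v where *: "x = (n, p)" "y = (m, q)"
      "(n, p) \<in> mtx_projections B" "(m, q) \<in> mtx_projections B"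
      "v \<in> mtx_carrier B m n" "p = mtx_mult B m (mtx_star B v) v" "q = mtx_mult B n v (mtx_star B v)"
      by (auto simp: murray_von_neumann_def)
    then show "(y, x) \<in> murray_von_neumann B"
      unfolding murray_von_neumann_def
      by (auto intro!: bexI[of _ "mtx_star B v"])
  qed
  show "trans (murray_von_neumann B)"
  proof (rule transI)
    fix x y z assume "(x, y) \<in> murray_von_neumann B" "(y, z) \<in> murray_von_neumann B"
    then obtain n p m q v k r w where *: "x = (n, p)" "y = (m, q)" "z = (k, r)"
      "(n, p) \<in> mtx_projections B" "(m, q) \<in> mtx_projections B" "(k, r) \<in> mtx_projections B"
      and v: "v \<in> mtx_carrier B m n" "p = mtx_mult B m (mtx_star B v) v" "q = mtx_mult B n v (mtx_star B v)"
      and w: "w \<in> mtx_carrier B k m" "q = mtx_mult B k (mtx_star B w) w" "r = mtx_mult B m w (mtx_star B w)"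
      by (auto simp: murray_von_neumann_def)
    have vs: "mtx_star B v \<in> mtx_carrier B n m" and ws: "mtx_star B w \<in> mtx_carrier B m k"
      using v w by auto
    have wv: "mtx_mult B m w v \<in> mtx_carrier B k n" using v w by auto
    have p: "p \<in> mtx_carrier B n n" "mtx_mult B n p p = p"
      and r: "r \<in> mtx_carrier B k k" "mtx_mult B k r r = r"
      and q: "q \<in> mtx_carrier B m m"
      using * by (auto simp: mtx_projections_def)
    have "mtx_mult B k (mtx_star B (mtx_mult B m w v)) (mtx_mult B m w v)
        = mtx_mult B m (mtx_star B v) (mtx_mult B m q v)"
      using v(1) w(1) vs ws wv
      by (simp add: mtx_star_mult[OF w(1) v(1)] mtx_mult_assoc[OF vs ws wv]
          mtx_mult_assoc[OF ws w(1) v(1), symmetric] w(2)[symmetric])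
    also have "\<dots> = mtx_mult B n (mtx_mult B m (mtx_star B v) v) (mtx_mult B m (mtx_star B v) v)"
      using v(1) vs mtx_mult_closed[OF vs v(1)]
      by (simp add: v(3) mtx_mult_assoc[OF v(1) vs v(1)]
          mtx_mult_assoc[OF vs v(1) mtx_mult_closed[OF vs v(1)]])
    also have "\<dots> = p" using p v(2) by simp
    finally have 1: "p = mtx_mult B k (mtx_star B (mtx_mult B m w v)) (mtx_mult B m w v)" by simp
    have "mtx_mult B n (mtx_mult B m w v) (mtx_star B (mtx_mult B m w v))
        = mtx_mult B m w (mtx_mult B m q (mtx_star B w))"
      using v(1) w(1) vs ws wv
      by (simp add: mtx_star_mult[OF w(1) v(1)] mtx_mult_assoc[OF w(1) v(1) mtx_mult_closed[OF vs ws]]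
          mtx_mult_assoc[OF v(1) vs ws, symmetric] v(3)[symmetric])
    also have "\<dots> = mtx_mult B k (mtx_mult B m w (mtx_star B w)) (mtx_mult B m w (mtx_star B w))"
      using w(1) ws
      by (simp add: w(2) mtx_mult_assoc[OF ws w(1) ws]
          mtx_mult_assoc[OF w(1) ws mtx_mult_closed[OF w(1) ws]])
    also have "\<dots> = r" using r w(3) by simp
    finally have 2: "r = mtx_mult B n (mtx_mult B m w v) (mtx_star B (mtx_mult B m w v))" by simp
    show "(x, z) \<in> murray_von_neumann B"
      unfolding murray_von_neumann_def using * wv 1 2 by auto
  qed
qed

lemma direct_sum_projection:
  assumes "P \<in> mtx_projections B" "Q \<in> mtx_projections B"
  shows "direct_sum B P Q \<in> mtx_projections B"
proof -
  obtain n p m q where "P = (n, p)" "Q = (m, q)" by fastforce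
  with assms show ?thesis
    by (auto simp: direct_sum_dsum mtx_projections_def dsum_star dsum_mult)
qed

lemma direct_sum_cong:
  assumes "(P, P') \<in> murray_von_neumann B" "(Q, Q') \<in> murray_von_neumann B"
  shows "(direct_sum B P Q, direct_sum B P' Q') \<in> murray_von_neumann B"
proof -
  obtain n p n' p' v where 1: "P = (n, p)" "P' = (n', p')" "P \<in> mtx_projections B" "P' \<in> mtx_projections B"
    "v \<in> mtx_carrier B n' n" "p = mtx_mult B n' (mtx_star B v) v" "p' = mtx_mult B n v (mtx_star B v)"
    using assms(1) by (auto simp: murray_von_neumann_def)
  obtain m q m' q' w where 2: "Q = (m, q)" "Q' = (m', q')" "Q \<in> mtx_projections B" "Q' \<in> mtx_projections B"
    "w \<in> mtx_carrier B m' m" "q = mtx_mult B m' (mtx_star B w) w" "q' = mtx_mult B m w (mtx_star B w)"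
    using assms(2) by (auto simp: murray_von_neumann_def)
  have s: "mtx_star B v \<in> mtx_carrier B n n'" "mtx_star B w \<in> mtx_carrier B m m'"
    using 1 2 by auto
  have "direct_sum B P Q \<in> mtx_projections B" "direct_sum B P' Q' \<in> mtx_projections B"
    using 1 2 direct_sum_projection by auto
  moreover have "dsum n' n v w \<in> mtx_carrier B (n' + m') (n + m)" using 1 2 by auto
  moreover have "dsum n n p q = mtx_mult B (n' + m') (mtx_star B (dsum n' n v w)) (dsum n' n v w)"
    using 1 2 s by (simp add: dsum_star dsum_mult)
  moreover have "dsum n' n' p' q' = mtx_mult B (n + m) (dsum n' n v w) (mtx_star B (dsum n' n v w))"
    using 1 2 s by (simp add: dsum_star dsum_mult)
  ultimately show ?thesis
    using 1(1,2) 2(1,2) unfolding murray_von_neumann_def by (auto simp: direct_sum_dsum)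
qed

text \<open>The projections themselves, placed off the diagonal, form the intertwiner.\<close>

lemma direct_sum_commute:
  assumes "P \<in> mtx_projections B" "Q \<in> mtx_projections B"
  shows "(direct_sum B P Q, direct_sum B Q P) \<in> murray_von_neumann B"
proof -
  obtain n p m q where 1: "P = (n, p)" "Q = (m, q)" by fastforce
  have p: "p \<in> mtx_carrier B n n" "mtx_star B p = p" "mtx_mult B n p p = p"
    and q: "q \<in> mtx_carrier B m m" "mtx_star B q = q" "mtx_mult B m q q = q"
    using assms 1 by (auto simp: mtx_projections_def)
  have "odsum m n q p \<in> mtx_carrier B (m + n) (n + m)" using p q by auto
  moreover have "dsum n n p q = mtx_mult B (m + n) (mtx_star B (odsum m n q p)) (odsum m n q p)"
    using p q by (simp add: odsum_star odsum_mult)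
  moreover have "dsum m m q p = mtx_mult B (n + m) (odsum m n q p) (mtx_star B (odsum m n q p))"
    using p q by (simp add: odsum_star odsum_mult)
  ultimately show ?thesis
    using 1 direct_sum_projection[OF assms] direct_sum_projection[OF assms(2,1)]
    unfolding murray_von_neumann_def by (auto simp: direct_sum_dsum)
qed

lemma direct_sum_assoc:
  "direct_sum B (direct_sum B P Q) S = direct_sum B P (direct_sum B Q S)"
proof -
  obtain n p m q k s where "P = (n, p)" "Q = (m, q)" "S = (k, s)" by (metis surj_pair)
  then show ?thesis
    by (auto simp: direct_sum_dsum dsum_def add.assoc diff_diff_left intro!: ext)
qed

lemma zero_projection: "(0, \<lambda>i j. \<zero>) \<in> mtx_projections B"
  unfolding mtx_projections_def by (auto intro!: mtx_carrierI simp: mtx_star_def mtx_mult_def)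

lemma direct_sum_zero:
  "P \<in> mtx_projections B \<Longrightarrow> direct_sum B (0, \<lambda>i j. \<zero>) P = P"
  by (cases P) (auto simp: direct_sum_def)

abbreviation mvn_class :: "nat \<times> 'b mtx \<Rightarrow> (nat \<times> 'b mtx) set" where
  "mvn_class P \<equiv> murray_von_neumann B `` {P}"

lemma mvn_class_mult:
  assumes "P \<in> mtx_projections B" "Q \<in> mtx_projections B"
  shows "mvn_class P \<otimes>\<^bsub>projection_monoid B\<^esub> mvn_class Q = mvn_class (direct_sum B P Q)"
proof -
  have "congruent2 (murray_von_neumann B) (murray_von_neumann B)
      (\<lambda>P Q. mvn_class (direct_sum B P Q))"
    unfolding congruent2_def
    using direct_sum_cong equiv_class_eq[OF equiv_murray_von_neumann] by blast
  from UN_equiv_class2[OF equiv_murray_von_neumann equiv_murray_von_neumann this assms]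
  show ?thesis by (simp add: projection_monoid_def)
qed

lemma mvn_class_closed: "P \<in> mtx_projections B \<Longrightarrow> mvn_class P \<in> carrier (projection_monoid B)"
  by (simp add: projection_monoid_def quotientI)

lemma mvn_class_cases:
  assumes "X \<in> carrier (projection_monoid B)"
  obtains P where "P \<in> mtx_projections B" "X = mvn_class P"
  using assms by (auto simp: projection_monoid_def elim: quotientE)

lemma mvn_class_eq_iff:
  assumes "P \<in> mtx_projections B" "Q \<in> mtx_projections B"
  shows "mvn_class P = mvn_class Q \<longleftrightarrow> (P, Q) \<in> murray_von_neumann B"
  using eq_equiv_class_iff[OF equiv_murray_von_neumann assms] .

lemma projection_monoid_one: "\<one>\<^bsub>projection_monoid B\<^esub> = mvn_class (0, \<lambda>i j. \<zero>)"
  by (simp add: projection_monoid_def)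

lemma comm_monoid_projection_monoid: "comm_monoid (projection_monoid B)"
proof (rule comm_monoidI)
  fix X Y assume "X \<in> carrier (projection_monoid B)" "Y \<in> carrier (projection_monoid B)"
  then obtain P Q where *: "P \<in> mtx_projections B" "X = mvn_class P" "Q \<in> mtx_projections B" "Y = mvn_class Q"
    using mvn_class_cases by metis
  then show "X \<otimes>\<^bsub>projection_monoid B\<^esub> Y \<in> carrier (projection_monoid B)"
    by (simp add: mvn_class_mult mvn_class_closed direct_sum_projection)
  show "X \<otimes>\<^bsub>projection_monoid B\<^esub> Y = Y \<otimes>\<^bsub>projection_monoid B\<^esub> X"
    using * by (simp add: mvn_class_mult direct_sum_projection mvn_class_eq_iff direct_sum_commute)
  fix Z assume "Z \<in> carrier (projection_monoid B)"
  then obtain S where "S \<in> mtx_projections B" "Z = mvn_class S"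
    using mvn_class_cases by metis
  with * show "X \<otimes>\<^bsub>projection_monoid B\<^esub> Y \<otimes>\<^bsub>projection_monoid B\<^esub> Z
      = X \<otimes>\<^bsub>projection_monoid B\<^esub> (Y \<otimes>\<^bsub>projection_monoid B\<^esub> Z)"
    by (simp add: mvn_class_mult direct_sum_projection direct_sum_assoc)
next
  show "\<one>\<^bsub>projection_monoid B\<^esub> \<in> carrier (projection_monoid B)"
    by (simp add: projection_monoid_one mvn_class_closed zero_projection)
  fix X assume "X \<in> carrier (projection_monoid B)"
  then obtain P where "P \<in> mtx_projections B" "X = mvn_class P"
    using mvn_class_cases by metis
  then show "\<one>\<^bsub>projection_monoid B\<^esub> \<otimes>\<^bsub>projection_monoid B\<^esub> X = X"
    by (simp add: projection_monoid_one mvn_class_mult zero_projection direct_sum_zero)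
qed

end

section \<open>The Grothendieck group of a commutative monoid\<close>

lemma equiv_grothendieck_rel:
  assumes "comm_monoid M"
  shows "equiv (carrier M \<times> carrier M) (grothendieck_rel M)"
proof -
  interpret comm_monoid M by fact
  show ?thesis
  proof (rule equivI)
    show "grothendieck_rel M \<subseteq> (carrier M \<times> carrier M) \<times> (carrier M \<times> carrier M)"
      by (auto simp: grothendieck_rel_def)
    show "refl_on (carrier M \<times> carrier M) (grothendieck_rel M)"
      by (auto simp: refl_on_def grothendieck_rel_def)
    show "sym (grothendieck_rel M)"
      by (auto simp: sym_def grothendieck_rel_def) metis
    show "trans (grothendieck_rel M)"
    proof (rule transI)
      fix X Y Z assume "(X, Y) \<in> grothendieck_rel M" "(Y, Z) \<in> grothendieck_rel M"
      then obtain a b c d f g x y where *: "X = (a, b)" "Y = (c, d)" "Z = (f, g)"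
        and [simp]: "a \<in> carrier M" "b \<in> carrier M" "c \<in> carrier M" "d \<in> carrier M"
        "f \<in> carrier M" "g \<in> carrier M" "x \<in> carrier M" "y \<in> carrier M"
        and x: "a \<otimes>\<^bsub>M\<^esub> d \<otimes>\<^bsub>M\<^esub> x = c \<otimes>\<^bsub>M\<^esub> b \<otimes>\<^bsub>M\<^esub> x"
        and y: "c \<otimes>\<^bsub>M\<^esub> g \<otimes>\<^bsub>M\<^esub> y = f \<otimes>\<^bsub>M\<^esub> d \<otimes>\<^bsub>M\<^esub> y"
        by (auto simp: grothendieck_rel_def)
      have "a \<otimes>\<^bsub>M\<^esub> g \<otimes>\<^bsub>M\<^esub> (d \<otimes>\<^bsub>M\<^esub> x \<otimes>\<^bsub>M\<^esub> y) = (a \<otimes>\<^bsub>M\<^esub> d \<otimes>\<^bsub>M\<^esub> x) \<otimes>\<^bsub>M\<^esub> (g \<otimes>\<^bsub>M\<^esub> y)"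
        by (simp add: m_ac)
      also have "\<dots> = (c \<otimes>\<^bsub>M\<^esub> g \<otimes>\<^bsub>M\<^esub> y) \<otimes>\<^bsub>M\<^esub> (b \<otimes>\<^bsub>M\<^esub> x)"
        unfolding x by (simp add: m_ac)
      also have "\<dots> = f \<otimes>\<^bsub>M\<^esub> b \<otimes>\<^bsub>M\<^esub> (d \<otimes>\<^bsub>M\<^esub> x \<otimes>\<^bsub>M\<^esub> y)"
        unfolding y by (simp add: m_ac)
      finally show "(X, Z) \<in> grothendieck_rel M"
        unfolding * grothendieck_rel_def by (auto intro!: bexI[of _ "d \<otimes>\<^bsub>M\<^esub> x \<otimes>\<^bsub>M\<^esub> y"])
    qed
  qed
qed

context star_ring
begin

abbreviation k_class :: "nat \<times> 'b mtx \<Rightarrow> 'b k0_elem" where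
  "k_class P \<equiv> grothendieck_rel (projection_monoid B) `` {(mvn_class P, \<one>\<^bsub>projection_monoid B\<^esub>)}"

lemma K00_one: "\<one>\<^bsub>K00 B\<^esub> = k_class (0, \<lambda>i j. \<zero>)"
  by (simp add: K00_def grothendieck_group_def projection_monoid_one)

text \<open>Common summands cancel in the Grothendieck group, so a class vanishes exactly when its
  projection can be absorbed by another one. Both parts of the theorem enter or leave
  \<open>K0\<close> through this criterion.\<close>

lemma k_class_eq_one_iff:
  assumes P: "P \<in> mtx_projections B"
  shows "k_class P = \<one>\<^bsub>K00 B\<^esub> \<longleftrightarrow>
    (\<exists>Q\<in>mtx_projections B. (direct_sum B P Q, Q) \<in> murray_von_neumann B)"
proof -
  interpret M: comm_monoid "projection_monoid B" by (rule comm_monoid_projection_monoid)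
  let ?M = "projection_monoid B"
  have P': "mvn_class P \<in> carrier ?M" using P by (rule mvn_class_closed)
  have "k_class P = \<one>\<^bsub>K00 B\<^esub> \<longleftrightarrow>
      ((mvn_class P, \<one>\<^bsub>?M\<^esub>), (\<one>\<^bsub>?M\<^esub>, \<one>\<^bsub>?M\<^esub>)) \<in> grothendieck_rel ?M"
    unfolding K00_one projection_monoid_one[symmetric]
    using P' by (intro eq_equiv_class_iff[OF equiv_grothendieck_rel[OF comm_monoid_projection_monoid]]) auto
  also have "\<dots> \<longleftrightarrow> (\<exists>X\<in>carrier ?M. mvn_class P \<otimes>\<^bsub>?M\<^esub> X = X)"
    using P' by (auto simp: grothendieck_rel_def)
  also have "\<dots> \<longleftrightarrow> (\<exists>Q\<in>mtx_projections B. mvn_class P \<otimes>\<^bsub>?M\<^esub> mvn_class Q = mvn_class Q)"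
    using mvn_class_cases mvn_class_closed by metis
  also have "\<dots> \<longleftrightarrow> (\<exists>Q\<in>mtx_projections B. (direct_sum B P Q, Q) \<in> murray_von_neumann B)"
    using P by (intro bex_cong refl) (simp add: mvn_class_mult mvn_class_eq_iff direct_sum_projection)
  finally show ?thesis .
qed

end


section \<open>Functoriality\<close>

locale star_ring_hom = B: star_ring B + C: star_ring C
  for B :: "'b star_algebra" and C :: "'c star_algebra" +
  fixes h :: "'b \<Rightarrow> 'c"
  assumes hom_closed [simp, intro]: "a \<in> carrier B \<Longrightarrow> h a \<in> carrier C"
    and hom_add: "\<lbrakk>a \<in> carrier B; b \<in> carrier B\<rbrakk> \<Longrightarrow> h (a \<oplus>\<^bsub>B\<^esub> b) = h a \<oplus>\<^bsub>C\<^esub> h b"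
    and hom_mult: "\<lbrakk>a \<in> carrier B; b \<in> carrier B\<rbrakk> \<Longrightarrow> h (a \<otimes>\<^bsub>B\<^esub> b) = h a \<otimes>\<^bsub>C\<^esub> h b"
    and hom_star: "a \<in> carrier B \<Longrightarrow> h (star B a) = star C (h a)"
begin

lemma hom_zero [simp]: "h \<zero>\<^bsub>B\<^esub> = \<zero>\<^bsub>C\<^esub>"
proof -
  have "h \<zero>\<^bsub>B\<^esub> \<oplus>\<^bsub>C\<^esub> h \<zero>\<^bsub>B\<^esub> = h \<zero>\<^bsub>B\<^esub>"
    using hom_add[of "\<zero>\<^bsub>B\<^esub>" "\<zero>\<^bsub>B\<^esub>"] by simp
  then show ?thesis
    by (metis hom_closed B.zero_closed C.add.r_cancel_one)
qed

lemma hom_finsum: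
  assumes "finite I" "\<And>i. i \<in> I \<Longrightarrow> f i \<in> carrier B"
  shows "h (finsum B f I) = finsum C (\<lambda>i. h (f i)) I"
  using assms
proof (induction I)
  case (insert x I)
  then show ?case
    by (simp add: B.finsum_insert C.finsum_insert Pi_I hom_add B.finsum_closed)
qed simp

abbreviation hmtx :: "'b mtx \<Rightarrow> 'c mtx" where "hmtx a \<equiv> \<lambda>i j. h (a i j)"

lemma hmtx_closed [intro]: "a \<in> mtx_carrier B m n \<Longrightarrow> hmtx a \<in> mtx_carrier C m n"
  by (rule C.mtx_carrierI) (simp_all add: B.mtx_outside)

lemma hmtx_mult:
  "a \<in> mtx_carrier B m k \<Longrightarrow> b \<in> mtx_carrier B k n \<Longrightarrow>
    hmtx (mtx_mult B k a b) = mtx_mult C k (hmtx a) (hmtx b)"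
  by (intro ext) (simp add: mtx_mult_def hom_finsum hom_mult)

lemma hmtx_star: "a \<in> mtx_carrier B m n \<Longrightarrow> hmtx (mtx_star B a) = mtx_star C (hmtx a)"
  by (intro ext) (simp add: mtx_star_def hom_star)

abbreviation hproj :: "nat \<times> 'b mtx \<Rightarrow> nat \<times> 'c mtx" where "hproj P \<equiv> (fst P, hmtx (snd P))"

lemma hproj_projection: "P \<in> mtx_projections B \<Longrightarrow> hproj P \<in> mtx_projections C"
  by (cases P)
     (auto simp: mtx_projections_def hmtx_mult[symmetric] hmtx_star[symmetric])

lemma hproj_mvn:
  assumes "(P, Q) \<in> murray_von_neumann B"
  shows "(hproj P, hproj Q) \<in> murray_von_neumann C"
proof -
  obtain n p m q v where *: "P = (n, p)" "Q = (m, q)"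
      "P \<in> mtx_projections B" "Q \<in> mtx_projections B"
      "v \<in> mtx_carrier B m n" "p = mtx_mult B m (mtx_star B v) v" "q = mtx_mult B n v (mtx_star B v)"
      using assms by (auto simp: murray_von_neumann_def)
  have s: "mtx_star B v \<in> mtx_carrier B n m" using * by auto
  have "hmtx v \<in> mtx_carrier C m n" using * by auto
  moreover have "hmtx p = mtx_mult C m (mtx_star C (hmtx v)) (hmtx v)"
    using hmtx_mult[OF s *(5)] hmtx_star[OF *(5)] *(6) by simp
  moreover have "hmtx q = mtx_mult C n (hmtx v) (mtx_star C (hmtx v))"
    using hmtx_mult[OF *(5) s] hmtx_star[OF *(5)] *(7) by simp
  ultimately show ?thesis
    using hproj_projection[OF *(3)] hproj_projection[OF *(4)] *(1,2)
    by (auto simp: murray_von_neumann_def)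
qed

lemma hproj_direct_sum: "hproj (direct_sum B P Q) = direct_sum C (hproj P) (hproj Q)"
  by (cases P; cases Q) (auto simp: direct_sum_def intro!: ext)

text \<open>The union in the definition runs over all representatives. Intertwiners are mapped to
  intertwiners, so all of them contribute the same class.\<close>

lemma projection_monoid_map_class:
  assumes "P \<in> mtx_projections B"
  shows "projection_monoid_map C h (B.mvn_class P) = C.mvn_class (hproj P)"
proof -
  have "(\<lambda>P. C.mvn_class (hproj P)) respects murray_von_neumann B"
    unfolding congruent_def
    using hproj_mvn equiv_class_eq[OF C.equiv_murray_von_neumann] by blast
  from UN_equiv_class[OF B.equiv_murray_von_neumann this assms] show ?thesis
    by (simp add: projection_monoid_map_def case_prod_beta)
qed

lemma projection_monoid_map_closed:
  "X \<in> carrier (projection_monoid B) \<Longrightarrow> projection_monoid_map C h X \<in> carrier (projection_monoid C)"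
  by (erule B.mvn_class_cases) (simp add: projection_monoid_map_class C.mvn_class_closed hproj_projection)

lemma projection_monoid_map_mult:
  assumes "X \<in> carrier (projection_monoid B)" "Y \<in> carrier (projection_monoid B)"
  shows "projection_monoid_map C h (X \<otimes>\<^bsub>projection_monoid B\<^esub> Y)
    = projection_monoid_map C h X \<otimes>\<^bsub>projection_monoid C\<^esub> projection_monoid_map C h Y"
proof -
  obtain P Q where *: "P \<in> mtx_projections B" "X = B.mvn_class P" "Q \<in> mtx_projections B" "Y = B.mvn_class Q"
    using B.mvn_class_cases assms by metis
  then show ?thesis
    using hproj_direct_sum[of P Q]
    by (simp add: B.mvn_class_mult C.mvn_class_mult projection_monoid_map_class
        B.direct_sum_projection hproj_projection)
qed

lemma K00_map_class:
  assumes "a \<in> carrier (projection_monoid B)" "b \<in> carrier (projection_monoid B)"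
  shows "K00_map C h (grothendieck_rel (projection_monoid B) `` {(a, b)})
    = grothendieck_rel (projection_monoid C) `` {(projection_monoid_map C h a, projection_monoid_map C h b)}"
proof -
  interpret M: comm_monoid "projection_monoid B" by (rule B.comm_monoid_projection_monoid)
  interpret N: comm_monoid "projection_monoid C" by (rule C.comm_monoid_projection_monoid)
  note e1 = equiv_grothendieck_rel[OF B.comm_monoid_projection_monoid]
  note e2 = equiv_grothendieck_rel[OF C.comm_monoid_projection_monoid]
  have rel: "((projection_monoid_map C h a, projection_monoid_map C h b),
      (projection_monoid_map C h c, projection_monoid_map C h d)) \<in> grothendieck_rel (projection_monoid C)"
    if r: "((a, b), (c, d)) \<in> grothendieck_rel (projection_monoid B)" for a b c d
  proof -
    from r obtain x where x: "a \<in> carrier (projection_monoid B)" "b \<in> carrier (projection_monoid B)"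
        "c \<in> carrier (projection_monoid B)" "d \<in> carrier (projection_monoid B)"
        "x \<in> carrier (projection_monoid B)"
        "a \<otimes>\<^bsub>projection_monoid B\<^esub> d \<otimes>\<^bsub>projection_monoid B\<^esub> x
          = c \<otimes>\<^bsub>projection_monoid B\<^esub> b \<otimes>\<^bsub>projection_monoid B\<^esub> x"
      by (auto simp: grothendieck_rel_def)
    from arg_cong[OF x(6), of "projection_monoid_map C h"] x(1-5) show ?thesis
      by (auto simp: grothendieck_rel_def projection_monoid_map_mult projection_monoid_map_closed)
  qed
  have "(\<lambda>(a, b). grothendieck_rel (projection_monoid C) ``
     {(projection_monoid_map C h a, projection_monoid_map C h b)}) respects grothendieck_rel (projection_monoid B)"
    unfolding congruent_def
    using rel equiv_class_eq[OF e2] by fastforce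
  from UN_equiv_class[OF e1 this, of "(a, b)"] assms show ?thesis
    by (simp add: K00_map_def)
qed

lemma K00_map_k_class:
  assumes "P \<in> mtx_projections B"
  shows "K00_map C h (B.k_class P) = C.k_class (hproj P)"
  using assms
  by (simp add: K00_map_class B.mvn_class_closed B.projection_monoid_one B.zero_projection
      projection_monoid_map_class C.projection_monoid_one)

end

section \<open>Nonunital *-algebras\<close>

text \<open>The Roe algebra with infinite-dimensional coefficients has no unit in general, so
  \<open>one\<close> is left out of the axioms and a unit is adjoined below.\<close>

locale star_alg = abelian_group A for A :: "'b star_algebra" (structure) +
  assumes m_closed [simp, intro]: "\<lbrakk>a \<in> carrier A; b \<in> carrier A\<rbrakk> \<Longrightarrow> a \<otimes> b \<in> carrier A"
    and m_assoc: "\<lbrakk>a \<in> carrier A; b \<in> carrier A; c \<in> carrier A\<rbrakk> \<Longrightarrow> a \<otimes> b \<otimes> c = a \<otimes> (b \<otimes> c)"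
    and l_distr: "\<lbrakk>a \<in> carrier A; b \<in> carrier A; c \<in> carrier A\<rbrakk> \<Longrightarrow> (a \<oplus> b) \<otimes> c = a \<otimes> c \<oplus> b \<otimes> c"
    and r_distr: "\<lbrakk>a \<in> carrier A; b \<in> carrier A; c \<in> carrier A\<rbrakk> \<Longrightarrow> c \<otimes> (a \<oplus> b) = c \<otimes> a \<oplus> c \<otimes> b"
    and smult_closed [simp, intro]: "a \<in> carrier A \<Longrightarrow> z \<odot> a \<in> carrier A"
    and smult_l_distr: "a \<in> carrier A \<Longrightarrow> (z + w) \<odot> a = z \<odot> a \<oplus> w \<odot> a"
    and smult_r_distr: "\<lbrakk>a \<in> carrier A; b \<in> carrier A\<rbrakk> \<Longrightarrow> z \<odot> (a \<oplus> b) = z \<odot> a \<oplus> z \<odot> b"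
    and smult_smult: "a \<in> carrier A \<Longrightarrow> z \<odot> (w \<odot> a) = (z * w) \<odot> a"
    and smult_one [simp]: "a \<in> carrier A \<Longrightarrow> 1 \<odot> a = a"
    and smult_mult_left: "\<lbrakk>a \<in> carrier A; b \<in> carrier A\<rbrakk> \<Longrightarrow> (z \<odot> a) \<otimes> b = z \<odot> (a \<otimes> b)"
    and smult_mult_right: "\<lbrakk>a \<in> carrier A; b \<in> carrier A\<rbrakk> \<Longrightarrow> a \<otimes> (z \<odot> b) = z \<odot> (a \<otimes> b)"
    and star_closed [simp, intro]: "a \<in> carrier A \<Longrightarrow> star A a \<in> carrier A"
    and star_star [simp]: "a \<in> carrier A \<Longrightarrow> star A (star A a) = a"
    and star_add: "\<lbrakk>a \<in> carrier A; b \<in> carrier A\<rbrakk> \<Longrightarrow> star A (a \<oplus> b) = star A a \<oplus> star A b"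
    and star_mult: "\<lbrakk>a \<in> carrier A; b \<in> carrier A\<rbrakk> \<Longrightarrow> star A (a \<otimes> b) = star A b \<otimes> star A a"
    and star_smult: "a \<in> carrier A \<Longrightarrow> star A (z \<odot> a) = cnj z \<odot> star A a"
begin

lemma smult_zero_left [simp]: "a \<in> carrier A \<Longrightarrow> 0 \<odot> a = \<zero>"
  using smult_l_distr[of a 0 0] by (metis add_0 smult_closed add.r_cancel_one)

lemma smult_zero_right [simp]: "z \<odot> \<zero> = \<zero>"
  using smult_r_distr[of \<zero> \<zero> z] by (metis l_zero zero_closed smult_closed add.r_cancel_one)

lemma mult_zero_left [simp]: "a \<in> carrier A \<Longrightarrow> \<zero> \<otimes> a = \<zero>"
  using l_distr[of \<zero> \<zero> a] by (metis l_zero zero_closed m_closed add.r_cancel_one)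

lemma mult_zero_right [simp]: "a \<in> carrier A \<Longrightarrow> a \<otimes> \<zero> = \<zero>"
  using r_distr[of \<zero> \<zero> a] by (metis l_zero zero_closed m_closed add.r_cancel_one)

lemma star_zero [simp]: "star A \<zero> = \<zero>"
  using star_add[of \<zero> \<zero>] by (metis l_zero zero_closed star_closed add.r_cancel_one)

lemma unitization_simps [simp]:
  "carrier (unitization A) = carrier A \<times> UNIV"
  "\<one>\<^bsub>unitization A\<^esub> = (\<zero>, 1)"
  "\<zero>\<^bsub>unitization A\<^esub> = (\<zero>, 0)"
  "(a, s) \<oplus>\<^bsub>unitization A\<^esub> (b, t) = (a \<oplus> b, s + t)"
  "(a, s) \<otimes>\<^bsub>unitization A\<^esub> (b, t) = (a \<otimes> b \<oplus> (s \<odot> b \<oplus> t \<odot> a), s * t)"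
  "star (unitization A) (a, s) = (star A a, cnj s)"
  by (simp_all add: unitization_def)

lemma star_ring_unitization: "star_ring (unitization A)"
proof -
  interpret U: abelian_group "unitization A"
  proof (rule abelian_groupI)
    fix x assume "x \<in> carrier (unitization A)"
    then show "\<exists>y\<in>carrier (unitization A). y \<oplus>\<^bsub>unitization A\<^esub> x = \<zero>\<^bsub>unitization A\<^esub>"
      by (intro bexI[of _ "(\<ominus> fst x, - snd x)"]) (auto simp: l_neg)
  qed (auto simp: a_ac)
  interpret R: ring "unitization A"
  proof (rule ringI)
    show "monoid (unitization A)"
    proof (rule monoidI)
      fix x y z assume "x \<in> carrier (unitization A)" "y \<in> carrier (unitization A)" "z \<in> carrier (unitization A)"
      then obtain a s b t c u where *: "x = (a, s)" "y = (b, t)" "z = (c, u)"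
        and [simp]: "a \<in> carrier A" "b \<in> carrier A" "c \<in> carrier A" by auto
      show "x \<otimes>\<^bsub>unitization A\<^esub> y \<otimes>\<^bsub>unitization A\<^esub> z = x \<otimes>\<^bsub>unitization A\<^esub> (y \<otimes>\<^bsub>unitization A\<^esub> z)"
        unfolding *
        by (simp add: l_distr r_distr smult_r_distr smult_mult_left smult_mult_right
            m_assoc smult_smult a_ac mult.assoc mult.commute[of u])
    qed auto
    fix x y z assume "x \<in> carrier (unitization A)" "y \<in> carrier (unitization A)" "z \<in> carrier (unitization A)"
    then obtain a s b t c u where *: "x = (a, s)" "y = (b, t)" "z = (c, u)"
      and [simp]: "a \<in> carrier A" "b \<in> carrier A" "c \<in> carrier A" by auto
    show "(x \<oplus>\<^bsub>unitization A\<^esub> y) \<otimes>\<^bsub>unitization A\<^esub> z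
        = x \<otimes>\<^bsub>unitization A\<^esub> z \<oplus>\<^bsub>unitization A\<^esub> y \<otimes>\<^bsub>unitization A\<^esub> z"
      unfolding * by (simp add: l_distr smult_l_distr smult_r_distr a_ac distrib_right)
    show "z \<otimes>\<^bsub>unitization A\<^esub> (x \<oplus>\<^bsub>unitization A\<^esub> y)
        = z \<otimes>\<^bsub>unitization A\<^esub> x \<oplus>\<^bsub>unitization A\<^esub> z \<otimes>\<^bsub>unitization A\<^esub> y"
      unfolding * by (simp add: r_distr smult_l_distr smult_r_distr a_ac distrib_left)
  qed (rule U.abelian_group_axioms)
  show ?thesis
  proof (unfold_locales)
    fix x assume "x \<in> carrier (unitization A)"
    then obtain a s where *: "x = (a, s)" and [simp]: "a \<in> carrier A" by auto
    show "star (unitization A) x \<in> carrier (unitization A)"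
      "star (unitization A) (star (unitization A) x) = x"
      unfolding * by simp_all
    fix y assume "y \<in> carrier (unitization A)"
    then obtain b t where **: "y = (b, t)" and [simp]: "b \<in> carrier A" by auto
    show "star (unitization A) (x \<oplus>\<^bsub>unitization A\<^esub> y)
        = star (unitization A) x \<oplus>\<^bsub>unitization A\<^esub> star (unitization A) y"
      unfolding * ** by (simp add: star_add)
    show "star (unitization A) (x \<otimes>\<^bsub>unitization A\<^esub> y)
        = star (unitization A) y \<otimes>\<^bsub>unitization A\<^esub> star (unitization A) x"
      unfolding * ** by (simp add: star_add star_mult star_smult a_ac mult.commute)
  qed
qed

end

sublocale star_alg \<subseteq> U: star_ring "unitization A"
  by (rule star_ring_unitization)

context star_alg
begin

text \<open>The size does not enter, so the same function is the corner embedding of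
  \<open>p\<close> into the matrices of every positive size.\<close>

definition mtx1 :: "'b \<Rightarrow> ('b \<times> complex) mtx" where
  "mtx1 p = (\<lambda>i j. if i = 0 \<and> j = 0 then (p, 0) else (\<zero>, 0))"

lemma K0_class_k_class: "K0_class A p = U.k_class (1, mtx1 p)"
  unfolding K0_class_def mtx1_def unitization_simps(3) ..

lemma K0_one: "\<one>\<^bsub>K0 A\<^esub> = \<one>\<^bsub>K00 (unitization A)\<^esub>"
  by (simp add: K0_def)

lemma finsum_single:
  "f 0 \<in> carrier (unitization A) \<Longrightarrow> finsum (unitization A) f {..<Suc 0} = f 0"
  by (subst U.finsum_delta[of "{..<Suc 0}" 0]) auto

lemma mtx1_closed: "p \<in> carrier A \<Longrightarrow> 0 < N \<Longrightarrow> mtx1 p \<in> mtx_carrier (unitization A) N N"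
  by (rule U.mtx_carrierI) (auto simp: mtx1_def)

lemma mtx1_star: "mtx_star (unitization A) (mtx1 p) = mtx1 (star A p)"
  by (auto simp: mtx_star_def mtx1_def intro!: ext)

lemma mtx1_mult:
  assumes "p \<in> carrier A" "q \<in> carrier A" "0 < N"
  shows "mtx_mult (unitization A) N (mtx1 p) (mtx1 q) = mtx1 (p \<otimes> q)"
proof (intro ext)
  fix i j
  show "mtx_mult (unitization A) N (mtx1 p) (mtx1 q) i j = mtx1 (p \<otimes> q) i j"
    unfolding mtx_mult_def using assms
    by (subst U.finsum_delta[of "{..<N}" 0]) (auto simp: mtx1_def)
qed

lemma mtx1_projection:
  "p \<in> carrier A \<Longrightarrow> star A p = p \<Longrightarrow> p \<otimes> p = p \<Longrightarrow> (1, mtx1 p) \<in> mtx_projections (unitization A)"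
  by (simp add: mtx_projections_def mtx1_closed mtx1_star mtx1_mult)

text \<open>The row \<open>(a, b)\<close> implements an equivalence of the direct sum of \<open>p\<close> and \<open>q\<close> with \<open>q\<close>.\<close>

lemma K0_class_eq_oneI:
  assumes [simp]: "a \<in> carrier A" "b \<in> carrier A"
    and p: "star A a \<otimes> a = p" "p \<otimes> p = p" and q: "star A b \<otimes> b = q" "q \<otimes> q = q"
    and ab: "star A a \<otimes> b = \<zero>" and sum: "a \<otimes> star A a \<oplus> b \<otimes> star A b = q"
  shows "K0_class A p = \<one>\<^bsub>K0 A\<^esub>"
proof -
  have [simp]: "p \<in> carrier A" "q \<in> carrier A" using p q by auto
  have ps: "star A p = p" "star A q = q"
    using star_mult[of "star A a" a] star_mult[of "star A b" b] p q by auto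
  have P: "(1, mtx1 p) \<in> mtx_projections (unitization A)"
    and Q: "(1, mtx1 q) \<in> mtx_projections (unitization A)"
    using p q ps by (intro mtx1_projection; simp)+
  have ba: "star A b \<otimes> a = \<zero>" using arg_cong[OF ab, of "star A"] by (simp add: star_mult)
  define v where "v = (\<lambda>(i::nat) (j::nat). if i = 0 \<and> j = 0 then (a, 0::complex) else if i = 0 \<and> j = 1 then (b, 0) else (\<zero>, 0))"
  have v: "v \<in> mtx_carrier (unitization A) 1 2"
    by (rule U.mtx_carrierI) (auto simp: v_def)
  have "snd (direct_sum (unitization A) (1, mtx1 p) (1, mtx1 q))
      = mtx_mult (unitization A) 1 (mtx_star (unitization A) v) v"
  proof (intro ext)
    fix i j :: nat
    consider "i = 0" | "i = 1" | "i > 1" by linarith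
    moreover consider "j = 0" | "j = 1" | "j > 1" by linarith
    ultimately show "snd (direct_sum (unitization A) (1, mtx1 p) (1, mtx1 q)) i j
        = mtx_mult (unitization A) 1 (mtx_star (unitization A) v) v i j"
      by (cases; cases)
         (auto simp: direct_sum_def mtx_mult_def mtx_star_def finsum_single v_def mtx1_def p q ab ba)
  qed
  moreover have "mtx1 q = mtx_mult (unitization A) 2 v (mtx_star (unitization A) v)"
  proof (intro ext)
    fix i j
    have "mtx_mult (unitization A) 2 v (mtx_star (unitization A) v) i j =
       v i 1 \<otimes>\<^bsub>unitization A\<^esub> star (unitization A) (v j 1) \<oplus>\<^bsub>unitization A\<^esub>
         v i 0 \<otimes>\<^bsub>unitization A\<^esub> star (unitization A) (v j 0)"
      unfolding mtx_mult_def numeral_2_eq_2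
      by (subst lessThan_Suc, subst U.finsum_insert)
         (use v in \<open>auto simp: finsum_single mtx_star_def simp del: unitization_simps\<close>)
    also have "\<dots> = mtx1 q i j"
      using sum by (auto simp: v_def mtx1_def a_comm)
    finally show "mtx1 q i j = mtx_mult (unitization A) 2 v (mtx_star (unitization A) v) i j" ..
  qed
  ultimately have "(direct_sum (unitization A) (1, mtx1 p) (1, mtx1 q), (1, mtx1 q))
      \<in> murray_von_neumann (unitization A)"
    using U.direct_sum_projection[OF P Q] Q v
    unfolding murray_von_neumann_def by (auto simp: direct_sum_def numeral_2_eq_2)
  then show ?thesis
    unfolding K0_class_k_class K0_one using U.k_class_eq_one_iff[OF P] Q by blast
qed

end

locale star_alg_hom = A: star_alg A + C: star_alg C
  for A :: "'b star_algebra" and C :: "'c star_algebra" +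
  fixes h :: "'b \<Rightarrow> 'c"
  assumes h_closed [simp, intro]: "a \<in> carrier A \<Longrightarrow> h a \<in> carrier C"
    and h_add: "\<lbrakk>a \<in> carrier A; b \<in> carrier A\<rbrakk> \<Longrightarrow> h (a \<oplus>\<^bsub>A\<^esub> b) = h a \<oplus>\<^bsub>C\<^esub> h b"
    and h_mult: "\<lbrakk>a \<in> carrier A; b \<in> carrier A\<rbrakk> \<Longrightarrow> h (a \<otimes>\<^bsub>A\<^esub> b) = h a \<otimes>\<^bsub>C\<^esub> h b"
    and h_smult: "a \<in> carrier A \<Longrightarrow> h (z \<odot>\<^bsub>A\<^esub> a) = z \<odot>\<^bsub>C\<^esub> h a"
    and h_star: "a \<in> carrier A \<Longrightarrow> h (star A a) = star C (h a)"
begin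

lemma h_zero: "h \<zero>\<^bsub>A\<^esub> = \<zero>\<^bsub>C\<^esub>"
  using h_smult[of "\<zero>\<^bsub>A\<^esub>" 0] by simp

lemma star_ring_hom_unitization:
  "star_ring_hom (unitization A) (unitization C) (\<lambda>(a, s). (h a, s))"
  by unfold_locales (auto simp: h_add h_mult h_smult h_star)

lemma K0_map_class:
  assumes "p \<in> carrier A" "star A p = p" "p \<otimes>\<^bsub>A\<^esub> p = p"
  shows "K0_map C h (K0_class A p) = K0_class C (h p)"
proof -
  interpret H: star_ring_hom "unitization A" "unitization C" "\<lambda>(a, s). (h a, s)"
    by (rule star_ring_hom_unitization)
  have "(\<lambda>i j. case A.mtx1 p i j of (a, s) \<Rightarrow> (h a, s)) = C.mtx1 (h p)"
    by (auto simp: A.mtx1_def C.mtx1_def h_zero intro!: ext)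
  with H.K00_map_k_class[OF A.mtx1_projection[OF assms]] show ?thesis
    unfolding K0_map_def A.K0_class_k_class C.K0_class_k_class by simp
qed

end


section \<open>Square matrices as a *-ring\<close>

text \<open>Square matrices are packaged as a ring so that identities between them can be computed
  in \<open>star_ring\<close>, which has no scalars; the \<open>smult\<close> field is a
  dummy.\<close>

definition mtx_ring :: "'b star_algebra \<Rightarrow> nat \<Rightarrow> 'b mtx star_algebra" where
  "mtx_ring B N = \<lparr>carrier = mtx_carrier B N N, mult = mtx_mult B N,
     one = (\<lambda>i j. if i = j \<and> i < N then \<one>\<^bsub>B\<^esub> else \<zero>\<^bsub>B\<^esub>),
     zero = (\<lambda>i j. \<zero>\<^bsub>B\<^esub>), add = (\<lambda>a b i j. a i j \<oplus>\<^bsub>B\<^esub> b i j),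
     smult = (\<lambda>c a. a), star = mtx_star B\<rparr>"

lemma mtx_ring_simps [simp]:
  "carrier (mtx_ring B N) = mtx_carrier B N N"
  "mult (mtx_ring B N) = mtx_mult B N"
  "one (mtx_ring B N) = (\<lambda>i j. if i = j \<and> i < N then \<one>\<^bsub>B\<^esub> else \<zero>\<^bsub>B\<^esub>)"
  "zero (mtx_ring B N) = (\<lambda>i j. \<zero>\<^bsub>B\<^esub>)"
  "add (mtx_ring B N) = (\<lambda>a b i j. a i j \<oplus>\<^bsub>B\<^esub> b i j)"
  "star (mtx_ring B N) = mtx_star B"
  by (simp_all add: mtx_ring_def)

context star_ring
begin

lemma star_ring_mtx_ring: "star_ring (mtx_ring B N)"
proof -
  interpret G: abelian_group "mtx_ring B N"
  proof (rule abelian_groupI)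
    fix x y assume x: "x \<in> carrier (mtx_ring B N)" and y: "y \<in> carrier (mtx_ring B N)"
    show "x \<oplus>\<^bsub>mtx_ring B N\<^esub> y \<in> carrier (mtx_ring B N)"
      using x y by (simp, intro mtx_carrierI) (simp_all add: mtx_outside[of x N N] mtx_outside[of y N N])
    show "x \<oplus>\<^bsub>mtx_ring B N\<^esub> y = y \<oplus>\<^bsub>mtx_ring B N\<^esub> x"
      using x y by (auto simp: a_comm)
    fix z assume z: "z \<in> carrier (mtx_ring B N)"
    show "x \<oplus>\<^bsub>mtx_ring B N\<^esub> y \<oplus>\<^bsub>mtx_ring B N\<^esub> z = x \<oplus>\<^bsub>mtx_ring B N\<^esub> (y \<oplus>\<^bsub>mtx_ring B N\<^esub> z)"
      using x y z by (auto simp: a_assoc)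
  next
    fix x assume x: "x \<in> carrier (mtx_ring B N)"
    show "\<zero>\<^bsub>mtx_ring B N\<^esub> \<oplus>\<^bsub>mtx_ring B N\<^esub> x = x" using x by auto
    have "(\<lambda>i j. \<ominus> x i j) \<in> carrier (mtx_ring B N)"
      using x by (simp, intro mtx_carrierI) (simp_all add: mtx_outside[of x N N])
    then show "\<exists>y\<in>carrier (mtx_ring B N). y \<oplus>\<^bsub>mtx_ring B N\<^esub> x = \<zero>\<^bsub>mtx_ring B N\<^esub>"
      using x by (intro bexI[of _ "\<lambda>i j. \<ominus> x i j"]) (auto simp: l_neg)
  qed (auto intro!: mtx_carrierI)
  have one: "one (mtx_ring B N) \<in> mtx_carrier B N N"
    by (simp, rule mtx_carrierI) auto
  interpret R: ring "mtx_ring B N"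
  proof (rule ringI)
    show "monoid (mtx_ring B N)"
    proof (rule monoidI)
      fix x assume x: "x \<in> carrier (mtx_ring B N)"
      show "\<one>\<^bsub>mtx_ring B N\<^esub> \<otimes>\<^bsub>mtx_ring B N\<^esub> x = x"
      proof (intro ext)
        fix i j
        show "(\<one>\<^bsub>mtx_ring B N\<^esub> \<otimes>\<^bsub>mtx_ring B N\<^esub> x) i j = x i j"
        proof (cases "i < N")
          case True
          with x show ?thesis
            by (simp add: mtx_mult_def) (subst finsum_delta[of "{..<N}" i]; simp)
        next
          case False
          with x show ?thesis
            by (simp add: mtx_mult_def mtx_outside[of x N N])
        qed
      qed
      show "x \<otimes>\<^bsub>mtx_ring B N\<^esub> \<one>\<^bsub>mtx_ring B N\<^esub> = x"
      proof (intro ext)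
        fix i j
        show "(x \<otimes>\<^bsub>mtx_ring B N\<^esub> \<one>\<^bsub>mtx_ring B N\<^esub>) i j = x i j"
        proof (cases "j < N")
          case True
          with x show ?thesis
            by (simp add: mtx_mult_def) (subst finsum_delta[of "{..<N}" j]; simp)
        next
          case False
          with x show ?thesis
            by (simp add: mtx_mult_def mtx_outside[of x N N]) (rule finsum_neutral; auto)
        qed
      qed
    qed (use one mtx_mult_assoc in \<open>auto simp del: mtx_ring_simps(3)\<close>)
    fix x y z assume x: "x \<in> carrier (mtx_ring B N)" and y: "y \<in> carrier (mtx_ring B N)"
      and z: "z \<in> carrier (mtx_ring B N)"
    then show "(x \<oplus>\<^bsub>mtx_ring B N\<^esub> y) \<otimes>\<^bsub>mtx_ring B N\<^esub> z
        = x \<otimes>\<^bsub>mtx_ring B N\<^esub> z \<oplus>\<^bsub>mtx_ring B N\<^esub> y \<otimes>\<^bsub>mtx_ring B N\<^esub> z"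
      by (intro ext) (simp add: mtx_mult_def l_distr finsum_addf)
    show "z \<otimes>\<^bsub>mtx_ring B N\<^esub> (x \<oplus>\<^bsub>mtx_ring B N\<^esub> y)
        = z \<otimes>\<^bsub>mtx_ring B N\<^esub> x \<oplus>\<^bsub>mtx_ring B N\<^esub> z \<otimes>\<^bsub>mtx_ring B N\<^esub> y"
      using x y z by (intro ext) (simp add: mtx_mult_def r_distr finsum_addf)
  qed (rule G.abelian_group_axioms)
  show ?thesis
    by unfold_locales (auto simp: mtx_star_mult, auto simp: mtx_star_def star_add)
qed

text \<open>With \<open>w = x v (p + x) x\<close> the isometry is \<open>u = w + (1 - x)\<close>, and
  \<open>y = x v (p + x) p\<close> spans its cokernel.\<close>

lemma isometry_of_equivalence:
  assumes c [simp]: "p \<in> carrier B" "x \<in> carrier B" "v \<in> carrier B"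
    and p: "star B p = p" "p \<otimes> p = p" and x: "star B x = x" "x \<otimes> x = x" and px: "p \<otimes> x = \<zero>"
    and v: "star B v \<otimes> v = p \<oplus> x" "v \<otimes> star B v = x"
  obtains u y where "u \<in> carrier B" "y \<in> carrier B" "star B u \<otimes> u = \<one>" "star B y \<otimes> y = p"
    "star B u \<otimes> y = \<zero>" "u \<otimes> star B u \<oplus> y \<otimes> star B y = \<one>" "y \<otimes> p = y"
proof -
  have xp: "x \<otimes> p = \<zero>" using arg_cong[OF px, of "star B"] by (simp add: star_mult p x)
  define e where "e = p \<oplus> x"
  have [simp]: "e \<in> carrier B" "star B e = e" by (auto simp: e_def star_add p x)
  have e: "e \<otimes> e = e" "e \<otimes> p = p" "p \<otimes> e = p" "e \<otimes> x = x" "x \<otimes> e = x"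
    by (simp_all add: e_def l_distr r_distr p x px xp)
  define z where "z = \<one> \<ominus> x"
  have [simp]: "z \<in> carrier B" by (auto simp: z_def)
  have xz1: "x \<oplus> z = \<one>" unfolding z_def minus_eq by (metis a_lcomm c(2) one_closed r_neg r_zero a_inv_closed)
  have xz: "x \<otimes> z = \<zero>" "z \<otimes> x = \<zero>"
    by (simp_all add: z_def minus_eq r_distr l_distr r_minus l_minus x r_neg)
  have zz: "z \<otimes> z = z"
    using arg_cong[OF xz1, of "\<lambda>t. t \<otimes> z"] by (simp add: l_distr xz)
  have zs: "star B z = z"
  proof -
    have "x \<oplus> star B z = x \<oplus> z"
      unfolding xz1 using arg_cong[OF xz1, of "star B"] by (simp add: star_add x)
    then show ?thesis by simp
  qed
  \<comment> \<open>In a *-ring the two relations for \<open>v\<close> do not imply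
    \<open>x v = v\<close>. Cutting \<open>v\<close> down on both sides enforces
    \<open>v1 = x v1\<close> and \<open>v1 = v1 e\<close> while the products with the adjoint remain
    \<open>e\<close> and \<open>x\<close>.\<close>
  define v1 where "v1 = x \<otimes> (v \<otimes> e)"
  have [simp]: "v1 \<in> carrier B" by (auto simp: v1_def)
  have v1s: "star B v1 = e \<otimes> (star B v \<otimes> x)" by (simp add: v1_def star_mult x m_assoc)
  have "star B v1 \<otimes> v1 = e \<otimes> (star B v \<otimes> ((x \<otimes> x) \<otimes> (v \<otimes> e)))"
    by (simp add: v1s, simp add: v1_def m_assoc)
  also have "\<dots> = e \<otimes> ((star B v \<otimes> v) \<otimes> ((star B v \<otimes> v) \<otimes> e))"
    unfolding x(2) unfolding v(2)[symmetric] by (simp add: m_assoc)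
  also have "\<dots> = e" unfolding v(1) e_def[symmetric] by (simp add: e)
  finally have v1v1: "star B v1 \<otimes> v1 = e" .
  have "v1 \<otimes> star B v1 = x \<otimes> (v \<otimes> ((e \<otimes> e) \<otimes> (star B v \<otimes> x)))"
    by (simp add: v1s, simp add: v1_def m_assoc)
  also have "\<dots> = x \<otimes> ((v \<otimes> star B v) \<otimes> ((v \<otimes> star B v) \<otimes> x))"
    unfolding e(1) unfolding e_def v(1)[symmetric] by (simp add: m_assoc)
  also have "\<dots> = x" unfolding v(2) by (simp add: x)
  finally have v1v1s: "v1 \<otimes> star B v1 = x" .
  have xv1: "x \<otimes> v1 = v1" unfolding v1_def by (simp add: m_assoc[symmetric] x)
  have zv1: "z \<otimes> v1 = \<zero>"
  proof -
    have "z \<otimes> v1 = z \<otimes> (x \<otimes> v1)" by (simp add: xv1)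
    also have "\<dots> = \<zero>" by (simp add: m_assoc[symmetric] xz)
    finally show ?thesis .
  qed
  have v1e: "v1 \<otimes> e = v1" unfolding v1_def by (simp add: m_assoc e)
  have v1v1': "star B v1 \<otimes> (v1 \<otimes> t) = e \<otimes> t" if "t \<in> carrier B" for t
    using that v1v1 by (simp add: m_assoc[symmetric])
  have zv1': "z \<otimes> (v1 \<otimes> t) = \<zero>" if "t \<in> carrier B" for t
    using that zv1 by (simp add: m_assoc[symmetric])
  \<comment> \<open>\<open>v1\<close> is a partial isometry from \<open>e\<close> onto
    \<open>x\<close>. Its part \<open>w\<close> on \<open>x\<close> is isometric there, and its part
    \<open>y\<close> on \<open>p\<close> fills exactly what the range of \<open>w\<close> misses
    inside \<open>x\<close>.\<close>
  define w where "w = v1 \<otimes> x"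
  define y where "y = v1 \<otimes> p"
  have [simp]: "w \<in> carrier B" "y \<in> carrier B" by (auto simp: w_def y_def)
  have ws: "star B w = x \<otimes> star B v1" and ys: "star B y = p \<otimes> star B v1"
    by (simp_all add: w_def y_def star_mult p x)
  have ww: "star B w \<otimes> w = x" by (simp add: ws, simp add: w_def m_assoc v1v1' e x)
  have wy: "star B w \<otimes> y = \<zero>" by (simp add: ws, simp add: y_def m_assoc v1v1' e xp)
  have yy: "star B y \<otimes> y = p" by (simp add: ys, simp add: y_def m_assoc v1v1' e p)
  have zw: "z \<otimes> w = \<zero>" "z \<otimes> y = \<zero>" by (simp_all add: w_def y_def zv1')
  have wz: "star B w \<otimes> z = \<zero>" using arg_cong[OF zw(1), of "star B"] by (simp add: star_mult zs)
  have wz': "w \<otimes> z = \<zero>" by (simp add: w_def m_assoc xz)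
  have wz'': "z \<otimes> star B w = \<zero>" using arg_cong[OF wz', of "star B"] by (simp add: star_mult zs)
  have "w \<otimes> star B w \<oplus> y \<otimes> star B y = v1 \<otimes> ((x \<otimes> x) \<otimes> star B v1) \<oplus> v1 \<otimes> ((p \<otimes> p) \<otimes> star B v1)"
    by (simp add: ws ys, simp add: w_def y_def m_assoc)
  also have "\<dots> = v1 \<otimes> (e \<otimes> star B v1)"
    by (simp add: e_def x p l_distr r_distr a_comm)
  also have "\<dots> = x" by (simp add: m_assoc[symmetric] v1e v1v1s)
  finally have wwyy: "w \<otimes> star B w \<oplus> y \<otimes> star B y = x" .
  show ?thesis
  proof (rule that[of "w \<oplus> z" y])
    show "star B (w \<oplus> z) \<otimes> (w \<oplus> z) = \<one>"
      by (simp add: star_add zs l_distr r_distr ww zw wz zz xz1)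
    show "star B (w \<oplus> z) \<otimes> y = \<zero>"
      by (simp add: star_add zs l_distr r_distr wy zw)
    have "(w \<oplus> z) \<otimes> star B (w \<oplus> z) \<oplus> y \<otimes> star B y = (w \<otimes> star B w \<oplus> y \<otimes> star B y) \<oplus> z"
      by (simp add: star_add zs l_distr r_distr wz' wz'' zz a_ac)
    then show "(w \<oplus> z) \<otimes> star B (w \<oplus> z) \<oplus> y \<otimes> star B y = \<one>"
      by (simp add: wwyy xz1)
    show "y \<otimes> p = y" by (simp add: y_def m_assoc p)
  qed (use yy in auto)
qed

end

context star_ring_hom
begin

lemma star_ring_hom_mtx_ring: "star_ring_hom (mtx_ring B N) (mtx_ring C N) hmtx"
proof -
  interpret R: star_ring "mtx_ring B N" by (rule B.star_ring_mtx_ring)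
  interpret S: star_ring "mtx_ring C N" by (rule C.star_ring_mtx_ring)
  show ?thesis
  proof unfold_locales
    fix a assume a: "a \<in> carrier (mtx_ring B N)"
    show "hmtx a \<in> carrier (mtx_ring C N)"
      "hmtx (star (mtx_ring B N) a) = star (mtx_ring C N) (hmtx a)"
      using a by (simp_all add: hmtx_closed hmtx_star[of a N N])
    fix b assume b: "b \<in> carrier (mtx_ring B N)"
    show "hmtx (a \<oplus>\<^bsub>mtx_ring B N\<^esub> b) = hmtx a \<oplus>\<^bsub>mtx_ring C N\<^esub> hmtx b"
      using a b by (intro ext) (simp add: hom_add)
    show "hmtx (a \<otimes>\<^bsub>mtx_ring B N\<^esub> b) = hmtx a \<otimes>\<^bsub>mtx_ring C N\<^esub> hmtx b"
      using a b hmtx_mult[of a N N b N] by simp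
  qed
qed

lemma hmtx_one: "h \<one>\<^bsub>B\<^esub> = \<one>\<^bsub>C\<^esub> \<Longrightarrow> hmtx (one (mtx_ring B N)) = one (mtx_ring C N)"
  by (intro ext) simp

end

section \<open>Scalar parts of matrices over a unitization\<close>

lemma star_ring_complex_algebra: "star_ring complex_algebra"
proof -
  interpret abelian_group complex_algebra
    by (rule abelian_groupI) (auto simp: complex_algebra_def algebra_simps intro: exI[of _ "- x" for x])
  interpret ring complex_algebra
    by (rule ringI) (unfold_locales, auto simp: complex_algebra_def algebra_simps)
  show ?thesis by unfold_locales (auto simp: complex_algebra_def)
qed

context star_alg
begin

lemma star_ring_hom_snd: "star_ring_hom (unitization A) complex_algebra snd"
proof -
  interpret star_ring complex_algebra by (rule star_ring_complex_algebra)
  show ?thesis by unfold_locales (auto simp: complex_algebra_def)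
qed

text \<open>A section of the augmentation \<open>snd\<close>: it lifts a scalar unitary to the
  unitization, where it can be divided out.\<close>

lemma star_ring_hom_scalar: "star_ring_hom complex_algebra (unitization A) (\<lambda>c. (\<zero>, c))"
proof -
  interpret star_ring complex_algebra by (rule star_ring_complex_algebra)
  show ?thesis by unfold_locales (auto simp: complex_algebra_def)
qed

text \<open>The projection that absorbs \<open>p\<close> yields, after padding to square matrices,
  an isometry whose missing range carries a copy of \<open>p\<close>. By the last conclusion all
  entries of \<open>u - 1\<close> have scalar part 0, hence come from \<open>A\<close>.\<close>

lemma K0_class_eq_one_isometry:
  assumes p: "p \<in> carrier A" "star A p = p" "p \<otimes> p = p" and eq: "K0_class A p = \<one>\<^bsub>K0 A\<^esub>"
  obtains N u y where "0 < N"
    "u \<in> mtx_carrier (unitization A) N N" "y \<in> mtx_carrier (unitization A) N N"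
    "mtx_mult (unitization A) N (mtx_star (unitization A) u) u = one (mtx_ring (unitization A) N)"
    "mtx_mult (unitization A) N (mtx_star (unitization A) y) y = mtx1 p"
    "mtx_mult (unitization A) N (mtx_star (unitization A) u) y = (\<lambda>i j. (\<zero>, 0))"
    "\<And>i j. snd (u i j) = (if i = j \<and> i < N then 1 else 0)"
proof -
  let ?U = "unitization A"
  note P1 = mtx1_projection[OF p]
  obtain Q where Q: "Q \<in> mtx_projections ?U" "(direct_sum ?U (1, mtx1 p) Q, Q) \<in> murray_von_neumann ?U"
    using eq U.k_class_eq_one_iff[OF P1] by (auto simp: K0_class_k_class K0_one)
  obtain k x where kx: "Q = (k, x)" by fastforce
  obtain v where v: "v \<in> mtx_carrier ?U k (1 + k)"
      "U.dsum 1 1 (mtx1 p) x = mtx_mult ?U k (mtx_star ?U v) v"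
      "x = mtx_mult ?U (1 + k) v (mtx_star ?U v)"
    using Q(2) unfolding kx murray_von_neumann_def by (auto simp: U.direct_sum_dsum)
  have x: "x \<in> mtx_carrier ?U k k" "mtx_star ?U x = x" "mtx_mult ?U k x x = x"
    using Q(1) by (auto simp: kx mtx_projections_def)
  define N where "N = 1 + k"
  define o' where "o' = (\<lambda>(i::nat) (j::nat). \<zero>\<^bsub>?U\<^esub>)"
  have o: "o' \<in> mtx_carrier ?U m n" "mtx_star ?U o' = o'" for m n
    unfolding o'_def by (auto intro!: U.mtx_carrierI simp: mtx_star_def)
  have o_mult: "mtx_mult ?U l o' a = o'" if "a \<in> mtx_carrier ?U l n" for a l n
    unfolding mtx_mult_def using U.mtx_entry[OF that]
    by (intro ext) (auto simp: o'_def simp del: unitization_simps intro!: U.finsum_neutral)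
  have mult_o: "mtx_mult ?U l a o' = o'" if "a \<in> mtx_carrier ?U n l" for a l n
    unfolding mtx_mult_def using U.mtx_entry[OF that]
    by (intro ext) (auto simp: o'_def simp del: unitization_simps intro!: U.finsum_neutral)
  \<comment> \<open>The block of size 1 by 0 puts a zero row on top of \<open>v\<close>. This makes
    \<open>v\<close> square and turns the equivalence into one between \<open>P + X\<close> and
    \<open>X\<close> inside a single matrix ring.\<close>
  define P X V where "P = U.dsum 1 1 (mtx1 p) o'" and "X = U.dsum 1 1 o' x" and "V = U.dsum 1 0 o' v"
  interpret R: star_ring "mtx_ring ?U N" by (rule U.star_ring_mtx_ring)
  have m1: "mtx1 p \<in> mtx_carrier ?U 1 1" using p by (simp add: mtx1_closed)
  have PX: "P \<in> mtx_carrier ?U N N" "X \<in> mtx_carrier ?U N N"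
    unfolding P_def X_def N_def using U.dsum_closed[OF m1 o(1)[of k k]] U.dsum_closed[OF o(1)[of 1 1] x(1)] by simp_all
  have V: "V \<in> mtx_carrier ?U N N"
    using U.dsum_closed[of o' 1 0 v k "1 + k"] v(1) o unfolding V_def N_def by simp
  have vs: "mtx_star ?U v \<in> mtx_carrier ?U (1 + k) k" using v by auto
  have P_eq: "P = mtx1 p"
    by (auto simp: P_def U.dsum_def mtx1_def o'_def intro!: ext)
  have VV: "mtx_mult ?U N (mtx_star ?U V) V = U.dsum 1 1 (mtx1 p) x"
    using U.dsum_mult[of "mtx_star ?U o'" 0 1 "mtx_star ?U v" "1+k" k o' 0 v "1 + k"] o v vs
    unfolding V_def N_def U.dsum_star by (simp add: U.dsum_def)
  have VVs: "mtx_mult ?U N V (mtx_star ?U V) = X"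
    using U.dsum_mult[of o' 1 0 v k "1+k" "mtx_star ?U o'" 1 "mtx_star ?U v" k] o v vs
    unfolding V_def N_def U.dsum_star X_def by (simp add: o_mult[of _ 0 1])
  have sum: "U.dsum 1 1 (mtx1 p) x = (\<lambda>i j. P i j \<oplus>\<^bsub>?U\<^esub> X i j)"
    using U.mtx_entry[OF x(1)] U.mtx_entry[OF m1]
    by (intro ext) (simp add: P_def X_def U.dsum_def o'_def del: unitization_simps)
  obtain u y where uy: "u \<in> mtx_carrier ?U N N" "y \<in> mtx_carrier ?U N N"
      "mtx_mult ?U N (mtx_star ?U u) u = one (mtx_ring ?U N)"
      "mtx_mult ?U N (mtx_star ?U y) y = P"
      "mtx_mult ?U N (mtx_star ?U u) y = zero (mtx_ring ?U N)"
      "add (mtx_ring ?U N) (mtx_mult ?U N u (mtx_star ?U u)) (mtx_mult ?U N y (mtx_star ?U y)) = one (mtx_ring ?U N)"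
      "mtx_mult ?U N y P = y"
  proof (rule R.isometry_of_equivalence[of P X V, unfolded mtx_ring_simps(1,2,6)])
    show "mtx_star ?U P = P" "mtx_star ?U X = X"
      using p x o by (simp_all add: P_def X_def U.dsum_star mtx1_star)
    show "mtx_mult ?U N P P = P" "mtx_mult ?U N X X = X"
      using U.dsum_mult[OF m1 o(1)[of k k] m1 o(1)[of k k]] U.dsum_mult[OF o(1)[of 1 1] x(1) o(1)[of 1 1] x(1)]
        p x mtx1_mult[of p p 1] o_mult[OF o(1)[of 1 1]] o_mult[OF o(1)[of k k]]
      unfolding P_def X_def N_def by simp_all
    show "mtx_mult ?U N P X = zero (mtx_ring ?U N)"
      using U.dsum_mult[OF m1 o(1)[of k k] o(1)[of 1 1] x(1)] o_mult[OF x(1)] mult_o[OF m1]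
      unfolding P_def X_def N_def by simp (auto simp: U.dsum_def o'_def intro!: ext)
  qed (use PX V VV VVs sum in auto)
  interpret S: star_ring_hom ?U complex_algebra snd by (rule star_ring_hom_snd)
  interpret T: star_ring_hom complex_algebra ?U "\<lambda>c. (\<zero>, c)" by (rule star_ring_hom_scalar)
  interpret SM: star_ring_hom "mtx_ring ?U N" "mtx_ring complex_algebra N" S.hmtx
    by (rule S.star_ring_hom_mtx_ring)
  interpret TM: star_ring_hom "mtx_ring complex_algebra N" "mtx_ring ?U N" T.hmtx
    by (rule T.star_ring_hom_mtx_ring)
  let ?C = "mtx_ring complex_algebra N" and ?R = "mtx_ring ?U N"
  note [simp del] = mtx_ring_simps
  have uyR [simp]: "u \<in> carrier ?R" "y \<in> carrier ?R" using uy by (simp_all add: mtx_ring_simps)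
  have uyR': "star ?R u \<otimes>\<^bsub>?R\<^esub> u = \<one>\<^bsub>?R\<^esub>" "star ?R y \<otimes>\<^bsub>?R\<^esub> y = P" "star ?R u \<otimes>\<^bsub>?R\<^esub> y = \<zero>\<^bsub>?R\<^esub>"
    "u \<otimes>\<^bsub>?R\<^esub> star ?R u \<oplus>\<^bsub>?R\<^esub> y \<otimes>\<^bsub>?R\<^esub> star ?R y = \<one>\<^bsub>?R\<^esub>" "y \<otimes>\<^bsub>?R\<^esub> P = y"
    using uy by (simp_all add: mtx_ring_simps)
  have PR: "P \<in> carrier ?R" using PX by (simp add: mtx_ring_simps)
  define s where "s = S.hmtx u"
  have [simp]: "s \<in> carrier ?C" unfolding s_def by (rule SM.hom_closed) simp
  have s1: "S.hmtx \<one>\<^bsub>?R\<^esub> = \<one>\<^bsub>?C\<^esub>"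
    by (rule S.hmtx_one) (simp add: complex_algebra_def)
  have t1: "T.hmtx \<one>\<^bsub>?C\<^esub> = \<one>\<^bsub>?R\<^esub>"
    by (rule T.hmtx_one) (simp add: complex_algebra_def)
  have ss: "star ?C s \<otimes>\<^bsub>?C\<^esub> s = \<one>\<^bsub>?C\<^esub>"
    using arg_cong[OF uyR'(1), of S.hmtx] unfolding s1
    by (subst (asm) SM.hom_mult) (simp_all add: SM.hom_star[of u, folded s_def] s_def)
  \<comment> \<open>Since \<open>y = y P\<close> and \<open>P\<close> has no scalar part, neither
    has \<open>y\<close>. Taking scalar parts in the relation that sums to 1 then shows that the
    scalar isometry \<open>s\<close> is unitary.\<close>
  have "S.hmtx P = \<zero>\<^bsub>?C\<^esub>"
    by (auto simp: P_eq mtx1_def complex_algebra_def mtx_ring_simps intro!: ext)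
  then have "S.hmtx y = \<zero>\<^bsub>?C\<^esub>"
    using SM.hom_mult[of y P] PR uyR'(5) SM.hom_closed[of y] by simp
  moreover have "S.hmtx (u \<otimes>\<^bsub>?R\<^esub> star ?R u \<oplus>\<^bsub>?R\<^esub> y \<otimes>\<^bsub>?R\<^esub> star ?R y)
      = s \<otimes>\<^bsub>?C\<^esub> star ?C s \<oplus>\<^bsub>?C\<^esub> S.hmtx y \<otimes>\<^bsub>?C\<^esub> star ?C (S.hmtx y)"
    by (subst SM.hom_add, simp, simp, subst SM.hom_mult, simp, simp, subst SM.hom_mult, simp, simp)
       (simp add: SM.hom_star[OF uyR(1)] SM.hom_star[OF uyR(2)] s_def)
  ultimately have ss': "s \<otimes>\<^bsub>?C\<^esub> star ?C s = \<one>\<^bsub>?C\<^esub>"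
    unfolding uyR'(4) s1 by simp
  define t where "t = T.hmtx s"
  have [simp]: "t \<in> carrier ?R" unfolding t_def by (rule TM.hom_closed) simp
  have tt: "t \<otimes>\<^bsub>?R\<^esub> star ?R t = \<one>\<^bsub>?R\<^esub>"
    using TM.hom_mult[of s "star ?C s"] TM.hom_star[of s] by (simp add: ss' t1 t_def)
  have st: "S.hmtx t = s" by (simp add: t_def)
  have tt': "t \<otimes>\<^bsub>?R\<^esub> (star ?R t \<otimes>\<^bsub>?R\<^esub> a) = a" if "a \<in> carrier ?R" for a
    using that tt by (simp add: R.m_assoc[symmetric])
  \<comment> \<open>Multiplication by the adjoint of the scalar unitary \<open>t\<close> keeps the
    relations between \<open>u\<close> and \<open>y\<close> and turns the scalar part of
    \<open>u\<close> into the identity.\<close>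
  define u' y' where "u' = star ?R t \<otimes>\<^bsub>?R\<^esub> u" and "y' = star ?R t \<otimes>\<^bsub>?R\<^esub> y"
  have [simp]: "u' \<in> carrier ?R" "y' \<in> carrier ?R" by (simp_all add: u'_def y'_def)
  have "S.hmtx u' = \<one>\<^bsub>?C\<^esub>"
    unfolding u'_def by (subst SM.hom_mult, simp, simp)
      (simp add: SM.hom_star[of t, simplified] st, simp add: s_def[symmetric] ss)
  then have snd_u: "snd (u' i j) = (if i = j \<and> i < N then 1 else 0)" for i j
    by (auto simp: fun_eq_iff mtx_ring_simps complex_algebra_def)
  show ?thesis
  proof (rule that[of N u' y'])
    show "0 < N" by (simp add: N_def)
    show "u' \<in> mtx_carrier ?U N N" "y' \<in> mtx_carrier ?U N N"
      using \<open>u' \<in> carrier ?R\<close> \<open>y' \<in> carrier ?R\<close> by (simp_all add: mtx_ring_simps)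
    have "star ?R u' \<otimes>\<^bsub>?R\<^esub> u' = \<one>\<^bsub>?R\<^esub>" "star ?R y' \<otimes>\<^bsub>?R\<^esub> y' = P" "star ?R u' \<otimes>\<^bsub>?R\<^esub> y' = \<zero>\<^bsub>?R\<^esub>"
      unfolding u'_def y'_def by (simp_all add: R.star_mult R.m_assoc tt' uyR')
    then show "mtx_mult ?U N (mtx_star ?U u') u' = \<one>\<^bsub>?R\<^esub>"
      "mtx_mult ?U N (mtx_star ?U y') y' = mtx1 p"
      "mtx_mult ?U N (mtx_star ?U u') y' = (\<lambda>i j. (\<zero>, 0))"
      by (simp_all add: P_eq mtx_ring_simps)
  qed (rule snd_u)
qed

end

section \<open>Hilbert spaces on explicit carriers\<close>

text \<open>Vectors are determined by their inner products, which makes all vector space axioms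
  consequences of the linearity of the inner product.\<close>

locale inner_space =
  fixes E :: "'v hspace"
  assumes zero_closed [simp, intro]: "hzero E \<in> hcarrier E"
    and add_closed [simp, intro]: "\<lbrakk>x \<in> hcarrier E; y \<in> hcarrier E\<rbrakk> \<Longrightarrow> hadd E x y \<in> hcarrier E"
    and scale_closed [simp, intro]: "x \<in> hcarrier E \<Longrightarrow> hscale E c x \<in> hcarrier E"
    and inner_commute: "\<lbrakk>x \<in> hcarrier E; y \<in> hcarrier E\<rbrakk> \<Longrightarrow> hinner E x y = cnj (hinner E y x)"
    and inner_add_right: "\<lbrakk>x \<in> hcarrier E; y \<in> hcarrier E; z \<in> hcarrier E\<rbrakk>
      \<Longrightarrow> hinner E x (hadd E y z) = hinner E x y + hinner E x z"
    and inner_scale_right: "\<lbrakk>x \<in> hcarrier E; y \<in> hcarrier E\<rbrakk>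
      \<Longrightarrow> hinner E x (hscale E c y) = c * hinner E x y"
    and inner_zero_right: "x \<in> hcarrier E \<Longrightarrow> hinner E x (hzero E) = 0"
    and inner_nonneg: "x \<in> hcarrier E \<Longrightarrow> 0 \<le> Re (hinner E x x)"
    and inner_ext: "\<lbrakk>x \<in> hcarrier E; y \<in> hcarrier E; \<And>z. z \<in> hcarrier E \<Longrightarrow> hinner E z x = hinner E z y\<rbrakk> \<Longrightarrow> x = y"
begin

lemma inner_add_left: "\<lbrakk>x \<in> hcarrier E; y \<in> hcarrier E; z \<in> hcarrier E\<rbrakk>
    \<Longrightarrow> hinner E (hadd E y z) x = hinner E y x + hinner E z x"
  using inner_add_right[of x y z] inner_commute[of "hadd E y z" x] inner_commute[of y x] inner_commute[of z x]
  by simp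

lemma inner_scale_left: "\<lbrakk>x \<in> hcarrier E; y \<in> hcarrier E\<rbrakk>
    \<Longrightarrow> hinner E (hscale E c y) x = cnj c * hinner E y x"
  using inner_scale_right[of x y c] inner_commute[of "hscale E c y" x] inner_commute[of y x] by simp

lemma inner_zero_left: "x \<in> hcarrier E \<Longrightarrow> hinner E (hzero E) x = 0"
  using inner_zero_right[of x] inner_commute[of "hzero E" x] by simp

lemma diff_closed [simp, intro]: "\<lbrakk>x \<in> hcarrier E; y \<in> hcarrier E\<rbrakk> \<Longrightarrow> hdiff E x y \<in> hcarrier E"
  by (simp add: hdiff_def)

lemma inner_diff_right: "\<lbrakk>x \<in> hcarrier E; y \<in> hcarrier E; z \<in> hcarrier E\<rbrakk>
    \<Longrightarrow> hinner E x (hdiff E y z) = hinner E x y - hinner E x z"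
  by (simp add: hdiff_def inner_add_right inner_scale_right)

lemma inner_diff_left: "\<lbrakk>x \<in> hcarrier E; y \<in> hcarrier E; z \<in> hcarrier E\<rbrakk>
    \<Longrightarrow> hinner E (hdiff E y z) x = hinner E y x - hinner E z x"
  by (simp add: hdiff_def inner_add_left inner_scale_left)

lemmas inner_simps = inner_add_right inner_scale_right inner_zero_right inner_diff_right
  inner_add_left inner_scale_left inner_zero_left inner_diff_left

lemma norm_sq: "x \<in> hcarrier E \<Longrightarrow> (hnorm E x)\<^sup>2 = Re (hinner E x x)"
  by (simp add: hnorm_def inner_nonneg)

lemma norm_nonneg [simp]: "x \<in> hcarrier E \<Longrightarrow> 0 \<le> hnorm E x"
  by (simp add: hnorm_def inner_nonneg)

lemma inner_self: "x \<in> hcarrier E \<Longrightarrow> hinner E x x = complex_of_real ((hnorm E x)\<^sup>2)"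
  using inner_commute[of x x] by (simp add: norm_sq complex_eq_iff)

lemma inner_commute_Re: "\<lbrakk>x \<in> hcarrier E; y \<in> hcarrier E\<rbrakk> \<Longrightarrow> Re (hinner E x y) = Re (hinner E y x)"
  using inner_commute[of x y] by simp

lemma cmod_inner_commute: "\<lbrakk>x \<in> hcarrier E; y \<in> hcarrier E\<rbrakk> \<Longrightarrow> cmod (hinner E x y) = cmod (hinner E y x)"
  using inner_commute[of x y] by simp

lemma norm_zero [simp]: "hnorm E (hzero E) = 0"
  by (simp add: hnorm_def inner_simps)

lemma norm_scale: "x \<in> hcarrier E \<Longrightarrow> hnorm E (hscale E c x) = cmod c * hnorm E x"
proof -
  assume x: "x \<in> hcarrier E"
  have "hinner E (hscale E c x) (hscale E c x) = cnj c * (c * hinner E x x)"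
    using x by (simp add: inner_simps)
  then have "(hnorm E (hscale E c x))\<^sup>2 = Re (cnj c * (c * hinner E x x))"
    using norm_sq[OF scale_closed[OF x]] by simp
  also have "cnj c * (c * hinner E x x) = complex_of_real ((cmod c)\<^sup>2) * hinner E x x"
    by (metis complex_norm_square mult.assoc mult.commute)
  also have "Re \<dots> = (cmod c * hnorm E x)\<^sup>2"
    unfolding inner_self[OF x] of_real_mult[symmetric] Re_complex_of_real by (simp add: power_mult_distrib)
  finally show ?thesis using x by (simp add: power2_eq_iff_nonneg)
qed

lemma norm_diff_sq: "\<lbrakk>x \<in> hcarrier E; y \<in> hcarrier E\<rbrakk> \<Longrightarrow>
    (hnorm E (hdiff E x y))\<^sup>2 = (hnorm E x)\<^sup>2 - 2 * Re (hinner E x y) + (hnorm E y)\<^sup>2"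
  by (simp add: norm_sq inner_simps inner_commute_Re[of y x])

lemma norm_add_sq: "\<lbrakk>x \<in> hcarrier E; y \<in> hcarrier E\<rbrakk> \<Longrightarrow>
    (hnorm E (hadd E x y))\<^sup>2 = (hnorm E x)\<^sup>2 + 2 * Re (hinner E x y) + (hnorm E y)\<^sup>2"
  by (simp add: norm_sq inner_simps inner_commute_Re[of y x])

lemma Cauchy_Schwarz:
  assumes [simp]: "x \<in> hcarrier E" "y \<in> hcarrier E"
  shows "cmod (hinner E x y) \<le> hnorm E x * hnorm E y"
proof -
  define b where "b = (cmod (hinner E x y))\<^sup>2"
  have b0: "b \<ge> 0" by (simp add: b_def)
  have *: "0 \<le> (hnorm E x)\<^sup>2 - 2 * r * b + r\<^sup>2 * b * (hnorm E y)\<^sup>2" for r :: real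
  proof -
    define t where "t = complex_of_real r * cnj (hinner E x y)"
    have t: "(cmod t)\<^sup>2 = r\<^sup>2 * b" by (simp add: t_def norm_mult power_mult_distrib b_def)
    have "t * hinner E x y = complex_of_real (r * b)"
      by (simp add: t_def b_def mult.assoc) (metis complex_norm_square mult.commute of_real_power)
    then have "(hnorm E (hdiff E x (hscale E t y)))\<^sup>2 = (hnorm E x)\<^sup>2 - 2 * r * b + r\<^sup>2 * b * (hnorm E y)\<^sup>2"
      by (simp add: norm_diff_sq inner_simps norm_scale power_mult_distrib t)
    then show ?thesis by (metis zero_le_power2)
  qed
  have "b \<le> (hnorm E x)\<^sup>2 * (hnorm E y)\<^sup>2"
  proof (cases "hnorm E y = 0")
    case True
    have "b = 0"
    proof (rule ccontr)
      assume "b \<noteq> 0"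
      \<comment> \<open>For a null vector \<open>y\<close> the right-hand side is affine in
        \<open>r\<close>; this choice of \<open>r\<close> makes it -1.\<close>
      with *[of "((hnorm E x)\<^sup>2 + 1) / (2 * b)"] True show False by (simp add: field_simps)
    qed
    then show ?thesis by simp
  next
    case False
    define B where "B = (hnorm E y)\<^sup>2"
    have B: "B > 0" using False by (simp add: B_def)
    then have "(1 / B)\<^sup>2 * b * B = b / B" by (simp add: power2_eq_square)
    with *[of "1 / B", folded B_def] B show ?thesis
      unfolding B_def[symmetric] by (simp add: pos_divide_le_eq)
  qed
  then have "(cmod (hinner E x y))\<^sup>2 \<le> (hnorm E x * hnorm E y)\<^sup>2"
    by (simp add: b_def power_mult_distrib)
  then show ?thesis by (rule power2_le_imp_le) simp
qed

lemma norm_eq_zeroD: "x \<in> hcarrier E \<Longrightarrow> hnorm E x = 0 \<Longrightarrow> x = hzero E"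
  using Cauchy_Schwarz[of _ x] by (intro inner_ext) (auto simp: inner_simps)

lemma norm_triangle:
  assumes [simp]: "x \<in> hcarrier E" "y \<in> hcarrier E"
  shows "hnorm E (hadd E x y) \<le> hnorm E x + hnorm E y"
proof (rule power2_le_imp_le)
  have "Re (hinner E x y) \<le> hnorm E x * hnorm E y"
    using Cauchy_Schwarz[of x y] complex_Re_le_cmod[of "hinner E x y"] by simp
  then show "(hnorm E (hadd E x y))\<^sup>2 \<le> (hnorm E x + hnorm E y)\<^sup>2"
    by (simp add: norm_add_sq power2_sum)
qed simp

lemma diff_commute_norm: "\<lbrakk>x \<in> hcarrier E; y \<in> hcarrier E\<rbrakk> \<Longrightarrow> hnorm E (hdiff E x y) = hnorm E (hdiff E y x)"
  by (rule power2_eq_imp_eq) (simp_all add: norm_diff_sq inner_commute_Re[of y x])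

lemma norm_triangle_diff:
  assumes [simp]: "x \<in> hcarrier E" "y \<in> hcarrier E" "z \<in> hcarrier E"
  shows "hnorm E (hdiff E x z) \<le> hnorm E (hdiff E x y) + hnorm E (hdiff E y z)"
proof -
  have "hdiff E x z = hadd E (hdiff E x y) (hdiff E y z)"
    by (rule inner_ext) (simp_all add: inner_simps)
  then show ?thesis using norm_triangle[of "hdiff E x y" "hdiff E y z"] by simp
qed

lemma norm_diff_le: "\<lbrakk>x \<in> hcarrier E; y \<in> hcarrier E\<rbrakk> \<Longrightarrow> hnorm E (hdiff E x y) \<le> hnorm E x + hnorm E y"
  unfolding hdiff_def by (rule order_trans[OF norm_triangle]) (simp_all add: norm_scale)

lemma norm_le_diff: "\<lbrakk>x \<in> hcarrier E; y \<in> hcarrier E\<rbrakk> \<Longrightarrow> hnorm E x \<le> hnorm E y + hnorm E (hdiff E x y)"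
proof -
  assume [simp]: "x \<in> hcarrier E" "y \<in> hcarrier E"
  have "x = hadd E y (hdiff E x y)"
    by (rule inner_ext) (simp_all add: inner_simps)
  then show ?thesis using norm_triangle[of y "hdiff E x y"] by simp
qed

lemma inner_tendsto:
  assumes [simp]: "\<And>n. X n \<in> hcarrier E" "y \<in> hcarrier E" "z \<in> hcarrier E"
    and lim: "(\<lambda>n. hnorm E (hdiff E (X n) y)) \<longlonglongrightarrow> 0"
  shows "(\<lambda>n. hinner E z (X n)) \<longlonglongrightarrow> hinner E z y"
proof -
  have "(\<lambda>n. hnorm E z * hnorm E (hdiff E (X n) y)) \<longlonglongrightarrow> hnorm E z * 0"
    by (intro tendsto_intros lim)
  then have "(\<lambda>n. hinner E z (X n) - hinner E z y) \<longlonglongrightarrow> 0"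
    by (intro Lim_null_comparison[of "\<lambda>n. hinner E z (X n) - hinner E z y"])
       (use Cauchy_Schwarz[of z "hdiff E (X _) y"] in \<open>auto simp: inner_simps intro!: always_eventually\<close>)
  then show ?thesis by (simp add: LIM_zero_iff)
qed

text \<open>A finite linear combination on a carrier is specified by its inner products, which
  determine it by \<open>inner_ext\<close>.\<close>

lemma finite_combination:
  assumes "finite F" "\<And>i. i \<in> F \<Longrightarrow> b i \<in> hcarrier E"
  obtains w where "w \<in> hcarrier E" "w \<in> hspan E (b ` F)"
    "\<And>z. z \<in> hcarrier E \<Longrightarrow> hinner E z w = (\<Sum>i\<in>F. a i * hinner E z (b i))"
proof -
  \<comment> \<open>\<open>S\<close> equals \<open>F\<close> but stays fixed during the induction on
    \<open>F\<close>, so that the span does not change.\<close>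
  have "\<exists>w\<in>hcarrier E \<inter> hspan E (b ` S). \<forall>z\<in>hcarrier E. hinner E z w = (\<Sum>i\<in>F. a i * hinner E z (b i))"
    if "F \<subseteq> S" "S \<subseteq> F" for S
    using assms(1) assms(2) that(1)
  proof (induction F)
    case empty
    show ?case by (intro bexI[of _ "hzero E"]) (auto simp: inner_simps intro: hspan.zero)
  next
    case (insert j F)
    then obtain w where w: "w \<in> hcarrier E" "w \<in> hspan E (b ` S)"
      "\<forall>z\<in>hcarrier E. hinner E z w = (\<Sum>i\<in>F. a i * hinner E z (b i))" by auto
    with insert show ?case
      by (intro bexI[of _ "hadd E (hscale E (a j) (b j)) w"])
         (auto simp: inner_simps intro: hspan.add hspan.scale hspan.base)
  qed
  from this[of F] show ?thesis using that by blast
qed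

section \<open>Orthonormal families and their coefficients\<close>

definition orthonormal :: "'i set \<Rightarrow> ('i \<Rightarrow> 'v) \<Rightarrow> bool" where
  "orthonormal I b \<longleftrightarrow> (\<forall>i\<in>I. b i \<in> hcarrier E) \<and> (\<forall>i\<in>I. \<forall>j\<in>I. hinner E (b i) (b j) = (if i = j then 1 else 0))"

lemma orthonormal_closed: "orthonormal I b \<Longrightarrow> i \<in> I \<Longrightarrow> b i \<in> hcarrier E"
  by (simp add: orthonormal_def)

lemma orthonormal_inner: "orthonormal I b \<Longrightarrow> i \<in> I \<Longrightarrow> j \<in> I \<Longrightarrow> hinner E (b i) (b j) = (if i = j then 1 else 0)"
  by (simp add: orthonormal_def)

lemma orthonormal_subset: "orthonormal I b \<Longrightarrow> J \<subseteq> I \<Longrightarrow> orthonormal J b"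
  by (simp add: orthonormal_def subset_iff)

lemma orthonormal_reindex: "orthonormal I b \<Longrightarrow> f ` J \<subseteq> I \<Longrightarrow> inj_on f J \<Longrightarrow> orthonormal J (\<lambda>j. b (f j))"
  by (simp add: orthonormal_def image_subset_iff inj_on_eq_iff)

text \<open>The partial Fourier sum \<open>w\<close> satisfies \<open>|y - w|^2 = |y|^2 - S\<close>,
  where \<open>S\<close> is the sum of the squared coefficients.\<close>

lemma Bessel:
  assumes b: "orthonormal I b" and y [simp]: "y \<in> hcarrier E" and F: "finite F" "F \<subseteq> I"
  shows "(\<Sum>i\<in>F. (cmod (hinner E (b i) y))\<^sup>2) \<le> (hnorm E y)\<^sup>2"
proof -
  have bF [simp]: "b i \<in> hcarrier E" if "i \<in> F" for i using b F that by (auto simp: orthonormal_def)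
  obtain w where [simp]: "w \<in> hcarrier E" and
    w: "\<And>z. z \<in> hcarrier E \<Longrightarrow> hinner E z w = (\<Sum>i\<in>F. hinner E (b i) y * hinner E z (b i))"
    using finite_combination[OF F(1), of b "\<lambda>i. hinner E (b i) y"] by auto
  define S where "S = (\<Sum>i\<in>F. (cmod (hinner E (b i) y))\<^sup>2)"
  have bw: "hinner E (b j) w = hinner E (b j) y" if "j \<in> F" for j
  proof -
    have "hinner E (b j) w = (\<Sum>i\<in>F. if i = j then hinner E (b i) y else 0)"
      unfolding w[OF bF[OF that]]
      using that F by (intro sum.cong refl) (auto simp: orthonormal_inner[OF b] subset_iff)
    also have "\<dots> = hinner E (b j) y" using that F by (simp add: sum.delta)
    finally show ?thesis .
  qed
  have "hinner E y w = complex_of_real S"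
    by (simp add: w S_def) (intro sum.cong refl, simp add: inner_commute[of y] complex_norm_square[symmetric])
  moreover have "hinner E w w = complex_of_real S"
  proof -
    have "hinner E w w = (\<Sum>i\<in>F. hinner E (b i) y * hinner E w (b i))" by (rule w) simp
    also have "\<dots> = (\<Sum>i\<in>F. complex_of_real ((cmod (hinner E (b i) y))\<^sup>2))"
      by (intro sum.cong refl) (simp add: inner_commute[of w] bw complex_norm_square[symmetric])
    finally show ?thesis by (simp add: S_def)
  qed
  ultimately have "(hnorm E (hdiff E y w))\<^sup>2 = (hnorm E y)\<^sup>2 - S"
    by (simp add: norm_diff_sq norm_sq[of w])
  then show ?thesis unfolding S_def[symmetric] by (metis diff_ge_0_iff_ge zero_le_power2)
qed

lemma coefficients_summable:
  assumes b: "orthonormal I b" and y: "y \<in> hcarrier E"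
  shows "(\<lambda>i. (cmod (hinner E (b i) y))\<^sup>2) summable_on I"
    and "(\<Sum>\<^sub>\<infinity>i\<in>I. (cmod (hinner E (b i) y))\<^sup>2) \<le> (hnorm E y)\<^sup>2"
proof -
  show s: "(\<lambda>i. (cmod (hinner E (b i) y))\<^sup>2) summable_on I"
    by (rule nonneg_bdd_above_summable_on) (use Bessel[OF b y] in \<open>auto intro!: bdd_aboveI2\<close>)
  show "(\<Sum>\<^sub>\<infinity>i\<in>I. (cmod (hinner E (b i) y))\<^sup>2) \<le> (hnorm E y)\<^sup>2"
    by (rule infsum_le_finite_sums[OF s]) (use Bessel[OF b y] in auto)
qed

text \<open>This form will define the operator taking each \<open>b i\<close> to \<open>c i\<close>.
  The Cauchy-Schwarz inequality for square summable families and Bessel's inequality for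
  \<open>b\<close> and for \<open>c\<close> bound it.\<close>

lemma coefficient_form:
  assumes c: "orthonormal I c" and b: "orthonormal I b" and xy [simp]: "x \<in> hcarrier E" "y \<in> hcarrier E"
  shows "(\<lambda>i. cmod (hinner E x (c i) * hinner E (b i) y)) summable_on I"
    and "cmod (\<Sum>\<^sub>\<infinity>i\<in>I. hinner E x (c i) * hinner E (b i) y) \<le> hnorm E x * hnorm E y"
proof -
  have fin: "(\<Sum>i\<in>F. cmod (hinner E x (c i) * hinner E (b i) y)) \<le> hnorm E x * hnorm E y"
    if F: "finite F" "F \<subseteq> I" for F
  proof -
    have "(\<Sum>i\<in>F. cmod (hinner E x (c i) * hinner E (b i) y))
        = (\<Sum>i\<in>F. \<bar>cmod (hinner E (c i) x)\<bar> * \<bar>cmod (hinner E (b i) y)\<bar>)"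
      using F by (intro sum.cong refl)
        (auto simp: norm_mult cmod_inner_commute[of x "c _"] orthonormal_closed[OF c])
    also have "\<dots> \<le> L2_set (\<lambda>i. cmod (hinner E (c i) x)) F * L2_set (\<lambda>i. cmod (hinner E (b i) y)) F"
      by (rule L2_set_mult_ineq)
    also have "\<dots> \<le> hnorm E x * hnorm E y"
      by (intro mult_mono) (use Bessel[OF c _ F, of x] Bessel[OF b _ F, of y]
          in \<open>auto simp: L2_set_def intro!: real_le_lsqrt sum_nonneg\<close>)
    finally show ?thesis .
  qed
  show s: "(\<lambda>i. cmod (hinner E x (c i) * hinner E (b i) y)) summable_on I"
    by (rule nonneg_bdd_above_summable_on) (use fin in \<open>auto intro!: bdd_aboveI2\<close>)
  have "cmod (\<Sum>\<^sub>\<infinity>i\<in>I. hinner E x (c i) * hinner E (b i) y)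
      \<le> (\<Sum>\<^sub>\<infinity>i\<in>I. cmod (hinner E x (c i) * hinner E (b i) y))"
    by (rule norm_infsum_bound[OF s])
  also have "\<dots> \<le> hnorm E x * hnorm E y"
    by (rule infsum_le_finite_sums[OF s]) (use fin in auto)
  finally show "cmod (\<Sum>\<^sub>\<infinity>i\<in>I. hinner E x (c i) * hinner E (b i) y) \<le> hnorm E x * hnorm E y" .
qed

end

locale hilbert = inner_space E for E :: "'v hspace" +
  assumes complete: "\<lbrakk>\<And>n. X n \<in> hcarrier E;
      \<And>\<epsilon>. \<epsilon> > 0 \<Longrightarrow> \<exists>N. \<forall>m\<ge>N. \<forall>n\<ge>N. hnorm E (hdiff E (X m) (X n)) < \<epsilon>\<rbrakk>
    \<Longrightarrow> \<exists>y\<in>hcarrier E. (\<lambda>n. hnorm E (hdiff E (X n) y)) \<longlonglongrightarrow> 0"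
begin

text \<open>The first-order condition at a minimum: for small \<open>t\<close> a non-zero linear
  term outweighs the quadratic one.\<close>

lemma quadratic_nonneg_imp_zero:
  fixes a b :: real
  assumes "\<And>t. 0 \<le> 2 * t * a + t\<^sup>2 * b" "0 \<le> b"
  shows "a = 0"
proof (rule ccontr)
  assume a: "a \<noteq> 0"
  have "0 \<le> (2 * (- a / (b + 1)) * a + (- a / (b + 1))\<^sup>2 * b) * (b + 1)\<^sup>2"
    by (intro mult_nonneg_nonneg assms(1)) auto
  also have "\<dots> = - (a\<^sup>2 * (b + 2))"
    using assms(2) by (simp add: field_simps power2_eq_square add_nonneg_eq_0_iff)
  also have "\<dots> < 0" using a assms(2) by simp
  finally show False by simp
qed

text \<open>The representing vector minimises \<open>\<parallel>x\<parallel>\<^sup>2 - 2 Re (f x)\<close>.\<close>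

lemma Riesz_representation:
  assumes add: "\<And>x y. x \<in> hcarrier E \<Longrightarrow> y \<in> hcarrier E \<Longrightarrow> f (hadd E x y) = f x + f y"
    and scale: "\<And>c x. x \<in> hcarrier E \<Longrightarrow> f (hscale E c x) = c * f x"
    and bound: "\<And>x. x \<in> hcarrier E \<Longrightarrow> cmod (f x) \<le> C * hnorm E x"
  obtains z where "z \<in> hcarrier E" "\<And>x. x \<in> hcarrier E \<Longrightarrow> f x = hinner E z x"
proof -
  define Q where "Q x = (hnorm E x)\<^sup>2 - 2 * Re (f x)" for x
  have Q_ge: "- C\<^sup>2 \<le> Q x" if "x \<in> hcarrier E" for x
  proof -
    have "Re (f x) \<le> C * hnorm E x"
      using complex_Re_le_cmod[of "f x"] bound[OF that] by linarith
    moreover have "0 \<le> (hnorm E x - C)\<^sup>2" by simp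
    ultimately show ?thesis unfolding Q_def by (simp add: power2_diff mult.commute)
  qed
  define m where "m = Inf (Q ` hcarrier E)"
  have bdd: "bdd_below (Q ` hcarrier E)" using Q_ge by (auto intro!: bdd_belowI2)
  have m_le: "m \<le> Q x" if "x \<in> hcarrier E" for x
    unfolding m_def using that bdd by (intro cInf_lower) auto
  have "\<exists>x\<in>hcarrier E. Q x < m + 1 / (Suc n)" for n
    using cInf_lessD[of "Q ` hcarrier E" "m + 1 / Suc n"] unfolding m_def[symmetric] by auto
  then obtain X where X [simp]: "\<And>n. X n \<in> hcarrier E" and QX: "\<And>n. Q (X n) < m + 1 / Suc n"
    by metis
  \<comment> \<open>\<open>Q\<close> is compared with its value at the midpoint. By the
    parallelogram identity \<open>Q\<close> is strongly convex, so minimising sequences are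
    Cauchy.\<close>
  have par: "(hnorm E (hdiff E x y))\<^sup>2 \<le> 2 * (Q x - m) + 2 * (Q y - m)"
    if [simp]: "x \<in> hcarrier E" "y \<in> hcarrier E" for x y
  proof -
    have "m \<le> Q (hscale E (1/2) (hadd E x y))" by (rule m_le) simp
    also have "\<dots> = (Q x + Q y) / 2 - (hnorm E (hdiff E x y))\<^sup>2 / 4"
      by (simp add: Q_def norm_scale power_mult_distrib norm_add_sq norm_diff_sq scale add power_divide field_simps)
    finally have fin: "m \<le> (Q x + Q y) / 2 - (hnorm E (hdiff E x y))\<^sup>2 / 4" .
    have "4 * m \<le> 4 * ((Q x + Q y) / 2 - (hnorm E (hdiff E x y))\<^sup>2 / 4)"
      by (rule mult_left_mono[OF fin]) simp
    also have "\<dots> = 2 * Q x + 2 * Q y - (hnorm E (hdiff E x y))\<^sup>2" by simp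
    finally show ?thesis by (simp add: algebra_simps)
  qed
  have "\<exists>N. \<forall>p\<ge>N. \<forall>q\<ge>N. hnorm E (hdiff E (X p) (X q)) < \<epsilon>" if "\<epsilon> > 0" for \<epsilon>
  proof -
    have "0 < \<epsilon>\<^sup>2 / 4" using that by simp
    from nat_approx_posE[OF this] obtain N where N: "1 / real (Suc N) < \<epsilon>\<^sup>2 / 4" .
    have "hnorm E (hdiff E (X p) (X q)) < \<epsilon>" if "p \<ge> N" "q \<ge> N" for p q
    proof -
      have "1 / real (Suc p) \<le> 1 / real (Suc N)" "1 / real (Suc q) \<le> 1 / real (Suc N)"
        using that by (auto intro!: divide_left_mono)
      then have "(hnorm E (hdiff E (X p) (X q)))\<^sup>2 < \<epsilon>\<^sup>2"
        using par[of "X p" "X q"] QX[of p] QX[of q] N by simp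
      then show ?thesis using \<open>\<epsilon> > 0\<close> by (simp add: power_less_imp_less_base)
    qed
    then show ?thesis by blast
  qed
  from complete[OF X this] obtain z where z [simp]: "z \<in> hcarrier E"
    and lim: "(\<lambda>n. hnorm E (hdiff E (X n) z)) \<longlonglongrightarrow> 0" by auto
  have Re_eq: "Re (f h) = Re (hinner E z h)" if [simp]: "h \<in> hcarrier E" for h
  proof -
    have "0 \<le> 2 * t * (Re (hinner E h z) - Re (f h)) + t\<^sup>2 * (hnorm E h)\<^sup>2" for t :: real
    proof -
      \<comment> \<open>The variation in direction \<open>h\<close> is carried out at
        \<open>X n\<close>, with error \<open>1 / Suc n\<close>, and passes to the limit through the
        inner products with \<open>h\<close>.\<close>
      have "- (1 / real (Suc n)) \<le> 2 * t * (Re (hinner E h (X n)) - Re (f h)) + t\<^sup>2 * (hnorm E h)\<^sup>2" for n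
      proof -
        have "m \<le> Q (hadd E (X n) (hscale E t h))" by (rule m_le) simp
        also have "\<dots> = Q (X n) + (2 * t * (Re (hinner E h (X n)) - Re (f h)) + t\<^sup>2 * (hnorm E h)\<^sup>2)"
          by (simp add: Q_def norm_add_sq norm_scale power_mult_distrib inner_simps add scale
              algebra_simps inner_commute_Re[of h])
        finally show ?thesis using QX[of n] by linarith
      qed
      moreover have "(\<lambda>n. - (1 / real (Suc n))) \<longlonglongrightarrow> - 0"
        by (intro tendsto_minus LIMSEQ_Suc[OF lim_1_over_n])
      moreover have "(\<lambda>n. 2 * t * (Re (hinner E h (X n)) - Re (f h)) + t\<^sup>2 * (hnorm E h)\<^sup>2)
          \<longlonglongrightarrow> 2 * t * (Re (hinner E h z) - Re (f h)) + t\<^sup>2 * (hnorm E h)\<^sup>2"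
        by (intro tendsto_intros inner_tendsto lim) auto
      ultimately show ?thesis by (intro LIMSEQ_le[of "\<lambda>n. - (1 / real (Suc n))" 0]) auto
    qed
    from quadratic_nonneg_imp_zero[OF this] show ?thesis by (simp add: inner_commute_Re[of h])
  qed
  show ?thesis
  proof (rule that[OF z])
    fix x assume [simp]: "x \<in> hcarrier E"
    have "Re (\<i> * f x) = Re (\<i> * hinner E z x)"
      using Re_eq[of "hscale E \<i> x"] by (simp add: scale inner_simps)
    then show "f x = hinner E z x" using Re_eq[of x] by (simp add: complex_eq_iff)
  qed
qed

end


section \<open>Bounded operators\<close>

context inner_space
begin

lemma op_closed [simp, intro]: "T \<in> bounded_operators E \<Longrightarrow> x \<in> hcarrier E \<Longrightarrow> T x \<in> hcarrier E"
  by (auto simp: bounded_operators_def)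

lemma op_add: "\<lbrakk>T \<in> bounded_operators E; x \<in> hcarrier E; y \<in> hcarrier E\<rbrakk> \<Longrightarrow> T (hadd E x y) = hadd E (T x) (T y)"
  by (auto simp: bounded_operators_def)

lemma op_scale: "\<lbrakk>T \<in> bounded_operators E; x \<in> hcarrier E\<rbrakk> \<Longrightarrow> T (hscale E c x) = hscale E c (T x)"
  by (auto simp: bounded_operators_def)

lemma op_diff: "\<lbrakk>T \<in> bounded_operators E; x \<in> hcarrier E; y \<in> hcarrier E\<rbrakk> \<Longrightarrow> T (hdiff E x y) = hdiff E (T x) (T y)"
  by (simp add: hdiff_def op_add op_scale)

lemma op_zero: "T \<in> bounded_operators E \<Longrightarrow> T (hzero E) = hzero E"
proof -
  assume T: "T \<in> bounded_operators E"
  have "hzero E = hscale E 0 (hzero E)" by (rule inner_ext) (simp_all add: inner_simps)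
  then have "T (hzero E) = hscale E 0 (T (hzero E))" using op_scale[OF T, of "hzero E" 0] by simp
  also have "\<dots> = hzero E" using T by (intro inner_ext) (simp_all add: inner_simps)
  finally show ?thesis .
qed

lemma op_bound:
  assumes "T \<in> bounded_operators E"
  obtains C where "0 < C" "\<And>x. x \<in> hcarrier E \<Longrightarrow> hnorm E (T x) \<le> C * hnorm E x"
proof -
  obtain C where C: "\<And>x. x \<in> hcarrier E \<Longrightarrow> hnorm E (T x) \<le> C * hnorm E x"
    using assms unfolding bounded_operators_def by blast
  have "hnorm E (T x) \<le> (\<bar>C\<bar> + 1) * hnorm E x" if "x \<in> hcarrier E" for x
    using C[OF that] mult_right_mono[of C "\<bar>C\<bar> + 1" "hnorm E x"] that by fastforce
  then show ?thesis using that[of "\<bar>C\<bar> + 1"] by simp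
qed

lemma op_extensional: "T \<in> bounded_operators E \<Longrightarrow> x \<notin> hcarrier E \<Longrightarrow> T x = undefined"
  by (auto simp: bounded_operators_def)

lemma op_eqI:
  assumes "S \<in> bounded_operators E" "T \<in> bounded_operators E"
    and "\<And>x y. x \<in> hcarrier E \<Longrightarrow> y \<in> hcarrier E \<Longrightarrow> hinner E x (S y) = hinner E x (T y)"
  shows "S = T"
proof (rule ext)
  fix y show "S y = T y"
  proof (cases "y \<in> hcarrier E")
    case True
    with assms show ?thesis by (intro inner_ext) auto
  qed (simp add: op_extensional[OF assms(1)] op_extensional[OF assms(2)])
qed

lemma bounded_operatorI:
  assumes "T \<in> extensional (hcarrier E)" "\<And>x. x \<in> hcarrier E \<Longrightarrow> T x \<in> hcarrier E"
    "\<And>x y. \<lbrakk>x \<in> hcarrier E; y \<in> hcarrier E\<rbrakk> \<Longrightarrow> T (hadd E x y) = hadd E (T x) (T y)"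
    "\<And>c x. x \<in> hcarrier E \<Longrightarrow> T (hscale E c x) = hscale E c (T x)"
    "\<And>x. x \<in> hcarrier E \<Longrightarrow> hnorm E (T x) \<le> C * hnorm E x"
  shows "T \<in> bounded_operators E"
  using assms unfolding bounded_operators_def by (simp add: PiE_def Pi_def) blast

lemma operator_algebra_simps [simp]:
  "carrier (operator_algebra E) = bounded_operators E"
  "star (operator_algebra E) = hadjoint E"
  "x \<in> hcarrier E \<Longrightarrow> (S \<otimes>\<^bsub>operator_algebra E\<^esub> T) x = S (T x)"
  "x \<in> hcarrier E \<Longrightarrow> (S \<oplus>\<^bsub>operator_algebra E\<^esub> T) x = hadd E (S x) (T x)"
  "x \<in> hcarrier E \<Longrightarrow> (c \<odot>\<^bsub>operator_algebra E\<^esub> T) x = hscale E c (T x)"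
  "x \<in> hcarrier E \<Longrightarrow> \<zero>\<^bsub>operator_algebra E\<^esub> x = hzero E"
  by (simp_all add: operator_algebra_def compose_def)

lemma op_mult_closed [simp, intro]:
  assumes "S \<in> bounded_operators E" "T \<in> bounded_operators E"
  shows "S \<otimes>\<^bsub>operator_algebra E\<^esub> T \<in> bounded_operators E"
proof -
  obtain C where C: "0 < C" "\<And>x. x \<in> hcarrier E \<Longrightarrow> hnorm E (S x) \<le> C * hnorm E x"
    using op_bound[OF assms(1)] by blast
  obtain C' where C': "0 < C'" "\<And>x. x \<in> hcarrier E \<Longrightarrow> hnorm E (T x) \<le> C' * hnorm E x"
    using op_bound[OF assms(2)] by blast
  show ?thesis
  proof (rule bounded_operatorI[of _ "C * C'"])
    fix x assume x: "x \<in> hcarrier E"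
    have "hnorm E (S (T x)) \<le> C * (C' * hnorm E x)"
      by (rule order_trans[OF C(2)]) (use x assms C C' in \<open>auto intro!: mult_left_mono\<close>)
    then show "hnorm E ((S \<otimes>\<^bsub>operator_algebra E\<^esub> T) x) \<le> C * C' * hnorm E x"
      using x by (simp add: mult.assoc)
  qed (use assms in \<open>simp_all add: op_add op_scale\<close>, simp add: operator_algebra_def)
qed

lemma op_add_closed [simp, intro]:
  assumes "S \<in> bounded_operators E" "T \<in> bounded_operators E"
  shows "S \<oplus>\<^bsub>operator_algebra E\<^esub> T \<in> bounded_operators E"
proof -
  obtain C where C: "0 < C" "\<And>x. x \<in> hcarrier E \<Longrightarrow> hnorm E (S x) \<le> C * hnorm E x"
    using op_bound[OF assms(1)] by blast
  obtain C' where C': "0 < C'" "\<And>x. x \<in> hcarrier E \<Longrightarrow> hnorm E (T x) \<le> C' * hnorm E x"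
    using op_bound[OF assms(2)] by blast
  show ?thesis
  proof (rule bounded_operatorI[of _ "C + C'"])
    fix x assume x: "x \<in> hcarrier E"
    show "hnorm E ((S \<oplus>\<^bsub>operator_algebra E\<^esub> T) x) \<le> (C + C') * hnorm E x"
      using C(2)[OF x] C'(2)[OF x] norm_triangle[of "S x" "T x"] assms x by (simp add: distrib_right)
  next
    fix x y assume xy: "x \<in> hcarrier E" "y \<in> hcarrier E"
    show "(S \<oplus>\<^bsub>operator_algebra E\<^esub> T) (hadd E x y)
        = hadd E ((S \<oplus>\<^bsub>operator_algebra E\<^esub> T) x) ((S \<oplus>\<^bsub>operator_algebra E\<^esub> T) y)"
      using assms xy by (intro inner_ext) (simp_all add: op_add inner_simps)
  next
    fix x c assume x: "x \<in> hcarrier E"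
    show "(S \<oplus>\<^bsub>operator_algebra E\<^esub> T) (hscale E c x) = hscale E c ((S \<oplus>\<^bsub>operator_algebra E\<^esub> T) x)"
      using assms x by (intro inner_ext) (simp_all add: op_scale inner_simps algebra_simps)
  qed (use assms in \<open>simp_all\<close>, simp add: operator_algebra_def)
qed

lemma op_smult_closed [simp, intro]:
  assumes "T \<in> bounded_operators E"
  shows "c \<odot>\<^bsub>operator_algebra E\<^esub> T \<in> bounded_operators E"
proof -
  obtain C where C: "0 < C" "\<And>x. x \<in> hcarrier E \<Longrightarrow> hnorm E (T x) \<le> C * hnorm E x"
    using op_bound[OF assms(1)] by blast
  show ?thesis
  proof (rule bounded_operatorI[of _ "cmod c * C"])
    fix x assume x: "x \<in> hcarrier E"
    show "hnorm E ((c \<odot>\<^bsub>operator_algebra E\<^esub> T) x) \<le> cmod c * C * hnorm E x"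
      using C(2)[OF x] assms x by (simp add: norm_scale mult.assoc mult_left_mono)
  next
    fix x y assume xy: "x \<in> hcarrier E" "y \<in> hcarrier E"
    show "(c \<odot>\<^bsub>operator_algebra E\<^esub> T) (hadd E x y)
        = hadd E ((c \<odot>\<^bsub>operator_algebra E\<^esub> T) x) ((c \<odot>\<^bsub>operator_algebra E\<^esub> T) y)"
      using assms xy by (intro inner_ext) (simp_all add: op_add inner_simps algebra_simps)
  next
    fix x d assume x: "x \<in> hcarrier E"
    show "(c \<odot>\<^bsub>operator_algebra E\<^esub> T) (hscale E d x) = hscale E d ((c \<odot>\<^bsub>operator_algebra E\<^esub> T) x)"
      using assms x by (intro inner_ext) (simp_all add: op_scale inner_simps algebra_simps)
  qed (use assms in \<open>simp_all\<close>, simp add: operator_algebra_def)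
qed

lemma op_zero_closed [simp, intro]: "\<zero>\<^bsub>operator_algebra E\<^esub> \<in> bounded_operators E"
proof (rule bounded_operatorI[of _ 0])
  fix x y assume xy: "x \<in> hcarrier E" "y \<in> hcarrier E"
  show "\<zero>\<^bsub>operator_algebra E\<^esub> (hadd E x y) = hadd E (\<zero>\<^bsub>operator_algebra E\<^esub> x) (\<zero>\<^bsub>operator_algebra E\<^esub> y)"
    using xy by (intro inner_ext) (simp_all add: inner_simps)
next
  fix x c assume x: "x \<in> hcarrier E"
  show "\<zero>\<^bsub>operator_algebra E\<^esub> (hscale E c x) = hscale E c (\<zero>\<^bsub>operator_algebra E\<^esub> x)"
    using x by (intro inner_ext) (simp_all add: inner_simps)
qed (simp_all, simp add: operator_algebra_def)

end

section \<open>Operators given by bounded forms, and adjoints\<close>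

context hilbert
begin

text \<open>For fixed \<open>y\<close> the map taking \<open>x\<close> to
  \<open>cnj (\<beta> x y)\<close> is a bounded functional, to which Riesz applies. Adjoints and
  partial isometries are both obtained from their forms in this way.\<close>

lemma operator_of_form:
  assumes add: "\<And>x y z. \<lbrakk>x \<in> hcarrier E; y \<in> hcarrier E; z \<in> hcarrier E\<rbrakk> \<Longrightarrow> \<beta> x (hadd E y z) = \<beta> x y + \<beta> x z"
    and scale: "\<And>x c y. \<lbrakk>x \<in> hcarrier E; y \<in> hcarrier E\<rbrakk> \<Longrightarrow> \<beta> x (hscale E c y) = c * \<beta> x y"
    and add_left: "\<And>x y z. \<lbrakk>x \<in> hcarrier E; y \<in> hcarrier E; z \<in> hcarrier E\<rbrakk> \<Longrightarrow> \<beta> (hadd E y z) x = \<beta> y x + \<beta> z x"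
    and scale_left: "\<And>x c y. \<lbrakk>x \<in> hcarrier E; y \<in> hcarrier E\<rbrakk> \<Longrightarrow> \<beta> (hscale E c y) x = cnj c * \<beta> y x"
    and bound: "\<And>x y. \<lbrakk>x \<in> hcarrier E; y \<in> hcarrier E\<rbrakk> \<Longrightarrow> cmod (\<beta> x y) \<le> C * hnorm E x * hnorm E y"
  obtains T where "T \<in> bounded_operators E"
    "\<And>x y. \<lbrakk>x \<in> hcarrier E; y \<in> hcarrier E\<rbrakk> \<Longrightarrow> hinner E x (T y) = \<beta> x y"
proof -
  have "\<exists>z\<in>hcarrier E. \<forall>x\<in>hcarrier E. hinner E x z = \<beta> x y" if y: "y \<in> hcarrier E" for y
  proof -
    obtain z where z: "z \<in> hcarrier E" "\<And>x. x \<in> hcarrier E \<Longrightarrow> cnj (\<beta> x y) = hinner E z x"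
    proof (rule Riesz_representation[of "\<lambda>x. cnj (\<beta> x y)" "C * hnorm E y"])
      fix x assume x: "x \<in> hcarrier E"
      show "cmod (cnj (\<beta> x y)) \<le> C * hnorm E y * hnorm E x"
        using bound[OF x y] by (simp add: mult.assoc mult.commute[of "hnorm E x"])
    qed (use y add_left scale_left in auto)
    then show ?thesis by (metis complex_cnj_cnj inner_commute)
  qed
  then obtain t where t: "\<And>y. y \<in> hcarrier E \<Longrightarrow> t y \<in> hcarrier E"
    "\<And>x y. \<lbrakk>x \<in> hcarrier E; y \<in> hcarrier E\<rbrakk> \<Longrightarrow> hinner E x (t y) = \<beta> x y" by metis
  have "restrict t (hcarrier E) \<in> bounded_operators E"
  proof (rule bounded_operatorI[of _ C])
    fix x y assume xy: "x \<in> hcarrier E" "y \<in> hcarrier E"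
    show "restrict t (hcarrier E) (hadd E x y)
        = hadd E (restrict t (hcarrier E) x) (restrict t (hcarrier E) y)"
      using xy t by (intro inner_ext) (simp_all add: inner_simps add)
  next
    fix x c assume x: "x \<in> hcarrier E"
    show "restrict t (hcarrier E) (hscale E c x) = hscale E c (restrict t (hcarrier E) x)"
      using x t by (intro inner_ext) (simp_all add: inner_simps scale)
  next
    fix x assume x: "x \<in> hcarrier E"
    have "hnorm E (t x) * hnorm E (t x) \<le> C * hnorm E x * hnorm E (t x)"
      using t[OF x] x bound[of "t x" x] inner_self[of "t x"] t(2)[of "t x" x]
      by (simp add: norm_power power2_eq_square ac_simps norm_mult flip: of_real_mult)
    \<comment> \<open>The sign of \<open>C\<close> is not given; the bound at the pair
      \<open>(x, x)\<close> yields \<open>0 \<le> C\<close> unless \<open>x\<close> is a null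
      vector.\<close>
    moreover have "hnorm E (t x) \<le> C * hnorm E x" if "hnorm E (t x) = 0"
    proof (cases "hnorm E x = 0")
      case False
      then have "0 < hnorm E x" using norm_nonneg[OF x] by linarith
      moreover have "0 \<le> C * hnorm E x * hnorm E x"
        using bound[OF x x] norm_ge_zero order_trans by blast
      ultimately have "0 \<le> C" by (simp add: zero_le_mult_iff)
      then show ?thesis using that x by simp
    qed (use that in simp)
    ultimately show "hnorm E (restrict t (hcarrier E) x) \<le> C * hnorm E x"
      using x norm_nonneg[OF t(1)[OF x]]
      by (cases "hnorm E (t x) = 0") (auto intro: mult_right_le_imp_le[of _ "hnorm E (t x)"])
  qed (use t in auto)
  then show ?thesis using that[of "restrict t (hcarrier E)"] t by simp
qed

lemma adjoint:
  assumes T: "T \<in> bounded_operators E"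
  shows adjoint_closed [simp, intro]: "hadjoint E T \<in> bounded_operators E"
    and inner_adjoint: "\<lbrakk>x \<in> hcarrier E; y \<in> hcarrier E\<rbrakk> \<Longrightarrow> hinner E x (hadjoint E T y) = hinner E (T x) y"
proof -
  obtain C where C: "0 < C" "\<And>x. x \<in> hcarrier E \<Longrightarrow> hnorm E (T x) \<le> C * hnorm E x"
    using op_bound[OF T] by blast
  obtain S where S: "S \<in> bounded_operators E"
    "\<And>x y. \<lbrakk>x \<in> hcarrier E; y \<in> hcarrier E\<rbrakk> \<Longrightarrow> hinner E x (S y) = hinner E (T x) y"
  proof (rule operator_of_form[of "\<lambda>x y. hinner E (T x) y" C])
    fix x y assume xy: "x \<in> hcarrier E" "y \<in> hcarrier E"
    show "cmod (hinner E (T x) y) \<le> C * hnorm E x * hnorm E y"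
      by (rule order_trans[OF Cauchy_Schwarz]) (use xy T C in \<open>auto intro!: mult_right_mono\<close>)
  qed (use T in \<open>auto simp: inner_simps op_add op_scale\<close>)
  have "hadjoint E T = S"
  proof (rule ext)
    fix y show "hadjoint E T y = S y"
    proof (cases "y \<in> hcarrier E")
      case True
      have "(THE z. z \<in> hcarrier E \<and> (\<forall>x\<in>hcarrier E. hinner E x z = hinner E (T x) y)) = S y"
        using True S by (intro the_equality) (auto intro!: inner_ext)
      then show ?thesis using True by (simp add: hadjoint_def)
    qed (simp add: hadjoint_def op_extensional[OF S(1)])
  qed
  with S show "hadjoint E T \<in> bounded_operators E"
    "\<lbrakk>x \<in> hcarrier E; y \<in> hcarrier E\<rbrakk> \<Longrightarrow> hinner E x (hadjoint E T y) = hinner E (T x) y" by auto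
qed

lemma inner_adjoint_left:
  "\<lbrakk>T \<in> bounded_operators E; x \<in> hcarrier E; y \<in> hcarrier E\<rbrakk> \<Longrightarrow> hinner E (hadjoint E T x) y = hinner E x (T y)"
  using inner_adjoint[of T y x] inner_commute[of "hadjoint E T x" y] inner_commute[of x "T y"] by simp

lemma adjoint_eqI:
  assumes "S \<in> bounded_operators E" "T \<in> bounded_operators E"
    and "\<And>x y. \<lbrakk>x \<in> hcarrier E; y \<in> hcarrier E\<rbrakk> \<Longrightarrow> hinner E x (S y) = hinner E (T x) y"
  shows "hadjoint E T = S"
  using assms by (intro op_eqI) (auto simp: inner_adjoint)

lemma star_alg_operator_algebra: "star_alg (operator_algebra E)"
proof -
  interpret abelian_group "operator_algebra E"
  proof (rule abelian_groupI)
    fix T assume T: "T \<in> carrier (operator_algebra E)"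
    then show "\<exists>S\<in>carrier (operator_algebra E). S \<oplus>\<^bsub>operator_algebra E\<^esub> T = \<zero>\<^bsub>operator_algebra E\<^esub>"
      by (intro bexI[of _ "(-1) \<odot>\<^bsub>operator_algebra E\<^esub> T"] op_eqI) (auto simp: inner_simps)
  qed (auto intro!: op_eqI simp: inner_simps)
  show ?thesis
    by unfold_locales
       (auto intro!: op_eqI adjoint_eqI simp: inner_simps op_add op_scale inner_adjoint inner_adjoint_left
          distrib_right distrib_left)
qed

text \<open>\<open>|T' x|^2\<close> is the inner product of \<open>T (T' x)\<close> with
  \<open>x\<close>, where \<open>T'\<close> is the adjoint. The same constant serves on both sides,
  so adjoints of approximants approximate the adjoint equally well.\<close>

lemma adjoint_bound:
  assumes T: "T \<in> bounded_operators E" and C: "\<And>x. x \<in> hcarrier E \<Longrightarrow> hnorm E (T x) \<le> C * hnorm E x"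
    and x: "x \<in> hcarrier E" and C0: "0 \<le> C"
  shows "hnorm E (hadjoint E T x) \<le> C * hnorm E x"
proof -
  let ?y = "hadjoint E T x"
  have [simp]: "?y \<in> hcarrier E" using T x by auto
  have "hnorm E ?y * hnorm E ?y = cmod (hinner E ?y ?y)"
    by (simp add: inner_self power2_eq_square norm_mult)
  also have "\<dots> = cmod (hinner E (T ?y) x)" using T x by (simp add: inner_adjoint)
  also have "\<dots> \<le> hnorm E (T ?y) * hnorm E x" using T x by (intro Cauchy_Schwarz) auto
  also have "\<dots> \<le> C * hnorm E ?y * hnorm E x" using x by (intro mult_right_mono C) auto
  finally have "hnorm E ?y * hnorm E ?y \<le> (C * hnorm E x) * hnorm E ?y" by (simp add: ac_simps)
  moreover have "0 \<le> hnorm E ?y" "0 \<le> hnorm E x" using x by simp_all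
  ultimately show ?thesis
    using C0 by (cases "hnorm E ?y = 0") (auto intro: mult_right_le_imp_le[of _ "hnorm E ?y"])
qed

end

section \<open>Partial isometries between orthonormal families\<close>

context hilbert
begin

text \<open>The partial isometry taking \<open>b i\<close> to \<open>c i\<close> and vanishing on
  the orthogonal complement of the \<open>b i\<close>. It is encoded by its matrix coefficients, so
  that only series of complex numbers occur.\<close>

definition transport :: "'i set \<Rightarrow> ('i \<Rightarrow> 'v) \<Rightarrow> ('i \<Rightarrow> 'v) \<Rightarrow> 'v \<Rightarrow> 'v" where
  "transport I c b = (THE T. T \<in> bounded_operators E \<and> (\<forall>x\<in>hcarrier E. \<forall>y\<in>hcarrier E.
     hinner E x (T y) = (\<Sum>\<^sub>\<infinity>i\<in>I. hinner E x (c i) * hinner E (b i) y)))"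

context
  fixes I :: "'i set" and c b :: "'i \<Rightarrow> 'v"
  assumes c: "orthonormal I c" and b: "orthonormal I b"
begin

lemma transport_ex: "transport I c b \<in> bounded_operators E \<and> (\<forall>x\<in>hcarrier E. \<forall>y\<in>hcarrier E.
     hinner E x (transport I c b y) = (\<Sum>\<^sub>\<infinity>i\<in>I. hinner E x (c i) * hinner E (b i) y))"
proof -
  note closed = orthonormal_closed[OF c] orthonormal_closed[OF b]
  have sm: "(\<lambda>i. hinner E x (c i) * hinner E (b i) y) summable_on I" if "x \<in> hcarrier E" "y \<in> hcarrier E" for x y
    using abs_summable_summable[OF coefficient_form(1)[OF c b that]] .
  obtain T where T: "T \<in> bounded_operators E"
    "\<And>x y. \<lbrakk>x \<in> hcarrier E; y \<in> hcarrier E\<rbrakk>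
      \<Longrightarrow> hinner E x (T y) = (\<Sum>\<^sub>\<infinity>i\<in>I. hinner E x (c i) * hinner E (b i) y)"
  proof (rule operator_of_form[of "\<lambda>x y. \<Sum>\<^sub>\<infinity>i\<in>I. hinner E x (c i) * hinner E (b i) y" 1])
    fix x y z assume [simp]: "x \<in> hcarrier E" "y \<in> hcarrier E" "z \<in> hcarrier E"
    have "(\<Sum>\<^sub>\<infinity>i\<in>I. hinner E x (c i) * hinner E (b i) (hadd E y z))
      = (\<Sum>\<^sub>\<infinity>i\<in>I. hinner E x (c i) * hinner E (b i) y + hinner E x (c i) * hinner E (b i) z)"
      by (intro infsum_cong) (simp add: closed inner_simps distrib_left)
    then show "(\<Sum>\<^sub>\<infinity>i\<in>I. hinner E x (c i) * hinner E (b i) (hadd E y z))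
      = (\<Sum>\<^sub>\<infinity>i\<in>I. hinner E x (c i) * hinner E (b i) y) + (\<Sum>\<^sub>\<infinity>i\<in>I. hinner E x (c i) * hinner E (b i) z)"
      by (simp add: infsum_add sm)
    have "(\<Sum>\<^sub>\<infinity>i\<in>I. hinner E (hadd E y z) (c i) * hinner E (b i) x)
      = (\<Sum>\<^sub>\<infinity>i\<in>I. hinner E y (c i) * hinner E (b i) x + hinner E z (c i) * hinner E (b i) x)"
      by (intro infsum_cong) (simp add: closed inner_simps distrib_right)
    then show "(\<Sum>\<^sub>\<infinity>i\<in>I. hinner E (hadd E y z) (c i) * hinner E (b i) x)
      = (\<Sum>\<^sub>\<infinity>i\<in>I. hinner E y (c i) * hinner E (b i) x) + (\<Sum>\<^sub>\<infinity>i\<in>I. hinner E z (c i) * hinner E (b i) x)"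
      by (simp add: infsum_add sm)
  next
    fix x y k assume [simp]: "x \<in> hcarrier E" "y \<in> hcarrier E"
    have "(\<Sum>\<^sub>\<infinity>i\<in>I. hinner E x (c i) * hinner E (b i) (hscale E k y))
      = (\<Sum>\<^sub>\<infinity>i\<in>I. k * (hinner E x (c i) * hinner E (b i) y))"
      by (intro infsum_cong) (simp add: closed inner_simps)
    then show "(\<Sum>\<^sub>\<infinity>i\<in>I. hinner E x (c i) * hinner E (b i) (hscale E k y))
      = k * (\<Sum>\<^sub>\<infinity>i\<in>I. hinner E x (c i) * hinner E (b i) y)"
      by (simp add: infsum_cmult_right')
    have "(\<Sum>\<^sub>\<infinity>i\<in>I. hinner E (hscale E k y) (c i) * hinner E (b i) x)
      = (\<Sum>\<^sub>\<infinity>i\<in>I. cnj k * (hinner E y (c i) * hinner E (b i) x))"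
      by (intro infsum_cong) (simp add: closed inner_simps)
    then show "(\<Sum>\<^sub>\<infinity>i\<in>I. hinner E (hscale E k y) (c i) * hinner E (b i) x)
      = cnj k * (\<Sum>\<^sub>\<infinity>i\<in>I. hinner E y (c i) * hinner E (b i) x)"
      by (simp add: infsum_cmult_right')
  next
    fix x y assume "x \<in> hcarrier E" "y \<in> hcarrier E"
    then show "cmod (\<Sum>\<^sub>\<infinity>i\<in>I. hinner E x (c i) * hinner E (b i) y) \<le> 1 * hnorm E x * hnorm E y"
      using coefficient_form(2)[OF c b] by simp
  qed blast
  show ?thesis unfolding transport_def
    by (rule theI[of _ T]) (use T in \<open>auto intro!: op_eqI\<close>)
qed

lemma transport_closed [simp, intro]: "transport I c b \<in> bounded_operators E"
  using transport_ex by blast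

lemma inner_transport: "\<lbrakk>x \<in> hcarrier E; y \<in> hcarrier E\<rbrakk>
    \<Longrightarrow> hinner E x (transport I c b y) = (\<Sum>\<^sub>\<infinity>i\<in>I. hinner E x (c i) * hinner E (b i) y)"
  using transport_ex by blast

text \<open>By orthonormality a single term of the series survives. Composition of transports
  follows from this term by term.\<close>

lemma transport_coefficient:
  assumes "i \<in> I" "y \<in> hcarrier E"
  shows "hinner E (c i) (transport I c b y) = hinner E (b i) y"
proof -
  have "hinner E (c i) (transport I c b y) = (\<Sum>\<^sub>\<infinity>j\<in>I. if j = i then hinner E (b i) y else 0)"
    using assms by (simp add: inner_transport orthonormal_closed[OF c])
      (intro infsum_cong, auto simp: orthonormal_inner[OF c])
  also have "\<dots> = (\<Sum>\<^sub>\<infinity>j\<in>{i}. hinner E (b i) y)"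
    using assms(1) by (intro infsum_cong_neutral) auto
  also have "\<dots> = hinner E (b i) y" by simp
  finally show ?thesis .
qed

end

lemma transport_adjoint:
  assumes c: "orthonormal I c" and b: "orthonormal I b"
  shows "hadjoint E (transport I c b) = transport I b c"
proof (rule adjoint_eqI)
  fix x y assume [simp]: "x \<in> hcarrier E" "y \<in> hcarrier E"
  have "hinner E (transport I c b x) y = cnj (hinner E y (transport I c b x))"
    using c b by (intro inner_commute) auto
  also have "\<dots> = (\<Sum>\<^sub>\<infinity>i\<in>I. cnj (hinner E y (c i) * hinner E (b i) x))"
    by (simp add: inner_transport[OF c b] del: complex_cnj_mult flip: infsum_cnj)
  also have "\<dots> = (\<Sum>\<^sub>\<infinity>i\<in>I. hinner E x (b i) * hinner E (c i) y)"
    by (intro infsum_cong)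
       (simp add: inner_commute[of x] inner_commute[of _ y] orthonormal_closed[OF c] orthonormal_closed[OF b])
  finally show "hinner E x (transport I b c y) = hinner E (transport I c b x) y"
    by (simp add: inner_transport[OF b c])
qed (use c b in auto)

lemma transport_mult:
  assumes a: "orthonormal I a" and c: "orthonormal I c" and b: "orthonormal I b"
  shows "transport I a c \<otimes>\<^bsub>operator_algebra E\<^esub> transport I c b = transport I a b"
proof (rule op_eqI)
  fix x y assume [simp]: "x \<in> hcarrier E" "y \<in> hcarrier E"
  show "hinner E x ((transport I a c \<otimes>\<^bsub>operator_algebra E\<^esub> transport I c b) y) = hinner E x (transport I a b y)"
    using a b c by (simp add: inner_transport op_closed)
      (intro infsum_cong, simp add: transport_coefficient)
qed (use a b c in auto)

lemma transport_mult_zero: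
  assumes a: "orthonormal I a" and c: "orthonormal I c" and d: "orthonormal J d" and b: "orthonormal J b"
    and cd: "\<And>i j. i \<in> I \<Longrightarrow> j \<in> J \<Longrightarrow> hinner E (c i) (d j) = 0"
  shows "transport I a c \<otimes>\<^bsub>operator_algebra E\<^esub> transport J d b = \<zero>\<^bsub>operator_algebra E\<^esub>"
proof (rule op_eqI)
  fix x y assume [simp]: "x \<in> hcarrier E" "y \<in> hcarrier E"
  have "hinner E (c i) (transport J d b y) = 0" if "i \<in> I" for i
    unfolding inner_transport[OF d b orthonormal_closed[OF c that] \<open>y \<in> hcarrier E\<close>]
    by (rule infsum_0) (simp add: cd that)
  then show "hinner E x ((transport I a c \<otimes>\<^bsub>operator_algebra E\<^esub> transport J d b) y)
      = hinner E x (\<zero>\<^bsub>operator_algebra E\<^esub> y)"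
    using a c d b by (simp add: inner_transport op_closed inner_simps) (intro infsum_0, simp)
qed (use assms in auto)

lemma transport_Un:
  assumes c: "orthonormal (I \<union> J) c" and b: "orthonormal (I \<union> J) b" and disj: "I \<inter> J = {}"
  shows "transport (I \<union> J) c b = transport I c b \<oplus>\<^bsub>operator_algebra E\<^esub> transport J c b"
proof (rule op_eqI)
  note o = orthonormal_subset[OF c, of I] orthonormal_subset[OF c, of J]
    orthonormal_subset[OF b, of I] orthonormal_subset[OF b, of J]
  show "transport (I \<union> J) c b \<in> bounded_operators E"
    "transport I c b \<oplus>\<^bsub>operator_algebra E\<^esub> transport J c b \<in> bounded_operators E"
    using c b o by auto
  fix x y assume [simp]: "x \<in> hcarrier E" "y \<in> hcarrier E"
  show "hinner E x (transport (I \<union> J) c b y)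
      = hinner E x ((transport I c b \<oplus>\<^bsub>operator_algebra E\<^esub> transport J c b) y)"
    using o disj
    by (simp add: inner_transport[OF c b] inner_simps op_closed inner_transport)
       (rule infsum_Un_disjoint; (rule abs_summable_summable[OF coefficient_form(1)])?; simp)
qed

lemma transport_reindex:
  assumes c: "orthonormal (f ` I) c" and b: "orthonormal (f ` I) b" and f: "inj_on f I"
  shows "transport (f ` I) c b = transport I (\<lambda>i. c (f i)) (\<lambda>i. b (f i))"
proof -
  have o: "orthonormal I (\<lambda>i. c (f i))" "orthonormal I (\<lambda>i. b (f i))"
    by (rule orthonormal_reindex[OF c subset_refl f] orthonormal_reindex[OF b subset_refl f])+
  show ?thesis
  proof (rule op_eqI[OF transport_closed[OF c b] transport_closed[OF o]])
    fix x y assume xy: "x \<in> hcarrier E" "y \<in> hcarrier E"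
    show "hinner E x (transport (f ` I) c b y)
        = hinner E x (transport I (\<lambda>i. c (f i)) (\<lambda>i. b (f i)) y)"
      unfolding inner_transport[OF c b xy] inner_transport[OF o xy] infsum_reindex[OF f] o_def ..
  qed
qed

section \<open>Orthogonal projections onto closed spans\<close>

lemma hspan_closed: "S \<subseteq> hcarrier E \<Longrightarrow> x \<in> hspan E S \<Longrightarrow> x \<in> hcarrier E"
  by (erule hspan.induct) auto

text \<open>The operator is known only through inner products. The finite sums \<open>w\<close> have
  squared distance \<open>S - s\<close> from \<open>transport I b b y\<close>, the tail of a
  summable family, and this gives approximation in norm.\<close>

lemma transport_closed_hspan:
  assumes b: "orthonormal I b" and y [simp]: "y \<in> hcarrier E"
  shows "transport I b b y \<in> closed_hspan E (b ` I)"
proof -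
  let ?T = "transport I b b" and ?f = "\<lambda>i. (cmod (hinner E (b i) y))\<^sup>2"
  have T: "?T y \<in> hcarrier E" using b by (simp add: op_closed)
  note bc = orthonormal_closed[OF b]
  define S where "S = (\<Sum>\<^sub>\<infinity>i\<in>I. ?f i)"
  have hs: "(?f has_sum S) I" unfolding S_def using coefficients_summable(1)[OF b y] by (rule has_sum_infsum)
  have sq: "hinner E (b i) y * cnj (hinner E (b i) y) = complex_of_real (?f i)" for i
    by (rule complex_norm_square[symmetric])
  have bT: "hinner E (?T y) (b i) = cnj (hinner E (b i) y)" if "i \<in> I" for i
    using that T bc by (subst inner_commute) (auto simp: transport_coefficient[OF b b])
  have "hinner E (?T y) (?T y) = (\<Sum>\<^sub>\<infinity>i\<in>I. complex_of_real (?f i))"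
    using T by (simp add: inner_transport[OF b b] del: of_real_power)
      (intro infsum_cong, simp add: bT sq[symmetric] mult.commute del: of_real_power)
  also have "\<dots> = complex_of_real S" 
    using infsumI[OF has_sum_bounded_linear[OF bounded_linear_of_real hs]] by (simp add: o_def)
  finally have TT: "(hnorm E (?T y))\<^sup>2 = S" using T by (simp add: norm_sq)
  have "\<exists>w\<in>hspan E (b ` I). hnorm E (hdiff E (?T y) w) < \<epsilon>" if e: "\<epsilon> > 0" for \<epsilon>
  proof -
    have "\<forall>\<^sub>F F in finite_subsets_at_top I. dist (\<Sum>i\<in>F. ?f i) S < \<epsilon>\<^sup>2"
      using hs e unfolding has_sum_def tendsto_iff by simp
    then obtain F where F: "finite F" "F \<subseteq> I" "dist (\<Sum>i\<in>F. ?f i) S < \<epsilon>\<^sup>2"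
      unfolding eventually_finite_subsets_at_top by blast
    define s where "s = (\<Sum>i\<in>F. ?f i)"
    obtain w where w: "w \<in> hcarrier E" "w \<in> hspan E (b ` F)"
      "\<And>z. z \<in> hcarrier E \<Longrightarrow> hinner E z w = (\<Sum>i\<in>F. hinner E (b i) y * hinner E z (b i))"
      using finite_combination[OF F(1), of b "\<lambda>i. hinner E (b i) y"] bc F(2) by blast
    have wI: "w \<in> hspan E (b ` I)"
      using w(2) by (rule hspan.induct) (use F(2) in \<open>auto intro: hspan.intros\<close>)
    have bw: "hinner E (b j) w = hinner E (b j) y" if "j \<in> F" for j
    proof -
      have "j \<in> I" using that F(2) by blast
      then have "hinner E (b j) w = (\<Sum>i\<in>F. if i = j then hinner E (b i) y else 0)"
        unfolding w(3)[OF bc[OF \<open>j \<in> I\<close>]]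
        using F by (intro sum.cong refl) (auto simp: orthonormal_inner[OF b] subset_iff)
      also have "\<dots> = hinner E (b j) y" using that F by (simp add: sum.delta)
      finally show ?thesis .
    qed
    have "hinner E (?T y) w = (\<Sum>i\<in>F. complex_of_real (?f i))"
      using F by (simp only: w(3)[OF T]) (intro sum.cong refl, auto simp: bT sq[symmetric] simp del: of_real_power)
    then have 1: "Re (hinner E (?T y) w) = s" by (simp add: s_def)
    have "hinner E w (b i) = cnj (hinner E (b i) y)" if "i \<in> F" for i
      using that F bc w(1) by (subst inner_commute) (auto simp: bw)
    then have "hinner E w w = (\<Sum>i\<in>F. complex_of_real (?f i))"
      by (simp only: w(3)[OF w(1)]) (intro sum.cong refl, auto simp: sq[symmetric] simp del: of_real_power)
    then have 2: "(hnorm E w)\<^sup>2 = s" using w(1) by (simp add: s_def norm_sq)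
    have "(hnorm E (hdiff E (?T y) w))\<^sup>2 = S - s"
      using T w(1) by (simp add: norm_diff_sq TT 1 2)
    also have "\<dots> < \<epsilon>\<^sup>2" using F(3) unfolding s_def[symmetric] dist_real_def by linarith
    finally have "hnorm E (hdiff E (?T y) w) < \<epsilon>" using e by (simp add: power_less_imp_less_base)
    with wI show ?thesis by blast
  qed
  then show ?thesis using T by (auto simp: closed_hspan_def)
qed

text \<open>This brings the projection onto the span of a Wannier basis into the form that the
  swindle handles.\<close>

lemma orthogonal_projection_transport:
  assumes b: "orthonormal I b"
  shows "orthogonal_projection E (closed_hspan E (b ` I)) = transport I b b"
proof (rule ext)
  fix x
  note bc = orthonormal_closed[OF b]
  let ?V = "closed_hspan E (b ` I)" and ?T = "transport I b b"
  show "orthogonal_projection E ?V x = ?T x"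
  proof (cases "x \<in> hcarrier E")
    case True
    have Tx: "?T x \<in> hcarrier E" using b True by (simp add: op_closed)
    have bI: "b ` I \<subseteq> hcarrier E" using bc by auto
    have span0: "hinner E w (hdiff E x (?T x)) = 0" if "w \<in> hspan E (b ` I)" for w
      using that
    proof induction
      case (base w)
      then show ?case using True Tx bc by (auto simp: inner_simps transport_coefficient[OF b b])
    next
      case (add w w')
      then show ?case using True Tx hspan_closed[OF bI] by (simp add: inner_simps)
    next
      case (scale w c)
      then show ?case using True Tx hspan_closed[OF bI] by (simp add: inner_simps)
    qed (use True Tx in \<open>simp add: inner_simps\<close>)
    \<comment> \<open>A non-zero inner product of \<open>z\<close> with \<open>?d\<close> would
      persist for \<open>w\<close> in the algebraic span close enough to \<open>z\<close>, where it
      vanishes. The added 1 keeps the denominator positive.\<close>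
    have orth: "hinner E z (hdiff E x (?T x)) = 0" if z: "z \<in> ?V" for z
    proof (rule ccontr)
      let ?d = "hdiff E x (?T x)"
      have d: "?d \<in> hcarrier E" using True Tx by simp
      have zE: "z \<in> hcarrier E" using z by (simp add: closed_hspan_def)
      assume "hinner E z ?d \<noteq> 0"
      then have pos: "0 < cmod (hinner E z ?d) / (hnorm E ?d + 1)" using norm_nonneg[OF d] by simp
      then obtain w where w: "w \<in> hspan E (b ` I)" "hnorm E (hdiff E z w) < cmod (hinner E z ?d) / (hnorm E ?d + 1)"
        using z by (auto simp: closed_hspan_def)
      have wE: "w \<in> hcarrier E" using w(1) hspan_closed[OF bI] by blast
      have "cmod (hinner E z ?d) = cmod (hinner E (hdiff E z w) ?d)"
        using zE wE d span0[OF w(1)] by (simp add: inner_diff_left)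
      also have "\<dots> \<le> hnorm E (hdiff E z w) * hnorm E ?d" using zE wE d by (intro Cauchy_Schwarz) auto
      also have "\<dots> \<le> hnorm E (hdiff E z w) * (hnorm E ?d + 1)"
        using zE wE by (intro mult_left_mono) auto
      also have "\<dots> < cmod (hinner E z ?d)"
        using w(2) norm_nonneg[OF d] by (simp add: pos_less_divide_eq)
      finally show False by simp
    qed
    have "(THE y. y \<in> ?V \<and> (\<forall>z\<in>?V. hinner E z (hdiff E x y) = 0)) = ?T x"
    proof (rule the_equality)
      show "?T x \<in> ?V \<and> (\<forall>z\<in>?V. hinner E z (hdiff E x (?T x)) = 0)"
        using orth transport_closed_hspan[OF b True] by blast
      fix y assume y: "y \<in> ?V \<and> (\<forall>z\<in>?V. hinner E z (hdiff E x y) = 0)"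
      then have yE: "y \<in> hcarrier E" by (simp add: closed_hspan_def)
      \<comment> \<open>Both \<open>y\<close> and \<open>?T x\<close> lie in \<open>?V\<close>.
        Combining these four relations by linearity avoids showing that \<open>?V\<close> is closed
        under differences.\<close>
      have "hinner E y (hdiff E x y) = 0" "hinner E (?T x) (hdiff E x y) = 0"
        "hinner E y (hdiff E x (?T x)) = 0" "hinner E (?T x) (hdiff E x (?T x)) = 0"
        using y orth transport_closed_hspan[OF b True] by auto
      then have "hinner E (hdiff E y (?T x)) (hdiff E y (?T x)) = 0"
        using True yE Tx by (simp add: inner_simps)
      then have "hnorm E (hdiff E y (?T x)) = 0" by (simp add: hnorm_def)
      then have "hdiff E y (?T x) = hzero E" using yE Tx by (intro norm_eq_zeroD) auto
      then show "y = ?T x"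
        using yE Tx inner_diff_right[of _ y "?T x"] by (intro inner_ext) (auto simp: inner_simps)
    qed
    then show ?thesis using True by (simp add: orthogonal_projection_def)
  next
    case False
    then show ?thesis using op_extensional[OF transport_closed[OF b b]] by (simp add: orthogonal_projection_def)
  qed
qed

end


section \<open>Compact operators\<close>

context inner_space
begin

lemma compact_bounded: "compact_operator E T \<Longrightarrow> T \<in> bounded_operators E"
  by (simp add: compact_operator_def)

lemma compact_subsequence:
  assumes "compact_operator E T" "\<And>n::nat. X n \<in> hcarrier E" "\<And>n. hnorm E (X n) \<le> C"
  obtains r y where "strict_mono r" "y \<in> hcarrier E" "(\<lambda>n. hnorm E (hdiff E (T (X (r n))) y)) \<longlonglongrightarrow> 0"
  using assms unfolding compact_operator_def by blast

lemma compact_operatorI: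
  assumes "T \<in> bounded_operators E"
    and "\<And>X C. \<lbrakk>\<And>n::nat. X n \<in> hcarrier E; \<And>n. hnorm E (X n) \<le> C\<rbrakk> \<Longrightarrow>
      \<exists>r y. strict_mono r \<and> y \<in> hcarrier E \<and> (\<lambda>n. hnorm E (hdiff E (T (X (r n))) y)) \<longlonglongrightarrow> 0"
  shows "compact_operator E T"
  using assms unfolding compact_operator_def by blast

lemma op_tendsto:
  assumes S: "S \<in> bounded_operators E" and X: "\<And>n. X n \<in> hcarrier E" "y \<in> hcarrier E"
    and lim: "(\<lambda>n. hnorm E (hdiff E (X n) y)) \<longlonglongrightarrow> 0"
  shows "(\<lambda>n. hnorm E (hdiff E (S (X n)) (S y))) \<longlonglongrightarrow> 0"
proof -
  obtain C where C: "0 < C" "\<And>x. x \<in> hcarrier E \<Longrightarrow> hnorm E (S x) \<le> C * hnorm E x"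
    using op_bound[OF S] by blast
  have "hnorm E (hdiff E (S (X n)) (S y)) \<le> C * hnorm E (hdiff E (X n) y)" for n
    using C(2)[of "hdiff E (X n) y"] X by (simp add: op_diff[OF S])
  moreover have "(\<lambda>n. C * hnorm E (hdiff E (X n) y)) \<longlonglongrightarrow> C * 0" by (intro tendsto_intros lim)
  ultimately show ?thesis
    by (intro Lim_null_comparison[of "\<lambda>n. hnorm E (hdiff E (S (X n)) (S y))" "\<lambda>n. C * hnorm E (hdiff E (X n) y)"])
       (use S X in \<open>auto intro!: always_eventually\<close>)
qed

lemma compact_mult_left:
  assumes S: "S \<in> bounded_operators E" and T: "compact_operator E T"
  shows "compact_operator E (S \<otimes>\<^bsub>operator_algebra E\<^esub> T)"
proof (rule compact_operatorI)
  note T' = compact_bounded[OF T]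
  show "S \<otimes>\<^bsub>operator_algebra E\<^esub> T \<in> bounded_operators E" using S T' by simp
  fix X :: "nat \<Rightarrow> 'v" and C assume X: "\<And>n. X n \<in> hcarrier E" "\<And>n. hnorm E (X n) \<le> C"
  obtain r y where "strict_mono r" "y \<in> hcarrier E" "(\<lambda>n. hnorm E (hdiff E (T (X (r n))) y)) \<longlonglongrightarrow> 0"
    using compact_subsequence[OF T X] .
  with S T' X op_tendsto[OF S, of "\<lambda>n. T (X (r n))" y]
  show "\<exists>r y. strict_mono r \<and> y \<in> hcarrier E \<and>
      (\<lambda>n. hnorm E (hdiff E ((S \<otimes>\<^bsub>operator_algebra E\<^esub> T) (X (r n))) y)) \<longlonglongrightarrow> 0"
    by (intro exI[of _ r] exI[of _ "S y"]) auto
qed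

lemma compact_mult_right:
  assumes S: "S \<in> bounded_operators E" and T: "compact_operator E T"
  shows "compact_operator E (T \<otimes>\<^bsub>operator_algebra E\<^esub> S)"
proof (rule compact_operatorI)
  note T' = compact_bounded[OF T]
  show "T \<otimes>\<^bsub>operator_algebra E\<^esub> S \<in> bounded_operators E" using S T' by simp
  fix X :: "nat \<Rightarrow> 'v" and C assume X: "\<And>n. X n \<in> hcarrier E" "\<And>n. hnorm E (X n) \<le> C"
  obtain K where K: "0 < K" "\<And>x. x \<in> hcarrier E \<Longrightarrow> hnorm E (S x) \<le> K * hnorm E x"
    using op_bound[OF S] by blast
  have "hnorm E (S (X n)) \<le> K * C" for n
    using K(2)[OF X(1)[of n]] mult_left_mono[OF X(2)[of n], of K] K(1) by linarith
  then obtain r y where "strict_mono r" "y \<in> hcarrier E"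
      "(\<lambda>n. hnorm E (hdiff E (T (S (X (r n)))) y)) \<longlonglongrightarrow> 0"
    using compact_subsequence[OF T, of "\<lambda>n. S (X n)" "K * C"] S X by auto
  then show "\<exists>r y. strict_mono r \<and> y \<in> hcarrier E \<and>
      (\<lambda>n. hnorm E (hdiff E ((T \<otimes>\<^bsub>operator_algebra E\<^esub> S) (X (r n))) y)) \<longlonglongrightarrow> 0"
    using X by (intro exI[of _ r] exI[of _ y]) auto
qed

lemma compact_add:
  assumes S: "compact_operator E S" and T: "compact_operator E T"
  shows "compact_operator E (S \<oplus>\<^bsub>operator_algebra E\<^esub> T)"
proof (rule compact_operatorI)
  note S' = compact_bounded[OF S] and T' = compact_bounded[OF T]
  show "S \<oplus>\<^bsub>operator_algebra E\<^esub> T \<in> bounded_operators E" using S' T' by simp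
  fix X :: "nat \<Rightarrow> 'v" and C assume X: "\<And>n. X n \<in> hcarrier E" "\<And>n. hnorm E (X n) \<le> C"
  obtain r y where r: "strict_mono r" "y \<in> hcarrier E" "(\<lambda>n. hnorm E (hdiff E (S (X (r n))) y)) \<longlonglongrightarrow> 0"
    using compact_subsequence[OF S X] .
  obtain s z where s: "strict_mono s" "z \<in> hcarrier E" "(\<lambda>n. hnorm E (hdiff E (T (X (r (s n)))) z)) \<longlonglongrightarrow> 0"
    using compact_subsequence[OF T, of "\<lambda>n. X (r n)" C] X by blast
  have "(\<lambda>n. hnorm E (hdiff E (S (X (r (s n)))) y)) \<longlonglongrightarrow> 0"
    using LIMSEQ_subseq_LIMSEQ[OF r(3) s(1)] by (simp add: o_def)
  then have lim: "(\<lambda>n. hnorm E (hdiff E (S (X (r (s n)))) y) + hnorm E (hdiff E (T (X (r (s n)))) z)) \<longlonglongrightarrow> 0"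
    using tendsto_add[OF _ s(3)] by fastforce
  have "(\<lambda>n. hnorm E (hdiff E (hadd E (S (X (r (s n)))) (T (X (r (s n))))) (hadd E y z))) \<longlonglongrightarrow> 0"
  proof (rule Lim_null_comparison[OF always_eventually lim], rule allI)
    fix n
    have "hdiff E (hadd E (S (X (r (s n)))) (T (X (r (s n))))) (hadd E y z)
       = hadd E (hdiff E (S (X (r (s n)))) y) (hdiff E (T (X (r (s n)))) z)"
      using S' T' X r(2) s(2) by (intro inner_ext) (simp_all add: inner_simps op_closed)
    then show "norm (hnorm E (hdiff E (hadd E (S (X (r (s n)))) (T (X (r (s n))))) (hadd E y z)))
       \<le> hnorm E (hdiff E (S (X (r (s n)))) y) + hnorm E (hdiff E (T (X (r (s n)))) z)"
      using norm_triangle[of "hdiff E (S (X (r (s n)))) y" "hdiff E (T (X (r (s n)))) z"] S' T' X r(2) s(2)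
      by (simp add: op_closed)
  qed
  then show "\<exists>r y. strict_mono r \<and> y \<in> hcarrier E \<and>
      (\<lambda>n. hnorm E (hdiff E ((S \<oplus>\<^bsub>operator_algebra E\<^esub> T) (X (r n))) y)) \<longlonglongrightarrow> 0"
    using r s X strict_mono_o[OF r(1) s(1)] by (intro exI[of _ "r \<circ> s"] exI[of _ "hadd E y z"]) auto
qed

lemma compact_zero: "compact_operator E \<zero>\<^bsub>operator_algebra E\<^esub>"
proof (rule compact_operatorI)
  fix X :: "nat \<Rightarrow> 'v" and C assume X: "\<And>n. X n \<in> hcarrier E"
  have "hdiff E (hzero E) (hzero E) = hzero E" by (rule inner_ext) (auto simp: inner_simps)
  then show "\<exists>r y. strict_mono r \<and> y \<in> hcarrier E \<and>
      (\<lambda>n. hnorm E (hdiff E (\<zero>\<^bsub>operator_algebra E\<^esub> (X (r n))) y)) \<longlonglongrightarrow> 0"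
    using X by (intro exI[of _ id] exI[of _ "hzero E"]) (auto simp: strict_mono_def)
qed simp

lemma op_one_closed [simp, intro]: "(\<lambda>x\<in>hcarrier E. x) \<in> bounded_operators E"
  by (rule bounded_operatorI[of _ 1]) auto

lemma compact_smult:
  assumes "compact_operator E T"
  shows "compact_operator E (c \<odot>\<^bsub>operator_algebra E\<^esub> T)"
proof -
  note T = compact_bounded[OF assms]
  have "c \<odot>\<^bsub>operator_algebra E\<^esub> T
      = (c \<odot>\<^bsub>operator_algebra E\<^esub> (\<lambda>x\<in>hcarrier E. x)) \<otimes>\<^bsub>operator_algebra E\<^esub> T"
    using T by (intro op_eqI) auto
  then show ?thesis using compact_mult_left[OF _ assms] by simp
qed

definition rank_one :: "'v \<Rightarrow> 'v \<Rightarrow> 'v \<Rightarrow> 'v" where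
  "rank_one c b = (\<lambda>y\<in>hcarrier E. hscale E (hinner E b y) c)"

lemma rank_one_closed [simp, intro]:
  assumes [simp]: "c \<in> hcarrier E" "b \<in> hcarrier E"
  shows "rank_one c b \<in> bounded_operators E"
proof (rule bounded_operatorI[of _ "hnorm E b * hnorm E c"])
  fix x assume [simp]: "x \<in> hcarrier E"
  show "hnorm E (rank_one c b x) \<le> hnorm E b * hnorm E c * hnorm E x"
    using mult_right_mono[OF Cauchy_Schwarz[of b x], of "hnorm E c"]
    by (simp add: rank_one_def norm_scale ac_simps)
next
  fix x y assume [simp]: "x \<in> hcarrier E" "y \<in> hcarrier E"
  show "rank_one c b (hadd E x y) = hadd E (rank_one c b x) (rank_one c b y)"
    by (rule inner_ext) (auto simp: rank_one_def inner_simps distrib_right)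
next
  fix x k assume [simp]: "x \<in> hcarrier E"
  show "rank_one c b (hscale E k x) = hscale E k (rank_one c b x)"
    by (rule inner_ext) (auto simp: rank_one_def inner_simps)
qed (auto simp: rank_one_def)

lemma compact_rank_one:
  assumes c [simp]: "c \<in> hcarrier E" and b [simp]: "b \<in> hcarrier E"
  shows "compact_operator E (rank_one c b)"
proof (rule compact_operatorI)
  fix X :: "nat \<Rightarrow> 'v" and C assume X: "\<And>n. X n \<in> hcarrier E" "\<And>n. hnorm E (X n) \<le> C"
  have "cmod (hinner E b (X n)) \<le> hnorm E b * C" for n
    using Cauchy_Schwarz[OF b X(1)[of n]] mult_left_mono[OF X(2)[of n], of "hnorm E b"] by simp
  then have "bounded (range (\<lambda>n. hinner E b (X n)))" by (auto simp: bounded_iff)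
  then obtain l r where r: "strict_mono r" "((\<lambda>n. hinner E b (X n)) \<circ> r) \<longlonglongrightarrow> l"
    using bounded_imp_convergent_subsequence by blast
  have "(\<lambda>n. cmod (hinner E b (X (r n)) - l) * hnorm E c) \<longlonglongrightarrow> cmod (l - l) * hnorm E c"
    using r(2) by (intro tendsto_intros) (auto simp: o_def)
  moreover have "hdiff E (hscale E (hinner E b (X (r n))) c) (hscale E l c)
      = hscale E (hinner E b (X (r n)) - l) c" for n
    by (rule inner_ext) (auto simp: inner_simps left_diff_distrib)
  ultimately show "\<exists>r y. strict_mono r \<and> y \<in> hcarrier E \<and>
      (\<lambda>n. hnorm E (hdiff E (rank_one c b (X (r n))) y)) \<longlonglongrightarrow> 0"
    using r X by (intro exI[of _ r] exI[of _ "hscale E l c"]) (auto simp: rank_one_def norm_scale)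
qed simp

text \<open>Such a form belongs to a finite sum of rank one operators, which are split off one at a
  time.\<close>

lemma compact_of_finite_form:
  assumes "finite F" "T \<in> bounded_operators E" "\<And>i. i \<in> F \<Longrightarrow> c i \<in> hcarrier E" "\<And>i. i \<in> F \<Longrightarrow> b i \<in> hcarrier E"
    "\<And>x y. \<lbrakk>x \<in> hcarrier E; y \<in> hcarrier E\<rbrakk>
      \<Longrightarrow> hinner E x (T y) = (\<Sum>i\<in>F. hinner E x (c i) * hinner E (b i) y)"
  shows "compact_operator E T"
  using assms
proof (induction F arbitrary: T)
  case empty
  then have "T = \<zero>\<^bsub>operator_algebra E\<^esub>" by (intro op_eqI) (auto simp: inner_simps)
  then show ?case using compact_zero by simp
next
  case (insert j F)
  note [simp] = insert.prems(1)
  define S where "S = T \<oplus>\<^bsub>operator_algebra E\<^esub> ((-1) \<odot>\<^bsub>operator_algebra E\<^esub> rank_one (c j) (b j))"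
  have r: "rank_one (c j) (b j) \<in> bounded_operators E" using insert.prems by simp
  have "compact_operator E S"
  proof (rule insert.IH)
    show "S \<in> bounded_operators E" using r by (auto simp: S_def)
    fix x y assume [simp]: "x \<in> hcarrier E" "y \<in> hcarrier E"
    show "hinner E x (S y) = (\<Sum>i\<in>F. hinner E x (c i) * hinner E (b i) y)"
      using r insert.hyps insert.prems by (simp add: S_def inner_simps op_closed) (simp add: rank_one_def inner_simps)
  qed (use insert.prems in auto)
  moreover have "T = S \<oplus>\<^bsub>operator_algebra E\<^esub> rank_one (c j) (b j)"
    using r by (intro op_eqI) (auto simp: S_def inner_simps)
  moreover have "compact_operator E (rank_one (c j) (b j))" using insert.prems by (intro compact_rank_one) auto
  ultimately show ?case using compact_add by metis
qed

end

context hilbert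
begin

text \<open>Diagonal argument: a subsequence along which the images under all approximants converge
  has Cauchy images under their limit.\<close>

lemma compact_norm_limit:
  assumes T: "T \<in> bounded_operators E"
    and approx: "\<And>\<epsilon>. \<epsilon> > 0 \<Longrightarrow> \<exists>S. compact_operator E S \<and>
      (\<forall>x\<in>hcarrier E. hnorm E (hdiff E (T x) (S x)) \<le> \<epsilon> * hnorm E x)"
  shows "compact_operator E T"
proof (rule compact_operatorI[OF T])
  fix X :: "nat \<Rightarrow> 'v" and C assume X: "\<And>n. X n \<in> hcarrier E" "\<And>n. hnorm E (X n) \<le> C"
  have "\<forall>k::nat. \<exists>S. compact_operator E S \<and> (\<forall>x\<in>hcarrier E. hnorm E (hdiff E (T x) (S x)) \<le> (1 / Suc k) * hnorm E x)"
    by (intro allI approx) simp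
  then obtain S where S: "\<And>k. compact_operator E (S k)"
    "\<And>k x. x \<in> hcarrier E \<Longrightarrow> hnorm E (hdiff E (T x) (S k x)) \<le> (1 / Suc k) * hnorm E x" by metis
  have Sc [simp]: "S k x \<in> hcarrier E" if "x \<in> hcarrier E" for k x
    using that compact_bounded[OF S(1)] by auto
  define P where "P k s \<longleftrightarrow> (\<exists>y\<in>hcarrier E. (\<lambda>n. hnorm E (hdiff E (S k (X (s n))) y)) \<longlonglongrightarrow> 0)" for k and s :: "nat \<Rightarrow> nat"
  interpret subseqs P
  proof
    fix k and s :: "nat \<Rightarrow> nat" assume "strict_mono s"
    obtain r y where "strict_mono r" "y \<in> hcarrier E" "(\<lambda>n. hnorm E (hdiff E (S k (X (s (r n)))) y)) \<longlonglongrightarrow> 0"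
      using compact_subsequence[OF S(1)[of k], of "\<lambda>n. X (s n)" C] X by blast
    then show "\<exists>r'. strict_mono r' \<and> P k (s \<circ> r')" by (auto simp: P_def o_def)
  qed
  \<comment> \<open>The diagonal sequence is a subsequence of the \<open>k\<close>-th refinement
    only from the index \<open>Suc k\<close> on.\<close>
  have P_diag: "P k (diagseq \<circ> ((+) (Suc k)))" for k
  proof (rule diagseq_holds)
    fix n s r assume r: "strict_mono (r :: nat \<Rightarrow> nat)" and "P n s"
    then obtain y where "y \<in> hcarrier E" "(\<lambda>m. hnorm E (hdiff E (S n (X (s m))) y)) \<longlonglongrightarrow> 0"
      by (auto simp: P_def)
    from LIMSEQ_subseq_LIMSEQ[OF this(2) r] this(1) show "P n (s \<circ> r)" by (auto simp: P_def o_def)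
  qed
  let ?d = diagseq
  have C0: "0 \<le> C" using X(2)[of 0] norm_nonneg[OF X(1)[of 0]] by linarith
  have "\<exists>N. \<forall>m\<ge>N. \<forall>n\<ge>N. hnorm E (hdiff E (T (X (?d m))) (T (X (?d n)))) < \<epsilon>" if e: "\<epsilon> > 0" for \<epsilon>
  proof -
    \<comment> \<open>The vectors have norm at most \<open>C\<close>, so the approximant is off by
      at most \<epsilon> / 4. The distance to its limit costs another \<epsilon> / 4, and comparing
      two indices doubles the sum.\<close>
    have "0 < \<epsilon> / (4 * (C + 1))" using e C0 by simp
    then obtain k where k: "1 / real (Suc k) < \<epsilon> / (4 * (C + 1))" by (rule nat_approx_posE)
    have close: "hnorm E (hdiff E (T (X i)) (S k (X i))) < \<epsilon> / 4" for i
    proof -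
      have "hnorm E (hdiff E (T (X i)) (S k (X i))) \<le> 1 / real (Suc k) * hnorm E (X i)" by (rule S(2)[OF X(1)])
      also have "\<dots> \<le> 1 / real (Suc k) * (C + 1)" using X(2)[of i] by (intro mult_left_mono) auto
      also have "\<dots> < \<epsilon> / (4 * (C + 1)) * (C + 1)" using k C0 by (intro mult_strict_right_mono) auto
      also have "\<dots> = \<epsilon> / 4" using C0 by (simp add: field_simps add_nonneg_eq_0_iff)
      finally show ?thesis .
    qed
    obtain y where y: "y \<in> hcarrier E" "(\<lambda>n. hnorm E (hdiff E (S k (X (?d (Suc k + n)))) y)) \<longlonglongrightarrow> 0"
      using P_diag[of k] by (auto simp: P_def o_def)
    obtain N where N: "\<And>n. n \<ge> N \<Longrightarrow> hnorm E (hdiff E (S k (X (?d (Suc k + n)))) y) < \<epsilon> / 4"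
      using y(2) e X(1) y(1) unfolding LIMSEQ_iff by (metis Sc abs_of_nonneg diff_closed diff_zero norm_nonneg real_norm_def zero_less_divide_iff zero_less_numeral)
    have half: "hnorm E (hdiff E (T (X (?d n))) y) < \<epsilon> / 2" if "n \<ge> Suc k + N" for n
    proof -
      have "hnorm E (hdiff E (S k (X (?d n))) y) < \<epsilon> / 4" using N[of "n - Suc k"] that by simp
      moreover have "hnorm E (hdiff E (T (X (?d n))) y)
          \<le> hnorm E (hdiff E (T (X (?d n))) (S k (X (?d n)))) + hnorm E (hdiff E (S k (X (?d n))) y)"
        using X(1) y(1) T by (intro norm_triangle_diff) auto
      ultimately show ?thesis using close[of "?d n"] by linarith
    qed
    have "hnorm E (hdiff E (T (X (?d m))) (T (X (?d n)))) < \<epsilon>" if "m \<ge> Suc k + N" "n \<ge> Suc k + N" for m n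
    proof -
      have "hnorm E (hdiff E (T (X (?d m))) (T (X (?d n))))
          \<le> hnorm E (hdiff E (T (X (?d m))) y) + hnorm E (hdiff E y (T (X (?d n))))"
        using X(1) y(1) T by (intro norm_triangle_diff) auto
      moreover have "hnorm E (hdiff E y (T (X (?d n)))) = hnorm E (hdiff E (T (X (?d n))) y)"
        using X(1) y(1) T by (intro diff_commute_norm) auto
      ultimately show ?thesis using half[OF that(1)] half[OF that(2)] by linarith
    qed
    then show ?thesis by blast
  qed
  then obtain y where "y \<in> hcarrier E" "(\<lambda>n. hnorm E (hdiff E (T (X (?d n))) y)) \<longlonglongrightarrow> 0"
    using complete[of "\<lambda>n. T (X (?d n))"] T X by blast
  then show "\<exists>r y. strict_mono r \<and> y \<in> hcarrier E \<and> (\<lambda>n. hnorm E (hdiff E (T (X (r n))) y)) \<longlonglongrightarrow> 0"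
    using subseq_diagseq by blast
qed

text \<open>\<open>\<parallel>T\<^sup>* x\<parallel>\<^sup>2\<close> is the inner product of \<open>x\<close> with \<open>T T\<^sup>* x\<close>, and \<open>T T\<^sup>*\<close> is compact.\<close>

lemma compact_adjoint:
  assumes T: "compact_operator E T"
  shows "compact_operator E (hadjoint E T)"
proof (rule compact_operatorI)
  note T' = compact_bounded[OF T]
  let ?A = "hadjoint E T"
  show A: "?A \<in> bounded_operators E" using T' by simp
  fix X :: "nat \<Rightarrow> 'v" and C assume X: "\<And>n. X n \<in> hcarrier E" "\<And>n. hnorm E (X n) \<le> C"
  have C0: "0 \<le> C" using X(2)[of 0] norm_nonneg[OF X(1)[of 0]] by linarith
  obtain r y where r: "strict_mono r" "y \<in> hcarrier E"
    "(\<lambda>n. hnorm E (hdiff E ((T \<otimes>\<^bsub>operator_algebra E\<^esub> ?A) (X (r n))) y)) \<longlonglongrightarrow> 0"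
    using compact_subsequence[OF compact_mult_right[OF A T] X] .
  define e where "e n = hnorm E (hdiff E (T (?A (X (r n)))) y)" for n
  have e: "e \<longlonglongrightarrow> 0" using r(3) X(1) unfolding e_def by simp
  have bound: "(hnorm E (hdiff E (?A (X (r m))) (?A (X (r n)))))\<^sup>2 \<le> 2 * C * (e m + e n)" for m n
  proof -
    let ?x = "hdiff E (X (r m)) (X (r n))"
    have x: "?x \<in> hcarrier E" using X by simp
    have Ax: "?A ?x \<in> hcarrier E" using A x by auto
    have "(hnorm E (?A ?x))\<^sup>2 = cmod (hinner E (?A ?x) (?A ?x))"
      unfolding inner_self[OF Ax] by (simp add: norm_power)
    also have "hinner E (?A ?x) (?A ?x) = hinner E (T (?A ?x)) ?x" using T' Ax x by (simp add: inner_adjoint)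
    also have "cmod \<dots> \<le> hnorm E (T (?A ?x)) * hnorm E ?x" using T' Ax x by (intro Cauchy_Schwarz) auto
    also have "\<dots> \<le> (e m + e n) * (2 * C)"
    proof (intro mult_mono)
      have "T (?A ?x) = hdiff E (T (?A (X (r m)))) (T (?A (X (r n))))"
        using T' A X by (simp add: op_diff op_closed)
      also have "hnorm E \<dots> \<le> e m + hnorm E (hdiff E y (T (?A (X (r n)))))"
        unfolding e_def using T' A X r(2) by (intro norm_triangle_diff) (simp_all add: op_closed)
      also have "hnorm E (hdiff E y (T (?A (X (r n))))) = e n"
        unfolding e_def using T' A X r(2) by (intro diff_commute_norm) (simp_all add: op_closed)
      finally show "hnorm E (T (?A ?x)) \<le> e m + e n" .
      show "hnorm E ?x \<le> 2 * C" using norm_diff_le[of "X (r m)" "X (r n)"] X(1) X(2)[of "r m"] X(2)[of "r n"] by simp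
      have "0 \<le> e n" for n unfolding e_def using T' A X r(2) by (intro norm_nonneg diff_closed) (simp_all add: op_closed)
      then show "0 \<le> e m + e n" by (simp add: add_nonneg_nonneg)
    qed (use x in auto)
    finally show ?thesis using A X by (simp add: op_diff mult.commute)
  qed
  have "\<exists>N. \<forall>m\<ge>N. \<forall>n\<ge>N. hnorm E (hdiff E (?A (X (r m))) (?A (X (r n)))) < \<epsilon>" if eps: "\<epsilon> > 0" for \<epsilon>
  proof -
    have "0 < \<epsilon>\<^sup>2 / (4 * (C + 1))" using eps C0 by simp
    then obtain N where N: "\<And>n. n \<ge> N \<Longrightarrow> \<bar>e n\<bar> < \<epsilon>\<^sup>2 / (4 * (C + 1))"
      using e unfolding LIMSEQ_iff by fastforce
    have "hnorm E (hdiff E (?A (X (r m))) (?A (X (r n)))) < \<epsilon>" if mn: "m \<ge> N" "n \<ge> N" for m n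
    proof -
      have "2 * C * (e m + e n) \<le> 2 * C * (\<epsilon>\<^sup>2 / (4 * (C + 1)) + \<epsilon>\<^sup>2 / (4 * (C + 1)))"
        using N[OF mn(1)] N[OF mn(2)] C0 by (intro mult_left_mono) auto
      also have "\<dots> = C / (C + 1) * \<epsilon>\<^sup>2" using C0 by (simp add: field_simps add_nonneg_eq_0_iff)
      also have "\<dots> < 1 * \<epsilon>\<^sup>2" using C0 eps by (intro mult_strict_right_mono) auto
      finally have "(hnorm E (hdiff E (?A (X (r m))) (?A (X (r n)))))\<^sup>2 < \<epsilon>\<^sup>2" using bound[of m n] by simp
      then show ?thesis using eps by (simp add: power_less_imp_less_base)
    qed
    then show ?thesis by blast
  qed
  then obtain z where "z \<in> hcarrier E" "(\<lambda>n. hnorm E (hdiff E (?A (X (r n))) z)) \<longlonglongrightarrow> 0"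
    using complete[of "\<lambda>n. ?A (X (r n))"] A X by blast
  then show "\<exists>r y. strict_mono r \<and> y \<in> hcarrier E \<and> (\<lambda>n. hnorm E (hdiff E (?A (X (r n))) y)) \<longlonglongrightarrow> 0"
    using r(1) by blast
qed

end

section \<open>The Hilbert space of square integrable functions\<close>

text \<open>A Hilbert space given as a type is viewed as one with a carrier, so that the
  Cauchy-Schwarz inequality and the norm identities proved above apply to function values.\<close>

definition type_hspace :: "'k::complex_hilbert_space hspace" where
  "type_hspace = \<lparr>hcarrier = UNIV, hzero = 0, hadd = (+), hscale = scaleC, hinner = cinner\<rparr>"

lemma cinner_self: "cinner x x = complex_of_real ((norm x)\<^sup>2)" for x :: "'k::complex_hilbert_space"
proof -
  have "0 \<le> Re (cinner x x)"
    using norm_ge_zero[of x] unfolding norm_eq_sqrt_cinner[of x] by simp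
  moreover have "Im (cinner x x) = 0" using cinner_commute[of x x] by (simp add: complex_eq_iff)
  ultimately show ?thesis by (simp add: norm_eq_sqrt_cinner complex_eq_iff)
qed

lemma cinner_zero_right [simp]: "cinner x 0 = 0" for x :: "'k::complex_hilbert_space"
  using cinner_scaleC_right[of x 0 0] by simp

interpretation type_hspace: inner_space "type_hspace :: 'k::complex_hilbert_space hspace"
  rewrites "hcarrier (type_hspace :: 'k hspace) = UNIV" and "hzero (type_hspace :: 'k hspace) = 0"
    and "hadd (type_hspace :: 'k hspace) = (+)" and "hscale (type_hspace :: 'k hspace) = scaleC"
    and "hinner (type_hspace :: 'k hspace) = cinner" and "hnorm (type_hspace :: 'k hspace) = norm"
proof -
  show *: "hcarrier (type_hspace :: 'k hspace) = UNIV" "hzero (type_hspace :: 'k hspace) = 0"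
    "hadd (type_hspace :: 'k hspace) = (+)" "hscale (type_hspace :: 'k hspace) = scaleC"
    "hinner (type_hspace :: 'k hspace) = cinner" "hnorm (type_hspace :: 'k hspace) = norm"
    by (simp_all add: type_hspace_def hnorm_def norm_eq_sqrt_cinner fun_eq_iff)
  show "inner_space (type_hspace :: 'k hspace)"
  proof (unfold_locales; unfold *)
    fix x y :: 'k assume "\<And>z. z \<in> UNIV \<Longrightarrow> cinner z x = cinner z y"
    then have "cinner (x - y) (x - y) = 0"
      using cinner_add_right[of "x - y" "x - y" y] by simp
    then show "x = y" by (simp add: cinner_self)
  qed (use cinner_commute in \<open>auto simp: cinner_add_right cinner_scaleC_right cinner_self\<close>)
qed

lemmas cinner_simps = type_hspace.inner_add_left[OF UNIV_I UNIV_I UNIV_I]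
  type_hspace.inner_scale_left[OF UNIV_I UNIV_I] cinner_add_right cinner_scaleC_right

lemma cinner_zero_left [simp]: "cinner 0 x = 0" for x :: "'k::complex_hilbert_space"
  by (rule type_hspace.inner_zero_left) simp

lemma norm_scaleC: "norm (scaleC c x) = cmod c * norm x" for x :: "'k::complex_hilbert_space"
  by (rule type_hspace.norm_scale) simp

lemma cinner_bound: "cmod (cinner x y) \<le> (norm x)\<^sup>2 + (norm y)\<^sup>2" for x :: "'k::complex_hilbert_space"
proof -
  have "cmod (cinner x y) \<le> norm x * norm y" by (rule type_hspace.Cauchy_Schwarz) auto
  moreover have "0 \<le> (norm x - norm y)\<^sup>2" by simp
  then have "2 * (norm x * norm y) \<le> (norm x)\<^sup>2 + (norm y)\<^sup>2" by (simp add: power2_diff)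
  moreover have "0 \<le> norm x * norm y" by simp
  ultimately show ?thesis by linarith
qed

lemma norm_add_sq_le: "(norm (x + y))\<^sup>2 \<le> 2 * (norm x)\<^sup>2 + 2 * (norm y)\<^sup>2" for x :: "'k::real_normed_vector"
proof -
  have "(norm (x + y))\<^sup>2 \<le> (norm x + norm y)\<^sup>2" by (intro power_mono norm_triangle_ineq) auto
  moreover have "0 \<le> (norm x - norm y)\<^sup>2" by simp
  ultimately show ?thesis by (simp add: power2_diff power2_sum)
qed

text \<open>The target need not be second countable, so measurability of sums and inner products has to be
  assumed; it holds for a scalar target and for counting measures.\<close>

locale l2_space =
  fixes M :: "'a measure" and K :: "'k::complex_hilbert_space itself"
  assumes separable_range: "f \<in> borel_measurable M \<Longrightarrow> \<exists>S::'k set. countable S \<and> f ` space M \<subseteq> closure S"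
    and measurable_add: "\<lbrakk>f \<in> borel_measurable M; g \<in> borel_measurable M\<rbrakk> \<Longrightarrow> (\<lambda>x. f x + g x :: 'k) \<in> borel_measurable M"
    and measurable_scaleC: "\<lbrakk>u \<in> borel_measurable M; f \<in> borel_measurable M\<rbrakk> \<Longrightarrow> (\<lambda>x. scaleC (u x) (f x) :: 'k) \<in> borel_measurable M"
    and measurable_cinner: "\<lbrakk>f \<in> borel_measurable M; g \<in> borel_measurable M\<rbrakk> \<Longrightarrow> (\<lambda>x. cinner (f x) (g x :: 'k)) \<in> borel_measurable M"
begin

abbreviation L :: "('a \<Rightarrow> 'k) set hspace" where "L \<equiv> L2 M"

lemma measurable_norm: "f \<in> borel_measurable M \<Longrightarrow> (\<lambda>x. norm (f x :: 'k)) \<in> borel_measurable M"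
  by (rule measurable_compose[OF _ borel_measurable_continuous_onI[OF continuous_on_norm_id]])

lemma l2_iff: "f \<in> l2_functions M \<longleftrightarrow> f \<in> borel_measurable M \<and> (\<integral>\<^sup>+x. ennreal ((norm (f x :: 'k))\<^sup>2) \<partial>M) < \<infinity>"
  using separable_range[of f] by (auto simp: l2_functions_def)

lemma l2_measurable: "f \<in> l2_functions M \<Longrightarrow> (f :: 'a \<Rightarrow> 'k) \<in> borel_measurable M"
  by (simp add: l2_iff)

lemma measurable_norm_sq: "f \<in> borel_measurable M \<Longrightarrow> (\<lambda>x. (norm (f x :: 'k))\<^sup>2) \<in> borel_measurable M"
  by (intro borel_measurable_power measurable_norm)

lemma l2_integrable: "f \<in> l2_functions M \<Longrightarrow> integrable M (\<lambda>x. (norm (f x :: 'k))\<^sup>2)"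
  by (rule integrableI_bounded) (auto simp: l2_iff measurable_norm_sq)

lemma l2_dominated:
  assumes "f \<in> borel_measurable M" "integrable M w" "AE x in M. (norm (f x :: 'k))\<^sup>2 \<le> w x"
  shows "f \<in> l2_functions M"
proof -
  have "(\<integral>\<^sup>+x. ennreal ((norm (f x))\<^sup>2) \<partial>M) \<le> (\<integral>\<^sup>+x. ennreal (norm (w x)) \<partial>M)"
    using assms(3) by (intro nn_integral_mono_AE) (auto intro: ennreal_leI)
  also have "\<dots> < \<infinity>" using assms(2) by (simp add: integrable_iff_bounded)
  finally show ?thesis using assms(1) by (simp add: l2_iff)
qed

lemma l2_zero: "(\<lambda>x. 0 :: 'k) \<in> l2_functions M"
  by (simp add: l2_iff)

lemma l2_add: "\<lbrakk>f \<in> l2_functions M; g \<in> l2_functions M\<rbrakk> \<Longrightarrow> (\<lambda>x. f x + g x :: 'k) \<in> l2_functions M"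
  by (rule l2_dominated[where w = "\<lambda>x. 2 * (norm (f x))\<^sup>2 + 2 * (norm (g x))\<^sup>2"])
     (intro measurable_add l2_measurable l2_integrable Bochner_Integration.integrable_add
        integrable_mult_right AE_I2 norm_add_sq_le; assumption)+

lemma l2_mult:
  assumes "u \<in> borel_measurable M" "\<And>x. x \<in> space M \<Longrightarrow> cmod (u x) \<le> B" "f \<in> l2_functions M"
  shows "(\<lambda>x. scaleC (u x) (f x) :: 'k) \<in> l2_functions M"
proof (rule l2_dominated[where w = "\<lambda>x. B\<^sup>2 * (norm (f x))\<^sup>2"])
  show "AE x in M. (norm (scaleC (u x) (f x)))\<^sup>2 \<le> B\<^sup>2 * (norm (f x))\<^sup>2"
    using assms(2) by (intro AE_I2) (auto simp: norm_scaleC power_mult_distrib intro!: mult_right_mono power_mono)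
  show "(\<lambda>x. scaleC (u x) (f x)) \<in> borel_measurable M"
    by (intro measurable_scaleC l2_measurable assms)
  show "integrable M (\<lambda>x. B\<^sup>2 * (norm (f x))\<^sup>2)"
    by (intro integrable_mult_right l2_integrable assms)
qed

lemma l2_scale: "f \<in> l2_functions M \<Longrightarrow> (\<lambda>x. scaleC c (f x) :: 'k) \<in> l2_functions M"
  by (rule l2_mult[where B = "cmod c"]) auto

lemma l2_diff: "\<lbrakk>f \<in> l2_functions M; g \<in> l2_functions M\<rbrakk> \<Longrightarrow> (\<lambda>x. f x - g x :: 'k) \<in> l2_functions M"
  using l2_add[of f "\<lambda>x. scaleC (-1) (g x)"] l2_scale[of g "-1"] by simp

lemma l2_cinner_integrable:
  assumes "f \<in> l2_functions M" "g \<in> l2_functions M"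
  shows "integrable M (\<lambda>x. cinner (f x) (g x :: 'k))"
  by (rule Bochner_Integration.integrable_bound[where f = "\<lambda>x. (norm (f x))\<^sup>2 + (norm (g x))\<^sup>2"])
     (use assms in \<open>auto intro!: l2_integrable measurable_cinner l2_measurable AE_I2 cinner_bound\<close>)

lemma class_refl: "f \<in> l2_functions M \<Longrightarrow> (f :: 'a \<Rightarrow> 'k) \<in> l2_class M f"
  by (simp add: l2_class_def)

lemma rep_class:
  assumes "(f :: 'a \<Rightarrow> 'k) \<in> l2_functions M"
  shows rep_class_l2: "rep (l2_class M f) \<in> l2_functions M" and AE_rep_class: "AE x in M. rep (l2_class M f) x = f x"
proof -
  have "rep (l2_class M f) \<in> l2_class M f"
    unfolding rep_def by (rule someI[of _ f]) (rule class_refl[OF assms])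
  then show "rep (l2_class M f) \<in> l2_functions M" "AE x in M. rep (l2_class M f) x = f x"
    by (auto simp: l2_class_def)
qed

lemma class_eqI:
  assumes "AE x in M. f x = (g x :: 'k)"
  shows "l2_class M f = l2_class M g"
  unfolding l2_class_def
proof (intro Collect_cong conj_cong refl iffI)
  fix h assume "AE x in M. h x = f x" then show "AE x in M. h x = g x" using assms by eventually_elim simp
next
  fix h assume "AE x in M. h x = g x" then show "AE x in M. h x = f x" using assms by eventually_elim simp
qed

lemma class_closed [intro]: "(f :: 'a \<Rightarrow> 'k) \<in> l2_functions M \<Longrightarrow> l2_class M f \<in> hcarrier L"
  by (simp add: L2_def)

lemma carrier_rep:
  assumes "F \<in> hcarrier L"
  shows rep_l2: "rep F \<in> l2_functions M" and class_rep: "l2_class M (rep F) = F"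
proof -
  obtain f where f: "f \<in> l2_functions M" "F = l2_class M f" using assms by (auto simp: L2_def)
  then show "rep F \<in> l2_functions M" using rep_class_l2 by simp
  show "l2_class M (rep F) = F" unfolding f(2) by (rule class_eqI[OF AE_rep_class[OF f(1)]])
qed

lemma carrier_eqI: "\<lbrakk>F \<in> hcarrier L; G \<in> hcarrier L; AE x in M. rep F x = rep G x\<rbrakk> \<Longrightarrow> F = G"
  using class_rep class_eqI by metis

lemma inner_def: "hinner L F G = (LINT x|M. cinner (rep F x) (rep G x))"
  by (simp add: L2_def)

text \<open>\<open>rep\<close> picks arbitrary representatives; this allows inner products to be
  computed with any convenient ones.\<close>

lemma hinner_cong:
  assumes "F \<in> hcarrier L" "G \<in> hcarrier L" "(f :: 'a \<Rightarrow> 'k) \<in> l2_functions M" "g \<in> l2_functions M"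
    "AE x in M. rep F x = f x" "AE x in M. rep G x = g x"
  shows "hinner L F G = (LINT x|M. cinner (f x) (g x))"
  unfolding inner_def using assms(5,6)
  by (intro integral_cong_AE borel_measurable_integrable l2_cinner_integrable rep_l2 assms) auto

lemma hadd_L2:
  assumes F: "F \<in> hcarrier L" and G: "G \<in> hcarrier L"
  shows hadd_closed: "hadd L F G \<in> hcarrier L" and rep_hadd: "AE x in M. rep (hadd L F G) x = rep F x + rep G x"
  using l2_add[OF rep_l2[OF F] rep_l2[OF G]] by (auto simp: L2_def AE_rep_class)

lemma hscale_L2:
  assumes F: "F \<in> hcarrier L"
  shows hscale_closed: "hscale L c F \<in> hcarrier L" and rep_hscale: "AE x in M. rep (hscale L c F) x = scaleC c (rep F x)"
  using l2_scale[OF rep_l2[OF F], of c] by (auto simp: L2_def AE_rep_class)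

lemma hzero_closed: "hzero L \<in> hcarrier L" and rep_hzero: "AE x in M. rep (hzero L) x = 0"
  using l2_zero by (auto simp: L2_def AE_rep_class)

lemma inner_space_L2: "inner_space L"
proof
  fix F G H assume F: "F \<in> hcarrier L" and G: "G \<in> hcarrier L" and H: "H \<in> hcarrier L"
  note r = rep_l2[OF F] rep_l2[OF G] rep_l2[OF H]
  have "hinner L F (hadd L G H) = (LINT x|M. cinner (rep F x) (rep G x + rep H x))"
    using rep_hadd[OF G H] by (intro hinner_cong hadd_closed l2_add r F G H) auto
  also have "\<dots> = hinner L F G + hinner L F H"
    unfolding inner_def cinner_add_right
    by (intro Bochner_Integration.integral_add l2_cinner_integrable r)
  finally show "hinner L F (hadd L G H) = hinner L F G + hinner L F H" .
next
  fix F G c assume F: "F \<in> hcarrier L" and G: "G \<in> hcarrier L"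
  note r = rep_l2[OF F] rep_l2[OF G]
  show "hadd L F G \<in> hcarrier L" "hscale L c F \<in> hcarrier L" using hadd_closed[OF F G] hscale_closed[OF F] by auto
  have "hinner L F G = (LINT x|M. cnj (cinner (rep G x) (rep F x)))"
    unfolding inner_def by (intro Bochner_Integration.integral_cong refl cinner_commute)
  then show "hinner L F G = cnj (hinner L G F)" by (simp add: inner_def)
  have "hinner L F (hscale L c G) = (LINT x|M. cinner (rep F x) (scaleC c (rep G x)))"
    using rep_hscale[OF G] by (intro hinner_cong hscale_closed l2_scale r F G) auto
  then show "hinner L F (hscale L c G) = c * hinner L F G"
    by (simp add: inner_def cinner_scaleC_right)
next
  fix F assume F: "F \<in> hcarrier L"
  have "hinner L F (hzero L) = (LINT x|M. cinner (rep F x) 0)"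
    using rep_hzero by (intro hinner_cong hzero_closed l2_zero rep_l2 F) auto
  then show "hinner L F (hzero L) = 0" by simp
  show "0 \<le> Re (hinner L F F)" unfolding inner_def cinner_self
    by (simp add: Bochner_Integration.integral_nonneg del: of_real_power)
next
  fix F G assume F: "F \<in> hcarrier L" and G: "G \<in> hcarrier L"
    and eq: "\<And>H. H \<in> hcarrier L \<Longrightarrow> hinner L H F = hinner L H G"
  note r = rep_l2[OF F] rep_l2[OF G]
  define h where "h x = rep F x - rep G x" for x
  have h: "h \<in> l2_functions M" unfolding h_def by (intro l2_diff r)
  let ?H = "l2_class M h"
  have H: "?H \<in> hcarrier L" using h by auto
  have "(LINT x|M. cinner (h x) (rep F x)) = (LINT x|M. cinner (h x) (rep G x))"
    using eq[OF H] hinner_cong[OF H F h r(1) AE_rep_class[OF h]] hinner_cong[OF H G h r(2) AE_rep_class[OF h]] by simp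
  then have "(LINT x|M. cinner (h x) (rep F x) - cinner (h x) (rep G x)) = 0"
    by (subst Bochner_Integration.integral_diff) (auto intro!: l2_cinner_integrable h r)
  moreover have "cinner (h x) (rep F x) - cinner (h x) (rep G x) = complex_of_real ((norm (h x))\<^sup>2)" for x
    using cinner_add_right[of "h x" "h x" "rep G x"] cinner_self[of "h x"] by (simp add: h_def)
  ultimately have "(LINT x|M. (norm (h x))\<^sup>2) = 0" by (simp del: of_real_power)
  then have "AE x in M. (norm (h x))\<^sup>2 = 0"
    using integral_nonneg_eq_0_iff_AE[OF l2_integrable[OF h]] by simp
  then show "F = G" by (intro carrier_eqI F G) (auto simp: h_def)
qed (rule hzero_closed)

sublocale inner_space L by (rule inner_space_L2)

lemma rep_hdiff: "\<lbrakk>F \<in> hcarrier L; G \<in> hcarrier L\<rbrakk> \<Longrightarrow> AE x in M. rep (hdiff L F G) x = rep F x - rep G x"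
  unfolding hdiff_def using rep_hadd[of F "hscale L (-1) G"] rep_hscale[of G "-1"] hscale_closed[of G "-1"]
  by auto

lemma hnorm_sq_integral:
  assumes "F \<in> hcarrier L" "(f :: 'a \<Rightarrow> 'k) \<in> l2_functions M" "AE x in M. rep F x = f x"
  shows "(hnorm L F)\<^sup>2 = (LINT x|M. (norm (f x))\<^sup>2)"
proof -
  have "hinner L F F = (LINT x|M. complex_of_real ((norm (f x))\<^sup>2))"
    using hinner_cong[OF assms(1,1,2,2,3,3)] by (simp only: cinner_self)
  also have "\<dots> = complex_of_real (LINT x|M. (norm (f x))\<^sup>2)" by (rule integral_of_real[OF l2_integrable[OF assms(2)]])
  finally show ?thesis using assms(1) by (simp add: norm_sq)
qed

lemma hnorm_sq_nn_integral:
  assumes "F \<in> hcarrier L" "(f :: 'a \<Rightarrow> 'k) \<in> l2_functions M" "AE x in M. rep F x = f x"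
  shows "ennreal ((hnorm L F)\<^sup>2) = (\<integral>\<^sup>+x. ennreal ((norm (f x))\<^sup>2) \<partial>M)"
  unfolding hnorm_sq_integral[OF assms]
  by (rule nn_integral_eq_integral[symmetric]) (rule l2_integrable[OF assms(2)], simp)

lemma fatou_bound:
  fixes u :: "nat \<Rightarrow> 'a \<Rightarrow> ennreal"
  assumes "\<And>j. u j \<in> borel_measurable M" "AE x in M. (\<lambda>j. u j x) \<longlonglongrightarrow> v x" "\<And>j. j \<ge> J \<Longrightarrow> (\<integral>\<^sup>+x. u j x \<partial>M) \<le> c"
  shows "(\<integral>\<^sup>+x. v x \<partial>M) \<le> c"
proof -
  have "(\<integral>\<^sup>+x. v x \<partial>M) = (\<integral>\<^sup>+x. liminf (\<lambda>j. u j x) \<partial>M)"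
    using assms(2) by (intro nn_integral_cong_AE) (erule eventually_mono, simp add: lim_imp_Liminf)
  also have "\<dots> \<le> liminf (\<lambda>j. \<integral>\<^sup>+x. u j x \<partial>M)" by (rule nn_integral_liminf) (rule assms(1))
  also have "\<dots> \<le> liminf (\<lambda>j. c)"
    by (rule Liminf_mono) (use assms(3) in \<open>auto simp: eventually_sequentially\<close>)
  also have "\<dots> = c" by (simp add: Liminf_const)
  finally show ?thesis .
qed

text \<open>The Riesz-Fischer argument: a rapidly converging subsequence converges almost
  everywhere, and its pointwise limit is the limit in norm.\<close>

lemma L2_complete:
  assumes X: "\<And>n. X n \<in> hcarrier L"
    and Cauchy: "\<And>\<epsilon>. \<epsilon> > 0 \<Longrightarrow> \<exists>N. \<forall>m\<ge>N. \<forall>n\<ge>N. hnorm L (hdiff L (X m) (X n)) < \<epsilon>"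
  shows "\<exists>G\<in>hcarrier L. (\<lambda>n. hnorm L (hdiff L (X n) G)) \<longlonglongrightarrow> 0"
proof -
  define f where "f n = rep (X n)" for n
  have f: "f n \<in> l2_functions M" for n unfolding f_def by (rule rep_l2[OF X])
  have dist: "ennreal ((hnorm L (hdiff L (X m) (X n)))\<^sup>2) = (\<integral>\<^sup>+x. ennreal ((norm (f m x - f n x))\<^sup>2) \<partial>M)" for m n
    by (rule hnorm_sq_nn_integral) (auto intro!: l2_diff rep_l2 rep_hdiff X simp: f_def)
  have "\<forall>j. \<exists>N. \<forall>m\<ge>N. \<forall>n\<ge>N. hnorm L (hdiff L (X m) (X n)) < (1/4)^j" using Cauchy by simp
  then obtain N where N: "\<And>j m n. m \<ge> N j \<Longrightarrow> n \<ge> N j \<Longrightarrow> hnorm L (hdiff L (X m) (X n)) < (1/4)^j" by metis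
  \<comment> \<open>The sum makes \<open>k\<close> increasing and at least \<open>N j\<close>; the
    summand \<open>j\<close> makes it tend to infinity.\<close>
  define k where "k j = (\<Sum>i\<le>j. N i) + j" for j
  have kN: "k j \<ge> N j" for j unfolding k_def by (simp add: trans_le_add1 member_le_sum)
  have k_mono: "k j \<le> k (Suc j)" for j unfolding k_def by simp
  define d where "d j x = f (k (Suc j)) x - f (k j) x" for j x
  have dm: "d j \<in> borel_measurable M" for j unfolding d_def by (intro l2_measurable l2_diff f)
  \<comment> \<open>The squared steps integrate to at most \<open>16^-j\<close>. Weighted by
    \<open>4^j\<close> they are still summable, and finiteness of the weighted series at
    \<open>x\<close> forces \<open>norm (d j x)\<close> to decay like \<open>2^-j\<close>.\<close>
  have d_int: "(\<integral>\<^sup>+x. ennreal ((norm (d j x))\<^sup>2) \<partial>M) \<le> ennreal ((1/16)^j)" for j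
  proof -
    have "hnorm L (hdiff L (X (k (Suc j))) (X (k j))) \<le> (1/4)^j"
      using N[of j "k (Suc j)" "k j"] kN[of j] k_mono[of j] by linarith
    then have "(hnorm L (hdiff L (X (k (Suc j))) (X (k j))))\<^sup>2 \<le> ((1/4)^j)\<^sup>2"
      using X by (intro power_mono) auto
    also have "((1/4::real)^j)\<^sup>2 = (1/16)^j" by (simp add: power2_eq_square flip: power_mult_distrib)
    finally show ?thesis using dist[of "k (Suc j)" "k j"] unfolding d_def by (metis ennreal_leI)
  qed
  have "(\<integral>\<^sup>+x. (\<Sum>j. ennreal (4^j * (norm (d j x))\<^sup>2)) \<partial>M) = (\<Sum>j. \<integral>\<^sup>+x. ennreal (4^j * (norm (d j x))\<^sup>2) \<partial>M)"
    by (rule nn_integral_suminf) (auto intro!: borel_measurable_times measurable_norm_sq dm)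
  also have "\<dots> \<le> (\<Sum>j. ennreal ((1/4)^j))"
  proof (intro suminf_le allI)
    fix j
    have "(\<integral>\<^sup>+x. ennreal (4^j * (norm (d j x))\<^sup>2) \<partial>M) = ennreal (4^j) * (\<integral>\<^sup>+x. ennreal ((norm (d j x))\<^sup>2) \<partial>M)"
      by (subst nn_integral_cmult[symmetric]) (auto intro!: measurable_norm_sq dm simp: ennreal_mult)
    also have "\<dots> \<le> ennreal (4^j) * ennreal ((1/16)^j)" by (intro mult_left_mono d_int) auto
    also have "\<dots> = ennreal ((1/4)^j)" by (simp flip: ennreal_mult power_mult_distrib)
    finally show "(\<integral>\<^sup>+x. ennreal (4^j * (norm (d j x))\<^sup>2) \<partial>M) \<le> ennreal ((1/4)^j)" .
  qed auto
  also have "\<dots> = ennreal (\<Sum>j. (1/4)^j)" by (rule suminf_ennreal2) auto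
  finally have "(\<integral>\<^sup>+x. (\<Sum>j. ennreal (4^j * (norm (d j x))\<^sup>2)) \<partial>M) \<noteq> \<infinity>" using top.not_eq_extremum le_less_trans[OF _ ennreal_less_top] by auto
  then have "AE x in M. (\<Sum>j. ennreal (4^j * (norm (d j x))\<^sup>2)) \<noteq> \<infinity>"
    by (intro nn_integral_PInf_AE) (auto intro!: borel_measurable_times measurable_norm_sq dm borel_measurable_suminf_order)
  moreover have "convergent (\<lambda>j. f (k j) x)" if fin: "(\<Sum>j. ennreal (4^j * (norm (d j x))\<^sup>2)) \<noteq> \<infinity>" for x
  proof -
    obtain C where C: "C \<ge> 0" "(\<Sum>j. ennreal (4^j * (norm (d j x))\<^sup>2)) = ennreal C"
    proof -
      have "\<exists>C\<ge>0. S = ennreal C" if "S \<noteq> \<infinity>" for S using that by (cases S rule: ennreal_cases) auto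
      from this[OF fin] show ?thesis using that by blast
    qed
    have "norm (d j x) \<le> sqrt C * (1/2)^j" for j
    proof -
      have "ennreal (4^j * (norm (d j x))\<^sup>2) \<le> ennreal C"
        using sum_le_suminf[of "\<lambda>j. ennreal (4^j * (norm (d j x))\<^sup>2)" "{j}"] C by simp
      then have "4^j * (norm (d j x))\<^sup>2 \<le> C" using C by simp
      moreover have "(4::real)^j = (2^j)\<^sup>2" by (simp add: power2_eq_square flip: power_mult_distrib)
      ultimately have "2^j * norm (d j x) \<le> sqrt C" by (intro real_le_rsqrt) (simp add: power_mult_distrib)
      then show ?thesis by (simp add: power_divide field_simps)
    qed
    moreover have "summable (\<lambda>j. sqrt C * (1/2::real)^j)" by (rule summable_mult) (simp add: summable_geometric)
    ultimately have "summable (\<lambda>j. d j x)"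
      by (rule summable_comparison_test'[rotated, where N = 0])
    then have "convergent (\<lambda>n. f (k 0) x + (\<Sum>j<n. d j x))"
      by (simp add: summable_iff_convergent convergent_add convergent_const)
    moreover have "f (k 0) x + (\<Sum>j<n. d j x) = f (k n) x" for n
      unfolding d_def using sum_lessThan_telescope[of "\<lambda>j. f (k j) x" n] by simp
    ultimately show ?thesis by simp
  qed
  ultimately have "AE x in M. convergent (\<lambda>j. f (k j) x)" by auto
  then obtain Z where Z: "Z \<in> null_sets M" "\<And>x. x \<in> space M - Z \<Longrightarrow> convergent (\<lambda>j. f (k j) x)"
    by (auto elim!: AE_E3)
  have Zm [measurable]: "Z \<in> sets M" using Z(1) by auto
  define g where "g x = (if x \<in> Z then 0 else lim (\<lambda>j. f (k j) x))" for x
  have lim: "(\<lambda>j. if x \<in> Z then 0 else f (k j) x) \<longlonglongrightarrow> g x" if "x \<in> space M" for x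
    using Z(2)[of x] that by (auto simp: g_def convergent_LIMSEQ_iff)
  have gm: "g \<in> borel_measurable M"
  proof (rule borel_measurable_LIMSEQ_metric[OF _ lim])
    show "(\<lambda>x. if x \<in> Z then 0 else f (k j) x) \<in> borel_measurable M" for j
      by (rule measurable_If_set) (auto intro!: l2_measurable f simp: sets.Int)
  qed
  have "AE x in M. x \<notin> Z" using Z(1) by (rule AE_not_in)
  then have limAE: "AE x in M. (\<lambda>j. f (k j) x) \<longlonglongrightarrow> g x"
    using AE_space by eventually_elim (use lim in fastforce)
  have kj: "k j \<ge> j" for j by (simp add: k_def)
  \<comment> \<open>Fatou's lemma along the subsequence carries the Cauchy estimate over to the
    pointwise limit \<open>g\<close>.\<close>
  have tail: "\<exists>N. \<forall>n\<ge>N. (\<integral>\<^sup>+x. ennreal ((norm (g x - f n x))\<^sup>2) \<partial>M) \<le> ennreal (\<epsilon>\<^sup>2)" if e: "\<epsilon> > 0" for \<epsilon>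
  proof -
    obtain N where N: "\<And>m n. m \<ge> N \<Longrightarrow> n \<ge> N \<Longrightarrow> hnorm L (hdiff L (X m) (X n)) < \<epsilon>" using Cauchy[OF e] by blast
    have "(\<integral>\<^sup>+x. ennreal ((norm (g x - f n x))\<^sup>2) \<partial>M) \<le> ennreal (\<epsilon>\<^sup>2)" if n: "n \<ge> N" for n
    proof (rule fatou_bound[where u = "\<lambda>j x. ennreal ((norm (f (k j) x - f n x))\<^sup>2)" and J = N])
      show "(\<lambda>x. ennreal ((norm (f (k j) x - f n x))\<^sup>2)) \<in> borel_measurable M" for j
        by (intro measurable_compose[OF _ measurable_ennreal] measurable_norm_sq l2_measurable l2_diff f)
      show "AE x in M. (\<lambda>j. ennreal ((norm (f (k j) x - f n x))\<^sup>2)) \<longlonglongrightarrow> ennreal ((norm (g x - f n x))\<^sup>2)"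
        using limAE by eventually_elim (intro tendsto_intros)
      fix j assume "j \<ge> N"
      then have "hnorm L (hdiff L (X (k j)) (X n)) \<le> \<epsilon>" using N[of "k j" n] n kj[of j] by simp
      then have "(hnorm L (hdiff L (X (k j)) (X n)))\<^sup>2 \<le> \<epsilon>\<^sup>2" using X by (intro power_mono) auto
      then show "(\<integral>\<^sup>+x. ennreal ((norm (f (k j) x - f n x))\<^sup>2) \<partial>M) \<le> ennreal (\<epsilon>\<^sup>2)"
        using dist[of "k j" n] by (metis ennreal_leI)
    qed
    then show ?thesis by blast
  qed
  obtain N1 where N1: "(\<integral>\<^sup>+x. ennreal ((norm (g x - f N1 x))\<^sup>2) \<partial>M) \<le> ennreal (1\<^sup>2)" using tail[of 1] by auto
  have "(\<lambda>x. g x - f N1 x) \<in> borel_measurable M"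
    using measurable_add[OF gm measurable_scaleC[of "\<lambda>x. -1", OF _ l2_measurable[OF f[of N1]]]] by simp
  then have "(\<lambda>x. g x - f N1 x) \<in> l2_functions M"
    unfolding l2_iff using le_less_trans[OF N1 ennreal_less_top] by simp
  from l2_add[OF this f[of N1]] have g: "g \<in> l2_functions M" by simp
  let ?G = "l2_class M g"
  have G: "?G \<in> hcarrier L" using g by auto
  have "hnorm L (hdiff L (X n) ?G) = sqrt (enn2real (\<integral>\<^sup>+x. ennreal ((norm (g x - f n x))\<^sup>2) \<partial>M))" for n
  proof -
    have "ennreal ((hnorm L (hdiff L (X n) ?G))\<^sup>2) = (\<integral>\<^sup>+x. ennreal ((norm (f n x - g x))\<^sup>2) \<partial>M)"
      using rep_hdiff[OF X G, of n] AE_rep_class[OF g]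
      by (intro hnorm_sq_nn_integral diff_closed X G l2_diff f g) (auto simp: f_def)
    then have "(\<integral>\<^sup>+x. ennreal ((norm (g x - f n x))\<^sup>2) \<partial>M) = ennreal ((hnorm L (hdiff L (X n) ?G))\<^sup>2)"
      by (simp add: norm_minus_commute)
    then show ?thesis using X G by simp
  qed
  note eq = this
  have "(\<lambda>n. hnorm L (hdiff L (X n) ?G)) \<longlonglongrightarrow> 0"
  proof (rule LIMSEQ_I)
    fix r :: real assume r: "r > 0"
    then obtain N where N: "\<And>n. n \<ge> N \<Longrightarrow> (\<integral>\<^sup>+x. ennreal ((norm (g x - f n x))\<^sup>2) \<partial>M) \<le> ennreal ((r/2)\<^sup>2)"
      using tail[of "r/2"] by auto
    have "hnorm L (hdiff L (X n) ?G) \<le> r / 2" if "n \<ge> N" for n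
    proof -
      have "enn2real (\<integral>\<^sup>+x. ennreal ((norm (g x - f n x))\<^sup>2) \<partial>M) \<le> (r/2)\<^sup>2"
        using N[OF that] by (metis enn2real_ennreal enn2real_mono ennreal_less_top zero_le_power2)
      then show ?thesis unfolding eq using r by (metis less_imp_le half_gt_zero real_sqrt_le_mono real_sqrt_abs abs_of_nonneg)
    qed
    then show "\<exists>no. \<forall>n\<ge>no. norm (hnorm L (hdiff L (X n) ?G) - 0) < r"
      using r X G by (intro exI[of _ N]) force
  qed
  with G show ?thesis by blast
qed

sublocale hilbert L
  by unfold_locales (rule L2_complete)


section \<open>Multiplication operators and supports\<close>

definition bounded_multiplier :: "('a \<Rightarrow> complex) \<Rightarrow> bool" where
  "bounded_multiplier u \<longleftrightarrow> u \<in> borel_measurable M \<and> (\<exists>B. \<forall>x\<in>space M. cmod (u x) \<le> B)"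

lemma mult_l2: "bounded_multiplier u \<Longrightarrow> F \<in> hcarrier L \<Longrightarrow> (\<lambda>x. scaleC (u x) (rep F x)) \<in> l2_functions M"
  unfolding bounded_multiplier_def using l2_mult rep_l2 by blast

lemma mult_carrier:
  assumes "bounded_multiplier u" "F \<in> hcarrier L"
  shows "mult_operator M u F \<in> hcarrier L" and rep_mult: "AE x in M. rep (mult_operator M u F) x = scaleC (u x) (rep F x)"
  using mult_l2[OF assms] assms(2) by (auto simp: mult_operator_def AE_rep_class)

lemma inner_mult:
  assumes "bounded_multiplier u" "F \<in> hcarrier L" "G \<in> hcarrier L"
  shows "hinner L F (mult_operator M u G) = (LINT x|M. u x * cinner (rep F x) (rep G x))"
proof -
  have "hinner L F (mult_operator M u G) = (LINT x|M. cinner (rep F x) (scaleC (u x) (rep G x)))"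
    by (intro hinner_cong mult_carrier mult_l2 rep_l2 assms) (use rep_mult[OF assms(1,3)] in auto)
  then show ?thesis by (simp add: cinner_scaleC_right)
qed

lemma bounded_multiplier_cnj: "bounded_multiplier u \<Longrightarrow> bounded_multiplier (\<lambda>x. cnj (u x))"
  unfolding bounded_multiplier_def
  by (auto intro: measurable_compose[OF _ borel_measurable_continuous_onI[OF continuous_on_cnj[OF continuous_on_id]]])

lemma inner_mult_left:
  assumes "bounded_multiplier u" "F \<in> hcarrier L" "G \<in> hcarrier L"
  shows "hinner L (mult_operator M u F) G = hinner L F (mult_operator M (\<lambda>x. cnj (u x)) G)"
proof -
  have "hinner L (mult_operator M u F) G = cnj (hinner L G (mult_operator M u F))"
    by (intro inner_commute mult_carrier assms)
  also have "\<dots> = (LINT x|M. cnj (u x * cinner (rep G x) (rep F x)))"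
    unfolding inner_mult[OF assms(1,3,2)] by (simp del: complex_cnj_mult)
  also have "\<dots> = (LINT x|M. cnj (u x) * cinner (rep F x) (rep G x))"
    by (intro Bochner_Integration.integral_cong refl) (simp add: cinner_commute[of "rep F _"])
  also have "\<dots> = hinner L F (mult_operator M (\<lambda>x. cnj (u x)) G)"
    by (rule inner_mult[symmetric]) (intro bounded_multiplier_cnj assms)+
  finally show ?thesis .
qed

lemma mult_norm_le:
  assumes u: "bounded_multiplier u" and F: "F \<in> hcarrier L" and B: "\<And>x. x \<in> space M \<Longrightarrow> cmod (u x) \<le> B" "0 \<le> B"
  shows "hnorm L (mult_operator M u F) \<le> B * hnorm L F"
proof (rule power2_le_imp_le)
  have "(hnorm L (mult_operator M u F))\<^sup>2 = (LINT x|M. (norm (scaleC (u x) (rep F x)))\<^sup>2)"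
    by (intro hnorm_sq_integral mult_carrier mult_l2 rep_mult u F)
  also have "\<dots> \<le> (LINT x|M. B\<^sup>2 * (norm (rep F x))\<^sup>2)"
  proof (rule integral_mono)
    show "integrable M (\<lambda>x. (norm (scaleC (u x) (rep F x)))\<^sup>2)" by (intro l2_integrable mult_l2 u F)
    show "integrable M (\<lambda>x. B\<^sup>2 * (norm (rep F x))\<^sup>2)" by (intro integrable_mult_right l2_integrable rep_l2 F)
    show "(norm (scaleC (u x) (rep F x)))\<^sup>2 \<le> B\<^sup>2 * (norm (rep F x))\<^sup>2" if "x \<in> space M" for x
      using B(1)[OF that] by (auto simp: norm_scaleC power_mult_distrib intro!: mult_right_mono power_mono)
  qed
  also have "\<dots> = (B * hnorm L F)\<^sup>2"
    using hnorm_sq_integral[OF F rep_l2[OF F]] by (simp add: power_mult_distrib)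
  finally show "(hnorm L (mult_operator M u F))\<^sup>2 \<le> (B * hnorm L F)\<^sup>2" .
qed (use B F in simp)

text \<open>Linearity is checked against test vectors, by moving the multiplier to the other side of
  the inner product, where it becomes its conjugate.\<close>

lemma mult_bounded [intro]:
  assumes u: "bounded_multiplier u"
  shows "mult_operator M u \<in> bounded_operators L"
proof -
  obtain B where B: "\<And>x. x \<in> space M \<Longrightarrow> cmod (u x) \<le> B" using u by (auto simp: bounded_multiplier_def)
  show ?thesis
  proof (rule bounded_operatorI[of _ "\<bar>B\<bar>"])
    show "mult_operator M u \<in> extensional (hcarrier L)" by (simp add: mult_operator_def)
    fix F assume F: "F \<in> hcarrier L"
    show "mult_operator M u F \<in> hcarrier L" by (rule mult_carrier[OF u F])
    show "hnorm L (mult_operator M u F) \<le> \<bar>B\<bar> * hnorm L F"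
      by (rule mult_norm_le[OF u F]) (use B in fastforce)+
    fix c
    show "mult_operator M u (hscale L c F) = hscale L c (mult_operator M u F)"
      using u F bounded_multiplier_cnj[OF u]
      by (intro inner_ext) (auto simp: mult_carrier inner_simps inner_mult_left[of "\<lambda>x. cnj (u x)", simplified, symmetric])
    fix G assume G: "G \<in> hcarrier L"
    show "mult_operator M u (hadd L F G) = hadd L (mult_operator M u F) (mult_operator M u G)"
      using u F G bounded_multiplier_cnj[OF u]
      by (intro inner_ext) (auto simp: mult_carrier inner_simps inner_mult_left[of "\<lambda>x. cnj (u x)", simplified, symmetric])
  qed
qed

lemma mult_adjoint: "bounded_multiplier u \<Longrightarrow> hadjoint L (mult_operator M u) = mult_operator M (\<lambda>x. cnj (u x))"
  by (intro adjoint_eqI) (auto simp: inner_mult_left intro: bounded_multiplier_cnj)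

text \<open>A bound for the support by an arbitrary set, measurable or not, so that no regularity of
  unions and intersections has to be tracked.\<close>

definition supported :: "('a \<Rightarrow> 'k) set \<Rightarrow> 'a set \<Rightarrow> bool" where
  "supported F A \<longleftrightarrow> (AE x in M. x \<notin> A \<longrightarrow> rep F x = 0)"

lemma supported_mono: "supported F A \<Longrightarrow> A \<subseteq> B \<Longrightarrow> supported F B"
  unfolding supported_def by (erule eventually_mono) auto

lemma supported_inner_zero:
  assumes "supported F A" "supported G B" "A \<inter> B \<inter> space M = {}"
  shows "hinner L F G = 0"
proof -
  have "AE x in M. cinner (rep F x) (rep G x) = 0"
    using assms(1,2) AE_space unfolding supported_def by eventually_elim (use assms(3) in auto)
  then show ?thesis unfolding inner_def by (rule integral_eq_zero_AE)
qed

lemma supported_add: "\<lbrakk>F \<in> hcarrier L; G \<in> hcarrier L; supported F A; supported G A\<rbrakk> \<Longrightarrow> supported (hadd L F G) A"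
  unfolding supported_def using rep_hadd[of F G] by auto

lemma supported_scale: "\<lbrakk>F \<in> hcarrier L; supported F A\<rbrakk> \<Longrightarrow> supported (hscale L c F) A"
  unfolding supported_def using rep_hscale[of F c] by auto

lemma supported_zero: "supported (hzero L) A"
  unfolding supported_def using rep_hzero by auto

lemma supported_mult_set:
  assumes "bounded_multiplier u" "F \<in> hcarrier L" "\<And>x. x \<in> space M \<Longrightarrow> u x \<noteq> 0 \<Longrightarrow> x \<in> A"
  shows "supported (mult_operator M u F) A"
  using rep_mult[OF assms(1,2)] AE_space unfolding supported_def by eventually_elim (use assms(3) in force)

lemma mult_eq_self:
  assumes "bounded_multiplier u" "F \<in> hcarrier L" "supported F A" "\<And>x. x \<in> space M \<Longrightarrow> x \<in> A \<Longrightarrow> u x = 1"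
  shows "mult_operator M u F = F"
proof (rule carrier_eqI)
  show "AE x in M. rep (mult_operator M u F) x = rep F x"
    using rep_mult[OF assms(1,2)] assms(3) AE_space unfolding supported_def
    by eventually_elim (use assms(4) in \<open>force simp: scaleC_one\<close>)
qed (use assms mult_carrier in auto)

lemma mult_eq_zero:
  assumes "bounded_multiplier u" "F \<in> hcarrier L" "supported F A" "\<And>x. x \<in> space M \<Longrightarrow> x \<in> A \<Longrightarrow> u x = 0"
  shows "mult_operator M u F = hzero L"
proof (rule carrier_eqI)
  show "AE x in M. rep (mult_operator M u F) x = rep (hzero L) x"
    using rep_mult[OF assms(1,2)] assms(3) AE_space rep_hzero unfolding supported_def
    by eventually_elim (use assms(4) in force)
qed (use assms mult_carrier in auto)

lemma bounded_multiplier_indicator: "A \<inter> space M \<in> sets M \<Longrightarrow> bounded_multiplier (indicator A)"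
  unfolding bounded_multiplier_def
proof
  assume "A \<inter> space M \<in> sets M"
  then have "(indicator (A \<inter> space M) :: 'a \<Rightarrow> complex) \<in> borel_measurable M" by (rule borel_measurable_indicator)
  moreover have "(indicator (A \<inter> space M) :: 'a \<Rightarrow> complex) x = indicator A x" if "x \<in> space M" for x
    using that by (simp add: indicator_def)
  ultimately show "(indicator A :: 'a \<Rightarrow> complex) \<in> borel_measurable M"
    using measurable_cong by metis
qed (auto intro!: exI[of _ 1] simp: indicator_def)

end

section \<open>The Roe algebra is a *-algebra\<close>

lemma (in star_alg) star_alg_subalgebra:
  assumes S: "S \<subseteq> carrier A" "\<zero> \<in> S" "\<And>a b. a \<in> S \<Longrightarrow> b \<in> S \<Longrightarrow> a \<oplus> b \<in> S" "\<And>a b. a \<in> S \<Longrightarrow> b \<in> S \<Longrightarrow> a \<otimes> b \<in> S"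
    "\<And>c a. a \<in> S \<Longrightarrow> c \<odot> a \<in> S" "\<And>a. a \<in> S \<Longrightarrow> star A a \<in> S"
  shows "star_alg (A\<lparr>carrier := S\<rparr>)"
proof -
  have [simp]: "a \<in> carrier A" if "a \<in> S" for a using S(1) that by blast
  interpret S: abelian_group "A\<lparr>carrier := S\<rparr>"
  proof (rule abelian_groupI)
    fix a assume "a \<in> carrier (A\<lparr>carrier := S\<rparr>)"
    then show "\<exists>b\<in>carrier (A\<lparr>carrier := S\<rparr>). b \<oplus>\<^bsub>A\<lparr>carrier := S\<rparr>\<^esub> a = \<zero>\<^bsub>A\<lparr>carrier := S\<rparr>\<^esub>"
      using S(5)[of a "-1"] smult_l_distr[of a "-1" 1] by (intro bexI[of _ "(-1) \<odot> a"]) simp_all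
  qed (use S in \<open>auto simp: a_ac\<close>)
  show ?thesis
    by unfold_locales
       (use S in \<open>simp_all add: m_assoc l_distr r_distr smult_l_distr smult_r_distr smult_smult
          smult_mult_left smult_mult_right star_add star_mult star_smult\<close>)
qed

section \<open>Norm closures of *-algebras of operators\<close>

context hilbert
begin

lemma norm_closure_bounded: "T \<in> norm_closure E S \<Longrightarrow> T \<in> bounded_operators E"
  by (simp add: norm_closure_def)

lemma norm_closureD:
  assumes "T \<in> norm_closure E S" "\<epsilon> > 0"
  obtains U where "U \<in> S" "\<And>x. x \<in> hcarrier E \<Longrightarrow> hnorm E (hdiff E (T x) (U x)) \<le> \<epsilon> * hnorm E x"
  using assms unfolding norm_closure_def by blast

lemma norm_closureI:
  assumes "T \<in> bounded_operators E"
    "\<And>\<epsilon>. \<epsilon> > 0 \<Longrightarrow> \<exists>U\<in>S. \<forall>x\<in>hcarrier E. hnorm E (hdiff E (T x) (U x)) \<le> \<epsilon> * hnorm E x"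
  shows "T \<in> norm_closure E S"
  using assms unfolding norm_closure_def by blast

lemma norm_closure_base: "T \<in> S \<Longrightarrow> T \<in> bounded_operators E \<Longrightarrow> T \<in> norm_closure E S"
proof (rule norm_closureI)
  fix \<epsilon> :: real assume T: "T \<in> S" "T \<in> bounded_operators E" and e: "\<epsilon> > 0"
  have "hdiff E (T x) (T x) = hzero E" if "x \<in> hcarrier E" for x
    using T that by (intro inner_ext) (auto simp: inner_simps)
  with T e show "\<exists>U\<in>S. \<forall>x\<in>hcarrier E. hnorm E (hdiff E (T x) (U x)) \<le> \<epsilon> * hnorm E x"
    by (intro bexI[of _ T]) auto
qed

lemma norm_closure_add:
  assumes S: "S \<subseteq> bounded_operators E" "\<And>a b. a \<in> S \<Longrightarrow> b \<in> S \<Longrightarrow> a \<oplus>\<^bsub>operator_algebra E\<^esub> b \<in> S"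
    and T: "T \<in> norm_closure E S" "T' \<in> norm_closure E S"
  shows "T \<oplus>\<^bsub>operator_algebra E\<^esub> T' \<in> norm_closure E S"
proof (rule norm_closureI)
  note b = norm_closure_bounded[OF T(1)] norm_closure_bounded[OF T(2)]
  show "T \<oplus>\<^bsub>operator_algebra E\<^esub> T' \<in> bounded_operators E" using b by simp
  fix \<epsilon> :: real assume "\<epsilon> > 0"
  then have e: "\<epsilon> / 2 > 0" by simp
  obtain U where U: "U \<in> S" "\<And>x. x \<in> hcarrier E \<Longrightarrow> hnorm E (hdiff E (T x) (U x)) \<le> \<epsilon>/2 * hnorm E x"
    using norm_closureD[OF T(1) e] by blast
  obtain U' where U': "U' \<in> S" "\<And>x. x \<in> hcarrier E \<Longrightarrow> hnorm E (hdiff E (T' x) (U' x)) \<le> \<epsilon>/2 * hnorm E x"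
    using norm_closureD[OF T(2) e] by blast
  have c: "U \<in> bounded_operators E" "U' \<in> bounded_operators E" using U U' S by auto
  have "hnorm E (hdiff E (hadd E (T x) (T' x)) (hadd E (U x) (U' x))) \<le> \<epsilon> * hnorm E x"
    if x: "x \<in> hcarrier E" for x
  proof -
    have "hdiff E (hadd E (T x) (T' x)) (hadd E (U x) (U' x)) = hadd E (hdiff E (T x) (U x)) (hdiff E (T' x) (U' x))"
      using b c x by (intro inner_ext) (simp_all add: inner_simps op_closed)
    then show ?thesis
      using norm_triangle[of "hdiff E (T x) (U x)" "hdiff E (T' x) (U' x)"] U(2)[OF x] U'(2)[OF x] b c x
      by (simp add: op_closed)
  qed
  then show "\<exists>V\<in>S. \<forall>x\<in>hcarrier E. hnorm E (hdiff E ((T \<oplus>\<^bsub>operator_algebra E\<^esub> T') x) (V x)) \<le> \<epsilon> * hnorm E x"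
    using S(2)[OF U(1) U'(1)] by (intro bexI[of _ "U \<oplus>\<^bsub>operator_algebra E\<^esub> U'"]) auto
qed

lemma norm_closure_smult:
  assumes S: "S \<subseteq> bounded_operators E" "\<And>c a. a \<in> S \<Longrightarrow> c \<odot>\<^bsub>operator_algebra E\<^esub> a \<in> S"
    and T: "T \<in> norm_closure E S"
  shows "c \<odot>\<^bsub>operator_algebra E\<^esub> T \<in> norm_closure E S"
proof (rule norm_closureI)
  note b = norm_closure_bounded[OF T(1)]
  show "c \<odot>\<^bsub>operator_algebra E\<^esub> T \<in> bounded_operators E" using b by simp
  fix \<epsilon> :: real assume eps: "\<epsilon> > 0"
  have pos: "0 < cmod c + 1" by (simp add: add_nonneg_pos)
  then have e: "\<epsilon> / (cmod c + 1) > 0" using eps by simp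
  obtain U where U: "U \<in> S" "\<And>x. x \<in> hcarrier E \<Longrightarrow> hnorm E (hdiff E (T x) (U x)) \<le> \<epsilon> / (cmod c + 1) * hnorm E x"
    using norm_closureD[OF T(1) e] by blast
  have u: "U \<in> bounded_operators E" using U S by auto
  have "hnorm E (hdiff E (hscale E c (T x)) (hscale E c (U x))) \<le> \<epsilon> * hnorm E x"
    if x: "x \<in> hcarrier E" for x
  proof -
    have "hdiff E (hscale E c (T x)) (hscale E c (U x)) = hscale E c (hdiff E (T x) (U x))"
      using b u x by (intro inner_ext) (simp_all add: inner_simps op_closed right_diff_distrib)
    then have "hnorm E (hdiff E (hscale E c (T x)) (hscale E c (U x))) = cmod c * hnorm E (hdiff E (T x) (U x))"
      using b u x by (simp add: norm_scale op_closed)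
    also have "\<dots> \<le> (cmod c + 1) * (\<epsilon> / (cmod c + 1) * hnorm E x)"
      using U(2)[OF x] b u x by (intro mult_mono) (simp_all add: op_closed)
    also have "\<dots> = \<epsilon> * hnorm E x" using pos by simp
    finally show ?thesis .
  qed
  then show "\<exists>V\<in>S. \<forall>x\<in>hcarrier E. hnorm E (hdiff E ((c \<odot>\<^bsub>operator_algebra E\<^esub> T) x) (V x)) \<le> \<epsilon> * hnorm E x"
    using S(2)[OF U(1)] by (intro bexI[of _ "c \<odot>\<^bsub>operator_algebra E\<^esub> U"]) auto
qed

lemma norm_closure_mult:
  assumes S: "S \<subseteq> bounded_operators E" "\<And>a b. a \<in> S \<Longrightarrow> b \<in> S \<Longrightarrow> a \<otimes>\<^bsub>operator_algebra E\<^esub> b \<in> S"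
    and T: "T \<in> norm_closure E S" "T' \<in> norm_closure E S"
  shows "T \<otimes>\<^bsub>operator_algebra E\<^esub> T' \<in> norm_closure E S"
proof (rule norm_closureI)
  note b = norm_closure_bounded[OF T(1)] norm_closure_bounded[OF T(2)]
  show "T \<otimes>\<^bsub>operator_algebra E\<^esub> T' \<in> bounded_operators E" using b by simp
  fix \<epsilon> :: real assume eps: "\<epsilon> > 0"
  obtain C where C: "0 < C" "\<And>x. x \<in> hcarrier E \<Longrightarrow> hnorm E (T x) \<le> C * hnorm E x"
    using op_bound[OF b(1)] by blast
  have "\<epsilon> / (2 * C) > 0" using eps C by simp
  then obtain U' where U': "U' \<in> S" "\<And>x. x \<in> hcarrier E \<Longrightarrow> hnorm E (hdiff E (T' x) (U' x)) \<le> \<epsilon> / (2 * C) * hnorm E x"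
    using norm_closureD[OF T(2)] by blast
  have c': "U' \<in> bounded_operators E" using U' S by auto
  \<comment> \<open>A bound for \<open>U'\<close> fixes the accuracy demanded of \<open>U\<close>,
    because of the splitting \<open>T T' - U U' = T (T' - U') + (T - U) U'\<close>.\<close>
  obtain D where D: "0 < D" "\<And>x. x \<in> hcarrier E \<Longrightarrow> hnorm E (U' x) \<le> D * hnorm E x"
    using op_bound[OF c'] by blast
  have "\<epsilon> / (2 * D) > 0" using eps D by simp
  then obtain U where U: "U \<in> S" "\<And>x. x \<in> hcarrier E \<Longrightarrow> hnorm E (hdiff E (T x) (U x)) \<le> \<epsilon> / (2 * D) * hnorm E x"
    using norm_closureD[OF T(1)] by blast
  have c: "U \<in> bounded_operators E" using U S by auto
  have "hnorm E (hdiff E (T (T' x)) (U (U' x))) \<le> \<epsilon> * hnorm E x"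
    if x: "x \<in> hcarrier E" for x
  proof -
    have cl [simp]: "T' x \<in> hcarrier E" "U' x \<in> hcarrier E" "T (T' x) \<in> hcarrier E" "T (U' x) \<in> hcarrier E" "U (U' x) \<in> hcarrier E"
      using b c c' x by (simp_all add: op_closed)
    have "hnorm E (hdiff E (T (T' x)) (T (U' x))) = hnorm E (T (hdiff E (T' x) (U' x)))"
      using b by (simp add: op_diff)
    also have "\<dots> \<le> C * hnorm E (hdiff E (T' x) (U' x))" by (rule C(2)) simp
    also have "\<dots> \<le> C * (\<epsilon> / (2 * C) * hnorm E x)" using C(1) by (intro mult_left_mono U'(2) x) simp
    also have "\<dots> = \<epsilon> / 2 * hnorm E x" using C by simp
    finally have 1: "hnorm E (hdiff E (T (T' x)) (T (U' x))) \<le> \<epsilon> / 2 * hnorm E x" .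
    have "hnorm E (hdiff E (T (U' x)) (U (U' x))) \<le> \<epsilon> / (2 * D) * hnorm E (U' x)" by (rule U(2)) simp
    also have "\<dots> \<le> \<epsilon> / (2 * D) * (D * hnorm E x)" using D(1) eps by (intro mult_left_mono D(2) x) auto
    also have "\<dots> = \<epsilon> / 2 * hnorm E x" using D by simp
    finally have 2: "hnorm E (hdiff E (T (U' x)) (U (U' x))) \<le> \<epsilon> / 2 * hnorm E x" .
    show ?thesis using norm_triangle_diff[OF cl(3,4,5)] 1 2 by linarith
  qed
  then show "\<exists>V\<in>S. \<forall>x\<in>hcarrier E. hnorm E (hdiff E ((T \<otimes>\<^bsub>operator_algebra E\<^esub> T') x) (V x)) \<le> \<epsilon> * hnorm E x"
    using S(2)[OF U(1) U'(1)] by (intro bexI[of _ "U \<otimes>\<^bsub>operator_algebra E\<^esub> U'"]) auto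
qed

lemma norm_closure_adjoint:
  assumes S: "S \<subseteq> bounded_operators E" "\<And>a. a \<in> S \<Longrightarrow> hadjoint E a \<in> S"
    and T: "T \<in> norm_closure E S"
  shows "hadjoint E T \<in> norm_closure E S"
proof (rule norm_closureI)
  note b = norm_closure_bounded[OF T(1)]
  show "hadjoint E T \<in> bounded_operators E" using b by simp
  fix \<epsilon> :: real assume eps: "\<epsilon> > 0"
  obtain U where U: "U \<in> S" "\<And>x. x \<in> hcarrier E \<Longrightarrow> hnorm E (hdiff E (T x) (U x)) \<le> \<epsilon> * hnorm E x"
    using norm_closureD[OF T(1) eps] by blast
  have c: "U \<in> bounded_operators E" using U S by auto
  define V where "V = T \<oplus>\<^bsub>operator_algebra E\<^esub> ((-1) \<odot>\<^bsub>operator_algebra E\<^esub> U)"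
  have V: "V \<in> bounded_operators E" using b c by (simp add: V_def)
  have Vx: "V x = hdiff E (T x) (U x)" if "x \<in> hcarrier E" for x
    using that by (simp add: V_def hdiff_def)
  have "hnorm E (hdiff E (hadjoint E T x) (hadjoint E U x)) \<le> \<epsilon> * hnorm E x" if x: "x \<in> hcarrier E" for x
  proof -
    have "hdiff E (hadjoint E T x) (hadjoint E U x) = hadjoint E V x"
      using b c V x by (intro inner_ext) (simp_all add: inner_simps op_closed inner_adjoint Vx)
    then show ?thesis using adjoint_bound[OF V _ x, of \<epsilon>] U(2) Vx eps by simp
  qed
  then show "\<exists>V\<in>S. \<forall>x\<in>hcarrier E. hnorm E (hdiff E (hadjoint E T x) (V x)) \<le> \<epsilon> * hnorm E x"
    using S(2)[OF U(1)] by (intro bexI[of _ "hadjoint E U"]) auto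
qed

lemma star_alg_norm_closure:
  assumes S: "S \<subseteq> bounded_operators E" "\<zero>\<^bsub>operator_algebra E\<^esub> \<in> S"
    "\<And>a b. a \<in> S \<Longrightarrow> b \<in> S \<Longrightarrow> a \<oplus>\<^bsub>operator_algebra E\<^esub> b \<in> S"
    "\<And>a b. a \<in> S \<Longrightarrow> b \<in> S \<Longrightarrow> a \<otimes>\<^bsub>operator_algebra E\<^esub> b \<in> S"
    "\<And>c a. a \<in> S \<Longrightarrow> c \<odot>\<^bsub>operator_algebra E\<^esub> a \<in> S"
    "\<And>a. a \<in> S \<Longrightarrow> hadjoint E a \<in> S"
  shows "star_alg ((operator_algebra E)\<lparr>carrier := norm_closure E S\<rparr>)"
proof (rule star_alg.star_alg_subalgebra[OF star_alg_operator_algebra])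
  show "norm_closure E S \<subseteq> carrier (operator_algebra E)" using norm_closure_bounded by auto
  show "\<zero>\<^bsub>operator_algebra E\<^esub> \<in> norm_closure E S" using S(2) by (intro norm_closure_base) auto
  fix a b c assume a: "a \<in> norm_closure E S" and b: "b \<in> norm_closure E S"
  show "a \<oplus>\<^bsub>operator_algebra E\<^esub> b \<in> norm_closure E S" by (rule norm_closure_add[OF S(1,3) a b])
  show "a \<otimes>\<^bsub>operator_algebra E\<^esub> b \<in> norm_closure E S" by (rule norm_closure_mult[OF S(1,4) a b])
next
  fix a c assume a: "a \<in> norm_closure E S"
  show "c \<odot>\<^bsub>operator_algebra E\<^esub> a \<in> norm_closure E S" by (rule norm_closure_smult[OF S(1,5) a])
  show "star (operator_algebra E) a \<in> norm_closure E S"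
    using norm_closure_adjoint[OF S(1,6) a] by simp
qed

end

text \<open>These conditions cover both the counting measure on a locally finite set, where
  \<open>space M\<close> is that set, and a Borel measure on a proper space, where it is the whole
  type.\<close>

locale roe_space = l2_space M K for M :: "'a::metric_space measure" and K :: "'k::complex_hilbert_space itself" +
  assumes proper: "compact (space M \<inter> cball x r)"
    and open_measurable: "open U \<Longrightarrow> U \<inter> space M \<in> sets M"
begin

lemma continuous_measurable:
  fixes u :: "'a \<Rightarrow> complex"
  assumes "continuous_on (space M) u"
  shows "u \<in> borel_measurable M"
proof (rule borel_measurableI)
  fix S :: "complex set" assume "open S"
  then obtain A where "open A" "A \<inter> space M = u -` S \<inter> space M"
    using assms[unfolded continuous_on_open_invariant] by meson
  with open_measurable[of A] show "u -` S \<inter> space M \<in> sets M" by simp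
qed

lemma C0_multiplier:
  assumes "f \<in> C0 (space M)"
  shows "bounded_multiplier f"
proof -
  have f: "continuous_on (space M) f" using assms by (simp add: C0_def)
  obtain C where C: "C \<subseteq> space M" "compact C" "\<And>y. y \<in> space M - C \<Longrightarrow> norm (f y) < 1"
    using assms unfolding C0_def by (auto dest: spec[of _ 1])
  have "bounded (f ` C)" using compact_continuous_image[OF continuous_on_subset[OF f C(1)] C(2)] compact_imp_bounded by blast
  then obtain B where "\<And>x. x \<in> C \<Longrightarrow> norm (f x) \<le> B" by (auto simp: bounded_iff)
  then have "\<forall>x\<in>space M. cmod (f x) \<le> max B 1" using C(3) by (metis DiffI less_imp_le max.coboundedI1 max.coboundedI2)
  then show ?thesis unfolding bounded_multiplier_def using continuous_measurable[OF f] by blast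
qed

lemma C0_cnj: "f \<in> C0 (space M) \<Longrightarrow> (\<lambda>x. cnj (f x)) \<in> C0 (space M)"
  unfolding C0_def by (auto intro: continuous_on_cnj)

lemma C0_bounded_support:
  fixes f :: "'a \<Rightarrow> complex"
  assumes "continuous_on (space M) f" "\<And>y. y \<in> space M \<Longrightarrow> y \<notin> cball x r \<Longrightarrow> f y = 0"
  shows "f \<in> C0 (space M)"
proof -
  have "norm (f y) < \<epsilon>" if "0 < \<epsilon>" "y \<in> space M - (space M \<inter> cball x r)" for \<epsilon> y
    using that assms(2)[of y] by simp
  then show ?thesis
    unfolding C0_def using assms(1) proper[of x r] by (blast intro: exI[of _ "space M \<inter> cball x r"])
qed

text \<open>Vectors and arbitrary sets replace the functions in \<open>C0\<close>. In this form
  propagation can be followed through products, and it agrees with the original notion up to a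
  larger radius by \<open>finite_propagation_iff\<close>.\<close>

definition propagation_le :: "(('a \<Rightarrow> 'k) set \<Rightarrow> ('a \<Rightarrow> 'k) set) \<Rightarrow> real \<Rightarrow> bool" where
  "propagation_le T R \<longleftrightarrow> (\<forall>A B. \<forall>F\<in>hcarrier L. \<forall>G\<in>hcarrier L. supported F A \<and> supported G B \<and>
     (\<forall>a\<in>A. \<forall>b\<in>B. R < dist a b) \<longrightarrow> hinner L F (T G) = 0)"

lemma propagation_leD:
  "\<lbrakk>propagation_le T R; F \<in> hcarrier L; G \<in> hcarrier L; supported F A; supported G B;
    \<And>a b. a \<in> A \<Longrightarrow> b \<in> B \<Longrightarrow> R < dist a b\<rbrakk> \<Longrightarrow> hinner L F (T G) = 0"
  unfolding propagation_le_def by blast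

lemma propagation_le_mono: "propagation_le T R \<Longrightarrow> R \<le> R' \<Longrightarrow> propagation_le T R'"
  unfolding propagation_le_def by (meson le_less_trans)

text \<open>Dominated convergence, with the squared norm of \<open>rep F\<close> as majorant. It
  reduces propagation to bounded supports, the only ones on which a function in \<open>C0\<close>
  can be 1 throughout.\<close>

lemma truncation:
  assumes F: "F \<in> hcarrier L"
  shows "(\<lambda>n. hnorm L (hdiff L (mult_operator M (indicator (cball o' (real n))) F) F)) \<longlonglongrightarrow> 0"
proof -
  let ?u = "\<lambda>n. indicator (cball o' (real n)) :: 'a \<Rightarrow> complex"
  have bm: "bounded_multiplier (?u n)" for n
  proof (rule bounded_multiplier_indicator)
    have "cball o' (real n) \<inter> space M = space M - (- cball o' (real n)) \<inter> space M" by auto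
    also have "\<dots> \<in> sets M" by (intro sets.Diff sets.top open_measurable) auto
    finally show "cball o' (real n) \<inter> space M \<in> sets M" .
  qed
  define w where "w n x = (norm (scaleC (?u n x) (rep F x) - rep F x))\<^sup>2" for n x
  have l2: "(\<lambda>x. scaleC (?u n x) (rep F x) - rep F x) \<in> l2_functions M" for n
    by (intro l2_diff mult_l2 bm rep_l2 F)
  have "(hnorm L (hdiff L (mult_operator M (?u n) F) F))\<^sup>2 = (LINT x|M. w n x)" for n
    unfolding w_def
    by (intro hnorm_sq_integral diff_closed mult_carrier bm F l2)
       (use rep_hdiff[OF mult_carrier(1)[OF bm F] F, of n] rep_mult[OF bm F, of n] in auto)
  moreover have "(\<lambda>n. LINT x|M. w n x) \<longlonglongrightarrow> (LINT x|M. 0)"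
  proof (rule integral_dominated_convergence[where w = "\<lambda>x. (norm (rep F x))\<^sup>2"])
    show "w n \<in> borel_measurable M" for n unfolding w_def by (intro measurable_norm_sq l2_measurable l2)
    show "AE x in M. (\<lambda>n. w n x) \<longlonglongrightarrow> 0"
    proof (rule AE_I2)
      fix x
      have "\<forall>n\<ge>nat \<lceil>dist o' x\<rceil>. w n x = 0"
        by (simp add: w_def indicator_def scaleC_one nat_ceiling_le_eq)
      then show "(\<lambda>n. w n x) \<longlonglongrightarrow> 0"
        by (intro tendsto_eventually) (simp only: eventually_sequentially, blast)
    qed
    show "AE x in M. norm (w n x) \<le> (norm (rep F x))\<^sup>2" for n
      by (intro AE_I2) (auto simp: w_def indicator_def scaleC_one)
  qed (auto intro: l2_integrable rep_l2 F)
  ultimately have "(\<lambda>n. (hnorm L (hdiff L (mult_operator M (?u n) F) F))\<^sup>2) \<longlonglongrightarrow> 0" by simp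
  from tendsto_real_sqrt[OF this] show ?thesis
    using mult_carrier(1)[OF bm F] F by simp
qed

lemma supp_in_iff: "x \<in> supp_in Y f \<longleftrightarrow> x \<in> Y \<and> x \<in> closure {y \<in> Y. f y \<noteq> 0}"
  by (simp add: supp_in_def)

lemma inner_propagation_bounded:
  assumes T: "T \<in> bounded_operators L"
    and fp: "\<And>f g. \<lbrakk>f \<in> C0 (space M); g \<in> C0 (space M); setdist (supp_in (space M) f) (supp_in (space M) g) > R\<rbrakk>
     \<Longrightarrow> mult_operator M f \<otimes>\<^bsub>operator_algebra L\<^esub> T \<otimes>\<^bsub>operator_algebra L\<^esub> mult_operator M g = \<zero>\<^bsub>operator_algebra L\<^esub>"
    and FG: "F \<in> hcarrier L" "G \<in> hcarrier L" "supported F A" "supported G B"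
    and AB: "A \<subseteq> space M \<inter> cball o' r" "B \<subseteq> space M \<inter> cball o' r"
    and dist: "\<And>a b. a \<in> A \<Longrightarrow> b \<in> B \<Longrightarrow> R + 4 < dist a b"
  shows "hinner L F (T G) = 0"
proof (cases "A = {} \<or> B = {}")
  \<comment> \<open>\<open>setdist\<close> and \<open>infdist\<close> are 0 for an empty set, so
    this case bypasses the cut-off functions.\<close>
  case True
  then have "F = hzero L \<or> G = hzero L"
  proof
    assume "A = {}"
    then have "F = hzero L"
      using FG(3) rep_hzero unfolding supported_def by (intro carrier_eqI[OF FG(1) zero_closed]) auto
    then show ?thesis ..
  next
    assume "B = {}"
    then have "G = hzero L"
      using FG(4) rep_hzero unfolding supported_def by (intro carrier_eqI[OF FG(2) zero_closed]) auto
    then show ?thesis ..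
  qed
  then show ?thesis using T FG by (auto simp: inner_simps op_zero)
next
  case False
  \<comment> \<open>For non-empty \<open>S\<close> the function is 1 on \<open>S\<close> and 0 at
    distance 1 or more from it. Its support stays within 3/2 of \<open>S\<close>, which leaves room
    for the closure. The two supports together thus lose at most 3 of the distance
    \<open>R + 4\<close>.\<close>
  define cut where "cut S x = complex_of_real (max 0 (1 - infdist x S))" for S and x :: 'a
  have cut_C0: "cut S \<in> C0 (space M)" if S: "S \<noteq> {}" "S \<subseteq> space M \<inter> cball o' r" for S
  proof (rule C0_bounded_support[of _ o' "r + 1"])
    show "continuous_on (space M) (cut S)" unfolding cut_def by (intro continuous_intros)
    fix y assume "y \<notin> cball o' (r + 1)"
    then have "1 \<le> dist y s" if "s \<in> S" for s
      using S that dist_triangle[of o' y s] by (force simp: dist_commute)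
    then have "1 \<le> infdist y S" using S(1) by (simp add: infdist_def le_cINF_iff)
    then show "cut S y = 0" by (simp add: cut_def)
  qed
  have cut_supp: "\<exists>s\<in>S. dist x s < 3/2" if Sx: "S \<noteq> {}" "x \<in> supp_in (space M) (cut S)" for S x
  proof -
    obtain y where y: "cut S y \<noteq> 0" "dist y x < 1/4"
      using Sx(2) unfolding supp_in_iff closure_approachable by (auto dest: spec[of _ "1/4"])
    then have "infdist y S < 1" by (auto simp: cut_def max_def split: if_splits)
    then obtain s where "s \<in> S" "dist y s < 1"
      using Sx(1) by (auto simp: infdist_def cINF_less_iff)
    then show ?thesis using y(2) dist_triangle[of x s y] by (intro bexI[of _ s]) (auto simp: dist_commute)
  qed
  have self: "S \<subseteq> supp_in (space M) (cut S)" if "S \<subseteq> space M" for S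
    using that by (auto simp: supp_in_iff cut_def intro!: closure_subset[THEN subsetD])
  have "R + 1 \<le> setdist (supp_in (space M) (cut A)) (supp_in (space M) (cut B))"
  proof (rule le_setdistI)
    show "supp_in (space M) (cut A) \<noteq> {}" "supp_in (space M) (cut B) \<noteq> {}" using False AB self by blast+
    fix x y assume "x \<in> supp_in (space M) (cut A)" "y \<in> supp_in (space M) (cut B)"
    then obtain a b where "a \<in> A" "dist x a < 3/2" "b \<in> B" "dist y b < 3/2" using cut_supp False by metis
    with dist[of a b] dist_triangle[of a b x] dist_triangle[of x b y] show "R + 1 \<le> dist x y"
      by (simp add: dist_commute)
  qed
  then have zero: "mult_operator M (cut A) \<otimes>\<^bsub>operator_algebra L\<^esub> T \<otimes>\<^bsub>operator_algebra L\<^esub> mult_operator M (cut B)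
      = \<zero>\<^bsub>operator_algebra L\<^esub>"
    using False AB by (intro fp cut_C0) auto
  have bm: "bounded_multiplier (cut A)" "bounded_multiplier (cut B)"
    using False AB by (auto intro!: C0_multiplier cut_C0)
  have F: "mult_operator M (cut A) F = F" and G: "mult_operator M (cut B) G = G"
    by (rule mult_eq_self[OF bm(1) FG(1,3)] mult_eq_self[OF bm(2) FG(2,4)]; simp add: cut_def)+
  have real: "(\<lambda>x. cnj (cut A x)) = cut A" by (rule ext) (simp add: cut_def)
  have "hinner L F (T G) = hinner L (mult_operator M (cut A) F) (T (mult_operator M (cut B) G))" by (simp add: F G)
  also have "\<dots> = hinner L F (mult_operator M (cut A) (T (mult_operator M (cut B) G)))"
    using inner_mult_left[OF bm(1) FG(1), of "T G"] T FG by (simp add: real G op_closed)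
  also have "mult_operator M (cut A) (T (mult_operator M (cut B) G)) = hzero L"
    using fun_cong[OF zero, of G] FG by (simp add: mult_carrier[OF bm(2)])
  finally show ?thesis using FG by (simp add: inner_simps)
qed

text \<open>In one direction both vectors are truncated to balls, where cut-off functions exist, and
  the two radii tend to infinity one after the other. In the other direction multiplication by
  \<open>f\<close> localises a vector to the support of \<open>f\<close>.\<close>

lemma finite_propagation_iff:
  assumes T: "T \<in> bounded_operators L"
  shows "finite_propagation M T \<longleftrightarrow> (\<exists>R>0. propagation_le T R)"
proof
  assume "\<exists>R>0. propagation_le T R"
  then obtain R where R: "R > 0" "propagation_le T R" by blast
  show "finite_propagation M T"
    unfolding finite_propagation_def
  proof (intro exI[of _ R] conjI ballI impI R(1))
    fix f g assume f: "f \<in> C0 (space M)" and g: "g \<in> C0 (space M)"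
      and d: "R < setdist (supp_in (space M) f) (supp_in (space M) g)"
    note bm = C0_multiplier[OF f] C0_multiplier[OF g] C0_multiplier[OF C0_cnj[OF f]]
    show "mult_operator M f \<otimes>\<^bsub>operator_algebra L\<^esub> T \<otimes>\<^bsub>operator_algebra L\<^esub> mult_operator M g = \<zero>\<^bsub>operator_algebra L\<^esub>"
    proof (rule op_eqI)
      fix F G assume FG: "F \<in> hcarrier L" "G \<in> hcarrier L"
      have "hinner L (mult_operator M (\<lambda>x. cnj (f x)) F) (T (mult_operator M g G)) = 0"
      proof (rule propagation_leD[OF R(2)])
        show "supported (mult_operator M (\<lambda>x. cnj (f x)) F) (supp_in (space M) f)"
          by (rule supported_mult_set[OF bm(3) FG(1)]) (auto simp: supp_in_def intro!: closure_subset[THEN subsetD])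
        show "supported (mult_operator M g G) (supp_in (space M) g)"
          by (rule supported_mult_set[OF bm(2) FG(2)]) (auto simp: supp_in_def intro!: closure_subset[THEN subsetD])
        show "R < dist a b" if "a \<in> supp_in (space M) f" "b \<in> supp_in (space M) g" for a b
          using d setdist_le_dist[OF that] by linarith
      qed (use FG bm mult_carrier in auto)
      then show "hinner L F ((mult_operator M f \<otimes>\<^bsub>operator_algebra L\<^esub> T \<otimes>\<^bsub>operator_algebra L\<^esub> mult_operator M g) G)
          = hinner L F (\<zero>\<^bsub>operator_algebra L\<^esub> G)"
        using FG T inner_mult_left[OF bm(3) FG(1), of "T (mult_operator M g G)"] mult_carrier[OF bm(2) FG(2)]
        by (simp add: inner_simps op_closed)
    qed (use T bm mult_bounded in auto)
  qed
next
  assume "finite_propagation M T"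
  then obtain R where R: "R > 0" and fp: "\<And>f g. \<lbrakk>f \<in> C0 (space M); g \<in> C0 (space M); setdist (supp_in (space M) f) (supp_in (space M) g) > R\<rbrakk>
     \<Longrightarrow> mult_operator M f \<otimes>\<^bsub>operator_algebra L\<^esub> T \<otimes>\<^bsub>operator_algebra L\<^esub> mult_operator M g = \<zero>\<^bsub>operator_algebra L\<^esub>"
    unfolding finite_propagation_def by blast
  have "propagation_le T (R + 4)"
    unfolding propagation_le_def
  proof (intro allI ballI impI)
    fix A B F G assume FG: "F \<in> hcarrier L" "G \<in> hcarrier L"
      and *: "supported F A \<and> supported G B \<and> (\<forall>a\<in>A. \<forall>b\<in>B. R + 4 < dist a b)"
    define o' :: 'a where "o' = undefined"
    define u where "u n = (indicator (cball o' (real n)) :: 'a \<Rightarrow> complex)" for n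
    have bm: "bounded_multiplier (u n)" for n
      unfolding u_def
    proof (rule bounded_multiplier_indicator)
      have "cball o' (real n) \<inter> space M = space M - (- cball o' (real n)) \<inter> space M" by auto
      also have "\<dots> \<in> sets M" by (intro sets.Diff sets.top open_measurable) auto
      finally show "cball o' (real n) \<inter> space M \<in> sets M" .
    qed
    have supp: "supported (mult_operator M (u n) H) (S \<inter> space M \<inter> cball o' (real n))"
      if "H \<in> hcarrier L" "supported H S" for n H S
      using that(2) rep_mult[OF bm that(1), of n] AE_space unfolding supported_def
      by eventually_elim (auto simp: u_def indicator_def)
    have "hinner L (mult_operator M (u n) F) (T (mult_operator M (u m) G)) = 0" for n m
    proof (rule inner_propagation_bounded[OF T fp])
      show "A \<inter> space M \<inter> cball o' (real n) \<subseteq> space M \<inter> cball o' (real (max n m))"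
        "B \<inter> space M \<inter> cball o' (real m) \<subseteq> space M \<inter> cball o' (real (max n m))" by auto
    qed (use FG * supp mult_carrier[OF bm] in auto)
    moreover have "(\<lambda>m. hinner L (mult_operator M (u n) F) (T (mult_operator M (u m) G)))
        \<longlonglongrightarrow> hinner L (mult_operator M (u n) F) (T G)" for n
      using FG T mult_carrier[OF bm]
      by (intro inner_tendsto op_tendsto[OF T] truncation[of G o', folded u_def]) (auto simp: op_closed)
    ultimately have 0: "hinner L (mult_operator M (u n) F) (T G) = 0" for n
      using LIMSEQ_unique[OF tendsto_const] by fastforce
    have "(\<lambda>n. hinner L (T G) (mult_operator M (u n) F)) \<longlonglongrightarrow> hinner L (T G) F"
      using FG T mult_carrier[OF bm]
      by (intro inner_tendsto truncation[of F o', folded u_def]) (auto simp: op_closed)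
    moreover have "hinner L (T G) (mult_operator M (u n) F) = 0" for n
      using 0[of n] inner_commute[of "T G" "mult_operator M (u n) F"] FG T mult_carrier[OF bm] by (simp add: op_closed)
    ultimately have "hinner L (T G) F = 0" using LIMSEQ_unique[OF tendsto_const] by fastforce
    then show "hinner L F (T G) = 0"
      using inner_commute[of F "T G"] FG T by (simp add: op_closed)
  qed
  then show "\<exists>R>0. propagation_le T R" using R by (intro exI[of _ "R + 4"]) auto
qed

text \<open>Open balls make the neighbourhood measurable. Its complement is at distance at least
  \<open>R + 1\<close> from \<open>B\<close>, so the part of \<open>T G\<close> living there is
  orthogonal to \<open>T G\<close> itself, hence zero.\<close>

lemma supported_op:
  assumes T: "T \<in> bounded_operators L" "propagation_le T R" and G: "G \<in> hcarrier L" "supported G B"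
  shows "supported (T G) (\<Union>b\<in>B. ball b (R + 1))"
proof -
  define U where "U = (\<Union>b\<in>B. ball b (R + 1))"
  let ?u = "indicator (- U) :: 'a \<Rightarrow> complex"
  have bm: "bounded_multiplier ?u"
  proof (rule bounded_multiplier_indicator)
    have "- U \<inter> space M = space M - U \<inter> space M" by auto
    also have "\<dots> \<in> sets M" by (intro sets.Diff sets.top open_measurable) (auto simp: U_def)
    finally show "- U \<inter> space M \<in> sets M" .
  qed
  have TG: "T G \<in> hcarrier L" using T G by (simp add: op_closed)
  note uTG = mult_carrier[OF bm TG]
  have "supported (mult_operator M ?u (T G)) (- U)"
    by (rule supported_mult_set[OF bm TG]) (auto simp: indicator_def split: if_splits)
  then have 0: "hinner L (mult_operator M ?u (T G)) (T G) = 0"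
    by (rule propagation_leD[OF T(2) uTG(1) G(1) _ G(2)]) (auto simp: U_def not_less dist_commute add1_zle_eq intro: less_le_trans[of R "R + 1"])
  have cnj: "(\<lambda>x. cnj (?u x)) = ?u" by (auto simp: indicator_def)
  have idem: "mult_operator M ?u (mult_operator M ?u (T G)) = mult_operator M ?u (T G)"
    using \<open>supported (mult_operator M ?u (T G)) (- U)\<close>
    by (intro mult_eq_self[OF bm uTG(1)]) (auto simp: indicator_def)
  have "hinner L (mult_operator M ?u (T G)) (mult_operator M ?u (T G)) = 0"
    using inner_mult_left[OF bm uTG(1) TG] 0 by (simp add: cnj idem)
  then have "mult_operator M ?u (T G) = hzero L"
    using uTG(1) by (intro norm_eq_zeroD) (auto simp: hnorm_def)
  then show ?thesis
    using uTG(2) rep_hzero unfolding supported_def U_def[symmetric]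
    by (auto simp: indicator_def scaleC_one)
qed

text \<open>The extra 1 is the one in the neighbourhood of \<open>supported_op\<close>.\<close>

lemma propagation_le_mult:
  assumes S: "S \<in> bounded_operators L" "propagation_le S R" and T: "T \<in> bounded_operators L" "propagation_le T R'"
  shows "propagation_le (S \<otimes>\<^bsub>operator_algebra L\<^esub> T) (R + R' + 1)"
  unfolding propagation_le_def
proof (intro allI ballI impI)
  fix A B F G assume FG: "F \<in> hcarrier L" "G \<in> hcarrier L"
    and *: "supported F A \<and> supported G B \<and> (\<forall>a\<in>A. \<forall>b\<in>B. R + R' + 1 < dist a b)"
  have "hinner L F (S (T G)) = 0"
  proof (rule propagation_leD[OF S(2) FG(1)])
    show "supported (T G) (\<Union>b\<in>B. ball b (R' + 1))" using supported_op[OF T FG(2)] * by blast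
    show "R < dist a b" if ab: "a \<in> A" "b \<in> (\<Union>b\<in>B. ball b (R' + 1))" for a b
    proof -
      obtain c where "c \<in> B" "dist c b < R' + 1" using ab(2) by auto
      then show ?thesis using * ab(1) dist_triangle[of a c b] by (fastforce simp: dist_commute)
    qed
  qed (use FG T * in \<open>auto simp: op_closed\<close>)
  then show "hinner L F ((S \<otimes>\<^bsub>operator_algebra L\<^esub> T) G) = 0" using FG by simp
qed

lemma propagation_le_adjoint:
  assumes T: "T \<in> bounded_operators L" "propagation_le T R"
  shows "propagation_le (hadjoint L T) R"
  unfolding propagation_le_def
proof (intro allI ballI impI)
  fix A B F G assume FG: "F \<in> hcarrier L" "G \<in> hcarrier L"
    and *: "supported F A \<and> supported G B \<and> (\<forall>a\<in>A. \<forall>b\<in>B. R < dist a b)"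
  have "hinner L G (T F) = 0"
    by (rule propagation_leD[OF T(2) FG(2,1), of B A]) (use * in \<open>auto, metis dist_commute\<close>)
  then show "hinner L F (hadjoint L T G) = 0"
    using FG T inner_commute[of "T F" G] by (simp add: inner_adjoint op_closed)
qed

lemma propagation_le_add:
  assumes S: "S \<in> bounded_operators L" "propagation_le S R" and T: "T \<in> bounded_operators L" "propagation_le T R"
  shows "propagation_le (S \<oplus>\<^bsub>operator_algebra L\<^esub> T) R"
  unfolding propagation_le_def
proof (intro allI ballI impI)
  fix A B F G assume FG: "F \<in> hcarrier L" "G \<in> hcarrier L"
    and *: "supported F A \<and> supported G B \<and> (\<forall>a\<in>A. \<forall>b\<in>B. R < dist a b)"
  have "hinner L F (S G) = 0" "hinner L F (T G) = 0"
    using propagation_leD[OF S(2) FG, of A B] propagation_leD[OF T(2) FG, of A B] * by auto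
  then show "hinner L F ((S \<oplus>\<^bsub>operator_algebra L\<^esub> T) G) = 0" using FG S T by (simp add: inner_simps op_closed)
qed

lemma propagation_le_smult:
  assumes T: "T \<in> bounded_operators L" "propagation_le T R"
  shows "propagation_le (c \<odot>\<^bsub>operator_algebra L\<^esub> T) R"
  using T unfolding propagation_le_def by (auto simp: inner_simps op_closed)

section \<open>Locally compact operators of finite propagation\<close>

definition algebraic_roe :: "(('a \<Rightarrow> 'k) set \<Rightarrow> ('a \<Rightarrow> 'k) set) set" where
  "algebraic_roe = {T \<in> bounded_operators L. locally_compact_operator M T \<and> finite_propagation M T}"

lemma algebraic_roeD:
  assumes "T \<in> algebraic_roe"
  shows "T \<in> bounded_operators L"
    "f \<in> C0 (space M) \<Longrightarrow> compact_operator L (T \<otimes>\<^bsub>operator_algebra L\<^esub> mult_operator M f)"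
    "f \<in> C0 (space M) \<Longrightarrow> compact_operator L (mult_operator M f \<otimes>\<^bsub>operator_algebra L\<^esub> T)"
    "\<exists>R>0. propagation_le T R"
  using assms finite_propagation_iff unfolding algebraic_roe_def locally_compact_operator_def by blast+

lemma algebraic_roeI:
  assumes "T \<in> bounded_operators L"
    "\<And>f. f \<in> C0 (space M) \<Longrightarrow> compact_operator L (T \<otimes>\<^bsub>operator_algebra L\<^esub> mult_operator M f)"
    "\<And>f. f \<in> C0 (space M) \<Longrightarrow> compact_operator L (mult_operator M f \<otimes>\<^bsub>operator_algebra L\<^esub> T)"
    "R > 0" "propagation_le T R"
  shows "T \<in> algebraic_roe"
  using assms finite_propagation_iff[of T] unfolding algebraic_roe_def locally_compact_operator_def by blast

lemma algebraic_roe_mult: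
  assumes S: "S \<in> algebraic_roe" and T: "T \<in> algebraic_roe"
  shows "S \<otimes>\<^bsub>operator_algebra L\<^esub> T \<in> algebraic_roe"
proof -
  interpret B: star_alg "operator_algebra L" by (rule star_alg_operator_algebra)
  obtain R R' where R: "R > 0" "propagation_le S R" "R' > 0" "propagation_le T R'"
    using algebraic_roeD(4)[OF S] algebraic_roeD(4)[OF T] by blast
  note S' = algebraic_roeD(1)[OF S] and T' = algebraic_roeD(1)[OF T]
  show ?thesis
  proof (rule algebraic_roeI)
    show "propagation_le (S \<otimes>\<^bsub>operator_algebra L\<^esub> T) (R + R' + 1)" by (rule propagation_le_mult) fact+
    fix f assume f: "f \<in> C0 (space M)"
    note m = mult_bounded[OF C0_multiplier[OF f]]
    show "compact_operator L (S \<otimes>\<^bsub>operator_algebra L\<^esub> T \<otimes>\<^bsub>operator_algebra L\<^esub> mult_operator M f)"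
      using B.m_assoc[of S T "mult_operator M f"] compact_mult_left[OF S' algebraic_roeD(2)[OF T f]] S' T' m by simp
    show "compact_operator L (mult_operator M f \<otimes>\<^bsub>operator_algebra L\<^esub> (S \<otimes>\<^bsub>operator_algebra L\<^esub> T))"
      using B.m_assoc[of "mult_operator M f" S T] compact_mult_right[OF T' algebraic_roeD(3)[OF S f]] S' T' m by simp
  qed (use R S' T' in auto)
qed

lemma algebraic_roe_add:
  assumes S: "S \<in> algebraic_roe" and T: "T \<in> algebraic_roe"
  shows "S \<oplus>\<^bsub>operator_algebra L\<^esub> T \<in> algebraic_roe"
proof -
  interpret B: star_alg "operator_algebra L" by (rule star_alg_operator_algebra)
  obtain R R' where R: "R > 0" "propagation_le S R" "R' > 0" "propagation_le T R'"
    using algebraic_roeD(4)[OF S] algebraic_roeD(4)[OF T] by blast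
  note S' = algebraic_roeD(1)[OF S] and T' = algebraic_roeD(1)[OF T]
  show ?thesis
  proof (rule algebraic_roeI)
    show "propagation_le (S \<oplus>\<^bsub>operator_algebra L\<^esub> T) (max R R')"
      by (intro propagation_le_add S' T' propagation_le_mono[OF R(2)] propagation_le_mono[OF R(4)]) auto
    fix f assume f: "f \<in> C0 (space M)"
    note m = mult_bounded[OF C0_multiplier[OF f]]
    show "compact_operator L ((S \<oplus>\<^bsub>operator_algebra L\<^esub> T) \<otimes>\<^bsub>operator_algebra L\<^esub> mult_operator M f)"
      using B.l_distr[of S T "mult_operator M f"] compact_add[OF algebraic_roeD(2)[OF S f] algebraic_roeD(2)[OF T f]] S' T' m by simp
    show "compact_operator L (mult_operator M f \<otimes>\<^bsub>operator_algebra L\<^esub> (S \<oplus>\<^bsub>operator_algebra L\<^esub> T))"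
      using B.r_distr[of S T "mult_operator M f"] compact_add[OF algebraic_roeD(3)[OF S f] algebraic_roeD(3)[OF T f]] S' T' m by simp
  qed (use R S' T' in auto)
qed

lemma algebraic_roe_smult:
  assumes T: "T \<in> algebraic_roe"
  shows "c \<odot>\<^bsub>operator_algebra L\<^esub> T \<in> algebraic_roe"
proof -
  interpret B: star_alg "operator_algebra L" by (rule star_alg_operator_algebra)
  obtain R where R: "R > 0" "propagation_le T R" using algebraic_roeD(4)[OF T] by blast
  note T' = algebraic_roeD(1)[OF T]
  show ?thesis
  proof (rule algebraic_roeI)
    show "propagation_le (c \<odot>\<^bsub>operator_algebra L\<^esub> T) R" by (intro propagation_le_smult T' R)
    fix f assume f: "f \<in> C0 (space M)"
    note m = mult_bounded[OF C0_multiplier[OF f]]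
    show "compact_operator L ((c \<odot>\<^bsub>operator_algebra L\<^esub> T) \<otimes>\<^bsub>operator_algebra L\<^esub> mult_operator M f)"
      using B.smult_mult_left[of T "mult_operator M f" c] compact_smult[OF algebraic_roeD(2)[OF T f]] T' m by simp
    show "compact_operator L (mult_operator M f \<otimes>\<^bsub>operator_algebra L\<^esub> (c \<odot>\<^bsub>operator_algebra L\<^esub> T))"
      using B.smult_mult_right[of "mult_operator M f" T c] compact_smult[OF algebraic_roeD(3)[OF T f]] T' m by simp
  qed (use R T' in auto)
qed

lemma algebraic_roe_adjoint:
  assumes T: "T \<in> algebraic_roe"
  shows "hadjoint L T \<in> algebraic_roe"
proof -
  interpret B: star_alg "operator_algebra L" by (rule star_alg_operator_algebra)
  obtain R where R: "R > 0" "propagation_le T R" using algebraic_roeD(4)[OF T] by blast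
  note T' = algebraic_roeD(1)[OF T]
  show ?thesis
  proof (rule algebraic_roeI)
    show "propagation_le (hadjoint L T) R" by (intro propagation_le_adjoint T' R)
    fix f assume f: "f \<in> C0 (space M)"
    note m = mult_bounded[OF C0_multiplier[OF C0_cnj[OF f]]]
    have "hadjoint L (mult_operator M (\<lambda>x. cnj (f x))) = mult_operator M f"
      using mult_adjoint[OF C0_multiplier[OF C0_cnj[OF f]]] by simp
    then show "compact_operator L (hadjoint L T \<otimes>\<^bsub>operator_algebra L\<^esub> mult_operator M f)"
      "compact_operator L (mult_operator M f \<otimes>\<^bsub>operator_algebra L\<^esub> hadjoint L T)"
      using B.star_mult[of "mult_operator M (\<lambda>x. cnj (f x))" T] B.star_mult[of T "mult_operator M (\<lambda>x. cnj (f x))"] T' m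
        compact_adjoint[OF algebraic_roeD(3)[OF T C0_cnj[OF f]]] compact_adjoint[OF algebraic_roeD(2)[OF T C0_cnj[OF f]]]
      by simp_all
  qed (use R T' in auto)
qed

lemma algebraic_roe_zero: "\<zero>\<^bsub>operator_algebra L\<^esub> \<in> algebraic_roe"
proof -
  interpret B: star_alg "operator_algebra L" by (rule star_alg_operator_algebra)
  show ?thesis
    by (rule algebraic_roeI[of _ 1])
       (use B.mult_zero_left B.mult_zero_right mult_bounded[OF C0_multiplier] in
         \<open>auto simp: compact_zero propagation_le_def inner_simps\<close>)
qed

lemma roe_algebra_eq: "roe_algebra K M = (operator_algebra L)\<lparr>carrier := norm_closure L algebraic_roe\<rparr>"
  by (simp add: roe_algebra_def algebraic_roe_def)

lemma star_alg_roe_algebra: "star_alg (roe_algebra K M)"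
  unfolding roe_algebra_eq
  by (rule star_alg_norm_closure)
     (auto intro: algebraic_roe_zero algebraic_roe_add algebraic_roe_mult algebraic_roe_smult algebraic_roe_adjoint
       dest: algebraic_roeD(1))

lemma roe_algebra_simps [simp]:
  "carrier (roe_algebra K M) = norm_closure L algebraic_roe"
  "mult (roe_algebra K M) = mult (operator_algebra L)"
  "add (roe_algebra K M) = add (operator_algebra L)"
  "zero (roe_algebra K M) = zero (operator_algebra L)"
  "smult (roe_algebra K M) = smult (operator_algebra L)"
  "star (roe_algebra K M) = hadjoint L"
  by (simp_all add: roe_algebra_eq)

lemma algebraic_roe_carrier: "T \<in> algebraic_roe \<Longrightarrow> T \<in> norm_closure L algebraic_roe"
  by (intro norm_closure_base algebraic_roeD(1))


section \<open>Localised families\<close>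

text \<open>Indices are counted rather than points, so finitely many centres lie in a ball even with
  multiplicity.\<close>

definition locally_finite :: "'i set \<Rightarrow> ('i \<Rightarrow> 'a) \<Rightarrow> bool" where
  "locally_finite I p \<longleftrightarrow> (\<forall>x r. finite {i \<in> I. p i \<in> cball x r})"

lemma locally_finite_close:
  assumes "locally_finite I p" "\<And>i. i \<in> I \<Longrightarrow> dist (p i) (q i) \<le> \<alpha>"
  shows "locally_finite I q"
  unfolding locally_finite_def
proof (intro allI)
  fix x r
  have "{i \<in> I. q i \<in> cball x r} \<subseteq> {i \<in> I. p i \<in> cball x (r + \<alpha>)}"
  proof
    fix i assume "i \<in> {i \<in> I. q i \<in> cball x r}"
    then show "i \<in> {i \<in> I. p i \<in> cball x (r + \<alpha>)}"
      using assms(2)[of i] dist_triangle[of x "p i" "q i"] by (auto simp: dist_commute)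
  qed
  then show "finite {i \<in> I. q i \<in> cball x r}" using assms(1) finite_subset unfolding locally_finite_def by blast
qed

lemma transport_norm_le:
  assumes c: "orthonormal I c" and b: "orthonormal I b" and y: "y \<in> hcarrier L"
  shows "hnorm L (transport I c b y) \<le> hnorm L y"
proof -
  let ?z = "transport I c b y"
  have z: "?z \<in> hcarrier L" using transport_closed[OF c b] y by (simp add: op_closed)
  have "hnorm L ?z * hnorm L ?z = cmod (hinner L ?z ?z)"
    using z by (simp add: inner_self power2_eq_square norm_mult)
  also have "\<dots> \<le> hnorm L ?z * hnorm L y"
    unfolding inner_transport[OF c b z y] by (rule coefficient_form(2)[OF c b z y])
  finally show ?thesis
    using norm_nonneg[OF z] norm_nonneg[OF y]
    by (cases "hnorm L ?z = 0") (auto intro: mult_left_le_imp_le[of "hnorm L ?z"])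
qed

text \<open>Outside a compact set \<open>C\<close> the function \<open>f\<close> is smaller than
  \<epsilon>. Finitely many of the \<open>c i\<close> meet \<open>C\<close>, so cutting
  \<open>f\<close> down to \<open>C\<close> changes the product by at most \<epsilon> and leaves an
  operator of finite rank.\<close>

lemma compact_mult_transport:
  assumes c: "orthonormal I c" and b: "orthonormal I b" and f: "f \<in> C0 (space M)"
    and p: "locally_finite I p" and cp: "\<And>i. i \<in> I \<Longrightarrow> supported (c i) (cball (p i) R)"
  shows "compact_operator L (mult_operator M f \<otimes>\<^bsub>operator_algebra L\<^esub> transport I c b)"
proof (rule compact_norm_limit)
  note bf = C0_multiplier[OF f] and V = transport_closed[OF c b]
  show "mult_operator M f \<otimes>\<^bsub>operator_algebra L\<^esub> transport I c b \<in> bounded_operators L"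
    using V mult_bounded[OF bf] by simp
  fix \<epsilon> :: real assume e: "\<epsilon> > 0"
  obtain C where C: "C \<subseteq> space M" "compact C" "\<And>y. y \<in> space M - C \<Longrightarrow> norm (f y) < \<epsilon>"
    using f e unfolding C0_def mem_Collect_eq by meson
  obtain o' r where "\<forall>y\<in>C. dist o' y \<le> r" using compact_imp_bounded[OF C(2)] unfolding bounded_def by blast
  then have Cb: "C \<subseteq> cball o' r" by auto
  \<comment> \<open>If \<open>p i\<close> is farther than \<open>r + R\<close> from
    \<open>o'\<close>, then the ball carrying \<open>c i\<close> misses \<open>C\<close>.\<close>
  define J where "J = {i \<in> I. p i \<in> cball o' (r + R)}"
  have J: "finite J" "J \<subseteq> I" using p unfolding J_def locally_finite_def by auto
  define u where "u x = indicator C x * f x" for x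
  have Cm: "C \<in> sets M"
  proof -
    have "C = space M - (- C) \<inter> space M" using C(1) by auto
    also have "\<dots> \<in> sets M" using compact_imp_closed[OF C(2)] by (intro sets.Diff sets.top open_measurable) auto
    finally show ?thesis .
  qed
  have bu: "bounded_multiplier u"
  proof -
    obtain B where B: "\<And>x. x \<in> space M \<Longrightarrow> cmod (f x) \<le> B" using bf unfolding bounded_multiplier_def by blast
    have "\<forall>x\<in>space M. cmod (u x) \<le> \<bar>B\<bar>"
      using B by (auto simp: u_def indicator_def intro: order_trans[OF _ abs_ge_self])
    moreover have "u \<in> borel_measurable M"
      unfolding u_def using Cm bf by (intro borel_measurable_times borel_measurable_indicator) (auto simp: bounded_multiplier_def)
    ultimately show ?thesis unfolding bounded_multiplier_def by blast
  qed
  define w where "w x = f x - u x" for x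
  have bw: "bounded_multiplier w"
  proof -
    obtain B B' where B: "\<And>x. x \<in> space M \<Longrightarrow> cmod (f x) \<le> B" "\<And>x. x \<in> space M \<Longrightarrow> cmod (u x) \<le> B'"
      using bf bu unfolding bounded_multiplier_def by blast
    have "\<forall>x\<in>space M. cmod (w x) \<le> B + B'"
      unfolding w_def using B by (intro ballI order_trans[OF norm_triangle_ineq4] add_mono) auto
    moreover have "w \<in> borel_measurable M"
      unfolding w_def using bf bu by (intro borel_measurable_diff) (auto simp: bounded_multiplier_def)
    ultimately show ?thesis unfolding bounded_multiplier_def by blast
  qed
  have bcu: "bounded_multiplier (\<lambda>x. cnj (u x))" using bu by (rule bounded_multiplier_cnj)
  have uc: "mult_operator M u (c i) = hzero L" if "i \<in> I - J" for i
  proof (rule mult_eq_zero[OF bu orthonormal_closed[OF c]])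
    show "supported (c i) (cball (p i) R)" "i \<in> I" using that cp by auto
    fix x assume "x \<in> cball (p i) R"
    then have "x \<notin> C"
      using that Cb dist_triangle[of o' "p i" x] by (force simp: J_def dist_commute)
    then show "u x = 0" by (simp add: u_def)
  qed
  have "compact_operator L (mult_operator M u \<otimes>\<^bsub>operator_algebra L\<^esub> transport I c b)"
  proof (rule compact_of_finite_form[OF J(1), of _ "\<lambda>i. mult_operator M u (c i)" b])
    show "mult_operator M u \<otimes>\<^bsub>operator_algebra L\<^esub> transport I c b \<in> bounded_operators L"
      using V mult_bounded[OF bu] by simp
    show "mult_operator M u (c i) \<in> hcarrier L" "b i \<in> hcarrier L" if "i \<in> J" for i
      using that J(2) orthonormal_closed[OF c] orthonormal_closed[OF b] mult_carrier[OF bu] by auto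
    fix x y assume xy: "x \<in> hcarrier L" "y \<in> hcarrier L"
    have ux: "mult_operator M (\<lambda>x. cnj (u x)) x \<in> hcarrier L" using mult_carrier[OF bcu] xy by auto
    have eq: "hinner L (mult_operator M (\<lambda>x. cnj (u x)) x) z = hinner L x (mult_operator M u z)" if "z \<in> hcarrier L" for z
      using inner_mult_left[OF bcu xy(1) that] by simp
    have "hinner L x ((mult_operator M u \<otimes>\<^bsub>operator_algebra L\<^esub> transport I c b) y)
        = hinner L (mult_operator M (\<lambda>x. cnj (u x)) x) (transport I c b y)"
      using xy eq[of "transport I c b y"] V by (simp add: op_closed)
    also have "\<dots> = (\<Sum>\<^sub>\<infinity>i\<in>I. hinner L x (mult_operator M u (c i)) * hinner L (b i) y)"
      unfolding inner_transport[OF c b ux xy(2)]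
      by (intro infsum_cong) (simp add: eq orthonormal_closed[OF c])
    also have "\<dots> = (\<Sum>\<^sub>\<infinity>i\<in>J. hinner L x (mult_operator M u (c i)) * hinner L (b i) y)"
      using J(2) xy by (intro infsum_cong_neutral) (auto simp: uc inner_simps)
    also have "\<dots> = (\<Sum>i\<in>J. hinner L x (mult_operator M u (c i)) * hinner L (b i) y)"
      using J(1) by simp
    finally show "hinner L x ((mult_operator M u \<otimes>\<^bsub>operator_algebra L\<^esub> transport I c b) y)
      = (\<Sum>i\<in>J. hinner L x (mult_operator M u (c i)) * hinner L (b i) y)" .
  qed
  moreover have "hnorm L (hdiff L ((mult_operator M f \<otimes>\<^bsub>operator_algebra L\<^esub> transport I c b) x)
       ((mult_operator M u \<otimes>\<^bsub>operator_algebra L\<^esub> transport I c b) x)) \<le> \<epsilon> * hnorm L x" if x: "x \<in> hcarrier L" for x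
  proof -
    let ?z = "transport I c b x"
    have z: "?z \<in> hcarrier L" using V x by (simp add: op_closed)
    have "hdiff L (mult_operator M f ?z) (mult_operator M u ?z) = mult_operator M w ?z"
    proof (rule carrier_eqI)
      show "AE x in M. rep (hdiff L (mult_operator M f ?z) (mult_operator M u ?z)) x = rep (mult_operator M w ?z) x"
        using rep_hdiff[OF mult_carrier(1)[OF bf z] mult_carrier(1)[OF bu z]] rep_mult[OF bf z] rep_mult[OF bu z] rep_mult[OF bw z]
        by eventually_elim (simp add: w_def complex_vs.scale_left_diff_distrib)
    qed (use mult_carrier[OF bf z] mult_carrier[OF bu z] mult_carrier[OF bw z] in auto)
    also have "hnorm L \<dots> \<le> \<epsilon> * hnorm L ?z"
      using C(3) e by (intro mult_norm_le[OF bw z]) (auto simp: w_def u_def indicator_def intro: less_imp_le)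
    also have "\<dots> \<le> \<epsilon> * hnorm L x" using e transport_norm_le[OF c b x] by simp
    finally show ?thesis using x by simp
  qed
  ultimately show "\<exists>S. compact_operator L S \<and> (\<forall>x\<in>hcarrier L. hnorm L (hdiff L ((mult_operator M f \<otimes>\<^bsub>operator_algebra L\<^esub> transport I c b) x) (S x)) \<le> \<epsilon> * hnorm L x)"
    by blast
qed

text \<open>One half of local compactness is \<open>compact_mult_transport\<close>; the other half
  is the adjoint of the same statement with \<open>b\<close> and \<open>c\<close> exchanged.\<close>

lemma transport_algebraic_roe:
  assumes c: "orthonormal I c" and b: "orthonormal I b"
    and p: "locally_finite I p" and pq: "\<And>i. i \<in> I \<Longrightarrow> dist (p i) (q i) \<le> \<alpha>"
    and cp: "\<And>i. i \<in> I \<Longrightarrow> supported (c i) (cball (p i) R)" and bq: "\<And>i. i \<in> I \<Longrightarrow> supported (b i) (cball (q i) R)"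
  shows "transport I c b \<in> algebraic_roe"
proof -
  interpret B: star_alg "operator_algebra L" by (rule star_alg_operator_algebra)
  note V = transport_closed[OF c b] and V' = transport_closed[OF b c]
  have q: "locally_finite I q" using locally_finite_close[OF p pq] .
  show ?thesis
  proof (rule algebraic_roeI)
    fix f assume f: "f \<in> C0 (space M)"
    show "compact_operator L (mult_operator M f \<otimes>\<^bsub>operator_algebra L\<^esub> transport I c b)"
      by (rule compact_mult_transport[OF c b f p cp])
    let ?g = "\<lambda>x. cnj (f x)"
    note m = mult_bounded[OF C0_multiplier[OF C0_cnj[OF f]]]
    have "hadjoint L (mult_operator M ?g) = mult_operator M f"
      using mult_adjoint[OF C0_multiplier[OF C0_cnj[OF f]]] by simp
    then show "compact_operator L (transport I c b \<otimes>\<^bsub>operator_algebra L\<^esub> mult_operator M f)"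
      using B.star_mult[of "mult_operator M ?g" "transport I b c"] m V'
        compact_adjoint[OF compact_mult_transport[OF b c C0_cnj[OF f] q bq]] transport_adjoint[OF b c] by simp
  next
    \<comment> \<open>An index \<open>i\<close> can only connect a point within \<open>R\<close> of
      \<open>p i\<close> to a point within \<open>R\<close> of \<open>q i\<close>, and these centres
      are within \<alpha> of each other. The absolute values and the 1 make the constant
      positive.\<close>
    show "propagation_le (transport I c b) (2 * \<bar>R\<bar> + \<bar>\<alpha>\<bar> + 1)"
      unfolding propagation_le_def
    proof (intro allI ballI impI)
      fix A B' F G assume FG: "F \<in> hcarrier L" "G \<in> hcarrier L"
        and *: "supported F A \<and> supported G B' \<and> (\<forall>a\<in>A. \<forall>b\<in>B'. 2 * \<bar>R\<bar> + \<bar>\<alpha>\<bar> + 1 < dist a b)"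
      have "hinner L F (c i) * hinner L (b i) G = 0" if i: "i \<in> I" for i
      proof (rule ccontr)
        assume "\<not> ?thesis"
        then have "A \<inter> cball (p i) R \<inter> space M \<noteq> {}" "cball (q i) R \<inter> B' \<inter> space M \<noteq> {}"
          using supported_inner_zero[of F A "c i" "cball (p i) R"] supported_inner_zero[of "b i" "cball (q i) R" G B']
            * cp[OF i] bq[OF i] by auto
        then obtain a b' where "a \<in> A" "a \<in> cball (p i) R" "b' \<in> B'" "b' \<in> cball (q i) R" by blast
        then show False
          using * pq[OF i] dist_triangle[of a b' "p i"] dist_triangle[of "p i" b' "q i"]
          by (fastforce simp: dist_commute)
      qed
      then show "hinner L F (transport I c b G) = 0"
        unfolding inner_transport[OF c b FG] by (rule infsum_0)
    qed
  qed (use V in auto)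
qed

end

section \<open>Rays to infinity\<close>

text \<open>Koenig's lemma: follow vertices with infinitely many geodesic continuations.\<close>

lemma geodesic_ray:
  fixes E :: "('a \<times> 'a) set"
  assumes fin: "\<And>v. finite (E `` {v})" and inf: "infinite (E\<^sup>* `` {x})"
  obtains s where "s 0 = x" "\<And>n. (s n, s (Suc n)) \<in> E" "inj s"
proof -
  define d where "d u = (LEAST n. (x, u) \<in> E ^^ n)" for u
  have d_le: "d u \<le> n" if "(x, u) \<in> E ^^ n" for u n unfolding d_def using that by (rule Least_le)
  have d_path: "(x, u) \<in> E ^^ d u" if "(x, u) \<in> E\<^sup>*" for u
    unfolding d_def by (rule LeastI_ex[OF rtrancl_imp_relpow[OF that]])
  \<comment> \<open>The vertices that a geodesic from \<open>x\<close> can reach through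
    \<open>v\<close>.\<close>
  define C where "C v = {u. \<exists>m. (v, u) \<in> E ^^ m \<and> d u = d v + m}" for v
  have step: "\<exists>w. (v, w) \<in> E \<and> d w = Suc (d v) \<and> (x, w) \<in> E\<^sup>* \<and> infinite (C w)"
    if v: "(x, v) \<in> E\<^sup>*" "infinite (C v)" for v
  proof -
    define N where "N = {w. (v, w) \<in> E \<and> d w = Suc (d v)}"
    \<comment> \<open>A geodesic leaving \<open>v\<close> continues through a neighbour one step
      farther from \<open>x\<close>. There are finitely many of these, so one of them inherits
      infinitely many continuations.\<close>
    have "C v \<subseteq> {v} \<union> (\<Union>w\<in>N. C w)"
    proof
      fix u assume "u \<in> C v"
      then obtain m where m: "(v, u) \<in> E ^^ m" "d u = d v + m" by (auto simp: C_def)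
      show "u \<in> {v} \<union> (\<Union>w\<in>N. C w)"
      proof (cases m)
        case 0
        then show ?thesis using m by simp
      next
        case (Suc k)
        then obtain w where w: "(v, w) \<in> E" "(w, u) \<in> E ^^ k" using m(1) by (meson relpow_Suc_D2)
        have "d w \<le> Suc (d v)" by (rule d_le) (use d_path[OF v(1)] w(1) in auto)
        have xw: "(x, w) \<in> E\<^sup>*" using v(1) w(1) by simp
        have "d u \<le> d w + k" by (rule d_le) (use relpow_add[of "d w" k E] d_path[OF xw] w(2) in auto)
        then have "d w = Suc (d v)" "d u = d w + k" using \<open>d w \<le> Suc (d v)\<close> m(2) Suc by auto
        then show ?thesis using w by (auto simp: N_def C_def)
      qed
    qed
    moreover have "finite N" by (rule finite_subset[OF _ fin[of v]]) (auto simp: N_def)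
    moreover have "finite ({v} \<union> (\<Union>w\<in>N. C w))" if "\<And>w. w \<in> N \<Longrightarrow> finite (C w)"
      using that \<open>finite N\<close> by simp
    ultimately obtain w where "w \<in> N" "infinite (C w)"
      using v(2) finite_subset by metis
    then show ?thesis using v(1) by (intro exI[of _ w]) (auto simp: N_def)
  qed
  have "d x = 0" using d_le[of x 0] by simp
  then have Cx: "infinite (C x)"
    using inf d_path by (auto simp: C_def elim!: contrapos_nn intro: finite_subset[rotated])
  have "\<exists>s. \<forall>n. ((x, s n) \<in> E\<^sup>* \<and> infinite (C (s n)) \<and> (n = 0 \<longrightarrow> s n = x)) \<and>
    ((s n, s (Suc n)) \<in> E \<and> d (s (Suc n)) = Suc (d (s n)))"
  proof (rule dependent_nat_choice[of "\<lambda>n v. (x, v) \<in> E\<^sup>* \<and> infinite (C v) \<and> (n = 0 \<longrightarrow> v = x)"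
        "\<lambda>n v w. (v, w) \<in> E \<and> d w = Suc (d v)"])
    show "\<exists>v. (x, v) \<in> E\<^sup>* \<and> infinite (C v) \<and> (0 = (0::nat) \<longrightarrow> v = x)" using Cx by blast
    fix v and n :: nat assume "(x, v) \<in> E\<^sup>* \<and> infinite (C v) \<and> (n = 0 \<longrightarrow> v = x)"
    then show "\<exists>w. ((x, w) \<in> E\<^sup>* \<and> infinite (C w) \<and> (Suc n = 0 \<longrightarrow> w = x)) \<and> (v, w) \<in> E \<and> d w = Suc (d v)"
      using step[of v] by blast
  qed
  then obtain s where s: "\<And>n. (x, s n) \<in> E\<^sup>* \<and> infinite (C (s n)) \<and> (n = 0 \<longrightarrow> s n = x)"
    "\<And>n. (s n, s (Suc n)) \<in> E \<and> d (s (Suc n)) = Suc (d (s n))" by blast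
  have s0: "s 0 = x" using s(1)[of 0] by simp
  \<comment> \<open>The distance from \<open>x\<close> grows by one in each step, so the ray visits
    no vertex twice.\<close>
  have "d (s n) = n" for n by (induction n) (use s(2) s0 \<open>d x = 0\<close> in auto)
  then have "inj s" by (metis injI)
  with s s0 that show ?thesis by blast
qed

text \<open>The ray from \<open>x\<close> avoids the largest possible ball, so a given vertex is met only by
  rays from the finitely many points in or enclosed by a ball.\<close>

lemma rays_to_infinity:
  fixes D :: "'a::metric_space set"
  assumes loc: "\<And>x r. finite (D \<inter> cball x r)" and comp: "no_finite_components D \<alpha>"
  obtains \<gamma> where "\<And>x. x \<in> D \<Longrightarrow> \<gamma> x 0 = x" "\<And>x n. x \<in> D \<Longrightarrow> \<gamma> x n \<in> D"
    "\<And>x n. x \<in> D \<Longrightarrow> dist (\<gamma> x n) (\<gamma> x (Suc n)) \<le> \<alpha>"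
    "\<And>v. finite {(x, n). x \<in> D \<and> \<gamma> x n = v}"
proof -
  define G where "G = graph_edges D \<alpha>"
  have G: "x \<in> D" "y \<in> D" "dist x y \<le> \<alpha>" if "(x, y) \<in> G" for x y using that by (auto simp: G_def graph_edges_def)
  have G_sym: "(y, x) \<in> G" if "(x, y) \<in> G" for x y using that by (auto simp: G_def graph_edges_def dist_commute)
  have G_fin: "finite (G `` {x})" for x
    by (rule finite_subset[OF _ loc[of x \<alpha>]]) (use G in auto)
  define o' :: 'a where "o' = undefined"
  \<comment> \<open>The radius -1 makes \<open>F 0\<close> empty, so that every point of
    \<open>D\<close> is good for 0 and a largest good index exists.\<close>
  define F where "F k = D \<inter> cball o' (real k - 1)" for k
  have F_fin: "finite (F k)" for k unfolding F_def by (rule loc)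
  have F_mono: "F k \<subseteq> F l" if "k \<le> l" for k l using that by (auto simp: F_def)
  have F_ex: "\<exists>k. x \<in> F k" if "x \<in> D" for x
  proof -
    obtain n where "dist o' x + 1 \<le> real n" using real_arch_simple by blast
    then have "x \<in> F n" using that by (simp add: F_def)
    then show ?thesis ..
  qed
  define H where "H k = G \<inter> (D - F k) \<times> (D - F k)" for k
  have H_sym: "sym (H k)" for k using G_sym by (auto simp: H_def sym_def)
  have H_in: "y \<in> D - F k" if "(x, y) \<in> (H k)\<^sup>*" "x \<in> D - F k" for x y k
    using that by (induction rule: rtrancl_induct) (auto simp: H_def)
  define good where "good x k \<longleftrightarrow> x \<notin> F k \<and> infinite ((H k)\<^sup>* `` {x})" for x k
  have inf: "infinite (G\<^sup>* `` {x})" if "x \<in> D" for x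
    using comp that by (auto simp: no_finite_components_def connected_components_def G_def)
  have good0: "good x 0" if "x \<in> D" for x
  proof -
    have "H 0 = G" using G by (auto simp: H_def F_def)
    then show ?thesis using inf[OF that] by (simp add: good_def F_def)
  qed
  have good_bound: "\<exists>b. \<forall>k. good x k \<longrightarrow> k \<le> b" if x: "x \<in> D" for x
  proof -
    obtain b where "x \<in> F b" using F_ex[OF x] by blast
    then have "\<not> good x k" if "b \<le> k" for k using F_mono[OF that] by (auto simp: good_def)
    then show ?thesis by (metis nat_le_linear)
  qed
  define \<kappa> where "\<kappa> x = (GREATEST k. good x k)" for x
  have \<kappa>: "good x (\<kappa> x)" if "x \<in> D" for x
  proof -
    obtain b where b: "\<forall>k. good x k \<longrightarrow> k \<le> b" using good_bound[OF \<open>x \<in> D\<close>] ..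
    show ?thesis unfolding \<kappa>_def by (rule GreatestI_nat[where P = "good x", OF good0[OF \<open>x \<in> D\<close>], of b]) (use b in blast)
  qed
  have \<kappa>_max: "k \<le> \<kappa> x" if "x \<in> D" "good x k" for x k
  proof -
    obtain b where b: "\<forall>k. good x k \<longrightarrow> k \<le> b" using good_bound[OF \<open>x \<in> D\<close>] ..
    show ?thesis unfolding \<kappa>_def by (rule Greatest_le_nat[where P = "good x", OF \<open>good x k\<close>, of b]) (use b in blast)
  qed
  have "\<exists>s. s 0 = x \<and> (\<forall>n. (s n, s (Suc n)) \<in> H (\<kappa> x)) \<and> inj s" if "x \<in> D" for x
  proof -
    have "finite (H (\<kappa> x) `` {v})" for v by (rule finite_subset[OF _ G_fin[of v]]) (auto simp: H_def)
    moreover have "infinite ((H (\<kappa> x))\<^sup>* `` {x})" using \<kappa>[OF that] by (simp add: good_def)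
    ultimately show ?thesis using geodesic_ray by metis
  qed
  then obtain \<gamma> where \<gamma>: "\<And>x. x \<in> D \<Longrightarrow> \<gamma> x 0 = x" "\<And>x n. x \<in> D \<Longrightarrow> (\<gamma> x n, \<gamma> x (Suc n)) \<in> H (\<kappa> x)"
    "\<And>x. x \<in> D \<Longrightarrow> inj (\<gamma> x)" by metis
  \<comment> \<open>A finite component of the complement of \<open>F j\<close> is not a component of
    the whole graph, so it contains a neighbour of \<open>F j\<close>. There are finitely many such
    neighbours, and each accounts for a single finite component.\<close>
  have enclosed: "finite {x \<in> D. \<not> good x j}" for j
  proof -
    define N where "N = {y. (\<exists>z\<in>F j. (y, z) \<in> G) \<and> finite ((H j)\<^sup>* `` {y})}"
    have "N \<subseteq> (\<Union>z\<in>F j. G `` {z})" using G_sym by (auto simp: N_def)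
    then have N_fin: "finite N" using F_fin G_fin by (auto intro: finite_subset)
    have "{x \<in> D. \<not> good x j} \<subseteq> F j \<union> (\<Union>y\<in>N. (H j)\<^sup>* `` {y})"
    proof
      fix x assume "x \<in> {x \<in> D. \<not> good x j}"
      then have x: "x \<in> D" "x \<in> F j \<or> finite ((H j)\<^sup>* `` {x})" by (auto simp: good_def)
      show "x \<in> F j \<union> (\<Union>y\<in>N. (H j)\<^sup>* `` {y})"
      proof (cases "x \<in> F j")
        case False
        then have fin: "finite ((H j)\<^sup>* `` {x})" using x by blast
        have "\<not> G\<^sup>* `` {x} \<subseteq> (H j)\<^sup>* `` {x}" using finite_subset[OF _ fin] inf[OF x(1)] by blast
        then obtain u where u: "(x, u) \<in> G\<^sup>*" "(x, u) \<notin> (H j)\<^sup>*" by blast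
        have "\<exists>y z. (x, y) \<in> (H j)\<^sup>* \<and> (y, z) \<in> G \<and> z \<in> F j"
          using u
        proof (induction rule: rtrancl_induct)
          case (step y z)
          show ?case
          proof (cases "(x, y) \<in> (H j)\<^sup>*")
            case True
            have "y \<in> D - F j" using H_in[OF True] x(1) False by blast
            moreover have "(y, z) \<notin> H j" using True step.prems by (meson rtrancl.rtrancl_into_rtrancl)
            ultimately have "z \<in> F j" using step.hyps(2) G(2) by (auto simp: H_def)
            then show ?thesis using True step.hyps(2) by blast
          qed (use step.IH in blast)
        qed simp
        then obtain y z where yz: "(x, y) \<in> (H j)\<^sup>*" "(y, z) \<in> G" "z \<in> F j" by blast
        have yx: "(y, x) \<in> (H j)\<^sup>*" using yz(1) H_sym by (metis sym_rtrancl symE)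
        have "(H j)\<^sup>* `` {y} \<subseteq> (H j)\<^sup>* `` {x}" using yz(1) by (auto intro: rtrancl_trans)
        then have "y \<in> N" using yz fin finite_subset by (auto simp: N_def)
        then show ?thesis using yx by blast
      qed simp
    qed
    moreover have "finite (F j \<union> (\<Union>y\<in>N. (H j)\<^sup>* `` {y}))" using F_fin N_fin by (auto simp: N_def)
    ultimately show ?thesis using finite_subset by blast
  qed
  have \<gamma>_in: "\<gamma> x n \<in> D - F (\<kappa> x)" if "x \<in> D" for x n
    using \<gamma>(2)[OF that, of n] by (auto simp: H_def)
  show ?thesis
  proof (rule that[of \<gamma>])
    fix v
    show "finite {(x, n). x \<in> D \<and> \<gamma> x n = v}"
    proof (cases "v \<in> D")
      case True
      then obtain j where j: "v \<in> F j" using F_ex by blast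
      have "fst ` {(x, n). x \<in> D \<and> \<gamma> x n = v} \<subseteq> {x \<in> D. \<not> good x j}"
      proof clarsimp
        fix x n assume x: "x \<in> D" "v = \<gamma> x n" "good x j"
        have "j \<le> \<kappa> x" using \<kappa>_max x by blast
        then have "v \<in> F (\<kappa> x)" using F_mono j by blast
        then show False using \<gamma>_in[OF x(1), of n] x(2) by blast
      qed
      \<comment> \<open>Rays are injective, so each of them passes \<open>v\<close> at most
        once.\<close>
      moreover have "inj_on fst {(x, n). x \<in> D \<and> \<gamma> x n = v}"
        using \<gamma>(3) by (auto simp: inj_on_def)
      ultimately show ?thesis using enclosed[of j] by (meson finite_imageD finite_subset)
    next
      case False
      then have "{(x, n). x \<in> D \<and> \<gamma> x n = v} = {}" using \<gamma>_in by auto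
      then show ?thesis by (simp only: finite.emptyI)
    qed
  qed (use \<gamma> \<gamma>_in G(3) in \<open>auto simp: H_def\<close>)
qed


section \<open>The Eilenberg swindle\<close>

context inner_space
begin

lemma hspan_expansion:
  assumes F: "finite I" and b: "orthonormal I b" and x: "x \<in> hspan E (b ` I)" and z: "z \<in> hcarrier E"
  shows "hinner E z x = (\<Sum>i\<in>I. hinner E z (b i) * hinner E (b i) x)"
proof -
  note bc = orthonormal_closed[OF b]
  have "x \<in> hcarrier E \<and> hinner E z x = (\<Sum>i\<in>I. hinner E z (b i) * hinner E (b i) x)"
    using x
  proof induction
    case zero
    show ?case using z bc by (simp add: inner_simps)
  next
    case (base x)
    then obtain j where j: "j \<in> I" "x = b j" by blast
    have "(\<Sum>i\<in>I. hinner E z (b i) * hinner E (b i) x) = (\<Sum>i\<in>I. if i = j then hinner E z (b j) else 0)"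
      using j by (intro sum.cong refl) (auto simp: orthonormal_inner[OF b])
    also have "\<dots> = hinner E z x" using j F by simp
    finally show ?case using j bc by simp
  next
    case (add x y)
    then show ?case using z bc by (simp add: inner_simps distrib_left sum.distrib)
  next
    case (scale x c)
    then show ?case using z bc by (simp add: inner_simps sum_distrib_left mult.left_commute)
  qed
  then show ?thesis ..
qed

text \<open>Gram-Schmidt inside the subspace \<open>S\<close>, which by hypothesis is never
  exhausted by a finite orthonormal family.\<close>

lemma orthonormal_sequence:
  assumes S: "S \<subseteq> hcarrier E" "hzero E \<in> S" "\<And>x y. x \<in> S \<Longrightarrow> y \<in> S \<Longrightarrow> hadd E x y \<in> S"
      "\<And>c x. x \<in> S \<Longrightarrow> hscale E c x \<in> S"
    and inf: "\<And>n b. orthonormal {..<n::nat} b \<Longrightarrow> b ` {..<n} \<subseteq> S \<Longrightarrow> \<exists>x\<in>S. x \<notin> hspan E (b ` {..<n})"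
  obtains b :: "nat \<Rightarrow> 'v" where "orthonormal UNIV b" "range b \<subseteq> S"
proof -
  have step: "\<exists>y. y \<in> S \<and> orthonormal {..<Suc n} (b(n := y))"
    if b: "orthonormal {..<n::nat} b" "b ` {..<n} \<subseteq> S" for n b
  proof -
    obtain x where x: "x \<in> S" "x \<notin> hspan E (b ` {..<n})" using inf[OF b] by blast
    have xE [simp]: "x \<in> hcarrier E" using x S by blast
    note bc = orthonormal_closed[OF b(1)]
    obtain w where w: "w \<in> hcarrier E" "w \<in> hspan E (b ` {..<n})"
      "\<And>z. z \<in> hcarrier E \<Longrightarrow> hinner E z w = (\<Sum>i\<in>{..<n}. hinner E (b i) x * hinner E z (b i))"
      using finite_combination[of "{..<n}" b "\<lambda>i. hinner E (b i) x"] bc by blast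
    have wS: "w \<in> S" using w(2) by induction (use b(2) S in auto)
    define y where "y = hdiff E x w"
    have yE: "y \<in> hcarrier E" using w by (simp add: y_def)
    have yS: "y \<in> S" unfolding y_def hdiff_def using S x wS by blast
    have bw: "hinner E (b j) w = hinner E (b j) x" if "j < n" for j
    proof -
      have "hinner E (b j) w = (\<Sum>i\<in>{..<n}. if i = j then hinner E (b j) x else 0)"
        unfolding w(3)[OF bc[OF lessThan_iff[THEN iffD2, OF that]]]
        using that by (intro sum.cong refl) (simp add: orthonormal_inner[OF b(1)])
      then show ?thesis using that by simp
    qed
    have by0: "hinner E (b j) y = 0" if "j < n" for j
      using that bw bc w by (simp add: y_def inner_simps)
    have "hnorm E y \<noteq> 0"
    proof
      assume "hnorm E y = 0"
      then have "y = hzero E" using norm_eq_zeroD yE by blast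
      then have "x = w" using w inner_diff_right[of _ x w] by (intro inner_ext) (auto simp: y_def inner_simps)
      then show False using w x by blast
    qed
    then have pos: "hnorm E y > 0" using norm_nonneg[OF yE] by linarith
    define y' where "y' = hscale E (complex_of_real (1 / hnorm E y)) y"
    have y': "y' \<in> hcarrier E" "y' \<in> S" using yE yS S by (auto simp: y'_def)
    have "hnorm E y' = 1" using pos yE by (simp add: y'_def norm_scale norm_divide)
    then have y'1: "hinner E y' y' = 1" using inner_self[OF y'(1)] by simp
    have by': "hinner E (b j) y' = 0" "hinner E y' (b j) = 0" if "j < n" for j
      using that by0[OF that] bc yE inner_commute[of y' "b j"] y'(1) by (simp_all add: y'_def inner_simps)
    have "orthonormal {..<Suc n} (b(n := y'))"
      using b(1) y' y'1 by' unfolding orthonormal_def by (auto simp: less_Suc_eq)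
    then show ?thesis using y' by blast
  qed
  \<comment> \<open>The recursion runs over functions \<open>B n\<close> whose values below
    \<open>n\<close> are final; the limit takes its value at \<open>i\<close> from
    \<open>B (Suc i)\<close>.\<close>
  define P where "P n b \<longleftrightarrow> orthonormal {..<n} b \<and> b ` {..<n} \<subseteq> S" for n :: nat and b :: "nat \<Rightarrow> 'v"
  have "\<exists>B. \<forall>n. P n (B n) \<and> (\<exists>y. B (Suc n) = (B n)(n := y))"
  proof (rule dependent_nat_choice[of P "\<lambda>n b b'. \<exists>y. b' = b(n := y)"])
    show "\<exists>b. P 0 b" by (auto simp: P_def orthonormal_def)
    fix b n assume "P n b"
    then obtain y where "y \<in> S" "orthonormal {..<Suc n} (b(n := y))"
      using step[of n b] unfolding P_def by blast
    moreover have "(b(n := y)) ` {..<Suc n} \<subseteq> S" using \<open>P n b\<close> \<open>y \<in> S\<close> by (auto simp: P_def less_Suc_eq)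
    ultimately show "\<exists>b'. P (Suc n) b' \<and> (\<exists>y. b' = b(n := y))" by (intro exI[of _ "b(n := y)"]) (auto simp: P_def)
  qed
  then obtain B where B: "\<And>n. P n (B n)" "\<And>n. \<exists>y. B (Suc n) = (B n)(n := y)" by blast
  have stable: "B (n + k) i = B n i" if "i < n" for n k i
  proof (induction k)
    case (Suc k)
    obtain y where "B (Suc (n + k)) = (B (n + k))(n + k := y)" using B(2) by blast
    then show ?case using Suc that by simp
  qed simp
  define b where "b i = B (Suc i) i" for i
  have bB: "b i = B n i" if "i < n" for i n
    using stable[of i "Suc i" "n - Suc i"] that by (simp add: b_def)
  have "orthonormal UNIV b"
    unfolding orthonormal_def
  proof (intro conjI ballI)
    fix i j
    have "orthonormal {..<Suc (max i j)} (B (Suc (max i j)))" using B(1) by (simp add: P_def)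
    then show "hinner E (b i) (b j) = (if i = j then 1 else 0)" "b i \<in> hcarrier E"
      unfolding orthonormal_def by (simp_all add: bB[of _ "Suc (max i j)"])
  qed
  moreover have "range b \<subseteq> S"
  proof clarsimp
    fix i show "b i \<in> S" using B(1)[of "Suc i"] by (auto simp: P_def b_def)
  qed
  ultimately show ?thesis using that by blast
qed

end

context roe_space
begin

theorem swindle:
  assumes loc: "\<And>x r. finite (D \<inter> cball x r)" and comp: "no_finite_components D \<alpha>"
    and D0: "D0 \<subseteq> D" and disj: "\<And>u v. u \<in> D \<Longrightarrow> v \<in> D \<Longrightarrow> u \<noteq> v \<Longrightarrow> cball u r \<inter> cball v r = {}"
    and \<phi>: "orthonormal D0 \<phi>" "\<And>x. x \<in> D0 \<Longrightarrow> supported (\<phi> x) (cball x R)"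
    and inf: "\<And>v n b. \<lbrakk>v \<in> D; orthonormal {..<n::nat} b; \<And>i. i < n \<Longrightarrow> supported (b i) (cball v r)\<rbrakk>
      \<Longrightarrow> \<exists>F\<in>hcarrier L. supported F (cball v r) \<and> F \<notin> hspan L (b ` {..<n})"
  shows "transport D0 \<phi> \<phi> \<in> algebraic_roe"
    and "K0_class (roe_algebra K M) (transport D0 \<phi> \<phi>) = \<one>\<^bsub>K0 (roe_algebra K M)\<^esub>"
proof -
  interpret A: star_alg "roe_algebra K M" by (rule star_alg_roe_algebra)
  obtain \<gamma> where \<gamma>: "\<And>x. x \<in> D \<Longrightarrow> \<gamma> x 0 = x" "\<And>x n. x \<in> D \<Longrightarrow> \<gamma> x n \<in> D"
    "\<And>x n. x \<in> D \<Longrightarrow> dist (\<gamma> x n) (\<gamma> x (Suc n)) \<le> \<alpha>"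
    "\<And>v. finite {(x, n). x \<in> D \<and> \<gamma> x n = v}"
    using rays_to_infinity[OF loc comp] by blast
  have "\<exists>b :: nat \<Rightarrow> _. orthonormal UNIV b \<and> range b \<subseteq> {F \<in> hcarrier L. supported F (cball v r)}" if v: "v \<in> D" for v
  proof (rule orthonormal_sequence[of "{F \<in> hcarrier L. supported F (cball v r)}"])
    fix n :: nat and b assume "orthonormal {..<n} b" "b ` {..<n} \<subseteq> {F \<in> hcarrier L. supported F (cball v r)}"
    then show "\<exists>x\<in>{F \<in> hcarrier L. supported F (cball v r)}. x \<notin> hspan L (b ` {..<n})"
      using inf[OF v, of n b] by blast
  qed (auto simp: supported_zero supported_add supported_scale)
  then obtain \<Psi> where \<Psi>: "\<And>v. v \<in> D \<Longrightarrow> orthonormal UNIV (\<Psi> v :: nat \<Rightarrow> _)"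
    "\<And>v j. v \<in> D \<Longrightarrow> supported (\<Psi> v j) (cball v r)" by (metis (mono_tags, lifting) mem_Collect_eq range_subsetD)
  have \<Psi>o: "orthonormal (D \<times> UNIV) (\<lambda>(v, j). \<Psi> v j)"
    unfolding orthonormal_def
  proof (intro conjI ballI)
    fix k assume "k \<in> D \<times> (UNIV :: nat set)"
    then obtain u i where k: "k = (u, i)" and u: "u \<in> D" by auto
    show "(\<lambda>(v, j). \<Psi> v j) k \<in> hcarrier L" using orthonormal_closed[OF \<Psi>(1)[OF u]] by (simp add: k)
    fix l assume "l \<in> D \<times> (UNIV :: nat set)"
    then obtain v j where l: "l = (v, j)" and v: "v \<in> D" by auto
    show "hinner L ((\<lambda>(v, j). \<Psi> v j) k) ((\<lambda>(v, j). \<Psi> v j) l) = (if k = l then 1 else 0)"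
      using orthonormal_inner[OF \<Psi>(1)[OF u]] supported_inner_zero[OF \<Psi>(2)[OF u] \<Psi>(2)[OF v]] disj[OF u v]
      by (cases "u = v") (auto simp: k l)
  qed
  \<comment> \<open>The pairs whose vector is to live near \<open>v\<close>. Being finite, this set
    is enumerated injectively by \<open>to_nat_on\<close>, which assigns different members of
    \<open>\<Psi> v\<close> to different pairs.\<close>
  define H where "H v = {(x, n). x \<in> D0 \<and> \<gamma> x (Suc n) = v}" for v
  have H_fin: "finite (H v)" for v
  proof (rule finite_subset)
    show "H v \<subseteq> (\<lambda>(x, n). (x, n - 1)) ` {(x, n). x \<in> D \<and> \<gamma> x n = v}"
    proof
      fix y assume "y \<in> H v"
      then obtain x n where "y = (x, n)" "x \<in> D0" "\<gamma> x (Suc n) = v" by (auto simp: H_def)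
      then show "y \<in> (\<lambda>(x, n). (x, n - 1)) ` {(x, n). x \<in> D \<and> \<gamma> x n = v}"
        using D0 by (intro image_eqI[of _ _ "(x, Suc n)"]) auto
    qed
  qed (use \<gamma>(4) in simp)
  define I where "I = D0 \<times> (UNIV :: nat set)"
  define loc_of where "loc_of = (\<lambda>(x, n). \<gamma> x (Suc n))"
  define g where "g i = (loc_of i, to_nat_on (H (loc_of i)) i)" for i
  have IH: "i \<in> H (loc_of i)" if "i \<in> I" for i using that by (auto simp: I_def H_def loc_of_def)
  have g: "g ` I \<subseteq> D \<times> UNIV" "inj_on g I"
  proof -
    show "g ` I \<subseteq> D \<times> UNIV" using D0 \<gamma>(2) by (auto simp: g_def I_def loc_of_def)
    show "inj_on g I"
    proof (rule inj_onI)
    fix i j assume ij: "i \<in> I" "j \<in> I" "g i = g j"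
    then have "loc_of i = loc_of j" "to_nat_on (H (loc_of i)) i = to_nat_on (H (loc_of i)) j" by (auto simp: g_def)
    then show "i = j"
      using IH[OF ij(1)] IH[OF ij(2)] inj_on_to_nat_on[OF countable_finite[OF H_fin[of "loc_of i"]]]
      by (metis inj_on_eq_iff)
    qed
  qed
  define \<psi> where "\<psi> i = (\<lambda>(v, j). \<Psi> v j) (g i)" for i
  have \<psi>o: "orthonormal I \<psi>" unfolding \<psi>_def by (rule orthonormal_reindex[OF \<Psi>o g])
  have \<psi>s: "supported (\<psi> i) (cball (loc_of i) r)" if "i \<in> I" for i
    using that \<Psi>(2)[of "loc_of i"] D0 \<gamma>(2) by (auto simp: \<psi>_def g_def I_def loc_of_def)
  have lf: "locally_finite I loc_of"
    unfolding locally_finite_def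
  proof (intro allI)
    fix x r
    have "{i \<in> I. loc_of i \<in> cball x r} \<subseteq> (\<Union>v\<in>D \<inter> cball x r. H v)"
      using D0 \<gamma>(2) by (auto simp: I_def loc_of_def H_def)
    then show "finite {i \<in> I. loc_of i \<in> cball x r}" using H_fin loc by (auto intro: finite_subset)
  qed
  have lf0: "locally_finite D0 (\<lambda>x. x)"
    unfolding locally_finite_def using D0 by (auto intro: finite_subset[OF _ loc])
  \<comment> \<open>\<open>I\<close> is the disjoint union of the starting indices and the shifted
    ones. Hence the ranges of \<open>a\<close> and \<open>b\<close> are orthogonal and together make
    up the range of \<open>?q\<close>.\<close>
  let ?s = "\<lambda>(x, n). (x, Suc n)" and ?z = "\<lambda>x. (x, 0::nat)"
  have sI: "?s ` I \<subseteq> I" "?z ` D0 \<subseteq> I" "inj_on ?s I" "inj_on ?z D0" and I_Un: "?z ` D0 \<union> ?s ` I = I" and I_Int: "?z ` D0 \<inter> ?s ` I = {}"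
  proof -
    show "?z ` D0 \<union> ?s ` I = I"
    proof (intro equalityI subsetI)
      fix i assume "i \<in> I"
      then obtain x n where "i = (x, n)" "x \<in> D0" by (auto simp: I_def)
      then show "i \<in> ?z ` D0 \<union> ?s ` I" by (cases n) (auto simp: I_def intro!: image_eqI[of _ ?s "(x, n - 1)"])
    qed (auto simp: I_def)
  qed (auto simp: I_def inj_on_def)
  note o0 = orthonormal_reindex[OF \<psi>o sI(2,4)] and oS = orthonormal_reindex[OF \<psi>o sI(1,3)]
  define a b where "a = transport D0 (\<lambda>x. \<psi> (?z x)) \<phi>" and "b = transport I (\<lambda>i. \<psi> (?s i)) \<psi>"
  define R' where "R' = max R r"
  have rR: "cball x R \<subseteq> cball x R'" "cball x r \<subseteq> cball x R'" for x by (auto simp: R'_def)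
  have a: "a \<in> algebraic_roe"
    unfolding a_def
  proof (rule transport_algebraic_roe[OF o0 \<phi>(1)])
    show "locally_finite D0 (\<lambda>x. loc_of (?z x))"
      by (rule locally_finite_close[OF lf0, where \<alpha> = \<alpha>]) (use \<gamma>(1) \<gamma>(3)[of _ 0] D0 in \<open>auto simp: loc_of_def subset_iff\<close>)
    fix x assume x: "x \<in> D0"
    show "dist (loc_of (?z x)) x \<le> \<alpha>" using \<gamma>(1)[of x] \<gamma>(3)[of x 0] x D0 by (auto simp: loc_of_def dist_commute subset_iff)
    show "supported (\<psi> (?z x)) (cball (loc_of (?z x)) R')"
      by (rule supported_mono[OF \<psi>s rR(2)]) (use x in \<open>simp add: I_def\<close>)
    show "supported (\<phi> x) (cball x R')" by (rule supported_mono[OF \<phi>(2)[OF x] rR(1)])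
  qed
  have b: "b \<in> algebraic_roe"
    unfolding b_def
  proof (rule transport_algebraic_roe[OF oS \<psi>o])
    show d: "dist (loc_of (?s i)) (loc_of i) \<le> \<alpha>" if "i \<in> I" for i
      using that \<gamma>(3) D0 by (auto simp: I_def loc_of_def dist_commute subset_iff)
    show "locally_finite I (\<lambda>i. loc_of (?s i))"
      by (rule locally_finite_close[OF lf, where \<alpha> = \<alpha>]) (use d in \<open>auto simp: dist_commute\<close>)
    fix i assume i: "i \<in> I"
    show "supported (\<psi> (?s i)) (cball (loc_of (?s i)) R')"
      by (rule supported_mono[OF \<psi>s rR(2)]) (use i sI(1) in blast)
    show "supported (\<psi> i) (cball (loc_of i) R')" by (rule supported_mono[OF \<psi>s[OF i] rR(2)])
  qed
  let ?p = "transport D0 \<phi> \<phi>" and ?q = "transport I \<psi> \<psi>"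
  show p: "?p \<in> algebraic_roe"
    by (rule transport_algebraic_roe[OF \<phi>(1) \<phi>(1) lf0, where q = "\<lambda>x. x" and \<alpha> = 0 and R = R]) (use \<phi>(2) in auto)
  have aa: "hadjoint L a = transport D0 \<phi> (\<lambda>x. \<psi> (?z x))" unfolding a_def by (rule transport_adjoint[OF o0 \<phi>(1)])
  have bb: "hadjoint L b = transport I \<psi> (\<lambda>i. \<psi> (?s i))" unfolding b_def by (rule transport_adjoint[OF oS \<psi>o])
  show "K0_class (roe_algebra K M) ?p = \<one>\<^bsub>K0 (roe_algebra K M)\<^esub>"
  proof (rule A.K0_class_eq_oneI[where a = a and b = b and q = ?q]; (unfold roe_algebra_simps)?)
    show "a \<in> norm_closure L algebraic_roe" "b \<in> norm_closure L algebraic_roe"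
      using a b by (auto intro: algebraic_roe_carrier)
    show "hadjoint L a \<otimes>\<^bsub>operator_algebra L\<^esub> a = ?p" unfolding aa unfolding a_def by (rule transport_mult[OF \<phi>(1) o0 \<phi>(1)])
    show "hadjoint L b \<otimes>\<^bsub>operator_algebra L\<^esub> b = ?q" unfolding bb unfolding b_def by (rule transport_mult[OF \<psi>o oS \<psi>o])
    show "?p \<otimes>\<^bsub>operator_algebra L\<^esub> ?p = ?p" by (rule transport_mult[OF \<phi>(1) \<phi>(1) \<phi>(1)])
    show "?q \<otimes>\<^bsub>operator_algebra L\<^esub> ?q = ?q" by (rule transport_mult[OF \<psi>o \<psi>o \<psi>o])
    show "hadjoint L a \<otimes>\<^bsub>operator_algebra L\<^esub> b = \<zero>\<^bsub>operator_algebra L\<^esub>"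
      unfolding aa b_def
    proof (rule transport_mult_zero[OF \<phi>(1) o0 oS \<psi>o])
      fix x i assume "x \<in> D0" "i \<in> I"
      then show "hinner L (\<psi> (?z x)) (\<psi> (?s i)) = 0"
        using sI(1,2) by (subst orthonormal_inner[OF \<psi>o]) (auto split: prod.splits)
    qed
    have "a \<otimes>\<^bsub>operator_algebra L\<^esub> hadjoint L a = transport D0 (\<lambda>x. \<psi> (?z x)) (\<lambda>x. \<psi> (?z x))"
      unfolding aa unfolding a_def by (rule transport_mult[OF o0 \<phi>(1) o0])
    also have "\<dots> = transport (?z ` D0) \<psi> \<psi>"
      by (rule transport_reindex[symmetric]) (use orthonormal_subset[OF \<psi>o sI(2)] sI(4) in auto)
    finally have 1: "a \<otimes>\<^bsub>operator_algebra L\<^esub> hadjoint L a = transport (?z ` D0) \<psi> \<psi>" .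
    have "b \<otimes>\<^bsub>operator_algebra L\<^esub> hadjoint L b = transport I (\<lambda>i. \<psi> (?s i)) (\<lambda>i. \<psi> (?s i))"
      unfolding bb unfolding b_def by (rule transport_mult[OF oS \<psi>o oS])
    also have "\<dots> = transport (?s ` I) \<psi> \<psi>"
      by (rule transport_reindex[symmetric]) (use orthonormal_subset[OF \<psi>o sI(1)] sI(3) in auto)
    finally have 2: "b \<otimes>\<^bsub>operator_algebra L\<^esub> hadjoint L b = transport (?s ` I) \<psi> \<psi>" .
    show "a \<otimes>\<^bsub>operator_algebra L\<^esub> hadjoint L a \<oplus>\<^bsub>operator_algebra L\<^esub> b \<otimes>\<^bsub>operator_algebra L\<^esub> hadjoint L b = ?q"
      unfolding 1 2 using transport_Un[of "?z ` D0" "?s ` I" \<psi> \<psi>] I_Un I_Int \<psi>o by simp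
  qed
qed

end

section \<open>Wannier bases on non-discrete spaces\<close>

text \<open>Bounded geometry concerns balls of positive radius centred in \<open>D\<close>. A ball
  around \<open>x\<close> that meets \<open>D\<close> in \<open>y\<close> has its points of
  \<open>D\<close> within \<open>2 * r + 1\<close> of \<open>y\<close>.\<close>

lemma bounded_geometry_locally_finite:
  assumes "bounded_geometry D"
  shows "finite (D \<inter> cball x r)"
proof (cases "D \<inter> cball x r = {}")
  case False
  then obtain y where y: "y \<in> D" "dist x y \<le> r" by auto
  then have r: "0 \<le> r" using zero_le_dist order_trans by blast
  have "D \<inter> cball x r \<subseteq> D \<inter> cball y (2 * r + 1)"
  proof
    fix z assume "z \<in> D \<inter> cball x r"
    then show "z \<in> D \<inter> cball y (2 * r + 1)" using y dist_triangle[of y z x] by (auto simp: dist_commute)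
  qed
  moreover have "0 < 2 * r + 1" using r by simp
  then have "finite (D \<inter> cball y (2 * r + 1))" using assms y(1) unfolding bounded_geometry_def by blast
  ultimately show ?thesis by (rule finite_subset)
qed simp

lemma roe_space_borel:
  fixes M :: "'a::metric_space measure"
  assumes "sets M = sets borel" "\<And>(x :: 'a) r. compact (cball x r)"
  shows "roe_space TYPE(complex) M"
proof unfold_locales
  have sp: "space M = UNIV" using sets_eq_imp_space_eq[OF assms(1)] by simp
  obtain S :: "complex set" where S: "countable S" "\<And>X. open X \<Longrightarrow> X \<noteq> {} \<Longrightarrow> \<exists>s\<in>S. s \<in> X"
    using countable_dense_exists by blast
  have "z \<in> closure S" for z
    unfolding closure_approachable
  proof (intro allI impI)
    fix \<epsilon> :: real assume "\<epsilon> > 0"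
    then show "\<exists>y\<in>S. dist y z < \<epsilon>" using S(2)[of "ball z \<epsilon>"] by (auto simp: dist_commute)
  qed
  with S(1) show "\<exists>S :: complex set. countable S \<and> f ` space M \<subseteq> closure S" for f by blast
  show "compact (space M \<inter> cball x r)" for x r using assms(2) by (simp add: sp)
  show "U \<inter> space M \<in> sets M" if "open U" for U using that assms(1) by (simp add: sp)
qed (auto simp: scaleC_complex_def cinner_complex_def
    intro!: borel_measurable_times measurable_compose[OF _ borel_measurable_continuous_onI[OF continuous_on_cnj[OF continuous_on_id]]])

lemma uniform_discrete_disjoint:
  assumes "uniform_discrete D"
  obtains r where "0 < r" "\<And>u v. u \<in> D \<Longrightarrow> v \<in> D \<Longrightarrow> u \<noteq> v \<Longrightarrow> cball u r \<inter> cball v r = {}"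
proof -
  obtain \<epsilon> where e: "\<epsilon> > 0" "\<And>x y. x \<in> D \<Longrightarrow> y \<in> D \<Longrightarrow> dist x y < \<epsilon> \<Longrightarrow> x = y"
    using assms unfolding uniform_discrete_def by metis
  have "cball u (\<epsilon> / 3) \<inter> cball v (\<epsilon> / 3) = {}" if "u \<in> D" "v \<in> D" "u \<noteq> v" for u v
  proof (rule ccontr)
    assume "\<not> ?thesis"
    then obtain z where "dist u z \<le> \<epsilon> / 3" "dist v z \<le> \<epsilon> / 3" by auto
    then have "dist u v < \<epsilon>" using dist_triangle[of u v z] e(1) by (simp add: dist_commute)
    then show False using e(2) that by blast
  qed
  then show ?thesis using that[of "\<epsilon> / 3"] e(1) by simp
qed

text \<open>Near each point off the ball \<open>rep F\<close> vanishes almost everywhere. By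
  compactness finitely many such neighbourhoods cover a shell \<open>K n\<close>, and the countably
  many shells exhaust the complement of the ball.\<close>

lemma essential_support_AE:
  fixes M :: "'a::metric_space measure"
  assumes cb: "\<And>(x :: 'a) r. compact (cball x r)"
    and sub: "essential_support M F \<subseteq> cball x R"
  shows "AE y in M. y \<notin> cball x R \<longrightarrow> rep F y = 0"
proof -
  define K where "K n = cball x (real n) \<inter> {y. R + 1 / Suc n \<le> dist x y}" for n
  have "AE y in M. y \<in> K n \<longrightarrow> rep F y = 0" for n
  proof -
    have "closed {y. R + 1 / Suc n \<le> dist x y}"
      by (intro closed_Collect_le continuous_intros)
    then have K: "compact (K n)" unfolding K_def using cb by (intro compact_Int_closed)
    have "\<forall>y\<in>K n. \<exists>U. open U \<and> y \<in> U \<and> (AE z in M. z \<in> U \<longrightarrow> rep F z = 0)"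
    proof
      fix y assume "y \<in> K n"
      then have "R + 1 / Suc n \<le> dist x y" by (simp add: K_def)
      moreover have "0 < 1 / real (Suc n)" by simp
      ultimately have "y \<notin> cball x R" unfolding mem_cball by linarith
      then have "y \<notin> essential_support M F" using sub by blast
      then show "\<exists>U. open U \<and> y \<in> U \<and> (AE z in M. z \<in> U \<longrightarrow> rep F z = 0)"
        unfolding essential_support_def by blast
    qed
    then obtain U where U: "\<And>y. y \<in> K n \<Longrightarrow> open (U y) \<and> y \<in> U y \<and> (AE z in M. z \<in> U y \<longrightarrow> rep F z = 0)" by metis
    have "K n \<subseteq> (\<Union>y\<in>K n. U y)" using U by blast
    then obtain T where T: "T \<subseteq> K n" "finite T" "K n \<subseteq> (\<Union>y\<in>T. U y)"
      using compactE_image[OF K, of "K n" U] U by blast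
    have "AE z in M. \<forall>y\<in>T. z \<in> U y \<longrightarrow> rep F z = 0"
      using T(1) U by (intro AE_finite_allI[OF T(2)]) blast
    then show ?thesis by eventually_elim (use T(3) in blast)
  qed
  then have "AE y in M. \<forall>n. y \<in> K n \<longrightarrow> rep F y = 0" unfolding AE_all_countable by blast
  then show ?thesis
  proof eventually_elim
    case (elim y)
    show ?case
    proof
      assume "y \<notin> cball x R"
      then have "0 < dist x y - R" by simp
      then obtain n0 where n0: "1 / real (Suc n0) < dist x y - R" by (rule nat_approx_posE)
      obtain n1 where n1: "dist x y \<le> real n1" using real_arch_simple by blast
      define n where "n = max n0 n1"
      have "1 / real (Suc n) \<le> 1 / real (Suc n0)" by (rule divide_left_mono) (auto simp: n_def)
      then have "y \<in> K n" using n0 n1 by (simp add: K_def n_def)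
      then show "rep F y = 0" using elim by blast
    qed
  qed
qed

text \<open>If finitely many \<open>b i\<close> spanned all functions supported in the ball, then
  multiplication by a bump function living there would have finite rank and be compact, against
  ampleness.\<close>

lemma (in roe_space) ample_infinite_dimensional:
  assumes ample: "\<And>f. f \<in> C0 (space M) \<Longrightarrow> \<exists>x\<in>space M. f x \<noteq> 0 \<Longrightarrow> \<not> compact_operator L (mult_operator M f)"
    and v: "v \<in> space M" and r: "0 < r"
    and b: "orthonormal {..<n::nat} b" and bs: "\<And>i. i < n \<Longrightarrow> supported (b i) (cball v r)"
  shows "\<exists>F\<in>hcarrier L. supported F (cball v r) \<and> F \<notin> hspan L (b ` {..<n})"
proof (rule ccontr)
  assume "\<not> ?thesis"
  then have span: "F \<in> hspan L (b ` {..<n})" if "F \<in> hcarrier L" "supported F (cball v r)" for F using that by blast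
  note bc = orthonormal_closed[OF b]
  define f where "f x = complex_of_real (max 0 (r - dist v x))" for x
  have f: "f \<in> C0 (space M)"
  proof (rule C0_bounded_support[of _ v r])
    show "continuous_on (space M) f" unfolding f_def by (intro continuous_intros)
  qed (auto simp: f_def)
  note bf = C0_multiplier[OF f]
  have fr: "(\<lambda>x. cnj (f x)) = f" by (auto simp: f_def)
  have "compact_operator L (mult_operator M f)"
  proof (rule compact_of_finite_form[of "{..<n}" _ b "\<lambda>i. mult_operator M f (b i)"])
    fix x y assume xy: "x \<in> hcarrier L" "y \<in> hcarrier L"
    have "supported (mult_operator M f y) (cball v r)"
      by (rule supported_mult_set[OF bf xy(2)]) (auto simp: f_def max_def split: if_splits)
    then have "hinner L x (mult_operator M f y) = (\<Sum>i<n. hinner L x (b i) * hinner L (b i) (mult_operator M f y))"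
      using xy mult_carrier[OF bf xy(2)] by (intro hspan_expansion[OF _ b] span) auto
    also have "\<dots> = (\<Sum>i<n. hinner L x (b i) * hinner L (mult_operator M f (b i)) y)"
      using xy bc by (intro sum.cong refl) (simp add: inner_mult_left[OF bf] fr)
    finally show "hinner L x (mult_operator M f y) = (\<Sum>i<n. hinner L x (b i) * hinner L (mult_operator M f (b i)) y)" .
  qed (use bc mult_carrier[OF bf] mult_bounded[OF bf] in auto)
  moreover have "\<exists>x\<in>space M. f x \<noteq> 0" using v r by (intro bexI[of _ v]) (auto simp: f_def)
  ultimately show False using ample[OF f] by blast
qed

text \<open>\<open>essential_support_AE\<close> supplies the localisation that
  \<open>swindle\<close> asks for, and ampleness the infinite dimension.\<close>

theorem wannier_K0_class:
  fixes D :: "'a::metric_space set" and M :: "'a measure"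
  assumes D: "uniform_discrete D" "bounded_geometry D" and comp: "no_finite_components D \<alpha>"
    and M: "proper_metric_measure_space M" "ample_module M"
    and D0: "D0 \<subseteq> D" and \<phi>: "wannier_basis M D0 \<phi>"
  shows "K0_class (roe_algebra TYPE(complex) M) (wannier_projection M D0 \<phi>) = \<one>\<^bsub>K0 (roe_algebra TYPE(complex) M)\<^esub>"
proof -
  have cb: "compact (cball x r)" for x :: 'a and r using M(1) by (simp add: proper_metric_measure_space_def)
  have sp: "space M = UNIV" using M(1) sets_eq_imp_space_eq[of M borel] by (simp add: proper_metric_measure_space_def)
  interpret roe_space M "TYPE(complex)"
    using M(1) by (intro roe_space_borel) (auto simp: proper_metric_measure_space_def)
  obtain r where r: "0 < r" "\<And>u v. u \<in> D \<Longrightarrow> v \<in> D \<Longrightarrow> u \<noteq> v \<Longrightarrow> cball u r \<inter> cball v r = {}"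
    using uniform_discrete_disjoint[OF D(1)] by blast
  obtain R where R: "\<And>x. x \<in> D0 \<Longrightarrow> essential_support M (\<phi> x) \<subseteq> cball x R"
    using \<phi> unfolding wannier_basis_def by blast
  have o: "orthonormal D0 \<phi>" using \<phi> unfolding wannier_basis_def orthonormal_def by blast
  have "wannier_projection M D0 \<phi> = transport D0 \<phi> \<phi>"
    unfolding wannier_projection_def by (rule orthogonal_projection_transport[OF o])
  moreover have "K0_class (roe_algebra TYPE(complex) M) (transport D0 \<phi> \<phi>) = \<one>\<^bsub>K0 (roe_algebra TYPE(complex) M)\<^esub>"
  proof (rule swindle(2)[OF bounded_geometry_locally_finite[OF D(2)] comp D0 r(2) o])
    show "supported (\<phi> x) (cball x R)" if "x \<in> D0" for x
      unfolding supported_def by (rule essential_support_AE[OF cb R[OF that]])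
    have ample: "\<not> compact_operator L (mult_operator M f)" if "f \<in> C0 (space M)" "\<exists>x\<in>space M. f x \<noteq> 0" for f
      using M(2) that unfolding ample_module_def by blast
    fix v n b assume "v \<in> D" "orthonormal {..<n::nat} b" "\<And>i. i < n \<Longrightarrow> supported (b i) (cball v r)"
    then show "\<exists>F\<in>hcarrier L. supported F (cball v r) \<and> F \<notin> hspan L (b ` {..<n})"
      by (intro ample_infinite_dimensional[OF ample _ r(1)]) (simp_all add: sp)
  qed
  ultimately show ?thesis by simp
qed


section \<open>Discrete spaces and stabilisation\<close>

lemma cinner_ext: "(\<And>z. cinner z x = cinner z y) \<Longrightarrow> x = (y :: 'k::complex_hilbert_space)"
  using type_hspace.inner_ext[of x y] by simp

text \<open>A locally finite set is countable, so every function on it has separable range. All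
  subsets are measurable, which settles measurability for targets that are not second
  countable.\<close>

lemma roe_space_count_space:
  fixes D :: "'a::metric_space set"
  assumes fin: "\<And>x r. finite (D \<inter> cball x r)"
  shows "roe_space TYPE('k::complex_hilbert_space) (count_space D)"
proof unfold_locales
  have "\<exists>n. dist undefined x \<le> real n" for x :: 'a by (rule real_arch_simple)
  then have "D \<subseteq> (\<Union>n. D \<inter> cball undefined (real n))" by auto
  moreover have "countable (\<Union>n. D \<inter> cball undefined (real n))" by (rule countable_UN) (simp_all add: countable_finite fin)
  ultimately have D: "countable D" by (rule countable_subset)
  show "\<exists>S :: 'k set. countable S \<and> f ` space (count_space D) \<subseteq> closure S" for f
    using D closure_subset[of "f ` D"] by (intro exI[of _ "f ` D"]) simp
  show "compact (space (count_space D) \<inter> cball x r)" for x r using fin by (simp add: finite_imp_compact)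
qed auto

locale discrete_roe = roe_space "count_space D" K for D :: "'a::metric_space set" and K :: "'k::complex_hilbert_space itself" +
  assumes discrete_finite: "finite (D \<inter> cball x r)"
begin

abbreviation "MD \<equiv> count_space D"

definition delta :: "'a \<Rightarrow> 'k \<Rightarrow> ('a \<Rightarrow> 'k) set" where
  "delta x h = l2_class MD (\<lambda>y. if y = x then h else 0)"

lemma discrete_eqI:
  "\<lbrakk>F \<in> hcarrier L; G \<in> hcarrier L; \<And>x. x \<in> D \<Longrightarrow> rep F x = rep G x\<rbrakk> \<Longrightarrow> F = G"
  by (rule carrier_eqI) (auto simp: AE_count_space)

lemma rep_discrete: "f \<in> l2_functions MD \<Longrightarrow> x \<in> D \<Longrightarrow> rep (l2_class MD f) x = (f x :: 'k)"
  using AE_rep_class[of f] by (simp add: AE_count_space)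

lemma finite_support_l2:
  assumes "finite {x \<in> D. f x \<noteq> (0::'k)}"
  shows "f \<in> l2_functions MD"
proof -
  have "(\<integral>\<^sup>+x. ennreal ((norm (f x))\<^sup>2) \<partial>MD) = (\<Sum>x\<in>{x \<in> D. 0 < ennreal ((norm (f x))\<^sup>2)}. ennreal ((norm (f x))\<^sup>2))"
    by (rule nn_integral_count_space) (rule finite_subset[OF _ assms], auto)
  also have "\<dots> < \<infinity>" by simp
  finally show ?thesis by (simp add: l2_iff)
qed

lemma delta_l2: "(\<lambda>y. if y = x then h else 0 :: 'k) \<in> l2_functions MD"
  by (rule finite_support_l2) (rule finite_subset[of _ "{x}"], auto)

lemma delta_closed [simp, intro]: "delta x h \<in> hcarrier L"
  unfolding delta_def using delta_l2 by auto

lemma rep_delta: "y \<in> D \<Longrightarrow> rep (delta x h) y = (if y = x then h else 0)"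
  unfolding delta_def by (rule rep_discrete[OF delta_l2])

lemma inner_delta:
  assumes "x \<in> D" "F \<in> hcarrier L"
  shows "hinner L (delta x h) F = cinner h (rep F x)"
proof -
  let ?f = "\<lambda>y. cinner (rep (delta x h) y) (rep F y)"
  have sub: "{y \<in> D. ?f y \<noteq> 0} \<subseteq> {x}" by (auto simp: rep_delta split: if_splits)
  have "hinner L (delta x h) F = (\<Sum>y | y \<in> D \<and> ?f y \<noteq> 0. ?f y)"
    unfolding inner_def by (rule lebesgue_integral_count_space_finite_support) (rule finite_subset[OF sub], simp)
  also have "\<dots> = (\<Sum>y\<in>{x}. ?f y)" using sub assms by (intro sum.mono_neutral_left) auto
  finally show ?thesis using assms by (simp add: rep_delta)
qed

lemma supported_discrete: "supported F A \<longleftrightarrow> (\<forall>x\<in>D. x \<notin> A \<longrightarrow> rep F x = 0)"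
  by (simp add: supported_def AE_count_space)

lemma supported_delta: "supported (delta x h) {x}"
  by (auto simp: supported_discrete rep_delta)

lemma discrete_multiplier: "\<lbrakk>\<And>x. x \<in> D \<Longrightarrow> cmod (u x) \<le> B\<rbrakk> \<Longrightarrow> bounded_multiplier u"
  unfolding bounded_multiplier_def by auto

lemma indicator_multiplier: "bounded_multiplier (indicator A)"
  by (rule discrete_multiplier[of _ 1]) (auto simp: indicator_def)

lemma rep_mult_discrete: "\<lbrakk>bounded_multiplier u; F \<in> hcarrier L; x \<in> D\<rbrakk> \<Longrightarrow> rep (mult_operator MD u F) x = scaleC (u x) (rep F x)"
  using rep_mult[of u F] by (simp add: AE_count_space)

lemma rep_hadd_discrete: "\<lbrakk>F \<in> hcarrier L; G \<in> hcarrier L; x \<in> D\<rbrakk> \<Longrightarrow> rep (hadd L F G) x = rep F x + rep G x"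
  using rep_hadd[of F G] by (simp add: AE_count_space)

lemma rep_hscale_discrete: "\<lbrakk>F \<in> hcarrier L; x \<in> D\<rbrakk> \<Longrightarrow> rep (hscale L c F) x = scaleC c (rep F x)"
  using rep_hscale[of F c] by (simp add: AE_count_space)

lemma rep_hzero_discrete: "x \<in> D \<Longrightarrow> rep (hzero L) x = 0"
  using rep_hzero by (simp add: AE_count_space)

lemma orthonormal_delta:
  assumes "norm h = 1" "D0 \<subseteq> D"
  shows "orthonormal D0 (\<lambda>x. delta x h)"
  unfolding orthonormal_def using assms by (auto simp: inner_delta rep_delta cinner_self subset_iff)

text \<open>Evaluation at \<open>v\<close> is linear, so it maps the span of the \<open>b i\<close>
  into a finitely spanned subspace. This misses some \<open>h\<close>, and \<open>delta v h\<close>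
  is then the required vector.\<close>

lemma delta_infinite_dimensional:
  assumes inf: "infinite_dimensional TYPE('k)" and v: "v \<in> D" and b: "\<And>i. i < (n::nat) \<Longrightarrow> b i \<in> hcarrier L"
  shows "\<exists>F\<in>hcarrier L. supported F {v} \<and> F \<notin> hspan L (b ` {..<n})"
proof -
  let ?B = "(\<lambda>i. rep (b i) v) ` {..<n}"
  have "complex_vs.span ?B \<noteq> UNIV" using inf unfolding infinite_dimensional_def by blast
  then obtain h where h: "h \<notin> complex_vs.span ?B" by blast
  have bL: "b ` {..<n} \<subseteq> hcarrier L" using b by auto
  have "rep F v \<in> complex_vs.span ?B" if "F \<in> hspan L (b ` {..<n})" for F
    using that
  proof induction
    case zero
    show ?case using v by (simp add: rep_hzero_discrete complex_vs.span_zero)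
  next
    case (base F)
    then show ?case by (auto intro: complex_vs.span_base)
  next
    case (add F G)
    then show ?case using v hspan_closed[OF bL] by (simp add: rep_hadd_discrete complex_vs.span_add)
  next
    case (scale F c)
    then show ?case using v hspan_closed[OF bL] by (simp add: rep_hscale_discrete complex_vs.span_scale)
  qed
  then have "delta v h \<notin> hspan L (b ` {..<n})" using h v rep_delta[of v v h] by metis
  then show ?thesis using supported_delta by blast
qed

lemma discrete_swindle:
  assumes D: "uniform_discrete D" and comp: "no_finite_components D \<alpha>" and inf: "infinite_dimensional TYPE('k)"
    and D0: "D0 \<subseteq> D" and h: "norm h = 1"
  shows "K0_class (roe_algebra K MD) (transport D0 (\<lambda>x. delta x h) (\<lambda>x. delta x h)) = \<one>\<^bsub>K0 (roe_algebra K MD)\<^esub>"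
proof -
  obtain r where r: "0 < r" "\<And>u v. u \<in> D \<Longrightarrow> v \<in> D \<Longrightarrow> u \<noteq> v \<Longrightarrow> cball u r \<inter> cball v r = {}"
    using uniform_discrete_disjoint[OF D] by blast
  show ?thesis
  proof (rule swindle(2)[OF discrete_finite comp D0 r(2) orthonormal_delta[OF h D0]])
    show "supported (delta x h) (cball x 0)" if "x \<in> D0" for x using supported_delta[of x h] by simp
    fix v n b assume v: "v \<in> D" and b: "orthonormal {..<n::nat} b"
    have "\<exists>F\<in>hcarrier L. supported F {v} \<and> F \<notin> hspan L (b ` {..<n})"
      using orthonormal_closed[OF b] by (intro delta_infinite_dimensional[OF inf v]) auto
    then show "\<exists>F\<in>hcarrier L. supported F (cball v r) \<and> F \<notin> hspan L (b ` {..<n})"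
      using supported_mono[of _ "{v}" "cball v r"] r(1) by auto
  qed
qed

lemma transport_delta_roe:
  assumes "norm h = 1" "D0 \<subseteq> D"
  shows "transport D0 (\<lambda>x. delta x h) (\<lambda>x. delta x h) \<in> algebraic_roe"
proof (rule transport_algebraic_roe[where p = "\<lambda>x. x" and q = "\<lambda>x. x" and \<alpha> = 0 and R = 0])
  show "locally_finite D0 (\<lambda>x. x)"
    unfolding locally_finite_def using assms(2) by (auto intro: finite_subset[OF _ discrete_finite])
qed (use assms orthonormal_delta supported_delta in auto)

lemma rep_transport_delta:
  assumes h: "norm h = 1" and D0: "D0 \<subseteq> D" and F: "F \<in> hcarrier L" and x: "x \<in> D"
  shows "rep (transport D0 (\<lambda>x. delta x h) (\<lambda>x. delta x h) F) x = (if x \<in> D0 then scaleC (cinner h (rep F x)) h else 0)"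
proof -
  note o = orthonormal_delta[OF h D0]
  let ?T = "transport D0 (\<lambda>x. delta x h) (\<lambda>x. delta x h)"
  have T: "?T F \<in> hcarrier L" using transport_closed[OF o o] F by (simp add: op_closed)
  have "cinner k (rep (?T F) x) = cinner k (if x \<in> D0 then scaleC (cinner h (rep F x)) h else 0)" for k
  proof -
    have "cinner k (rep (?T F) x) = hinner L (delta x k) (?T F)" using x T by (simp add: inner_delta)
    also have "\<dots> = (\<Sum>\<^sub>\<infinity>y\<in>D0. hinner L (delta x k) (delta y h) * hinner L (delta y h) F)"
      using F by (simp add: inner_transport[OF o o])
    also have "\<dots> = (\<Sum>\<^sub>\<infinity>y\<in>{x} \<inter> D0. cinner k h * cinner h (rep F x))"
      using D0 x F by (intro infsum_cong_neutral) (auto simp: inner_delta rep_delta subset_iff)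
    also have "\<dots> = cinner k (if x \<in> D0 then scaleC (cinner h (rep F x)) h else 0)"
      by (simp add: cinner_scaleC_right)
    finally show ?thesis .
  qed
  then show ?thesis by (rule cinner_ext)
qed

end

lemma discrete_roe_intro:
  assumes "\<And>x r. finite (D \<inter> cball x r)"
  shows "discrete_roe TYPE('k::complex_hilbert_space) D"
proof -
  interpret roe_space "count_space D" "TYPE('k)" by (rule roe_space_count_space[OF assms])
  show ?thesis by unfold_locales (rule assms)
qed

text \<open>For a unit vector \<open>w\<close> in the range, self-adjointness gives
  \<open>cinner w h = cinner w (e h)\<close>, which is the coefficient of \<open>e h\<close> along
  \<open>w\<close>.\<close>

lemma rank_one_projection_form:
  assumes "rank_one_projection (e :: 'h::complex_hilbert_space \<Rightarrow> 'h)"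
  obtains w where "norm w = 1" "\<And>h. e h = scaleC (cinner w h) w"
proof -
  obtain v where v: "v \<noteq> 0" "range e = complex_vs.span {v}"
    and sa: "\<And>x y. cinner (e x) y = cinner x (e y)" and idem: "\<And>x. e (e x) = e x"
    using assms unfolding rank_one_projection_def by (auto simp: fun_eq_iff)
  define w where "w = scaleC (complex_of_real (1 / norm v)) v"
  have w: "norm w = 1" using v(1) by (simp add: w_def norm_scaleC norm_divide)
  have "w \<in> range e" unfolding v(2) w_def by (intro complex_vs.span_scale complex_vs.span_base) simp
  then have ew: "e w = w" using idem by auto
  have "e h = scaleC (cinner w h) w" for h
  proof -
    have "e h \<in> complex_vs.span {v}" using v(2) by blast
    then obtain c where c: "e h = scaleC c v" by (auto simp: complex_vs.span_singleton)
    have "v = scaleC (complex_of_real (norm v)) w" using v(1) by (simp add: w_def scaleC_scaleC scaleC_one)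
    then have d: "e h = scaleC (c * complex_of_real (norm v)) w" using c by (metis scaleC_scaleC)
    have "cinner w h = cinner w (e h)" using sa[of w h] ew by simp
    also have "\<dots> = c * complex_of_real (norm v)" using w by (simp add: d cinner_scaleC_right cinner_self)
    finally show ?thesis using d by simp
  qed
  with w that show ?thesis by blast
qed

section \<open>Tensoring with a rank one projection\<close>

locale stabilization =
  C: discrete_roe D "TYPE(complex)" + H: discrete_roe D "TYPE('h)"
  for D :: "'a::metric_space set" and e :: "'h::complex_hilbert_space \<Rightarrow> 'h" and w :: 'h +
  assumes w: "norm w = 1" and e: "e h = scaleC (cinner w h) w"
begin

text \<open>\<open>J\<close> embeds scalar functions isometrically as multiples of \<open>w\<close>,
  and \<open>J'\<close> is its adjoint. The tensor product of \<open>T\<close> with \<open>e\<close>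
  factors as \<open>J T J'\<close>, so its properties can be read off from \<open>T\<close>.\<close>

definition J :: "('a \<Rightarrow> complex) set \<Rightarrow> ('a \<Rightarrow> 'h) set" where
  "J F = elementary_tensor (count_space D) F w"

definition J' :: "('a \<Rightarrow> 'h) set \<Rightarrow> ('a \<Rightarrow> complex) set" where
  "J' G = l2_class (count_space D) (\<lambda>x. cinner w (rep G x))"

lemma tensor_l2:
  assumes "F \<in> hcarrier C.L"
  shows "(\<lambda>x. scaleC (rep F x) v) \<in> (l2_functions (count_space D) :: ('a \<Rightarrow> 'h) set)"
  by (rule H.l2_dominated[where w = "\<lambda>x. (norm v)\<^sup>2 * (norm (rep F x))\<^sup>2"])
     (use C.l2_integrable[OF C.rep_l2[OF assms]] in \<open>auto simp: norm_scaleC power_mult_distrib mult.commute\<close>)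

lemma tensor_closed: "F \<in> hcarrier C.L \<Longrightarrow> elementary_tensor (count_space D) F v \<in> hcarrier H.L"
  unfolding elementary_tensor_def using tensor_l2 by blast

lemma rep_tensor: "F \<in> hcarrier C.L \<Longrightarrow> x \<in> D \<Longrightarrow> rep (elementary_tensor (count_space D) F v) x = scaleC (rep F x) (v :: 'h)"
  unfolding elementary_tensor_def using H.rep_discrete[OF tensor_l2] by simp

lemma J_closed [simp]: "F \<in> hcarrier C.L \<Longrightarrow> J F \<in> hcarrier H.L"
  unfolding J_def by (rule tensor_closed)

lemma rep_J: "F \<in> hcarrier C.L \<Longrightarrow> x \<in> D \<Longrightarrow> rep (J F) x = scaleC (rep F x) w"
  unfolding J_def by (rule rep_tensor)

lemma J'_l2:
  assumes "G \<in> hcarrier H.L"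
  shows "(\<lambda>x. cinner w (rep G x)) \<in> l2_functions (count_space D)"
proof (rule C.l2_dominated[where w = "\<lambda>x. (norm (rep G x))\<^sup>2"])
  have "cmod (cinner w h) \<le> norm h" for h using type_hspace.Cauchy_Schwarz[of w h] w by simp
  then show "AE x in count_space D. (norm (cinner w (rep G x)))\<^sup>2 \<le> (norm (rep G x))\<^sup>2"
    by (intro AE_I2 power_mono) auto
qed (use H.l2_integrable[OF H.rep_l2[OF assms]] in auto)

lemma J'_closed [simp]: "G \<in> hcarrier H.L \<Longrightarrow> J' G \<in> hcarrier C.L"
  unfolding J'_def using J'_l2 by blast

lemma rep_J': "G \<in> hcarrier H.L \<Longrightarrow> x \<in> D \<Longrightarrow> rep (J' G) x = cinner w (rep G x)"
  unfolding J'_def using C.rep_discrete[OF J'_l2] by simp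

lemma cw: "cinner w w = 1"
  using w by (simp add: cinner_self)

lemma J'_J [simp]: "F \<in> hcarrier C.L \<Longrightarrow> J' (J F) = F"
  by (rule C.discrete_eqI) (auto simp: rep_J rep_J' cinner_scaleC_right cw)

lemma J_add: "\<lbrakk>F \<in> hcarrier C.L; G \<in> hcarrier C.L\<rbrakk> \<Longrightarrow> J (hadd C.L F G) = hadd H.L (J F) (J G)"
  by (rule H.discrete_eqI) (auto simp: rep_J C.rep_hadd_discrete H.rep_hadd_discrete scaleC_add_left)

lemma J_scale: "F \<in> hcarrier C.L \<Longrightarrow> J (hscale C.L c F) = hscale H.L c (J F)"
  by (rule H.discrete_eqI) (auto simp: rep_J C.rep_hscale_discrete H.rep_hscale_discrete scaleC_scaleC scaleC_complex_def)

lemma J'_add: "\<lbrakk>F \<in> hcarrier H.L; G \<in> hcarrier H.L\<rbrakk> \<Longrightarrow> J' (hadd H.L F G) = hadd C.L (J' F) (J' G)"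
  by (rule C.discrete_eqI) (auto simp: rep_J' C.rep_hadd_discrete H.rep_hadd_discrete cinner_add_right)

lemma J'_scale: "F \<in> hcarrier H.L \<Longrightarrow> J' (hscale H.L c F) = hscale C.L c (J' F)"
  by (rule C.discrete_eqI) (auto simp: rep_J' C.rep_hscale_discrete H.rep_hscale_discrete cinner_scaleC_right scaleC_complex_def)

lemma inner_J:
  assumes "F \<in> hcarrier C.L" "G \<in> hcarrier H.L"
  shows "hinner H.L (J F) G = hinner C.L F (J' G)"
  unfolding H.inner_def C.inner_def
  by (rule Bochner_Integration.integral_cong)
     (use assms in \<open>auto simp: rep_J rep_J' cinner_simps cinner_complex_def\<close>)

lemma inner_J_right:
  assumes "F \<in> hcarrier C.L" "G \<in> hcarrier H.L"
  shows "hinner H.L G (J F) = hinner C.L (J' G) F"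
  using inner_J[OF assms] H.inner_commute[of G "J F"] C.inner_commute[of "J' G" F] assms by simp

lemma norm_J: "F \<in> hcarrier C.L \<Longrightarrow> hnorm H.L (J F) = hnorm C.L F"
  by (simp add: hnorm_def inner_J)

lemma norm_J': "G \<in> hcarrier H.L \<Longrightarrow> hnorm C.L (J' G) \<le> hnorm H.L G"
proof -
  assume G: "G \<in> hcarrier H.L"
  have "hnorm C.L (J' G) * hnorm C.L (J' G) = cmod (hinner C.L (J' G) (J' G))"
    using G by (simp add: C.inner_self power2_eq_square norm_mult)
  also have "\<dots> = cmod (hinner H.L (J (J' G)) G)" using G by (simp add: inner_J)
  also have "\<dots> \<le> hnorm H.L (J (J' G)) * hnorm H.L G" using G by (intro H.Cauchy_Schwarz) auto
  also have "\<dots> = hnorm C.L (J' G) * hnorm H.L G" using G by (simp add: norm_J)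
  finally show ?thesis
    using C.norm_nonneg[OF J'_closed[OF G]] H.norm_nonneg[OF G]
    by (cases "hnorm C.L (J' G) = 0") (auto intro: mult_left_le_imp_le[of "hnorm C.L (J' G)"])
qed

definition stab :: "(('a \<Rightarrow> complex) set \<Rightarrow> ('a \<Rightarrow> complex) set) \<Rightarrow> ('a \<Rightarrow> 'h) set \<Rightarrow> ('a \<Rightarrow> 'h) set" where
  "stab T = (\<lambda>G\<in>hcarrier H.L. J (T (J' G)))"

lemma stab_apply: "G \<in> hcarrier H.L \<Longrightarrow> stab T G = J (T (J' G))"
  by (simp add: stab_def)

lemma stab_bounded:
  assumes T: "T \<in> bounded_operators C.L"
  shows "stab T \<in> bounded_operators H.L"
proof -
  obtain B where B: "0 < B" "\<And>x. x \<in> hcarrier C.L \<Longrightarrow> hnorm C.L (T x) \<le> B * hnorm C.L x"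
    using C.op_bound[OF T] by blast
  show ?thesis
  proof (rule H.bounded_operatorI[of _ B])
    fix G assume G: "G \<in> hcarrier H.L"
    have "hnorm C.L (T (J' G)) \<le> B * hnorm C.L (J' G)" using G by (intro B(2)) simp
    also have "\<dots> \<le> B * hnorm H.L G" using B(1) norm_J'[OF G] by (intro mult_left_mono) simp_all
    finally show "hnorm H.L (stab T G) \<le> B * hnorm H.L G"
      using G T by (simp add: stab_apply norm_J C.op_closed)
  qed (use T in \<open>auto simp: stab_apply J'_add J'_scale C.op_add C.op_scale J_add J_scale C.op_closed\<close>, simp add: stab_def)
qed

lemma tensor_operator_eq:
  assumes T: "T \<in> bounded_operators C.L"
  shows "tensor_operator (count_space D) T e = stab T"
  unfolding tensor_operator_def
proof (rule the_equality)
  have "stab T (elementary_tensor (count_space D) F v) = elementary_tensor (count_space D) (T F) (e v)"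
    if F: "F \<in> hcarrier C.L" for F v
  proof (rule H.discrete_eqI)
    have "J' (elementary_tensor (count_space D) F v) = hscale C.L (cinner w v) F"
      by (rule C.discrete_eqI)
         (use F in \<open>auto simp: tensor_closed rep_tensor rep_J' C.rep_hscale_discrete cinner_scaleC_right scaleC_complex_def\<close>)
    then have eq: "stab T (elementary_tensor (count_space D) F v) = J (hscale C.L (cinner w v) (T F))"
      using F T by (simp add: stab_apply tensor_closed C.op_scale)
    show "rep (stab T (elementary_tensor (count_space D) F v)) x = rep (elementary_tensor (count_space D) (T F) (e v)) x"
      if "x \<in> D" for x
      using F T that
      by (simp add: eq rep_J C.op_closed rep_tensor C.rep_hscale_discrete e scaleC_scaleC scaleC_complex_def mult.commute)
  qed (use F T stab_bounded[OF T] tensor_closed in \<open>auto simp: H.op_closed C.op_closed\<close>)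
  then show 1: "stab T \<in> bounded_operators H.L \<and> (\<forall>F\<in>hcarrier C.L. \<forall>v. stab T (elementary_tensor (count_space D) F v)
      = elementary_tensor (count_space D) (T F) (e v))"
    using stab_bounded[OF T] by blast
  fix S assume S: "S \<in> bounded_operators H.L \<and> (\<forall>F\<in>hcarrier C.L. \<forall>v. S (elementary_tensor (count_space D) F v)
      = elementary_tensor (count_space D) (T F) (e v))"
  have delta: "elementary_tensor (count_space D) (C.delta x 1) h = H.delta x h" for x and h :: 'h
    by (rule H.discrete_eqI) (auto simp: tensor_closed rep_tensor C.rep_delta H.rep_delta scaleC_one)
  have "S (H.delta x h) = stab T (H.delta x h)" for x h
    using S 1 by (metis delta C.delta_closed)
  \<comment> \<open>Agreement on elementary tensors is extended by passing to adjoints, in place of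
    a density argument: the value of the adjoint at \<open>x\<close> is determined by its inner
    products with \<open>H.delta x h\<close>, that is, by \<open>S\<close> at these vectors.\<close>
  then have adj: "hadjoint H.L S G = hadjoint H.L (stab T) G" if "G \<in> hcarrier H.L" for G
  proof (intro H.discrete_eqI)
    fix x assume x: "x \<in> D"
    have "cinner h (rep (hadjoint H.L S G) x) = cinner h (rep (hadjoint H.L (stab T) G) x)" for h
      using S 1 that x \<open>\<And>x h. S (H.delta x h) = stab T (H.delta x h)\<close>
      by (simp flip: H.inner_delta add: H.op_closed H.inner_adjoint)
    then show "rep (hadjoint H.L S G) x = rep (hadjoint H.L (stab T) G) x" by (rule cinner_ext)
  qed (use S 1 that in \<open>auto simp: H.op_closed\<close>)
  show "S = stab T"
  proof (rule H.op_eqI)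
    fix x y assume xy: "x \<in> hcarrier H.L" "y \<in> hcarrier H.L"
    have "hinner H.L x (S y) = hinner H.L (hadjoint H.L S x) y" using S xy by (simp add: H.inner_adjoint_left)
    also have "\<dots> = hinner H.L x (stab T y)" using 1 xy by (simp add: adj H.inner_adjoint_left)
    finally show "hinner H.L x (S y) = hinner H.L x (stab T y)" .
  qed (use S 1 in auto)
qed

lemma stab_add: "\<lbrakk>S \<in> bounded_operators C.L; T \<in> bounded_operators C.L\<rbrakk>
    \<Longrightarrow> stab (S \<oplus>\<^bsub>operator_algebra C.L\<^esub> T) = stab S \<oplus>\<^bsub>operator_algebra H.L\<^esub> stab T"
  by (rule H.op_eqI) (auto simp: stab_bounded stab_apply J_add C.op_closed)

lemma stab_smult: "T \<in> bounded_operators C.L \<Longrightarrow> stab (c \<odot>\<^bsub>operator_algebra C.L\<^esub> T) = c \<odot>\<^bsub>operator_algebra H.L\<^esub> stab T"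
  by (rule H.op_eqI) (auto simp: stab_bounded stab_apply J_scale C.op_closed)

lemma stab_mult: "\<lbrakk>S \<in> bounded_operators C.L; T \<in> bounded_operators C.L\<rbrakk>
    \<Longrightarrow> stab (S \<otimes>\<^bsub>operator_algebra C.L\<^esub> T) = stab S \<otimes>\<^bsub>operator_algebra H.L\<^esub> stab T"
  by (rule H.op_eqI) (auto simp: stab_bounded stab_apply C.op_closed)

lemma stab_adjoint: "T \<in> bounded_operators C.L \<Longrightarrow> stab (hadjoint C.L T) = hadjoint H.L (stab T)"
  by (rule H.adjoint_eqI[symmetric])
     (auto simp: stab_bounded stab_apply C.op_closed inner_J inner_J_right C.inner_adjoint)

lemma stab_propagation:
  assumes T: "T \<in> bounded_operators C.L" "C.propagation_le T R"
  shows "H.propagation_le (stab T) R"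
  unfolding H.propagation_le_def
proof (intro allI ballI impI)
  fix A B F G assume FG: "F \<in> hcarrier H.L" "G \<in> hcarrier H.L"
    and *: "H.supported F A \<and> H.supported G B \<and> (\<forall>a\<in>A. \<forall>b\<in>B. R < dist a b)"
  have "hinner C.L (J' F) (T (J' G)) = 0"
    by (rule C.propagation_leD[OF T(2), of _ _ A B])
       (use FG * in \<open>auto simp: C.supported_discrete H.supported_discrete rep_J'\<close>)
  then show "hinner H.L F (stab T G) = 0"
    using FG T by (simp add: stab_apply inner_J_right C.op_closed)
qed

lemma stab_compact:
  assumes T: "compact_operator C.L T"
  shows "compact_operator H.L (stab T)"
proof (rule H.compact_operatorI)
  note T' = C.compact_bounded[OF T]
  show "stab T \<in> bounded_operators H.L" by (rule stab_bounded[OF T'])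
  fix X :: "nat \<Rightarrow> _" and B assume X: "\<And>n. X n \<in> hcarrier H.L" "\<And>n. hnorm H.L (X n) \<le> B"
  have "hnorm C.L (J' (X n)) \<le> B" for n using norm_J'[OF X(1)] X(2) order_trans by blast
  then obtain r y where r: "strict_mono r" "y \<in> hcarrier C.L" "(\<lambda>n. hnorm C.L (hdiff C.L (T (J' (X (r n)))) y)) \<longlonglongrightarrow> 0"
    using C.compact_subsequence[OF T, of "\<lambda>n. J' (X n)" B] X(1) by auto
  have "hdiff H.L (stab T (X n)) (J y) = J (hdiff C.L (T (J' (X n))) y)" for n
    using X(1) T' r(2) by (simp add: stab_apply hdiff_def J_add J_scale C.op_closed)
  then have "hnorm H.L (hdiff H.L (stab T (X n)) (J y)) = hnorm C.L (hdiff C.L (T (J' (X n))) y)" for n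
    using X(1) T' r(2) by (simp add: norm_J C.op_closed)
  then show "\<exists>r y. strict_mono r \<and> y \<in> hcarrier H.L \<and> (\<lambda>n. hnorm H.L (hdiff H.L (stab T (X (r n))) y)) \<longlonglongrightarrow> 0"
    using r by (intro exI[of _ r] exI[of _ "J y"]) auto
qed

lemma mult_J: "\<lbrakk>C.bounded_multiplier f; F \<in> hcarrier C.L\<rbrakk>
    \<Longrightarrow> mult_operator (count_space D) f (J F) = J (mult_operator (count_space D) f F)"
proof (rule H.discrete_eqI)
  assume f: "C.bounded_multiplier f" and F: "F \<in> hcarrier C.L"
  then have f': "H.bounded_multiplier f" by (simp add: C.bounded_multiplier_def H.bounded_multiplier_def)
  note c = C.mult_carrier(1)[OF f F] H.mult_carrier(1)[OF f' J_closed[OF F]]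
  then show "mult_operator (count_space D) f (J F) \<in> hcarrier H.L" "J (mult_operator (count_space D) f F) \<in> hcarrier H.L"
    by simp_all
  show "rep (mult_operator (count_space D) f (J F)) x = rep (J (mult_operator (count_space D) f F)) x" if "x \<in> D" for x
    using that f f' F c by (simp add: rep_J H.rep_mult_discrete C.rep_mult_discrete scaleC_scaleC scaleC_complex_def)
qed

lemma mult_J': "\<lbrakk>C.bounded_multiplier f; G \<in> hcarrier H.L\<rbrakk>
    \<Longrightarrow> J' (mult_operator (count_space D) f G) = mult_operator (count_space D) f (J' G)"
proof (rule C.discrete_eqI)
  assume f: "C.bounded_multiplier f" and G: "G \<in> hcarrier H.L"
  then have f': "H.bounded_multiplier f" by (simp add: C.bounded_multiplier_def H.bounded_multiplier_def)
  note c = C.mult_carrier(1)[OF f J'_closed[OF G]] H.mult_carrier(1)[OF f' G]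
  then show "mult_operator (count_space D) f (J' G) \<in> hcarrier C.L" "J' (mult_operator (count_space D) f G) \<in> hcarrier C.L"
    by simp_all
  show "rep (J' (mult_operator (count_space D) f G)) x = rep (mult_operator (count_space D) f (J' G)) x" if "x \<in> D" for x
    using that f f' G c by (simp add: rep_J' H.rep_mult_discrete C.rep_mult_discrete cinner_scaleC_right scaleC_complex_def)
qed

lemma stab_algebraic_roe:
  assumes T: "T \<in> C.algebraic_roe"
  shows "stab T \<in> H.algebraic_roe"
proof -
  note T' = C.algebraic_roeD(1)[OF T]
  obtain R where R: "R > 0" "C.propagation_le T R" using C.algebraic_roeD(4)[OF T] by blast
  show ?thesis
  proof (rule H.algebraic_roeI)
    fix f assume f: "f \<in> C0 (space (count_space D))"
    note bf = C.C0_multiplier[OF f] and bf' = H.C0_multiplier[OF f]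
    have "stab T \<otimes>\<^bsub>operator_algebra H.L\<^esub> mult_operator (count_space D) f
        = stab (T \<otimes>\<^bsub>operator_algebra C.L\<^esub> mult_operator (count_space D) f)"
      by (rule H.op_eqI)
         (use T' C.mult_bounded[OF bf] H.mult_bounded[OF bf'] in \<open>auto simp: stab_bounded stab_apply mult_J'[OF bf] H.mult_carrier[OF bf']\<close>)
    then show "compact_operator H.L (stab T \<otimes>\<^bsub>operator_algebra H.L\<^esub> mult_operator (count_space D) f)"
      using stab_compact[OF C.algebraic_roeD(2)[OF T f]] by simp
    have "mult_operator (count_space D) f \<otimes>\<^bsub>operator_algebra H.L\<^esub> stab T
        = stab (mult_operator (count_space D) f \<otimes>\<^bsub>operator_algebra C.L\<^esub> T)"
      by (rule H.op_eqI)
         (use T' C.mult_bounded[OF bf] H.mult_bounded[OF bf'] in \<open>auto simp: stab_bounded stab_apply mult_J[OF bf] C.op_closed\<close>)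
    then show "compact_operator H.L (mult_operator (count_space D) f \<otimes>\<^bsub>operator_algebra H.L\<^esub> stab T)"
      using stab_compact[OF C.algebraic_roeD(3)[OF T f]] by simp
  qed (use R stab_bounded[OF T'] stab_propagation[OF T' R(2)] in auto)
qed

lemma stab_norm_closure:
  assumes T: "T \<in> norm_closure C.L C.algebraic_roe"
  shows "stab T \<in> norm_closure H.L H.algebraic_roe"
proof (rule H.norm_closureI)
  note T' = C.norm_closure_bounded[OF T]
  show "stab T \<in> bounded_operators H.L" by (rule stab_bounded[OF T'])
  fix \<epsilon> :: real assume e: "\<epsilon> > 0"
  obtain U where U: "U \<in> C.algebraic_roe" "\<And>x. x \<in> hcarrier C.L \<Longrightarrow> hnorm C.L (hdiff C.L (T x) (U x)) \<le> \<epsilon> * hnorm C.L x"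
    using C.norm_closureD[OF T e] by blast
  note U' = C.algebraic_roeD(1)[OF U(1)]
  have "hnorm H.L (hdiff H.L (stab T x) (stab U x)) \<le> \<epsilon> * hnorm H.L x" if x: "x \<in> hcarrier H.L" for x
  proof -
    have "hdiff H.L (stab T x) (stab U x) = J (hdiff C.L (T (J' x)) (U (J' x)))"
      using x T' U' by (simp add: stab_apply hdiff_def J_add J_scale C.op_closed)
    then have "hnorm H.L (hdiff H.L (stab T x) (stab U x)) \<le> \<epsilon> * hnorm C.L (J' x)"
      using x T' U' U(2)[of "J' x"] by (simp add: norm_J C.op_closed)
    also have "\<dots> \<le> \<epsilon> * hnorm H.L x" using e norm_J'[OF x] by simp
    finally show ?thesis .
  qed
  then show "\<exists>V\<in>H.algebraic_roe. \<forall>x\<in>hcarrier H.L. hnorm H.L (hdiff H.L (stab T x) (V x)) \<le> \<epsilon> * hnorm H.L x"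
    using stab_algebraic_roe[OF U(1)] by blast
qed

lemma star_alg_hom_stabilization:
  "star_alg_hom (roe_algebra TYPE(complex) (count_space D)) (roe_algebra TYPE('h) (count_space D)) (stabilization_map D e)"
proof -
  interpret CA: star_alg "roe_algebra TYPE(complex) (count_space D)" by (rule C.star_alg_roe_algebra)
  interpret HA: star_alg "roe_algebra TYPE('h) (count_space D)" by (rule H.star_alg_roe_algebra)
  interpret CB: star_alg "operator_algebra C.L" by (rule C.star_alg_operator_algebra)
  have eq: "stabilization_map D e T = stab T" if "T \<in> bounded_operators C.L" for T
    unfolding stabilization_map_def by (rule tensor_operator_eq[OF that])
  show ?thesis
    by unfold_locales
       (auto simp: eq C.norm_closure_bounded stab_norm_closure stab_add stab_mult stab_smult stab_adjoint)
qed

text \<open>The projection is the transport of the basis vectors \<open>C.delta x 1\<close> to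
  themselves, which gives its algebraic properties at once. Its stabilisation is the same transport
  with \<open>w\<close> in place of 1.\<close>

lemma subset_projection_facts:
  assumes "D0 \<subseteq> D"
  shows "subset_projection D D0 \<in> norm_closure C.L C.algebraic_roe"
    "hadjoint C.L (subset_projection D D0) = subset_projection D D0"
    "subset_projection D D0 \<otimes>\<^bsub>operator_algebra C.L\<^esub> subset_projection D D0 = subset_projection D D0"
    "stabilization_map D e (subset_projection D D0) = H.transport D0 (\<lambda>x. H.delta x w) (\<lambda>x. H.delta x w)"
proof -
  let ?P = "subset_projection D D0" and ?T = "C.transport D0 (\<lambda>x. C.delta x 1) (\<lambda>x. C.delta x 1)"
  have 1: "norm (1::complex) = 1" by simp
  note o = C.orthonormal_delta[OF 1 assms] and oH = H.orthonormal_delta[OF w assms]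
  have P: "?P = ?T"
  proof (rule C.op_eqI)
    show "?P \<in> bounded_operators C.L" unfolding subset_projection_def by (rule C.mult_bounded[OF C.indicator_multiplier])
    show T: "?T \<in> bounded_operators C.L" by (rule C.transport_closed[OF o o])
    fix x y assume y: "y \<in> hcarrier C.L"
    have "?P y = ?T y"
    proof (rule C.discrete_eqI)
      show "?P y \<in> hcarrier C.L" "?T y \<in> hcarrier C.L"
        using y \<open>?P \<in> bounded_operators C.L\<close> T by (simp_all add: C.op_closed)
      show "rep (?P y) x = rep (?T y) x" if "x \<in> D" for x
        using y that C.rep_transport_delta[OF 1 assms y that]
        by (simp add: subset_projection_def C.rep_mult_discrete[OF C.indicator_multiplier] scaleC_complex_def cinner_complex_def indicator_def)
    qed
    then show "hinner C.L x (?P y) = hinner C.L x (?T y)" by simp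
  qed
  show "?P \<in> norm_closure C.L C.algebraic_roe"
    unfolding P by (rule C.algebraic_roe_carrier[OF C.transport_delta_roe[OF 1 assms]])
  show "hadjoint C.L ?P = ?P" unfolding P by (rule C.transport_adjoint[OF o o])
  show "?P \<otimes>\<^bsub>operator_algebra C.L\<^esub> ?P = ?P" unfolding P by (rule C.transport_mult[OF o o o])
  have b: "?P \<in> bounded_operators C.L" unfolding P by (rule C.transport_closed[OF o o])
  have "stab ?P = H.transport D0 (\<lambda>x. H.delta x w) (\<lambda>x. H.delta x w)"
  proof (rule H.op_eqI[OF stab_bounded[OF b] H.transport_closed[OF oH oH]])
    fix x y assume y: "y \<in> hcarrier H.L"
    have "stab ?P y = H.transport D0 (\<lambda>x. H.delta x w) (\<lambda>x. H.delta x w) y"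
    proof (rule H.discrete_eqI)
      show "stab ?P y \<in> hcarrier H.L" "H.transport D0 (\<lambda>x. H.delta x w) (\<lambda>x. H.delta x w) y \<in> hcarrier H.L"
        using y stab_bounded[OF b] H.transport_closed[OF oH oH] by (simp_all add: H.op_closed)
      show "rep (stab ?P y) x = rep (H.transport D0 (\<lambda>x. H.delta x w) (\<lambda>x. H.delta x w) y) x" if "x \<in> D" for x
        using y that H.rep_transport_delta[OF w assms y that] C.op_closed[OF b J'_closed[OF y]]
        by (simp add: stab_apply rep_J subset_projection_def C.rep_mult_discrete[OF C.indicator_multiplier] rep_J'
            scaleC_complex_def indicator_def)
    qed
    then show "hinner H.L x (stab ?P y) = hinner H.L x (H.transport D0 (\<lambda>x. H.delta x w) (\<lambda>x. H.delta x w) y)" by simp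
  qed
  then show "stabilization_map D e ?P = H.transport D0 (\<lambda>x. H.delta x w) (\<lambda>x. H.delta x w)"
    unfolding stabilization_map_def tensor_operator_eq[OF b] .
qed

lemma stabilization_K0_subset_projection:
  assumes "D0 \<subseteq> D"
  shows "stabilization_K0 D e (K0_class (roe_algebra TYPE(complex) (count_space D)) (subset_projection D D0))
    = K0_class (roe_algebra TYPE('h) (count_space D)) (H.transport D0 (\<lambda>x. H.delta x w) (\<lambda>x. H.delta x w))"
proof -
  interpret S: star_alg_hom "roe_algebra TYPE(complex) (count_space D)" "roe_algebra TYPE('h) (count_space D)" "stabilization_map D e"
    by (rule star_alg_hom_stabilization)
  note f = subset_projection_facts[OF assms]
  show ?thesis
    unfolding stabilization_K0_def using S.K0_map_class[of "subset_projection D D0"] f by simp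
qed

end

section \<open>Finite powers of Hilbert spaces\<close>

text \<open>The space on which matrices of size \<open>N\<close> over the unitization act.
  Extensional functions make equality of vectors the same as equality of the \<open>N\<close>
  components.\<close>

definition hpow :: "'v hspace \<Rightarrow> nat \<Rightarrow> (nat \<Rightarrow> 'v) hspace" where
  "hpow E N = \<lparr>hcarrier = {..<N} \<rightarrow>\<^sub>E hcarrier E,
     hzero = (\<lambda>i\<in>{..<N}. hzero E),
     hadd = (\<lambda>\<xi> \<eta>. \<lambda>i\<in>{..<N}. hadd E (\<xi> i) (\<eta> i)),
     hscale = (\<lambda>c \<xi>. \<lambda>i\<in>{..<N}. hscale E c (\<xi> i)),
     hinner = (\<lambda>\<xi> \<eta>. \<Sum>i<N. hinner E (\<xi> i) (\<eta> i))\<rparr>"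

lemma hpow_simps [simp]:
  "hcarrier (hpow E N) = {..<N} \<rightarrow>\<^sub>E hcarrier E"
  "hinner (hpow E N) \<xi> \<eta> = (\<Sum>i<N. hinner E (\<xi> i) (\<eta> i))"
  "i < N \<Longrightarrow> hzero (hpow E N) i = hzero E"
  "i < N \<Longrightarrow> hadd (hpow E N) \<xi> \<eta> i = hadd E (\<xi> i) (\<eta> i)"
  "i < N \<Longrightarrow> hscale (hpow E N) c \<xi> i = hscale E c (\<xi> i)"
  "i < N \<Longrightarrow> hdiff (hpow E N) \<xi> \<eta> i = hdiff E (\<xi> i) (\<eta> i)"
  by (simp_all add: hpow_def hdiff_def)

context inner_space
begin

lemma hpow_component [simp]: "\<xi> \<in> {..<N} \<rightarrow>\<^sub>E hcarrier E \<Longrightarrow> i < N \<Longrightarrow> \<xi> i \<in> hcarrier E"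
  by auto

lemma inner_space_hpow: "inner_space (hpow E N)"
proof
  fix \<xi> \<eta> assume xi: "\<xi> \<in> hcarrier (hpow E N)" and eta: "\<eta> \<in> hcarrier (hpow E N)"
    and eq: "\<And>\<zeta>. \<zeta> \<in> hcarrier (hpow E N) \<Longrightarrow> hinner (hpow E N) \<zeta> \<xi> = hinner (hpow E N) \<zeta> \<eta>"
  show "\<xi> = \<eta>"
  proof (rule PiE_ext[of \<xi> "{..<N}" "\<lambda>_. hcarrier E"])
    fix i assume i: "i \<in> {..<N}"
    show "\<xi> i = \<eta> i"
    proof (rule inner_ext)
      fix z assume z: "z \<in> hcarrier E"
      define \<zeta> where "\<zeta> = (\<lambda>j\<in>{..<N}. if j = i then z else hzero E)"
      have "\<zeta> \<in> hcarrier (hpow E N)" using z by (auto simp: \<zeta>_def)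
      moreover have "hinner (hpow E N) \<zeta> \<theta> = hinner E z (\<theta> i)" if "\<theta> \<in> hcarrier (hpow E N)" for \<theta>
      proof -
        have "hinner (hpow E N) \<zeta> \<theta> = (\<Sum>j<N. if j = i then hinner E z (\<theta> i) else 0)"
          unfolding hpow_simps(2)
          by (rule sum.cong[OF refl]) (use that in \<open>auto simp: \<zeta>_def inner_zero_left\<close>)
        then show ?thesis using i by simp
      qed
      ultimately show "hinner E z (\<xi> i) = hinner E z (\<eta> i)" using eq xi eta by metis
    qed (use xi eta i in auto)
  qed (use xi eta in auto)
next
  fix \<xi> \<eta> assume *: "\<xi> \<in> hcarrier (hpow E N)" "\<eta> \<in> hcarrier (hpow E N)"
  have "(\<Sum>i<N. hinner E (\<xi> i) (\<eta> i)) = (\<Sum>i<N. cnj (hinner E (\<eta> i) (\<xi> i)))"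
    by (rule sum.cong[OF refl], rule inner_commute) (use * in auto)
  then show "hinner (hpow E N) \<xi> \<eta> = cnj (hinner (hpow E N) \<eta> \<xi>)" by simp
next
  fix \<xi> assume "\<xi> \<in> hcarrier (hpow E N)"
  then show "0 \<le> Re (hinner (hpow E N) \<xi> \<xi>)" by (auto intro!: sum_nonneg inner_nonneg)
qed (auto simp: inner_simps sum.distrib sum_distrib_left hpow_def intro!: sum.cong)

lemma hpow_norm_sq: "\<xi> \<in> {..<N} \<rightarrow>\<^sub>E hcarrier E \<Longrightarrow> (hnorm (hpow E N) \<xi>)\<^sup>2 = (\<Sum>i<N. (hnorm E (\<xi> i))\<^sup>2)"
  using inner_space.norm_sq[OF inner_space_hpow, of \<xi> N] by (simp add: norm_sq)

lemma hpow_component_le: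
  assumes "\<xi> \<in> {..<N} \<rightarrow>\<^sub>E hcarrier E" "i < N"
  shows "hnorm E (\<xi> i) \<le> hnorm (hpow E N) \<xi>"
proof (rule power2_le_imp_le)
  show "(hnorm E (\<xi> i))\<^sup>2 \<le> (hnorm (hpow E N) \<xi>)\<^sup>2"
    unfolding hpow_norm_sq[OF assms(1)] using assms(2) by (intro member_le_sum) auto
  show "0 \<le> hnorm (hpow E N) \<xi>" using inner_space.norm_nonneg[OF inner_space_hpow, of \<xi> N] assms by simp
qed

lemma hpow_norm_le_sum:
  assumes "\<xi> \<in> {..<N} \<rightarrow>\<^sub>E hcarrier E"
  shows "hnorm (hpow E N) \<xi> \<le> (\<Sum>i<N. hnorm E (\<xi> i))"
proof -
  have "hnorm (hpow E N) \<xi> = L2_set (\<lambda>i. hnorm E (\<xi> i)) {..<N}"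
    using hpow_norm_sq[OF assms] inner_space.norm_nonneg[OF inner_space_hpow, of \<xi> N] assms
    by (simp add: L2_set_def real_sqrt_unique)
  also have "\<dots> \<le> (\<Sum>i<N. hnorm E (\<xi> i))" by (rule L2_set_le_sum) (use assms in auto)
  finally show ?thesis .
qed

fun hsum :: "(nat \<Rightarrow> 'v) \<Rightarrow> nat \<Rightarrow> 'v" where
  "hsum f 0 = hzero E"
| "hsum f (Suc n) = hadd E (hsum f n) (f n)"

lemma hsum_closed [simp]: "(\<And>j. j < n \<Longrightarrow> f j \<in> hcarrier E) \<Longrightarrow> hsum f n \<in> hcarrier E"
  by (induction n) auto

lemma inner_hsum: "(\<And>j. j < n \<Longrightarrow> f j \<in> hcarrier E) \<Longrightarrow> z \<in> hcarrier E \<Longrightarrow> hinner E z (hsum f n) = (\<Sum>j<n. hinner E z (f j))"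
  by (induction n) (auto simp: inner_simps)

lemma inner_hsum_left: "(\<And>j. j < n \<Longrightarrow> f j \<in> hcarrier E) \<Longrightarrow> z \<in> hcarrier E \<Longrightarrow> hinner E (hsum f n) z = (\<Sum>j<n. hinner E (f j) z)"
  by (induction n) (auto simp: inner_simps)

lemma hsum_norm_le: "(\<And>j. j < n \<Longrightarrow> f j \<in> hcarrier E) \<Longrightarrow> hnorm E (hsum f n) \<le> (\<Sum>j<n. hnorm E (f j))"
proof (induction n)
  case (Suc n)
  then show ?case using norm_triangle[of "hsum f n" "f n"] by (simp add: less_Suc_eq)
qed simp


text \<open>Riesz: if the distance of \<open>\<xi>\<close> to the range of \<open>T\<close> is positive, then almost nearest points to
  the ranges of the powers of \<open>T\<close> give unit vectors on which \<open>T - 1\<close> has no convergent subsequence.\<close>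

lemma bounded_below_no_gap:
  assumes W: "W \<subseteq> hcarrier E" "\<And>x y. x \<in> W \<Longrightarrow> y \<in> W \<Longrightarrow> hadd E x y \<in> W" "\<And>c x. x \<in> W \<Longrightarrow> hscale E c x \<in> W"
    and T: "\<And>x. x \<in> W \<Longrightarrow> T x \<in> W" "\<And>x y. x \<in> W \<Longrightarrow> y \<in> W \<Longrightarrow> T (hadd E x y) = hadd E (T x) (T y)"
      "\<And>c x. x \<in> W \<Longrightarrow> T (hscale E c x) = hscale E c (T x)"
    and c: "0 < c" "\<And>x. x \<in> W \<Longrightarrow> c * hnorm E x \<le> hnorm E (T x)"
    and \<xi>: "\<xi> \<in> W" "0 < \<delta>" "\<And>x. x \<in> W \<Longrightarrow> \<delta> \<le> hnorm E (hdiff E \<xi> (T x))"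
    and compact: "\<And>X C. \<lbrakk>\<And>n::nat. X n \<in> W; \<And>n. hnorm E (X n) \<le> C\<rbrakk> \<Longrightarrow>
      \<exists>r y. strict_mono r \<and> y \<in> hcarrier E \<and> (\<lambda>n. hnorm E (hdiff E (hdiff E (T (X (r n))) (X (r n))) y)) \<longlonglongrightarrow> 0"
  shows False
proof -
  have WE [simp]: "x \<in> hcarrier E" if "x \<in> W" for x using that W(1) by blast
  have Wd: "hdiff E x y \<in> W" if "x \<in> W" "y \<in> W" for x y using that W unfolding hdiff_def by blast
  have Td: "T (hdiff E x y) = hdiff E (T x) (T y)" if "x \<in> W" "y \<in> W" for x y
    using that W T unfolding hdiff_def by simp
  have P: "(T ^^ n) x \<in> W" if "x \<in> W" for n x using that by (induction n) (auto intro: T(1))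
  have Pa: "(T ^^ n) (hadd E x y) = hadd E ((T ^^ n) x) ((T ^^ n) y)" if "x \<in> W" "y \<in> W" for n x y
    using that by (induction n) (auto simp: T P)
  have Ps: "(T ^^ n) (hscale E k x) = hscale E k ((T ^^ n) x)" if "x \<in> W" for n k x
    using that by (induction n) (auto simp: T P)
  have Pd: "(T ^^ n) (hdiff E x y) = hdiff E ((T ^^ n) x) ((T ^^ n) y)" if "x \<in> W" "y \<in> W" for n x y
    using that by (induction n) (auto simp: Td P)
  have Pc: "c ^ n * hnorm E x \<le> hnorm E ((T ^^ n) x)" if "x \<in> W" for n x
  proof (induction n)
    case (Suc n)
    have "c ^ Suc n * hnorm E x \<le> c * hnorm E ((T ^^ n) x)" using Suc c(1) by (simp add: mult.assoc)
    also have "\<dots> \<le> hnorm E ((T ^^ Suc n) x)" using c(2)[OF P[OF that]] by simp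
    finally show ?case .
  qed simp
  \<comment> \<open>The infimum \<open>d n\<close> of \<open>S n\<close> is the distance of
    \<open>(T ^^ n) \<xi>\<close> from the range of \<open>T ^^ Suc n\<close> on \<open>W\<close>.
    As \<open>T\<close> is bounded below by \<open>c\<close>, it shrinks the initial gap \<delta> at
    most by the factor \<open>c ^ n\<close>, so this distance stays positive.\<close>
  define S where "S n = (\<lambda>x. hnorm E (hdiff E ((T ^^ n) \<xi>) ((T ^^ Suc n) x))) ` W" for n
  have S_ge: "c ^ n * \<delta> \<le> s" if "s \<in> S n" for n s
  proof -
    obtain x where x: "x \<in> W" "s = hnorm E (hdiff E ((T ^^ n) \<xi>) ((T ^^ n) (T x)))"
      using \<open>s \<in> S n\<close> by (auto simp: S_def funpow_swap1)
    have "c ^ n * \<delta> \<le> c ^ n * hnorm E (hdiff E \<xi> (T x))" using c(1) \<xi>(3)[OF x(1)] by simp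
    also have "\<dots> \<le> hnorm E ((T ^^ n) (hdiff E \<xi> (T x)))" by (rule Pc[OF Wd[OF \<xi>(1) T(1)[OF x(1)]]])
    finally show ?thesis using x \<xi>(1) T(1) by (simp add: Pd)
  qed
  define d where "d n = Inf (S n)" for n
  have S_ne: "S n \<noteq> {}" for n using \<xi>(1) by (auto simp: S_def)
  have d_pos: "0 < d n" for n
  proof -
    have "0 < c ^ n * \<delta>" using c(1) \<xi>(2) by simp
    also have "\<dots> \<le> d n" unfolding d_def using S_ne S_ge by (rule cInf_greatest)
    finally show ?thesis .
  qed
  have d_le: "d n \<le> hnorm E (hdiff E ((T ^^ n) \<xi>) ((T ^^ Suc n) x))" if "x \<in> W" for n x
    unfolding d_def using that S_ge by (intro cInf_lower bdd_belowI) (auto simp: S_def)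
  \<comment> \<open>The infimum need not be attained; a point within a factor 2 of it suffices and
    produces the constant 1 / 2 below.\<close>
  have "\<exists>x\<in>W. hnorm E (hdiff E ((T ^^ n) \<xi>) ((T ^^ Suc n) x)) < 2 * d n" for n
    using cInf_lessD[OF S_ne, of n "2 * d n"] d_pos[of n] unfolding d_def[symmetric] by (auto simp: S_def)
  then obtain \<eta> where \<eta>: "\<And>n. \<eta> n \<in> W" "\<And>n. hnorm E (hdiff E ((T ^^ n) \<xi>) ((T ^^ Suc n) (\<eta> n))) < 2 * d n" by metis
  define z where "z n = hdiff E \<xi> (T (\<eta> n))" for n
  have z: "z n \<in> W" for n unfolding z_def using \<xi>(1) \<eta>(1) T(1) Wd by blast
  define t where "t n = hnorm E ((T ^^ n) (z n))" for n
  have t_eq: "(T ^^ n) (z n) = hdiff E ((T ^^ n) \<xi>) ((T ^^ Suc n) (\<eta> n))" for n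
    unfolding z_def using \<xi>(1) \<eta>(1) T(1) by (simp add: Pd funpow_swap1)
  have t: "0 < t n" "t n < 2 * d n" for n
    using \<eta>(2)[of n] d_le[OF \<eta>(1)[of n], of n] d_pos[of n] unfolding t_def t_eq by linarith+
  \<comment> \<open>These unit vectors lie in the range of \<open>T ^^ n\<close>, at distance at
    least 1 / 2 from the range of \<open>T ^^ Suc n\<close>.\<close>
  define x where "x n = (T ^^ n) (hscale E (complex_of_real (1 / t n)) (z n))" for n
  have x: "x n \<in> W" for n unfolding x_def using z W(3) P by blast
  have x_norm: "hnorm E (x n) = 1" for n
    using t(1)[of n] z P by (simp add: x_def Ps norm_scale norm_divide t_def)
  have far: "1 / 2 \<le> hnorm E (hdiff E (x n) ((T ^^ Suc n) v))" if v: "v \<in> W" for n v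
  proof -
    have "hdiff E (x n) ((T ^^ Suc n) v)
        = hscale E (complex_of_real (1 / t n)) (hdiff E ((T ^^ n) (z n)) (hscale E (complex_of_real (t n)) ((T ^^ Suc n) v)))"
      using t(1)[of n] z v P[OF v, of "Suc n"] P[OF z, of n]
      by (intro inner_ext) (simp_all add: x_def Ps inner_simps right_diff_distrib)
    then have "hnorm E (hdiff E (x n) ((T ^^ Suc n) v))
        = (1 / t n) * hnorm E (hdiff E ((T ^^ n) (z n)) (hscale E (complex_of_real (t n)) ((T ^^ Suc n) v)))"
      using t(1)[of n] z v P[OF v, of "Suc n"] P[OF z, of n] by (simp add: norm_scale norm_divide)
    also have "hdiff E ((T ^^ n) (z n)) (hscale E (complex_of_real (t n)) ((T ^^ Suc n) v))
        = hdiff E ((T ^^ n) \<xi>) ((T ^^ Suc n) (hadd E (\<eta> n) (hscale E (complex_of_real (t n)) v)))"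
      unfolding t_eq Pa[OF \<eta>(1) W(3)[OF v]] Ps[OF v]
      using v \<eta>(1) \<xi>(1) P[OF v, of "Suc n"] P[OF \<eta>(1), of "Suc n" n] P[OF \<xi>(1), of n]
      by (intro inner_ext) (simp_all add: inner_simps del: funpow.simps)
    also have "(1 / t n) * hnorm E \<dots> \<ge> (1 / t n) * d n"
      using t(1)[of n] W \<eta>(1) v by (intro mult_left_mono d_le) auto
    finally have "(1 / t n) * d n \<le> hnorm E (hdiff E (x n) ((T ^^ Suc n) v))" .
    moreover have "1 / 2 \<le> (1 / t n) * d n" using t[of n] by (simp add: field_simps)
    ultimately show ?thesis by linarith
  qed
  have sep: "1 / 2 \<le> hnorm E (hdiff E (hdiff E (T (x n)) (x n)) (hdiff E (T (x m)) (x m)))" if nm: "n < m" for n m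
  proof -
    define v where "v = hscale E (complex_of_real (1 / t n)) (z n)"
    define v' where "v' = hscale E (complex_of_real (1 / t m)) (z m)"
    have vv: "v \<in> W" "v' \<in> W" using z W(3) by (auto simp: v_def v'_def)
    define k where "k = m - Suc n"
    have m: "m = Suc n + k" using nm by (simp add: k_def)
    have xn: "x n = (T ^^ n) v" by (simp only: x_def v_def)
    have "x m = (T ^^ m) v'" by (simp only: x_def v'_def)
    then have xm: "x m = (T ^^ Suc n) ((T ^^ k) v')" by (simp only: m funpow_add o_apply)
    \<comment> \<open>For \<open>n < m\<close> the vectors \<open>T (x n)\<close>,
      \<open>T (x m)\<close> and \<open>x m\<close> all lie in the range of
      \<open>T ^^ Suc n\<close>. Hence the values of \<open>T - 1\<close> at \<open>x n\<close> and
      \<open>x m\<close> differ, up to sign, by \<open>x n\<close> minus an element of this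
      range.\<close>
    define a where "a = hadd E (hdiff E v (T ((T ^^ k) v'))) ((T ^^ k) v')"
    have a: "a \<in> W" unfolding a_def by (intro W(2) Wd vv P T(1))
    have Ta: "(T ^^ Suc n) a = hadd E (hdiff E (T (x n)) (T (x m))) (x m)"
      unfolding a_def
      using vv P T(1) Wd by (simp add: Pa Pd xn xm funpow_swap1 del: funpow.simps) (simp add: funpow_swap1)
    have "hnorm E (hdiff E (hdiff E (T (x n)) (x n)) (hdiff E (T (x m)) (x m)))
        = hnorm E (hdiff E (hadd E (hdiff E (T (x n)) (T (x m))) (x m)) (x n))"
      using x T(1) by (intro arg_cong[of _ _ "hnorm E"] inner_ext) (simp_all add: inner_simps)
    also have "\<dots> = hnorm E (hdiff E (x n) ((T ^^ Suc n) a))"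
      unfolding Ta using x T(1) by (intro diff_commute_norm) simp_all
    also have "\<dots> \<ge> 1 / 2" by (rule far[OF a])
    finally show ?thesis .
  qed
  obtain r y where r: "strict_mono r" "y \<in> hcarrier E" "(\<lambda>n. hnorm E (hdiff E (hdiff E (T (x (r n))) (x (r n))) y)) \<longlonglongrightarrow> 0"
    using compact[of x 1] x x_norm by auto
  then obtain n0 where n0: "\<And>n. n \<ge> n0 \<Longrightarrow> \<bar>hnorm E (hdiff E (hdiff E (T (x (r n))) (x (r n))) y)\<bar> < 1 / 4"
    unfolding LIMSEQ_iff by (metis diff_zero real_norm_def zero_less_divide_1_iff zero_less_numeral)
  let ?k = "\<lambda>n. hdiff E (T (x (r n))) (x (r n))"
  have k: "?k n \<in> hcarrier E" for n using x T(1) by simp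
  have "hnorm E (hdiff E (?k n0) (?k (Suc n0))) \<le> hnorm E (hdiff E (?k n0) y) + hnorm E (hdiff E y (?k (Suc n0)))"
    using k r(2) by (intro norm_triangle_diff)
  also have "hnorm E (hdiff E y (?k (Suc n0))) = hnorm E (hdiff E (?k (Suc n0)) y)"
    using k r(2) by (intro diff_commute_norm)
  also have "hnorm E (hdiff E (?k n0) y) + \<dots> < 1 / 2" using n0[of n0] n0[of "Suc n0"] by linarith
  finally show False using sep[of "r n0" "r (Suc n0)"] r(1) by (simp add: strict_mono_less)
qed

end


section \<open>Matrices over the unitization act on powers\<close>

context roe_space
begin

text \<open>The pair \<open>(T, s)\<close> stands for the operator \<open>T + s\<close>. This
  represents the unitization, faithfully or not, and turns relations between matrices into relations
  between operators.\<close>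

definition act :: "((('a \<Rightarrow> 'k) set \<Rightarrow> ('a \<Rightarrow> 'k) set) \<times> complex) \<Rightarrow> ('a \<Rightarrow> 'k) set \<Rightarrow> ('a \<Rightarrow> 'k) set" where
  "act a x = hadd L (fst a x) (hscale L (snd a) x)"

abbreviation "RU \<equiv> unitization (roe_algebra K M)"

lemma RU_fst: "a \<in> carrier RU \<Longrightarrow> fst a \<in> bounded_operators L"
  using norm_closure_bounded by (auto simp: unitization_def)

lemma act_closed [simp]: "fst a \<in> bounded_operators L \<Longrightarrow> x \<in> hcarrier L \<Longrightarrow> act a x \<in> hcarrier L"
  by (simp add: act_def op_closed)

lemma inner_act: "fst a \<in> bounded_operators L \<Longrightarrow> x \<in> hcarrier L \<Longrightarrow> z \<in> hcarrier L \<Longrightarrow>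
    hinner L z (act a x) = hinner L z (fst a x) + snd a * hinner L z x"
  by (simp add: act_def inner_simps op_closed)

lemma star_ring_RU: "star_ring RU"
proof -
  interpret A: star_alg "roe_algebra K M" by (rule star_alg_roe_algebra)
  show ?thesis by (rule A.star_ring_unitization)
qed

lemma RU_simps:
  "(a, s) \<oplus>\<^bsub>RU\<^esub> (b, t) = (a \<oplus>\<^bsub>operator_algebra L\<^esub> b, s + t)"
  "(a, s) \<otimes>\<^bsub>RU\<^esub> (b, t) = (a \<otimes>\<^bsub>operator_algebra L\<^esub> b \<oplus>\<^bsub>operator_algebra L\<^esub> (s \<odot>\<^bsub>operator_algebra L\<^esub> b \<oplus>\<^bsub>operator_algebra L\<^esub> t \<odot>\<^bsub>operator_algebra L\<^esub> a), s * t)"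
  "star RU (a, s) = (hadjoint L a, cnj s)"
  "\<zero>\<^bsub>RU\<^esub> = (\<zero>\<^bsub>operator_algebra L\<^esub>, 0)"
  "\<one>\<^bsub>RU\<^esub> = (\<zero>\<^bsub>operator_algebra L\<^esub>, 1)"
  by (simp_all add: unitization_def)

lemma inner_act_add:
  assumes "a \<in> carrier RU" "b \<in> carrier RU" "x \<in> hcarrier L" "z \<in> hcarrier L"
  shows "hinner L z (act (a \<oplus>\<^bsub>RU\<^esub> b) x) = hinner L z (act a x) + hinner L z (act b x)"
  using assms RU_fst[OF assms(1)] RU_fst[OF assms(2)]
  by (cases a; cases b) (simp add: RU_simps inner_act inner_simps op_closed distrib_right)

lemma act_mult:
  assumes "a \<in> carrier RU" "b \<in> carrier RU" "x \<in> hcarrier L"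
  shows "act (a \<otimes>\<^bsub>RU\<^esub> b) x = act a (act b x)"
proof -
  obtain T s U t where ab: "a = (T, s)" "b = (U, t)" by (metis surj_pair)
  have T: "T \<in> bounded_operators L" "U \<in> bounded_operators L" using RU_fst assms ab by fastforce+
  show ?thesis
  proof (rule inner_ext)
    fix z assume "z \<in> hcarrier L"
    then show "hinner L z (act (a \<otimes>\<^bsub>RU\<^esub> b) x) = hinner L z (act a (act b x))"
      using T assms(3) unfolding ab RU_simps
      by (simp add: act_def inner_simps op_closed op_add op_scale algebra_simps)
  qed (use T assms(3) in \<open>simp_all add: ab RU_simps\<close>)
qed

lemma inner_act_star:
  assumes "a \<in> carrier RU" "x \<in> hcarrier L" "z \<in> hcarrier L"
  shows "hinner L z (act (star RU a) x) = hinner L (act a z) x"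
  using assms RU_fst[OF assms(1)]
  by (cases a) (simp add: RU_simps act_def inner_simps op_closed inner_adjoint)

lemma inner_act_finsum:
  assumes "finite I" "\<And>i. i \<in> I \<Longrightarrow> f i \<in> carrier RU" "x \<in> hcarrier L" "z \<in> hcarrier L"
  shows "hinner L z (act (finsum RU f I) x) = (\<Sum>i\<in>I. hinner L z (act (f i) x))"
proof -
  interpret U: star_ring RU by (rule star_ring_RU)
  show ?thesis
    using assms(1,2)
  proof (induction I)
    case empty
    then show ?case using assms by (simp add: RU_simps act_def inner_simps)
  next
    case (insert i I)
    then show ?case
      using assms(3,4) by (subst U.finsum_insert) (auto simp: inner_act_add U.finsum_closed)
  qed
qed

definition mact :: "nat \<Rightarrow> ((('a \<Rightarrow> 'k) set \<Rightarrow> ('a \<Rightarrow> 'k) set) \<times> complex) mtx \<Rightarrow> (nat \<Rightarrow> ('a \<Rightarrow> 'k) set) \<Rightarrow> nat \<Rightarrow> ('a \<Rightarrow> 'k) set" where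
  "mact N v \<xi> = (\<lambda>i\<in>{..<N}. hsum (\<lambda>j. act (v i j) (\<xi> j)) N)"

text \<open>Only entries inside the index range are constrained, because the approximants of
  \<open>mtx_approximation\<close> do not vanish outside it.\<close>

definition op_mtx :: "nat \<Rightarrow> ((('a \<Rightarrow> 'k) set \<Rightarrow> ('a \<Rightarrow> 'k) set) \<times> complex) mtx \<Rightarrow> bool" where
  "op_mtx N v \<longleftrightarrow> (\<forall>i<N. \<forall>j<N. fst (v i j) \<in> bounded_operators L)"

lemma RU_op_mtx: "v \<in> mtx_carrier RU N N \<Longrightarrow> op_mtx N v"
  unfolding op_mtx_def using star_ring.mtx_entry[OF star_ring_RU] RU_fst by blast

context
  fixes N :: nat
begin

abbreviation "LN \<equiv> hpow L N"

interpretation P: inner_space LN by (rule inner_space_hpow)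

lemma mact_closed: "op_mtx N v \<Longrightarrow> \<xi> \<in> hcarrier LN \<Longrightarrow> mact N v \<xi> \<in> hcarrier LN"
  by (auto simp: mact_def op_mtx_def intro!: hsum_closed act_closed)

lemma mact_component: "i < N \<Longrightarrow> mact N v \<xi> i = hsum (\<lambda>j. act (v i j) (\<xi> j)) N"
  by (simp add: mact_def)

lemma inner_mact:
  assumes "op_mtx N v" "\<xi> \<in> hcarrier LN" "\<zeta> \<in> hcarrier LN"
  shows "hinner LN \<zeta> (mact N v \<xi>) = (\<Sum>i<N. \<Sum>j<N. hinner L (\<zeta> i) (act (v i j) (\<xi> j)))"
  using assms by (simp add: op_mtx_def mact_component) (intro sum.cong refl inner_hsum; simp)

lemma mact_add: "\<lbrakk>op_mtx N v; \<xi> \<in> hcarrier LN; \<eta> \<in> hcarrier LN\<rbrakk> \<Longrightarrow> mact N v (hadd LN \<xi> \<eta>) = hadd LN (mact N v \<xi>) (mact N v \<eta>)"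
  by (rule P.inner_ext)
     (simp_all add: mact_closed inner_mact P.inner_add_right P.add_closed del: hpow_simps(1,2),
      simp add: op_mtx_def inner_act inner_simps op_add op_closed algebra_simps flip: sum.distrib)

lemma mact_scale: "\<lbrakk>op_mtx N v; \<xi> \<in> hcarrier LN\<rbrakk> \<Longrightarrow> mact N v (hscale LN c \<xi>) = hscale LN c (mact N v \<xi>)"
  by (rule P.inner_ext)
     (simp_all add: mact_closed inner_mact P.inner_scale_right P.scale_closed del: hpow_simps(1,2),
      simp add: op_mtx_def inner_act inner_simps op_scale op_closed algebra_simps sum_distrib_left)

lemma mact_mult:
  assumes a: "a \<in> mtx_carrier RU N N" and b: "b \<in> mtx_carrier RU N N" and \<xi>: "\<xi> \<in> hcarrier LN"
  shows "mact N (mtx_mult RU N a b) \<xi> = mact N a (mact N b \<xi>)"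
proof (rule P.inner_ext)
  interpret U: star_ring RU by (rule star_ring_RU)
  note ab = RU_op_mtx[OF U.mtx_mult_closed[OF a b]] and oa = RU_op_mtx[OF a] and ob = RU_op_mtx[OF b]
  show "mact N (mtx_mult RU N a b) \<xi> \<in> hcarrier LN" "mact N a (mact N b \<xi>) \<in> hcarrier LN"
    using ab oa ob \<xi> mact_closed by blast+
  fix \<zeta> assume \<zeta>: "\<zeta> \<in> hcarrier LN"
  have entry: "hinner L (\<zeta> i) (act (mtx_mult RU N a b i j) (\<xi> j)) = (\<Sum>l<N. hinner L (\<zeta> i) (act (a i l) (act (b l j) (\<xi> j))))"
    if "i < N" "j < N" for i j
    unfolding mtx_mult_def using that \<zeta> \<xi> a b
    by (subst inner_act_finsum) (auto intro!: sum.cong simp: act_mult)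
  have comp: "hinner L (\<zeta> i) (act (a i l) (mact N b \<xi> l)) = (\<Sum>j<N. hinner L (\<zeta> i) (act (a i l) (act (b l j) (\<xi> j))))"
    if "i < N" "l < N" for i l
  proof -
    have al: "a i l \<in> carrier RU" using a by simp
    have s: "act (star RU (a i l)) (\<zeta> i) \<in> hcarrier L"
      using that \<zeta> RU_fst[OF U.star_closed[OF al]] by simp
    \<comment> \<open>\<open>hsum\<close> is accessible only through inner products, so
      \<open>a i l\<close> is moved to the other side before the sum is expanded.\<close>
    have flip: "hinner L (\<zeta> i) (act (a i l) x) = hinner L (act (star RU (a i l)) (\<zeta> i)) x" if "x \<in> hcarrier L" for x
      using inner_act_star[OF U.star_closed[OF al] that, of "\<zeta> i"] \<zeta> \<open>i < N\<close> U.star_star[OF al] by simp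
    have bc: "act (b l j) (\<xi> j) \<in> hcarrier L" if "j < N" for j
      using that \<open>l < N\<close> ob \<xi> by (simp add: op_mtx_def)
    show ?thesis
      using that s bc by (simp add: mact_component flip inner_hsum)
  qed
  have "hinner LN \<zeta> (mact N (mtx_mult RU N a b) \<xi>) = (\<Sum>i<N. \<Sum>j<N. \<Sum>l<N. hinner L (\<zeta> i) (act (a i l) (act (b l j) (\<xi> j))))"
    unfolding inner_mact[OF ab \<xi> \<zeta>] by (intro sum.cong refl) (simp add: entry)
  also have "\<dots> = (\<Sum>i<N. \<Sum>l<N. \<Sum>j<N. hinner L (\<zeta> i) (act (a i l) (act (b l j) (\<xi> j))))"
    by (intro sum.cong refl sum.swap)
  also have "\<dots> = hinner LN \<zeta> (mact N a (mact N b \<xi>))"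
    unfolding inner_mact[OF oa mact_closed[OF ob \<xi>] \<zeta>] by (intro sum.cong refl) (simp add: comp)
  finally show "hinner LN \<zeta> (mact N (mtx_mult RU N a b) \<xi>) = hinner LN \<zeta> (mact N a (mact N b \<xi>))" .
qed

lemma inner_mact_star:
  assumes a: "a \<in> mtx_carrier RU N N" and \<xi>: "\<xi> \<in> hcarrier LN" and \<zeta>: "\<zeta> \<in> hcarrier LN"
  shows "hinner LN \<zeta> (mact N (mtx_star RU a) \<xi>) = hinner LN (mact N a \<zeta>) \<xi>"
proof -
  interpret U: star_ring RU by (rule star_ring_RU)
  note oa = RU_op_mtx[OF a]
  have "hinner LN (mact N a \<zeta>) \<xi> = (\<Sum>j<N. \<Sum>i<N. hinner L (act (a j i) (\<zeta> i)) (\<xi> j))"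
    using oa \<xi> \<zeta> by (simp add: mact_component op_mtx_def) (intro sum.cong refl inner_hsum_left; simp)
  also have "\<dots> = (\<Sum>j<N. \<Sum>i<N. hinner L (\<zeta> i) (act (star RU (a j i)) (\<xi> j)))"
    using a \<xi> \<zeta> by (intro sum.cong refl) (simp add: inner_act_star)
  also have "\<dots> = (\<Sum>i<N. \<Sum>j<N. hinner L (\<zeta> i) (act (mtx_star RU a i j) (\<xi> j)))"
    by (subst sum.swap) (simp add: mtx_star_def)
  also have "\<dots> = hinner LN \<zeta> (mact N (mtx_star RU a) \<xi>)"
    by (rule inner_mact[OF RU_op_mtx[OF U.mtx_star_closed[OF a]] \<xi> \<zeta>, symmetric])
  finally show ?thesis ..
qed

text \<open>Only the operator parts are approximated. The scalar parts are kept exactly, so that an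
  approximant of \<open>u\<close> still differs from the identity by locally compact
  operators.\<close>

lemma mtx_approximation:
  assumes v: "v \<in> mtx_carrier RU N N" and \<delta>: "0 < \<delta>"
  obtains v' R where "\<And>i j. i < N \<Longrightarrow> j < N \<Longrightarrow> fst (v' i j) \<in> algebraic_roe"
    "\<And>i j. snd (v' i j) = snd (v i j)" "\<And>i j. i < N \<Longrightarrow> j < N \<Longrightarrow> propagation_le (fst (v' i j)) R"
    "\<And>\<xi>. \<xi> \<in> hcarrier LN \<Longrightarrow> hnorm LN (hdiff LN (mact N v \<xi>) (mact N v' \<xi>)) \<le> \<delta> * hnorm LN \<xi>"
proof -
  interpret U: star_ring RU by (rule star_ring_RU)
  \<comment> \<open>The errors of the \<open>N * N\<close> entries add up; the added 1 keeps the
    denominator positive for \<open>N = 0\<close>.\<close>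
  define \<epsilon> where "\<epsilon> = \<delta> / (real N * real N + 1)"
  have \<epsilon>: "0 < \<epsilon>" using \<delta> by (simp add: \<epsilon>_def add_nonneg_pos)
  have "\<exists>S\<in>algebraic_roe. \<forall>x\<in>hcarrier L. hnorm L (hdiff L (fst (v i j) x) (S x)) \<le> \<epsilon> * hnorm L x" for i j
  proof -
    have "fst (v i j) \<in> norm_closure L algebraic_roe"
      using U.mtx_entry[OF v, of i j] by (auto simp: unitization_def)
    then show ?thesis using norm_closureD[OF _ \<epsilon>] by metis
  qed
  then obtain S where S: "\<And>i j. S i j \<in> algebraic_roe"
    "\<And>i j x. x \<in> hcarrier L \<Longrightarrow> hnorm L (hdiff L (fst (v i j) x) (S i j x)) \<le> \<epsilon> * hnorm L x" by metis
  define v' where "v' i j = (S i j, snd (v i j))" for i j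
  have ov: "op_mtx N v" "op_mtx N v'"
    using RU_op_mtx[OF v] algebraic_roeD(1)[OF S(1)] by (auto simp: op_mtx_def v'_def)
  have "\<forall>i j. \<exists>r. propagation_le (S i j) r" using algebraic_roeD(4)[OF S(1)] by blast
  then obtain r where r: "\<And>i j. propagation_le (S i j) (r i j)" by metis
  define R where "R = (\<Sum>i<N. \<Sum>j<N. \<bar>r i j\<bar>)"
  have rR: "r i j \<le> R" if "i < N" "j < N" for i j
  proof -
    have "r i j \<le> (\<Sum>j<N. \<bar>r i j\<bar>)"
      using that(2) member_le_sum[of j "{..<N}" "\<lambda>j. \<bar>r i j\<bar>"] by fastforce
    also have "\<dots> \<le> R" unfolding R_def
      using that(1) member_le_sum[of i "{..<N}" "\<lambda>i. \<Sum>j<N. \<bar>r i j\<bar>"] by (auto simp: sum_nonneg)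
    finally show ?thesis .
  qed
  have "hnorm LN (hdiff LN (mact N v \<xi>) (mact N v' \<xi>)) \<le> \<delta> * hnorm LN \<xi>" if \<xi>: "\<xi> \<in> hcarrier LN" for \<xi>
  proof -
    let ?D = "hdiff LN (mact N v \<xi>) (mact N v' \<xi>)"
    have D: "?D \<in> hcarrier LN" using mact_closed[OF ov(1) \<xi>] mact_closed[OF ov(2) \<xi>] by (rule P.diff_closed)
    have n0: "0 \<le> hnorm LN \<xi>" using \<xi> by (rule P.norm_nonneg)
    have "hnorm L (?D i) \<le> real N * (\<epsilon> * hnorm LN \<xi>)" if i: "i < N" for i
    proof -
      have c: "fst (v i j) (\<xi> j) \<in> hcarrier L" "S i j (\<xi> j) \<in> hcarrier L" "\<xi> j \<in> hcarrier L"
        "act (v i j) (\<xi> j) \<in> hcarrier L" "act (v' i j) (\<xi> j) \<in> hcarrier L" if "j < N" for j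
        using that i ov \<xi> algebraic_roeD(1)[OF S(1)] by (auto simp: op_mtx_def op_closed)
      have "?D i = hsum (\<lambda>j. hdiff L (fst (v i j) (\<xi> j)) (S i j (\<xi> j))) N"
        using i c by (intro inner_ext)
          (simp_all add: mact_component inner_simps inner_hsum flip: sum_subtractf, simp add: act_def v'_def inner_simps)
      then have "hnorm L (?D i) \<le> (\<Sum>j<N. hnorm L (hdiff L (fst (v i j) (\<xi> j)) (S i j (\<xi> j))))"
        using hsum_norm_le[of N "\<lambda>j. hdiff L (fst (v i j) (\<xi> j)) (S i j (\<xi> j))"] c by simp
      also have "\<dots> \<le> (\<Sum>j<N. \<epsilon> * hnorm LN \<xi>)"
      proof (rule sum_mono)
        fix j assume "j \<in> {..<N}"
        then have j: "j < N" by simp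
        have "hnorm L (hdiff L (fst (v i j) (\<xi> j)) (S i j (\<xi> j))) \<le> \<epsilon> * hnorm L (\<xi> j)"
          by (rule S(2)[OF c(3)[OF j]])
        also have "\<dots> \<le> \<epsilon> * hnorm LN \<xi>"
          using \<epsilon> \<xi> by (intro mult_left_mono hpow_component_le j) simp_all
        finally show "hnorm L (hdiff L (fst (v i j) (\<xi> j)) (S i j (\<xi> j))) \<le> \<epsilon> * hnorm LN \<xi>" .
      qed
      finally show ?thesis by simp
    qed
    then have "(\<Sum>i<N. hnorm L (?D i)) \<le> (\<Sum>i<N. real N * (\<epsilon> * hnorm LN \<xi>))" by (intro sum_mono) simp
    then have "hnorm LN ?D \<le> real N * (real N * (\<epsilon> * hnorm LN \<xi>))"
      using hpow_norm_le_sum[of ?D N] D by simp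
    also have "\<dots> = (real N * real N) * \<epsilon> * hnorm LN \<xi>" by simp
    also have "\<dots> \<le> \<delta> * hnorm LN \<xi>"
    proof (rule mult_right_mono[OF _ n0])
      have "(real N * real N + 1) * \<epsilon> = \<delta>" unfolding \<epsilon>_def by (simp add: add_nonneg_eq_0_iff)
      then show "real N * real N * \<epsilon> \<le> \<delta>" using \<epsilon> by (simp add: distrib_right)
    qed
    finally show ?thesis .
  qed
  moreover have "propagation_le (S i j) R" if "i < N" "j < N" for i j
    using propagation_le_mono[OF r rR[OF that]] .
  ultimately show ?thesis
    using that[of v' R] S(1) by (simp add: v'_def)
qed

end

end

section \<open>Finite components obstruct vanishing\<close>

lemma (in l2_space) supported_hsum:
  "(\<And>j. j < n \<Longrightarrow> f j \<in> hcarrier L \<and> supported (f j) A) \<Longrightarrow> supported (hsum f n) A"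
  by (induction n) (auto simp: supported_zero intro!: supported_add)

lemma (in inner_space) common_subsequence:
  assumes "finite P" "\<And>p. p \<in> P \<Longrightarrow> compact_operator E (T p)"
    and X: "\<And>p n. p \<in> P \<Longrightarrow> X p n \<in> hcarrier E" "\<And>p n. p \<in> P \<Longrightarrow> hnorm E (X p n) \<le> C"
  shows "\<exists>r :: nat \<Rightarrow> nat. strict_mono r \<and> (\<forall>p\<in>P. \<exists>y\<in>hcarrier E. (\<lambda>n. hnorm E (hdiff E (T p (X p (r n))) y)) \<longlonglongrightarrow> 0)"
  using assms
proof (induction P)
  case empty
  show ?case by (intro exI[of _ id]) (auto simp: strict_mono_def)
next
  case (insert q P)
  then obtain r :: "nat \<Rightarrow> nat" where r: "strict_mono r"
    "\<And>p. p \<in> P \<Longrightarrow> \<exists>y\<in>hcarrier E. (\<lambda>n. hnorm E (hdiff E (T p (X p (r n))) y)) \<longlonglongrightarrow> 0" by auto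
  obtain s y where s: "strict_mono s" "y \<in> hcarrier E" "(\<lambda>n. hnorm E (hdiff E (T q (X q (r (s n)))) y)) \<longlonglongrightarrow> 0"
    using compact_subsequence[of "T q" "\<lambda>n. X q (r n)" C] insert.prems by auto
  have "\<exists>y\<in>hcarrier E. (\<lambda>n. hnorm E (hdiff E (T p (X p (r (s n)))) y)) \<longlonglongrightarrow> 0" if p: "p \<in> P" for p
  proof -
    obtain y where "y \<in> hcarrier E" "(\<lambda>n. hnorm E (hdiff E (T p (X p (r n))) y)) \<longlonglongrightarrow> 0" using r(2)[OF p] by blast
    with LIMSEQ_subseq_LIMSEQ[OF this(2) s(1)] show ?thesis by (auto simp: o_def)
  qed
  then show ?case using s strict_mono_o[OF r(1) s(1)] by (intro exI[of _ "\<lambda>n. r (s n)"]) (auto simp: o_def)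
qed

context discrete_roe
begin

text \<open>\<open>T\<close> moves supports by less than \<open>R + 1\<close>, whereas all other
  points of \<open>D\<close> are farther than \<alpha> from \<open>C\<close>.\<close>

lemma supported_component:
  assumes T: "T \<in> bounded_operators L" "propagation_le T R" and R: "R + 1 \<le> \<alpha>"
    and C: "\<And>c d. c \<in> C \<Longrightarrow> d \<in> D \<Longrightarrow> d \<notin> C \<Longrightarrow> \<alpha> < dist c d"
    and G: "G \<in> hcarrier L" "supported G C"
  shows "supported (T G) C"
proof -
  have s: "supported (T G) (\<Union>b\<in>C. ball b (R + 1))" by (rule supported_op[OF T G])
  have "rep (T G) x = 0" if x: "x \<in> D" "x \<notin> C" for x
  proof -
    have "x \<notin> (\<Union>b\<in>C. ball b (R + 1))" using C[OF _ x] R by fastforce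
    then show ?thesis using s x by (simp add: supported_discrete)
  qed
  then show ?thesis by (simp add: supported_discrete)
qed

theorem finite_component_obstruction:
  assumes h: "norm h = 1"
    and eq: "K0_class (roe_algebra K MD) (transport D (\<lambda>x. delta x h) (\<lambda>x. delta x h)) = \<one>\<^bsub>K0 (roe_algebra K MD)\<^esub>"
  shows "\<exists>\<alpha>>0. no_finite_components D \<alpha>"
proof (rule ccontr)
  assume none: "\<not> ?thesis"
  interpret A: star_alg "roe_algebra K MD" by (rule star_alg_roe_algebra)
  let ?p = "transport D (\<lambda>x. delta x h) (\<lambda>x. delta x h)"
  note o = orthonormal_delta[OF h subset_refl]
  have p: "?p \<in> carrier (roe_algebra K MD)" "star (roe_algebra K MD) ?p = ?p" "?p \<otimes>\<^bsub>roe_algebra K MD\<^esub> ?p = ?p"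
    using algebraic_roe_carrier[OF transport_delta_roe[OF h subset_refl]] transport_adjoint[OF o o] transport_mult[OF o o o]
    by simp_all
  obtain N u y where N: "0 < N" and u: "u \<in> mtx_carrier RU N N" and y: "y \<in> mtx_carrier RU N N"
    and uu: "mtx_mult RU N (mtx_star RU u) u = one (mtx_ring RU N)"
    and yy: "mtx_mult RU N (mtx_star RU y) y = A.mtx1 ?p"
    and uy: "mtx_mult RU N (mtx_star RU u) y = (\<lambda>i j. (\<zero>\<^bsub>roe_algebra K MD\<^esub>, 0))"
    and snd_u: "\<And>i j. snd (u i j) = (if i = j \<and> i < N then 1 else 0)"
    by (rule A.K0_class_eq_one_isometry[OF p eq]) (rule that)
  let ?LN = "hpow L N"
  interpret P: inner_space ?LN by (rule inner_space_hpow)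
  note ou = RU_op_mtx[OF u] and oy = RU_op_mtx[OF y]
  note us = A.U.mtx_star_closed[OF u] and ys = A.U.mtx_star_closed[OF y]
  have isometry: "hnorm ?LN (mact N u \<zeta>) = hnorm ?LN \<zeta>" if \<zeta>: "\<zeta> \<in> hcarrier ?LN" for \<zeta>
  proof -
    have "mact N (one (mtx_ring RU N)) \<zeta> = \<zeta>"
    proof (rule P.inner_ext)
      have o1: "op_mtx N (one (mtx_ring RU N))" by (auto simp: op_mtx_def RU_simps)
      show "mact N (one (mtx_ring RU N)) \<zeta> \<in> hcarrier ?LN" by (rule mact_closed[OF o1 \<zeta>])
      fix \<theta> assume \<theta>: "\<theta> \<in> hcarrier ?LN"
      have "hinner ?LN \<theta> (mact N (one (mtx_ring RU N)) \<zeta>)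
          = (\<Sum>i<N. \<Sum>j<N. if j = i then hinner L (\<theta> i) (\<zeta> i) else 0)"
        unfolding inner_mact[OF o1 \<zeta> \<theta>]
        using \<theta> \<zeta> by (intro sum.cong refl) (auto simp: RU_simps act_def inner_simps)
      also have "\<dots> = hinner ?LN \<theta> \<zeta>" by simp
      finally show "hinner ?LN \<theta> (mact N (one (mtx_ring RU N)) \<zeta>) = hinner ?LN \<theta> \<zeta>" .
    qed (rule \<zeta>)
    then have "hinner ?LN (mact N u \<zeta>) (mact N u \<zeta>) = hinner ?LN \<zeta> \<zeta>"
      using inner_mact_star[OF u mact_closed[OF ou \<zeta>] \<zeta>] mact_mult[OF us u \<zeta>] by (simp add: uu)
    then show ?thesis by (simp only: hnorm_def)
  qed
  have orth: "hinner ?LN (mact N u \<zeta>) (mact N y \<eta>) = 0" if \<zeta>: "\<zeta> \<in> hcarrier ?LN" and \<eta>: "\<eta> \<in> hcarrier ?LN" for \<zeta> \<eta>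
  proof -
    have o0: "op_mtx N (\<lambda>i j. (\<zero>\<^bsub>roe_algebra K MD\<^esub>, 0))" by (auto simp: op_mtx_def)
    have "hinner ?LN (mact N u \<zeta>) (mact N y \<eta>) = hinner ?LN \<zeta> (mact N (\<lambda>i j. (\<zero>\<^bsub>roe_algebra K MD\<^esub>, 0)) \<eta>)"
      using inner_mact_star[OF u mact_closed[OF oy \<eta>] \<zeta>] mact_mult[OF us y \<eta>] by (simp add: uy)
    also have "\<dots> = 0"
      unfolding inner_mact[OF o0 \<eta> \<zeta>] using \<zeta> \<eta> by (intro sum.neutral ballI) (simp add: act_def inner_simps)
    finally show ?thesis .
  qed
  \<comment> \<open>With this error the approximant of \<open>u\<close> is still bounded below by 3
    / 4, and the distance of \<open>\<xi>'\<close> from its range on \<open>W\<close> is still at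
    least 1 / 4.\<close>
  have quarter: "0 < (1/4::real)" by simp
  obtain u' R where u': "\<And>i j. i < N \<Longrightarrow> j < N \<Longrightarrow> fst (u' i j) \<in> algebraic_roe"
    "\<And>i j. snd (u' i j) = snd (u i j)" "\<And>i j. i < N \<Longrightarrow> j < N \<Longrightarrow> propagation_le (fst (u' i j)) R"
    "\<And>\<xi>. \<xi> \<in> hcarrier ?LN \<Longrightarrow> hnorm ?LN (hdiff ?LN (mact N u \<xi>) (mact N u' \<xi>)) \<le> 1/4 * hnorm ?LN \<xi>"
    using mtx_approximation[OF u quarter] by metis
  obtain y' R' where y': "\<And>i j. i < N \<Longrightarrow> j < N \<Longrightarrow> fst (y' i j) \<in> algebraic_roe"
    "\<And>i j. i < N \<Longrightarrow> j < N \<Longrightarrow> propagation_le (fst (y' i j)) R'"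
    "\<And>\<xi>. \<xi> \<in> hcarrier ?LN \<Longrightarrow> hnorm ?LN (hdiff ?LN (mact N y \<xi>) (mact N y' \<xi>)) \<le> 1/4 * hnorm ?LN \<xi>"
    using mtx_approximation[OF y quarter] by metis
  have ou': "op_mtx N u'" and oy': "op_mtx N y'"
    using u'(1) y'(1) algebraic_roeD(1) by (auto simp: op_mtx_def)
  \<comment> \<open>Large enough that neither approximant connects different components of the
    graph.\<close>
  define \<alpha> where "\<alpha> = \<bar>R\<bar> + \<bar>R'\<bar> + 1"
  have \<alpha>: "0 < \<alpha>" "R + 1 \<le> \<alpha>" "R' + 1 \<le> \<alpha>" by (auto simp: \<alpha>_def)
  obtain x where x: "x \<in> D" and fin: "finite ((graph_edges D \<alpha>)\<^sup>* `` {x})"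
    using none \<alpha>(1) unfolding no_finite_components_def connected_components_def by blast
  define C where "C = (graph_edges D \<alpha>)\<^sup>* `` {x}"
  have xC: "x \<in> C" by (simp add: C_def)
  have CD: "c \<in> D" if "c \<in> C" for c
  proof -
    have "(x, c) \<in> (graph_edges D \<alpha>)\<^sup>*" using that by (simp add: C_def)
    then show ?thesis using x by (induction rule: rtrancl_induct) (auto simp: graph_edges_def)
  qed
  have C_far: "\<alpha> < dist c d" if "c \<in> C" "d \<in> D" "d \<notin> C" for c d
  proof (rule ccontr)
    assume "\<not> \<alpha> < dist c d"
    then have "(c, d) \<in> graph_edges D \<alpha>" using that CD by (auto simp: graph_edges_def)
    then have "d \<in> C" using that(1) unfolding C_def by (auto intro: rtrancl_into_rtrancl)
    then show False using that(3) by blast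
  qed
  \<comment> \<open>The vectors supported on the finite component. Both approximants map
    \<open>W\<close> into itself.\<close>
  define W where "W = {\<xi> \<in> hcarrier ?LN. \<forall>i<N. supported (\<xi> i) C}"
  have W_mact: "mact N v \<xi> \<in> W" if v: "op_mtx N v" "\<And>i j. i < N \<Longrightarrow> j < N \<Longrightarrow> propagation_le (fst (v i j)) r" "r + 1 \<le> \<alpha>"
    and \<xi>: "\<xi> \<in> W" for v r \<xi>
  proof -
    have "act (v i j) (\<xi> j) \<in> hcarrier L \<and> supported (act (v i j) (\<xi> j)) C" if ij: "i < N" "j < N" for i j
    proof -
      have T: "fst (v i j) \<in> bounded_operators L" using v(1) ij by (simp add: op_mtx_def)
      have \<xi>j: "\<xi> j \<in> hcarrier L" "supported (\<xi> j) C" using \<xi> ij by (auto simp: W_def)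
      have "supported (fst (v i j) (\<xi> j)) C" by (rule supported_component[OF T v(2)[OF ij] v(3) C_far \<xi>j])
      then show ?thesis using T \<xi>j by (auto simp: act_def op_closed intro!: supported_add supported_scale)
    qed
    then have "supported (mact N v \<xi> i) C" if "i < N" for i
      using that by (simp add: mact_component supported_hsum)
    then show ?thesis using mact_closed[OF v(1)] \<xi> by (simp add: W_def)
  qed
  \<comment> \<open>A unit vector fixed by the projection \<open>mtx1 ?p\<close> and living at the
    point \<open>x\<close> of the component; \<open>y\<close> maps it to a unit vector orthogonal to
    the range of \<open>u\<close>.\<close>
  define \<eta> where "\<eta> = (\<lambda>i\<in>{..<N}. if i = 0 then delta x h else hzero L)"
  have \<eta>: "\<eta> \<in> W"
    unfolding W_def \<eta>_def using supported_mono[OF supported_delta] xC by (auto simp: supported_zero)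
  have \<eta>L: "\<eta> \<in> hcarrier ?LN" using \<eta> by (simp add: W_def)
  have "hinner ?LN \<eta> \<eta> = (\<Sum>i<N. if i = 0 then 1 else 0)"
    unfolding hpow_simps(2)
    by (rule sum.cong[OF refl]) (use x h in \<open>auto simp: \<eta>_def inner_delta rep_delta cinner_self inner_zero_left\<close>)
  then have \<eta>\<eta>: "hinner ?LN \<eta> \<eta> = 1" using N by simp
  then have \<eta>1: "hnorm ?LN \<eta> = 1" by (simp add: hnorm_def)
  define \<xi> where "\<xi> = mact N y \<eta>"
  have \<xi>L: "\<xi> \<in> hcarrier ?LN" unfolding \<xi>_def by (rule mact_closed[OF oy \<eta>L])
  have p_delta: "?p (delta x h) = delta x h"
    using x rep_transport_delta[OF h subset_refl, of "delta x h"] op_closed[OF transport_closed[OF o o], of "delta x h"] h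
    by (intro discrete_eqI) (auto simp: rep_delta cinner_self scaleC_one)
  have om: "op_mtx N (A.mtx1 ?p)"
    using transport_closed[OF o o] by (auto simp: op_mtx_def A.mtx1_def)
  have "mact N (A.mtx1 ?p) \<eta> = \<eta>"
  proof (rule P.inner_ext[OF mact_closed[OF om \<eta>L] \<eta>L])
    fix z assume z: "z \<in> hcarrier ?LN"
    have "hinner ?LN z (mact N (A.mtx1 ?p) \<eta>)
        = (\<Sum>i<N. \<Sum>j<N. if j = 0 then (if i = 0 then hinner L (z i) (delta x h) else 0) else 0)"
      unfolding inner_mact[OF om \<eta>L z]
      by (intro sum.cong refl) (use z p_delta in \<open>auto simp: A.mtx1_def act_def \<eta>_def inner_simps\<close>)
    also have "\<dots> = (\<Sum>i<N. if i = 0 then hinner L (z i) (delta x h) else 0)" using N by simp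
    also have "\<dots> = hinner ?LN z \<eta>"
      unfolding hpow_simps(2)
      by (intro sum.cong refl) (use z in \<open>auto simp: \<eta>_def inner_zero_right\<close>)
    finally show "hinner ?LN z (mact N (A.mtx1 ?p) \<eta>) = hinner ?LN z \<eta>" .
  qed
  then have "hinner ?LN \<xi> \<xi> = 1"
    using inner_mact_star[OF y \<xi>L \<eta>L] mact_mult[OF ys y \<eta>L] \<eta>\<eta> by (simp only: yy \<xi>_def)
  then have \<xi>1: "hnorm ?LN \<xi> = 1" by (simp add: hnorm_def)
  define \<xi>' where "\<xi>' = mact N y' \<eta>"
  have \<xi>'W: "\<xi>' \<in> W" unfolding \<xi>'_def by (rule W_mact[OF oy' y'(2) \<alpha>(3) \<eta>])
  have \<xi>'L: "\<xi>' \<in> hcarrier ?LN" using \<xi>'W by (simp add: W_def)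
  have \<xi>\<xi>': "hnorm ?LN (hdiff ?LN \<xi> \<xi>') \<le> 1/4" using y'(3)[OF \<eta>L] \<eta>1 by (simp add: \<xi>_def \<xi>'_def)
  \<comment> \<open>With \<open>t\<close> the norm of \<open>\<zeta>\<close>, orthogonality gives
    the distance \<open>sqrt (1 + t^2)\<close> from \<open>\<xi>\<close> to
    \<open>u \<zeta>\<close>, which is at least \<open>(1 + t) / 2\<close>. The two approximations
    cost \<open>1 / 4\<close> and \<open>t / 4\<close>, so at least \<open>(1 + t) / 4\<close>
    remains.\<close>
  have gap: "1/4 \<le> hnorm ?LN (hdiff ?LN \<xi>' (mact N u' \<zeta>))" if \<zeta>: "\<zeta> \<in> W" for \<zeta>
  proof -
    have \<zeta>L: "\<zeta> \<in> hcarrier ?LN" using \<zeta> by (simp add: W_def)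
    note c = mact_closed[OF ou \<zeta>L] mact_closed[OF ou' \<zeta>L]
    define t where "t = hnorm ?LN \<zeta>"
    have t: "0 \<le> t" unfolding t_def using \<zeta>L by (rule P.norm_nonneg)
    have "hinner ?LN \<xi> (mact N u \<zeta>) = cnj (hinner ?LN (mact N u \<zeta>) \<xi>)" by (rule P.inner_commute[OF \<xi>L c(1)])
    then have "hinner ?LN \<xi> (mact N u \<zeta>) = 0" unfolding \<xi>_def orth[OF \<zeta>L \<eta>L] by simp
    then have sq: "(hnorm ?LN (hdiff ?LN \<xi> (mact N u \<zeta>)))\<^sup>2 = 1 + t\<^sup>2"
      using P.norm_diff_sq[OF \<xi>L c(1)] \<xi>1 isometry[OF \<zeta>L] by (simp add: t_def del: hpow_simps)
    have "1/2 + 1/2 * t \<le> hnorm ?LN (hdiff ?LN \<xi> (mact N u \<zeta>))"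
    proof (rule power2_le_imp_le)
      have "0 \<le> (1 - t)\<^sup>2" by simp
      then have "2 * t \<le> 1 + t\<^sup>2" by (simp add: power2_diff)
      then have "(1 + 2 * t + t\<^sup>2) / 4 \<le> 1 + t\<^sup>2" using zero_le_power2[of t] by argo
      moreover have "(1/2 + 1/2 * t)\<^sup>2 = (1 + 2 * t + t\<^sup>2) / 4" by (simp add: power2_eq_square field_simps)
      ultimately have "(1/2 + 1/2 * t)\<^sup>2 \<le> 1 + t\<^sup>2" by simp
      then show "(1/2 + 1/2 * t)\<^sup>2 \<le> (hnorm ?LN (hdiff ?LN \<xi> (mact N u \<zeta>)))\<^sup>2" by (simp only: sq)
      show "0 \<le> hnorm ?LN (hdiff ?LN \<xi> (mact N u \<zeta>))" by (intro P.norm_nonneg P.diff_closed \<xi>L c)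
    qed
    moreover have "hnorm ?LN (hdiff ?LN \<xi> (mact N u \<zeta>)) \<le> hnorm ?LN (hdiff ?LN \<xi> \<xi>') + hnorm ?LN (hdiff ?LN \<xi>' (mact N u \<zeta>))"
      by (rule P.norm_triangle_diff[OF \<xi>L \<xi>'L c(1)])
    moreover have "hnorm ?LN (hdiff ?LN \<xi>' (mact N u \<zeta>)) \<le> hnorm ?LN (hdiff ?LN \<xi>' (mact N u' \<zeta>)) + hnorm ?LN (hdiff ?LN (mact N u' \<zeta>) (mact N u \<zeta>))"
      by (rule P.norm_triangle_diff[OF \<xi>'L c(2,1)])
    moreover have "hnorm ?LN (hdiff ?LN (mact N u' \<zeta>) (mact N u \<zeta>)) \<le> 1/4 * t"
      using u'(4)[OF \<zeta>L] P.diff_commute_norm[OF c(2,1)] by (simp only: t_def)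
    ultimately show ?thesis using \<xi>\<xi>' t by linarith
  qed
  have below: "3/4 * hnorm ?LN \<zeta> \<le> hnorm ?LN (mact N u' \<zeta>)" if \<zeta>: "\<zeta> \<in> W" for \<zeta>
  proof -
    have \<zeta>L: "\<zeta> \<in> hcarrier ?LN" using \<zeta> by (simp add: W_def)
    show ?thesis
      using P.norm_le_diff[OF mact_closed[OF ou \<zeta>L] mact_closed[OF ou' \<zeta>L]] u'(4)[OF \<zeta>L] isometry[OF \<zeta>L] by linarith
  qed
  obtain o' r where Cb: "\<And>c. c \<in> C \<Longrightarrow> dist o' c \<le> r"
    using finite_imp_bounded[OF fin] unfolding C_def bounded_def by blast
  \<comment> \<open>Equal to 1 on \<open>C\<close>. On functions supported in \<open>C\<close> the
    operator \<open>S i j\<close> therefore agrees with its product with \<open>f\<close>, which is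
    compact by local compactness.\<close>
  define f where "f z = complex_of_real (min 1 (max 0 (r + 1 - dist o' z)))" for z
  have f: "f \<in> C0 (space MD)"
  proof (rule C0_bounded_support[of _ o' "r + 1"])
    show "continuous_on (space MD) f" unfolding f_def by (intro continuous_intros)
  qed (auto simp: f_def)
  note bf = C0_multiplier[OF f]
  have f_id: "mult_operator MD f G = G" if "G \<in> hcarrier L" "supported G C" for G
    by (rule mult_eq_self[OF bf that]) (use Cb in \<open>fastforce simp: f_def\<close>)
  define S where "S i j = fst (u' i j)" for i j
  have S: "S i j \<in> bounded_operators L" "compact_operator L (S i j \<otimes>\<^bsub>operator_algebra L\<^esub> mult_operator MD f)" if "i < N" "j < N" for i j
    using algebraic_roeD(1)[OF u'(1)[OF that]] algebraic_roeD(2)[OF u'(1)[OF that] f] by (simp_all add: S_def)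
  \<comment> \<open>The scalar part of \<open>u'\<close> is still the identity matrix, so
    subtracting \<open>X\<close> leaves only the operators \<open>S i j\<close>.\<close>
  have diff_eq: "hdiff ?LN (mact N u' X) X i = hsum (\<lambda>j. S i j (X j)) N" if X: "X \<in> hcarrier ?LN" and i: "i < N" for X i
  proof (rule inner_ext)
    have c: "X j \<in> hcarrier L" "S i j (X j) \<in> hcarrier L" "act (u' i j) (X j) \<in> hcarrier L" if "j < N" for j
      using X S(1)[OF i that] that by (simp_all add: op_closed S_def)
    show "hdiff ?LN (mact N u' X) X i \<in> hcarrier L" "hsum (\<lambda>j. S i j (X j)) N \<in> hcarrier L"
      using i c by (simp_all add: mact_component)
    fix z assume z: "z \<in> hcarrier L"
    have "hinner L z (hdiff ?LN (mact N u' X) X i) = (\<Sum>j<N. hinner L z (act (u' i j) (X j))) - hinner L z (X i)"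
      using i c z by (simp add: mact_component inner_diff_right inner_hsum)
    also have "(\<Sum>j<N. hinner L z (act (u' i j) (X j))) = (\<Sum>j<N. hinner L z (S i j (X j)) + (if j = i then hinner L z (X i) else 0))"
      using i c z by (intro sum.cong refl) (auto simp: act_def S_def u'(2) snd_u inner_simps)
    also have "\<dots> = (\<Sum>j<N. hinner L z (S i j (X j))) + hinner L z (X i)"
      using i by (simp add: sum.distrib)
    finally show "hinner L z (hdiff ?LN (mact N u' X) X i) = hinner L z (hsum (\<lambda>j. S i j (X j)) N)"
      using c z by (simp add: inner_hsum)
  qed
  show False
  proof (rule P.bounded_below_no_gap[of W "mact N u'" "3/4" \<xi>' "1/4"])
    show "W \<subseteq> hcarrier ?LN" by (auto simp: W_def)
    have comp: "a i \<in> hcarrier L" if "a \<in> W" "i < N" for a i using that by (auto simp: W_def)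
    show "hadd ?LN a b \<in> W" if "a \<in> W" "b \<in> W" for a b
      using that comp[OF that(1)] comp[OF that(2)] P.add_closed[of a b]
      by (auto simp: W_def intro!: supported_add simp del: hpow_simps(1))
    show "hscale ?LN k a \<in> W" if "a \<in> W" for k a
      using that comp[OF that] P.scale_closed[of a k]
      by (auto simp: W_def intro!: supported_scale simp del: hpow_simps(1))
    show "mact N u' a \<in> W" if "a \<in> W" for a by (rule W_mact[OF ou' u'(3) \<alpha>(2) that])
    show "mact N u' (hadd ?LN a b) = hadd ?LN (mact N u' a) (mact N u' b)" if "a \<in> W" "b \<in> W" for a b
      using that by (intro mact_add ou') (simp_all add: W_def)
    show "mact N u' (hscale ?LN k a) = hscale ?LN k (mact N u' a)" if "a \<in> W" for k a
      using that by (intro mact_scale ou') (simp add: W_def)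
    fix X :: "nat \<Rightarrow> _" and B assume X: "\<And>n. X n \<in> W" "\<And>n. hnorm ?LN (X n) \<le> B"
    have XL: "X n \<in> hcarrier ?LN" for n using X(1)[of n] by (simp add: W_def)
    have Xc: "X n j \<in> hcarrier L" "supported (X n j) C" "hnorm L (X n j) \<le> B" if "j < N" for n j
      using that X(1)[of n] hpow_component_le[of "X n" N j] X(2)[of n] by (auto simp: W_def)
    \<comment> \<open>A single subsequence has to serve all pairs of matrix indices.\<close>
    obtain s :: "nat \<Rightarrow> nat" where s: "strict_mono s" "\<forall>p\<in>{..<N} \<times> {..<N}. \<exists>y\<in>hcarrier L.
        (\<lambda>n. hnorm L (hdiff L ((S (fst p) (snd p) \<otimes>\<^bsub>operator_algebra L\<^esub> mult_operator MD f) (X (s n) (snd p))) y)) \<longlonglongrightarrow> 0"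
      using common_subsequence[of "{..<N} \<times> {..<N}" "\<lambda>p. S (fst p) (snd p) \<otimes>\<^bsub>operator_algebra L\<^esub> mult_operator MD f"
          "\<lambda>p n. X n (snd p)" B] S(2) Xc by (auto simp del: operator_algebra_simps)
    then obtain Y where Y: "\<And>i j. i < N \<Longrightarrow> j < N \<Longrightarrow> Y i j \<in> hcarrier L"
      "\<And>i j. i < N \<Longrightarrow> j < N \<Longrightarrow>
        (\<lambda>n. hnorm L (hdiff L ((S i j \<otimes>\<^bsub>operator_algebra L\<^esub> mult_operator MD f) (X (s n) j)) (Y i j))) \<longlonglongrightarrow> 0"
    proof -
      have "\<forall>p\<in>{..<N} \<times> {..<N}. \<exists>y. y \<in> hcarrier L \<and>
        (\<lambda>n. hnorm L (hdiff L ((S (fst p) (snd p) \<otimes>\<^bsub>operator_algebra L\<^esub> mult_operator MD f) (X (s n) (snd p))) y)) \<longlonglongrightarrow> 0"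
        using s(2) by blast
      from bchoice[OF this] obtain Z where "\<forall>p\<in>{..<N} \<times> {..<N}. Z p \<in> hcarrier L \<and>
        (\<lambda>n. hnorm L (hdiff L ((S (fst p) (snd p) \<otimes>\<^bsub>operator_algebra L\<^esub> mult_operator MD f) (X (s n) (snd p))) (Z p))) \<longlonglongrightarrow> 0" ..
      then show ?thesis using that[of "\<lambda>i j. Z (i, j)"] by force
    qed
    have Y': "(\<lambda>n. hnorm L (hdiff L (S i j (X (s n) j)) (Y i j))) \<longlonglongrightarrow> 0" if "i < N" "j < N" for i j
      using Y(2)[OF that] Xc[OF that(2)] by (simp add: f_id)
    define \<theta> where "\<theta> = (\<lambda>i\<in>{..<N}. hsum (\<lambda>j. Y i j) N)"
    have \<theta>: "\<theta> \<in> hcarrier ?LN" using Y(1) by (auto simp: \<theta>_def)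
    let ?K = "\<lambda>n. hdiff ?LN (mact N u' (X (s n))) (X (s n))"
    have KL: "?K n \<in> hcarrier ?LN" for n by (intro P.diff_closed mact_closed ou' XL)
    have bound: "hnorm ?LN (hdiff ?LN (?K n) \<theta>) \<le> (\<Sum>i<N. \<Sum>j<N. hnorm L (hdiff L (S i j (X (s n) j)) (Y i j)))" for n
    proof -
      have dL: "hdiff ?LN (?K n) \<theta> \<in> hcarrier ?LN" by (rule P.diff_closed[OF KL \<theta>])
      then have "hnorm ?LN (hdiff ?LN (?K n) \<theta>) \<le> (\<Sum>i<N. hnorm L (hdiff ?LN (?K n) \<theta> i))"
        by (intro hpow_norm_le_sum) simp
      also have "\<dots> \<le> (\<Sum>i<N. \<Sum>j<N. hnorm L (hdiff L (S i j (X (s n) j)) (Y i j)))"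
      proof (rule sum_mono)
        fix i assume "i \<in> {..<N}"
        then have i: "i < N" by simp
        have c: "S i j (X (s n) j) \<in> hcarrier L" "Y i j \<in> hcarrier L" if "j < N" for j
          using S(1)[OF i that] Xc[OF that] Y(1)[OF i that] by (simp_all add: op_closed)
        have "hdiff ?LN (?K n) \<theta> i = hdiff L (?K n i) (\<theta> i)" using i by (rule hpow_simps(6))
        also have "\<dots> = hsum (\<lambda>j. hdiff L (S i j (X (s n) j)) (Y i j)) N"
          unfolding diff_eq[OF XL i] using i c
          by (intro inner_ext) (simp_all add: \<theta>_def inner_diff_right inner_hsum sum_subtractf)
        finally show "hnorm L (hdiff ?LN (?K n) \<theta> i) \<le> (\<Sum>j<N. hnorm L (hdiff L (S i j (X (s n) j)) (Y i j)))"
          using hsum_norm_le[of N "\<lambda>j. hdiff L (S i j (X (s n) j)) (Y i j)"] c by simp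
      qed
      finally show ?thesis .
    qed
    have "(\<lambda>n. \<Sum>i<N. \<Sum>j<N. hnorm L (hdiff L (S i j (X (s n) j)) (Y i j))) \<longlonglongrightarrow> (\<Sum>i<N. \<Sum>j<N. 0)"
      by (intro tendsto_sum Y') simp_all
    then have lim: "(\<lambda>n. \<Sum>i<N. \<Sum>j<N. hnorm L (hdiff L (S i j (X (s n) j)) (Y i j))) \<longlonglongrightarrow> 0" by simp
    have "(\<lambda>n. hnorm ?LN (hdiff ?LN (?K n) \<theta>)) \<longlonglongrightarrow> 0"
    proof (rule Lim_null_comparison[OF always_eventually lim], rule allI)
      fix n
      have "0 \<le> hnorm ?LN (hdiff ?LN (?K n) \<theta>)" by (rule P.norm_nonneg[OF P.diff_closed[OF KL \<theta>]])
      then show "norm (hnorm ?LN (hdiff ?LN (?K n) \<theta>)) \<le> (\<Sum>i<N. \<Sum>j<N. hnorm L (hdiff L (S i j (X (s n) j)) (Y i j)))"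
        unfolding real_norm_def using bound[of n] by (simp only: abs_of_nonneg)
    qed
    then show "\<exists>r y. strict_mono r \<and> y \<in> hcarrier ?LN \<and>
        (\<lambda>n. hnorm ?LN (hdiff ?LN (hdiff ?LN (mact N u' (X (r n))) (X (r n))) y)) \<longlonglongrightarrow> 0"
      using s(1) \<theta> by blast
  qed (use \<xi>'W gap below in simp_all)
qed

end

theorem theorem5:
  fixes D :: "'a :: metric_space set"
    and e :: "'h :: complex_hilbert_space \<Rightarrow> 'h"
  assumes "uniform_discrete D"
    and "bounded_geometry D"
    and "infinite_dimensional TYPE('h)"
    and "rank_one_projection e"
  shows
    "((\<exists>\<alpha>>0. no_finite_components D \<alpha>) \<longrightarrow>
        (\<forall>D0\<subseteq>D.
           stabilization_K0 D e
             (K0_class (roe_algebra TYPE(complex) (count_space D)) (subset_projection D D0))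
           = \<one>\<^bsub>K0 (roe_algebra TYPE('h) (count_space D))\<^esub>) \<and>
        (\<forall>M :: 'a measure.
           proper_metric_measure_space M \<and> nondegenerate_module M \<and> ample_module M \<and>
           non_atomic M \<and> coarsely_equivalent_subspace D \<longrightarrow>
           (\<forall>D0\<subseteq>D. \<forall>\<phi>. wannier_basis M D0 \<phi> \<longrightarrow>
              K0_class (roe_algebra TYPE(complex) M) (wannier_projection M D0 \<phi>)
              = \<one>\<^bsub>K0 (roe_algebra TYPE(complex) M)\<^esub>)))
     \<and>
     (stabilization_K0 D e
        (K0_class (roe_algebra TYPE(complex) (count_space D)) (subset_projection D D))
      = \<one>\<^bsub>K0 (roe_algebra TYPE('h) (count_space D))\<^esub> \<longrightarrow>
      (\<exists>\<alpha>>0. no_finite_components D \<alpha>))"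
proof -
  obtain w where w: "norm w = 1" "\<And>h. e h = scaleC (cinner w h) w"
    using rank_one_projection_form[OF assms(4)] by blast
  note fin = bounded_geometry_locally_finite[OF assms(2)]
  interpret C: discrete_roe D "TYPE(complex)" by (rule discrete_roe_intro[OF fin])
  interpret H: discrete_roe D "TYPE('h)" by (rule discrete_roe_intro[OF fin])
  interpret S: stabilization D e w by unfold_locales (use w in auto)
  have a1: "stabilization_K0 D e (K0_class (roe_algebra TYPE(complex) (count_space D)) (subset_projection D D0))
      = \<one>\<^bsub>K0 (roe_algebra TYPE('h) (count_space D))\<^esub>" if "no_finite_components D \<alpha>" "D0 \<subseteq> D" for \<alpha> D0
    unfolding S.stabilization_K0_subset_projection[OF that(2)]
    by (rule H.discrete_swindle[OF assms(1) that(1) assms(3) that(2) w(1)])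
  have a2: "K0_class (roe_algebra TYPE(complex) M) (wannier_projection M D0 \<phi>) = \<one>\<^bsub>K0 (roe_algebra TYPE(complex) M)\<^esub>"
    if "no_finite_components D \<alpha>" "proper_metric_measure_space M" "ample_module M" "D0 \<subseteq> D" "wannier_basis M D0 \<phi>"
    for \<alpha> M D0 \<phi>
    by (rule wannier_K0_class[OF assms(1,2) that])
  have b: "\<exists>\<alpha>>0. no_finite_components D \<alpha>"
    if "stabilization_K0 D e (K0_class (roe_algebra TYPE(complex) (count_space D)) (subset_projection D D))
      = \<one>\<^bsub>K0 (roe_algebra TYPE('h) (count_space D))\<^esub>"
    using that unfolding S.stabilization_K0_subset_projection[OF subset_refl]
    by (rule H.finite_component_obstruction[OF w(1)])
  show ?thesis using a1 a2 b by blast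
qed

end
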